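(* Let $\mathcal T$ be a field theory and let $\widetilde{\mathcal H}_{\mathcal T}$ be the bialgebra of specified graphs of $\mathcal T$, with product the concatenation (disjoint union), unit the empty graph $\mathbf 1$, and coproduct $\Delta(\bar\Gamma)=\sum_{\bar\gamma\subseteq\bar\Gamma,\ \bar\Gamma/\bar\gamma\in\mathcal T}\bar\gamma\otimes\bar\Gamma/\bar\gamma$ (sum over locally 1PI specified covering subgraphs). Let $\mathcal J$ be the ideal generated by the elements $\mathbf 1-\mathrm{res}\,\bar\Gamma$, where $\bar\Gamma$ is a 1PI specified graph. Then the quotient $$\mathcal H_{\mathcal T}=\widetilde{\mathcal H}_{\mathcal T}/\mathcal J$$ is a connected graded bialgebra (graded by the loop number), hence a connected graded Hopf algebra, and its coproduct is given, for every specified graph $\bar\Gamma$ with at least one internal edge, by $$\Delta(\bar\Gamma)=\mathbf 1\otimes\bar\Gamma+\bar\Gamma\otimes\mathbf 1+\sum_{\bar\gamma}\bar\gamma\otimes\bar\Gamma/\bar\gamma ,$$ where the sum runs over the proper locally 1PI specified covering subgraphs $\bar\gamma$ of $\bar\Gamma$ with $\bar\Gamma/\bar\gamma\in\mathcal T$.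
   Context: Graphs. A (Feynman) graph $\Gamma$ consists of a finite set $\mathcal V(\Gamma)$ of vertices, a finite set $\mathcal E(\Gamma)$ of half-edges, an involution $\sigma_\Gamma:\mathcal E(\Gamma)\to\mathcal E(\Gamma)$ and a map $\partial:\mathcal E(\Gamma)\to\mathcal V(\Gamma)$. For a vertex $v$, $st(v)=\{e:\partial(e)=v\}$. Fixed points of $\sigma_\Gamma$ are the external edges; pairs $\{e,\sigma_\Gamma(e)\}$ with $e\ne\sigma_\Gamma(e)$ are the internal edges, forming the set $\mathcal I(\Gamma)$. Cutting an internal edge means modifying $\sigma_\Gamma$ so that its two half-edges become fixed points. $\pi_0(\Gamma)$ is the set of connected components. The loop number is $L(\Gamma)=|\mathcal I(\Gamma)|-|\mathcal V(\Gamma)|+|\pi_0(\Gamma)|$. A graph is 1PI if it is connected and remains connected when any one internal edge is cut; it is locally 1PI if each connected component is 1PI (the empty graph is locally 1PI). A covering subgraph $\gamma$ of $\Gamma$ is a graph obtained from $\Gamma$ by cutting some (possibly no, possibly all) internal edges; it has the same vertices and half-edges. The contracted graph $\Gamma/\gamma$ has as vertices the connected components of $\gamma$, as half-edges the fixed points of $\sigma_\gamma$, as involution the restriction of $\sigma_\Gamma$, and a half-edge $e$ is attached to the component of $\gamma$ containing $\partial(e)$. The residue is $\mathrm{res}\,\Gamma=\Gamma/\Gamma$; the skeleton $\mathrm{sk}\,\Gamma$ is obtained by cutting all internal edges. Theory. Every half-edge carries a type in a set $\mathcal E(\mathcal T)$, and $\sigma_\Gamma$ preserves types. A vertex type is a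 function $\mathcal E(\mathcal T)\to\mathbb N$ (the number of half-edges of each type at the vertex); $\mathcal V(\mathcal T)$ is a prescribed set of vertex types. $\widetilde{\mathcal V}(\mathcal T)$ is a set of pairs $\tilde t=(t,k)$ (refined types) with $t\in\mathcal V(\mathcal T)$ and $k\in\mathbb N$, every $t$ occurring with at least one and only finitely many $k$. In a graph of $\mathcal T$ each vertex $v$ carries a refined type $(t,k)\in\widetilde{\mathcal V}(\mathcal T)$, where $t$ is the type of $v$ determined by the half-edges in $st(v)$. A locally 1PI graph is superficially divergent if the residue of each of its components is a vertex whose type lies in $\mathcal V(\mathcal T)$. Specified graphs. A specified graph of $\mathcal T$ is a pair $\bar\Gamma=(\Gamma,\underline i)$ where $\Gamma$ is a locally 1PI superficially divergent graph of $\mathcal T$ and $\underline i:\pi_0(\Gamma)\to\mathbb N$ is such that for each component $\Gamma_0$, if $t$ is the type of the vertex $\mathrm{res}\,\Gamma_0$, then $(t,\underline i(\Gamma_0))\in\widetilde{\mathcal V}(\mathcal T)$; if $\Gamma_0$ is a single vertex of refined type $(t,k)$ without internal edges, then $\underline i(\Gamma_0)=k$. A specified graph $(\gamma,\underline j)$ is a specified covering subgraph of $(\Gamma,\underline i)$, written $(\gamma,\underline j)\subseteq(\Gamma,\underline i)$, if $\gamma$ is a covering subgraph of $\Gamma$ (vertices keeping their refined types) and $\underline j(\gamma_0)=\underline i(\gamma_0)$ whenever the component $\gamma_0$ of $\gamma$ is also a full connected component of $\Gamma$. It is called proper here if $\gamma\neq\Gamma$ and $\gamma\ne\mathrm{sk}\,\Gamma$.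 The contracted specified graph is $\bar\Gamma/\bar\gamma=(\Gamma/\bar\gamma,\underline i)$, where $\Gamma/\bar\gamma$ is $\Gamma/\gamma$ with the vertex coming from a component $\gamma_0$ of $\gamma$ given the refined type $(t,\underline j(\gamma_0))$, $t$ being the type of $\mathrm{res}\,\gamma_0$ (the components of $\Gamma/\gamma$ being identified with those of $\Gamma$). It is in $\mathcal T$ if all its vertices have refined type in $\widetilde{\mathcal V}(\mathcal T)$. $\mathrm{res}\,\bar\Gamma=\bar\Gamma/\bar\Gamma$. Specified graphs are taken up to isomorphism (preserving half-edge types, refined vertex types and specification). The base field is $\mathbb C$; a basis of $\widetilde{\mathcal H}_{\mathcal T}$ is given by the isomorphism classes of specified graphs, including the empty graph. The counit of $\widetilde{\mathcal H}_{\mathcal T}$ is $\varepsilon(\bar\Gamma)=1$ if $\bar\Gamma$ has no internal edges and $0$ otherwise. *)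

theory Defs
  imports Complex_Main "HOL-Library.Poly_Mapping" "HOL-Library.FuncSet"
    "HOL-Algebra.Module" "HOL-Algebra.QuotRing"
begin

section \<open>Linear algebra over the complex numbers\<close>

definition complex_alg :: "(complex, complex) module" where
  "complex_alg = \<lparr>carrier = UNIV, mult = (*), one = 1, zero = 0, add = (+), smult = (*)\<rparr>"

locale complex_algebra = module complex_alg A + ring A for A (structure) +
  assumes smult_mult_left: "\<And>c x y. x \<in> carrier A \<Longrightarrow> y \<in> carrier A \<Longrightarrow>
      (c \<odot>\<^bsub>A\<^esub> x) \<otimes>\<^bsub>A\<^esub> y = c \<odot>\<^bsub>A\<^esub> (x \<otimes>\<^bsub>A\<^esub> y)"
    and smult_mult_right: "\<And>c x y. x \<in> carrier A \<Longrightarrow> y \<in> carrier A \<Longrightarrow>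
      x \<otimes>\<^bsub>A\<^esub> (c \<odot>\<^bsub>A\<^esub> y) = c \<odot>\<^bsub>A\<^esub> (x \<otimes>\<^bsub>A\<^esub> y)"

definition linear_map ::
  "(complex, 'a, 'm) module_scheme \<Rightarrow> (complex, 'b, 'n) module_scheme \<Rightarrow> ('a \<Rightarrow> 'b) \<Rightarrow> bool" where
  "linear_map M N f \<longleftrightarrow>
     f \<in> carrier M \<rightarrow> carrier N \<and>
     (\<forall>x\<in>carrier M. \<forall>y\<in>carrier M. f (x \<oplus>\<^bsub>M\<^esub> y) = f x \<oplus>\<^bsub>N\<^esub> f y) \<and>
     (\<forall>c. \<forall>x\<in>carrier M. f (c \<odot>\<^bsub>M\<^esub> x) = c \<odot>\<^bsub>N\<^esub> f x)"

definition lin_span :: "(complex, 'a, 'm) module_scheme \<Rightarrow> 'a set \<Rightarrow> 'a set" where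
  "lin_span M S = \<Inter>{H. submodule H complex_alg M \<and> S \<subseteq> H}"

text \<open>The monoid algebra \<open>\<complex>[G]\<close>; as a vector space it is free on \<open>carrier G\<close>.\<close>

definition monoid_algebra ::
  "('g, 'm) monoid_scheme \<Rightarrow> (complex, 'g \<Rightarrow>\<^sub>0 complex) module" where
  "monoid_algebra G =
     \<lparr>carrier = {f. Poly_Mapping.keys f \<subseteq> carrier G},
      mult = (\<lambda>f g. \<Sum>x\<in>Poly_Mapping.keys f. \<Sum>y\<in>Poly_Mapping.keys g.
                Poly_Mapping.single (x \<otimes>\<^bsub>G\<^esub> y) (Poly_Mapping.lookup f x * Poly_Mapping.lookup g y)),
      one = Poly_Mapping.single \<one>\<^bsub>G\<^esub> 1,
      zero = 0,
      add = (+),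
      smult = (\<lambda>c. Poly_Mapping.map ((*) c))\<rparr>"

definition quot_alg ::
  "(complex, 'a, 'm) module_scheme \<Rightarrow> 'a set \<Rightarrow> (complex, 'a set) module" where
  "quot_alg A I =
     ring.extend (A Quot I) (module.fields (\<lambda>c X. \<Union>x\<in>X. I +>\<^bsub>A\<^esub> (c \<odot>\<^bsub>A\<^esub> x)))"

subsection \<open>Tensor products\<close>

text \<open>\<open>A \<otimes> B\<close> is the free vector space on \<open>A \<times> B\<close> modulo the subspace spanned by the
  bilinearity relations. Since the free vector space is taken as the monoid algebra of
  \<open>A \<times> B\<close>, the quotient carries the multiplication \<open>(a \<otimes> b)(a' \<otimes> b') = aa' \<otimes> bb'\<close>.\<close>

definition free_pairs ::
  "(complex, 'a, 'm) module_scheme \<Rightarrow> (complex, 'b, 'n) module_scheme \<Rightarrow>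
   (complex, ('a \<times> 'b) \<Rightarrow>\<^sub>0 complex) module" where
  "free_pairs A B = monoid_algebra (A \<times>\<times> B)"

definition tensor_relations ::
  "(complex, 'a, 'm) module_scheme \<Rightarrow> (complex, 'b, 'n) module_scheme \<Rightarrow>
   (('a \<times> 'b) \<Rightarrow>\<^sub>0 complex) set" where
  "tensor_relations A B =
     {Poly_Mapping.single (a \<oplus>\<^bsub>A\<^esub> a', b) 1 - Poly_Mapping.single (a, b) 1 - Poly_Mapping.single (a', b) 1
        | a a' b. a \<in> carrier A \<and> a' \<in> carrier A \<and> b \<in> carrier B} \<union>
     {Poly_Mapping.single (a, b \<oplus>\<^bsub>B\<^esub> b') 1 - Poly_Mapping.single (a, b) 1 - Poly_Mapping.single (a, b') 1
        | a b b'. a \<in> carrier A \<and> b \<in> carrier B \<and> b' \<in> carrier B} \<union>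
     {Poly_Mapping.single (c \<odot>\<^bsub>A\<^esub> a, b) 1 - Poly_Mapping.single (a, b) c
        | c a b. a \<in> carrier A \<and> b \<in> carrier B} \<union>
     {Poly_Mapping.single (a, c \<odot>\<^bsub>B\<^esub> b) 1 - Poly_Mapping.single (a, b) c
        | c a b. a \<in> carrier A \<and> b \<in> carrier B}"

definition tensor_ker ::
  "(complex, 'a, 'm) module_scheme \<Rightarrow> (complex, 'b, 'n) module_scheme \<Rightarrow>
   (('a \<times> 'b) \<Rightarrow>\<^sub>0 complex) set" where
  "tensor_ker A B = lin_span (free_pairs A B) (tensor_relations A B)"

definition tensor ::
  "(complex, 'a, 'm) module_scheme \<Rightarrow> (complex, 'b, 'n) module_scheme \<Rightarrow>
   (complex, (('a \<times> 'b) \<Rightarrow>\<^sub>0 complex) set) module" where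
  "tensor A B = quot_alg (free_pairs A B) (tensor_ker A B)"

definition ptens ::
  "(complex, 'a, 'm) module_scheme \<Rightarrow> (complex, 'b, 'n) module_scheme \<Rightarrow> 'a \<Rightarrow> 'b \<Rightarrow>
   (('a \<times> 'b) \<Rightarrow>\<^sub>0 complex) set" where
  "ptens A B a b = tensor_ker A B +>\<^bsub>free_pairs A B\<^esub> Poly_Mapping.single (a, b) 1"

text \<open>The linear map out of a tensor product induced by a bilinear map \<open>\<phi>\<close> into \<open>M\<close>; bilinearity
  makes the image over all representatives of a tensor a singleton.\<close>

definition tensor_lift ::
  "(complex, 'c, 'k) module_scheme \<Rightarrow> ('a \<Rightarrow> 'b \<Rightarrow> 'c) \<Rightarrow> (('a \<times> 'b) \<Rightarrow>\<^sub>0 complex) set \<Rightarrow> 'c" where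
  "tensor_lift M \<phi> X = the_elem
     ((\<lambda>x. finsum M (\<lambda>p. Poly_Mapping.lookup x p \<odot>\<^bsub>M\<^esub> \<phi> (fst p) (snd p)) (Poly_Mapping.keys x)) ` X)"

definition tensor_map ::
  "(complex, 'c, 'm) module_scheme \<Rightarrow> (complex, 'd, 'n) module_scheme \<Rightarrow> ('a \<Rightarrow> 'c) \<Rightarrow> ('b \<Rightarrow> 'd) \<Rightarrow>
   (('a \<times> 'b) \<Rightarrow>\<^sub>0 complex) set \<Rightarrow> (('c \<times> 'd) \<Rightarrow>\<^sub>0 complex) set" where
  "tensor_map C D f g = tensor_lift (tensor C D) (\<lambda>a b. ptens C D (f a) (g b))"

definition tensor_assoc :: "(complex, 'a, 'm) module_scheme \<Rightarrow>
   (((('a \<times> 'a) \<Rightarrow>\<^sub>0 complex) set \<times> 'a) \<Rightarrow>\<^sub>0 complex) set \<Rightarrow>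
   (('a \<times> (('a \<times> 'a) \<Rightarrow>\<^sub>0 complex) set) \<Rightarrow>\<^sub>0 complex) set" where
  "tensor_assoc A =
     tensor_lift (tensor A (tensor A A))
       (\<lambda>u c. tensor_lift (tensor A (tensor A A))
                (\<lambda>a b. ptens A (tensor A A) a (ptens A A b c)) u)"

subsection \<open>Bialgebras and Hopf algebras\<close>

locale bialgebra = complex_algebra A for A (structure) +
  fixes \<Delta> :: "'a \<Rightarrow> (('a \<times> 'a) \<Rightarrow>\<^sub>0 complex) set" and \<epsilon> :: "'a \<Rightarrow> complex"
  assumes comult_linear: "linear_map A (tensor A A) \<Delta>"
    and counit_linear: "linear_map A complex_alg \<epsilon>"
    and comult_hom: "\<Delta> \<in> ring_hom A (tensor A A)"
    and counit_hom: "\<epsilon> \<in> ring_hom A complex_alg"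
    and coassoc: "\<And>x. x \<in> carrier A \<Longrightarrow>
      tensor_assoc A (tensor_map (tensor A A) A \<Delta> id (\<Delta> x)) = tensor_map A (tensor A A) id \<Delta> (\<Delta> x)"
    and counit_left: "\<And>x. x \<in> carrier A \<Longrightarrow> tensor_lift A (\<lambda>a b. \<epsilon> a \<odot>\<^bsub>A\<^esub> b) (\<Delta> x) = x"
    and counit_right: "\<And>x. x \<in> carrier A \<Longrightarrow> tensor_lift A (\<lambda>a b. \<epsilon> b \<odot>\<^bsub>A\<^esub> a) (\<Delta> x) = x"

definition tensor_degree ::
  "(complex, 'a, 'm) module_scheme \<Rightarrow> (nat \<Rightarrow> 'a set) \<Rightarrow> nat \<Rightarrow> (('a \<times> 'a) \<Rightarrow>\<^sub>0 complex) set set" where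
  "tensor_degree A gr n =
     lin_span (tensor A A) {ptens A A a b | a b p q. p + q = n \<and> a \<in> gr p \<and> b \<in> gr q}"

locale graded_bialgebra = bialgebra A \<Delta> \<epsilon> for A (structure) and \<Delta> and \<epsilon> +
  fixes gr :: "nat \<Rightarrow> 'a set"
  assumes gr_submodule: "\<And>n. submodule (gr n) complex_alg A"
    and gr_direct_sum: "\<And>x. x \<in> carrier A \<Longrightarrow>
      \<exists>!f. (\<forall>n. f n \<in> gr n) \<and> finite {n. f n \<noteq> \<zero>\<^bsub>A\<^esub>} \<and> x = finsum A f {n. f n \<noteq> \<zero>\<^bsub>A\<^esub>}"
    and gr_one: "\<one>\<^bsub>A\<^esub> \<in> gr 0"
    and gr_mult: "\<And>p q x y. x \<in> gr p \<Longrightarrow> y \<in> gr q \<Longrightarrow> x \<otimes>\<^bsub>A\<^esub> y \<in> gr (p + q)"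
    and gr_comult: "\<And>n x. x \<in> gr n \<Longrightarrow> \<Delta> x \<in> tensor_degree A gr n"
    and gr_counit: "\<And>n x. n > 0 \<Longrightarrow> x \<in> gr n \<Longrightarrow> \<epsilon> x = 0"

locale connected_graded_bialgebra = graded_bialgebra A \<Delta> \<epsilon> gr
  for A (structure) and \<Delta> and \<epsilon> and gr +
  assumes connected_zero: "gr 0 = {c \<odot>\<^bsub>A\<^esub> \<one>\<^bsub>A\<^esub> | c. True}"
    and connected_nontrivial: "\<one>\<^bsub>A\<^esub> \<noteq> \<zero>\<^bsub>A\<^esub>"

locale connected_graded_hopf_algebra = connected_graded_bialgebra A \<Delta> \<epsilon> gr
  for A (structure) and \<Delta> and \<epsilon> and gr +
  fixes S :: "'a \<Rightarrow> 'a"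
  assumes antipode_linear: "linear_map A A S"
    and antipode_left: "\<And>x. x \<in> carrier A \<Longrightarrow>
      tensor_lift A (\<lambda>a b. a \<otimes>\<^bsub>A\<^esub> b) (tensor_map A A S id (\<Delta> x)) = \<epsilon> x \<odot>\<^bsub>A\<^esub> \<one>\<^bsub>A\<^esub>"
    and antipode_right: "\<And>x. x \<in> carrier A \<Longrightarrow>
      tensor_lift A (\<lambda>a b. a \<otimes>\<^bsub>A\<^esub> b) (tensor_map A A id S (\<Delta> x)) = \<epsilon> x \<odot>\<^bsub>A\<^esub> \<one>\<^bsub>A\<^esub>"
    and antipode_graded: "\<And>n x. x \<in> gr n \<Longrightarrow> S x \<in> gr n"

section \<open>Feynman graphs\<close>

text \<open>The functions of a graph matter only on its carrier sets.\<close>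

record ('v, 'h, 'ty) fgraph =
  verts :: "'v set"
  hedges :: "'h set"
  sigma :: "'h \<Rightarrow> 'h"
  bdry :: "'h \<Rightarrow> 'v"
  htype :: "'h \<Rightarrow> 'ty"

text \<open>The type of a vertex is determined by its half-edges, so only the second entry of its refined
  type is stored.\<close>

record ('v, 'h, 'ty) lgraph = "('v, 'h, 'ty) fgraph" +
  vlab :: "'v \<Rightarrow> nat"

definition fgraph_wf :: "('v, 'h, 'ty, 'm) fgraph_scheme \<Rightarrow> bool" where
  "fgraph_wf \<Gamma> \<longleftrightarrow> finite (verts \<Gamma>) \<and> finite (hedges \<Gamma>) \<and>
     sigma \<Gamma> \<in> hedges \<Gamma> \<rightarrow> hedges \<Gamma> \<and> (\<forall>e\<in>hedges \<Gamma>. sigma \<Gamma> (sigma \<Gamma> e) = e) \<and>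
     bdry \<Gamma> \<in> hedges \<Gamma> \<rightarrow> verts \<Gamma>"

definition external :: "('v, 'h, 'ty, 'm) fgraph_scheme \<Rightarrow> 'h set" where
  "external \<Gamma> = {e \<in> hedges \<Gamma>. sigma \<Gamma> e = e}"

definition internal :: "('v, 'h, 'ty, 'm) fgraph_scheme \<Rightarrow> 'h set set" where
  "internal \<Gamma> = {{e, sigma \<Gamma> e} | e. e \<in> hedges \<Gamma> \<and> sigma \<Gamma> e \<noteq> e}"

definition cut :: "('v, 'h, 'ty, 'm) fgraph_scheme \<Rightarrow> 'h set set \<Rightarrow> ('v, 'h, 'ty, 'm) fgraph_scheme" where
  "cut \<Gamma> C = \<Gamma>\<lparr>sigma := (\<lambda>e. if e \<in> \<Union>C then e else sigma \<Gamma> e)\<rparr>"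

definition skeleton :: "('v, 'h, 'ty, 'm) fgraph_scheme \<Rightarrow> ('v, 'h, 'ty, 'm) fgraph_scheme" where
  "skeleton \<Gamma> = cut \<Gamma> (internal \<Gamma>)"

definition covering_subgraphs ::
  "('v, 'h, 'ty, 'm) fgraph_scheme \<Rightarrow> ('v, 'h, 'ty, 'm) fgraph_scheme set" where
  "covering_subgraphs \<Gamma> = {cut \<Gamma> C | C. C \<subseteq> internal \<Gamma>}"

definition adj :: "('v, 'h, 'ty, 'm) fgraph_scheme \<Rightarrow> ('v \<times> 'v) set" where
  "adj \<Gamma> = {(bdry \<Gamma> e, bdry \<Gamma> (sigma \<Gamma> e)) | e. e \<in> hedges \<Gamma>}"

text \<open>A connected component is represented by its set of vertices; \<open>component_graph\<close> is the
  component as a graph.\<close>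

definition components :: "('v, 'h, 'ty, 'm) fgraph_scheme \<Rightarrow> 'v set set" where
  "components \<Gamma> = verts \<Gamma> // (adj \<Gamma>)\<^sup>*"

definition component_of :: "('v, 'h, 'ty, 'm) fgraph_scheme \<Rightarrow> 'v \<Rightarrow> 'v set" where
  "component_of \<Gamma> v = (adj \<Gamma>)\<^sup>* `` {v}"

definition component_graph ::
  "('v, 'h, 'ty, 'm) fgraph_scheme \<Rightarrow> 'v set \<Rightarrow> ('v, 'h, 'ty, 'm) fgraph_scheme" where
  "component_graph \<Gamma> K = \<Gamma>\<lparr>verts := K, hedges := {e \<in> hedges \<Gamma>. bdry \<Gamma> e \<in> K}\<rparr>"

definition loop_number :: "('v, 'h, 'ty, 'm) fgraph_scheme \<Rightarrow> int" where
  "loop_number \<Gamma> = int (card (internal \<Gamma>)) - int (card (verts \<Gamma>)) + int (card (components \<Gamma>))"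

definition connected_graph :: "('v, 'h, 'ty, 'm) fgraph_scheme \<Rightarrow> bool" where
  "connected_graph \<Gamma> \<longleftrightarrow> card (components \<Gamma>) = 1"

definition one_PI :: "('v, 'h, 'ty, 'm) fgraph_scheme \<Rightarrow> bool" where
  "one_PI \<Gamma> \<longleftrightarrow> connected_graph \<Gamma> \<and> (\<forall>a\<in>internal \<Gamma>. connected_graph (cut \<Gamma> {a}))"

definition locally_one_PI :: "('v, 'h, 'ty, 'm) fgraph_scheme \<Rightarrow> bool" where
  "locally_one_PI \<Gamma> \<longleftrightarrow> (\<forall>K\<in>components \<Gamma>. one_PI (component_graph \<Gamma> K))"

definition contract ::
  "('v, 'h, 'ty, 'm) fgraph_scheme \<Rightarrow> ('v, 'h, 'ty, 'n) fgraph_scheme \<Rightarrow> ('v set, 'h, 'ty) fgraph" where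
  "contract \<Gamma> \<gamma> =
     \<lparr>verts = components \<gamma>, hedges = external \<gamma>, sigma = sigma \<Gamma>,
      bdry = (\<lambda>e. component_of \<gamma> (bdry \<Gamma> e)), htype = htype \<Gamma>\<rparr>"

definition residue :: "('v, 'h, 'ty, 'm) fgraph_scheme \<Rightarrow> ('v set, 'h, 'ty) fgraph" where
  "residue \<Gamma> = contract \<Gamma> \<Gamma>"

definition vtype :: "('v, 'h, 'ty, 'm) fgraph_scheme \<Rightarrow> 'v \<Rightarrow> 'ty \<Rightarrow> nat" where
  "vtype \<Gamma> v = (\<lambda>t. card {e \<in> hedges \<Gamma>. bdry \<Gamma> e = v \<and> htype \<Gamma> e = t})"

text \<open>The type of the unique vertex of the residue of the component \<open>K\<close>.\<close>

definition res_type :: "('v, 'h, 'ty, 'm) fgraph_scheme \<Rightarrow> 'v set \<Rightarrow> 'ty \<Rightarrow> nat" where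
  "res_type \<Gamma> K = vtype (residue (component_graph \<Gamma> K)) K"

section \<open>Field theories and specified graphs\<close>

record 'ty theory_data =
  edge_types :: "'ty set"
  vertex_types :: "('ty \<Rightarrow> nat) set"
  refined_types :: "(('ty \<Rightarrow> nat) \<times> nat) set"

text \<open>A function on \<open>edge_types T\<close> is represented by its extension by zero.\<close>

definition field_theory :: "'ty theory_data \<Rightarrow> bool" where
  "field_theory T \<longleftrightarrow>
     (\<forall>t\<in>vertex_types T. \<forall>a. a \<notin> edge_types T \<longrightarrow> t a = 0) \<and>
     fst ` refined_types T = vertex_types T \<and>
     (\<forall>t\<in>vertex_types T. finite {k. (t, k) \<in> refined_types T})"

definition graph_of_theory :: "'ty theory_data \<Rightarrow> ('v, 'h, 'ty) lgraph \<Rightarrow> bool" where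
  "graph_of_theory T \<Gamma> \<longleftrightarrow> fgraph_wf \<Gamma> \<and>
     htype \<Gamma> \<in> hedges \<Gamma> \<rightarrow> edge_types T \<and>
     (\<forall>e\<in>hedges \<Gamma>. htype \<Gamma> (sigma \<Gamma> e) = htype \<Gamma> e) \<and>
     (\<forall>v\<in>verts \<Gamma>. (vtype \<Gamma> v, vlab \<Gamma> v) \<in> refined_types T)"

definition superficially_divergent :: "'ty theory_data \<Rightarrow> ('v, 'h, 'ty) lgraph \<Rightarrow> bool" where
  "superficially_divergent T \<Gamma> \<longleftrightarrow> (\<forall>K\<in>components \<Gamma>. res_type \<Gamma> K \<in> vertex_types T)"

type_synonym ('v, 'h, 'ty) sgraph = "('v, 'h, 'ty) lgraph \<times> ('v set \<Rightarrow> nat)"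

definition specified_graph :: "'ty theory_data \<Rightarrow> ('v, 'h, 'ty) sgraph \<Rightarrow> bool" where
  "specified_graph T G \<longleftrightarrow> (case G of (\<Gamma>, i) \<Rightarrow>
     graph_of_theory T \<Gamma> \<and> locally_one_PI \<Gamma> \<and> superficially_divergent T \<Gamma> \<and>
     (\<forall>K\<in>components \<Gamma>. (res_type \<Gamma> K, i K) \<in> refined_types T) \<and>
     (\<forall>v. {v} \<in> components \<Gamma> \<and> internal (component_graph \<Gamma> {v}) = {} \<longrightarrow> i {v} = vlab \<Gamma> v))"

text \<open>\<open>K\<close> is a component of both graphs, with the same internal edges.\<close>

definition full_component :: "('v, 'h, 'ty) lgraph \<Rightarrow> ('v, 'h, 'ty) lgraph \<Rightarrow> 'v set \<Rightarrow> bool" where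
  "full_component \<Gamma> \<gamma> K \<longleftrightarrow> K \<in> components \<gamma> \<and> K \<in> components \<Gamma> \<and>
     internal (component_graph \<gamma> K) = internal (component_graph \<Gamma> K)"

text \<open>A specification of a subgraph is taken to be \<open>undefined\<close> off the components, so that
  distinct elements of this set are distinct specified covering subgraphs.\<close>

definition specified_subgraphs ::
  "'ty theory_data \<Rightarrow> ('v, 'h, 'ty) sgraph \<Rightarrow> ('v, 'h, 'ty) sgraph set" where
  "specified_subgraphs T G = {(\<gamma>, j).
     \<gamma> \<in> covering_subgraphs (fst G) \<and> j \<in> extensional (components \<gamma>) \<and>
     specified_graph T (\<gamma>, j) \<and> (\<forall>K. full_component (fst G) \<gamma> K \<longrightarrow> j K = snd G K)}"

text \<open>A component of the contracted graph is a set of components of \<open>\<gamma>\<close>, whose union is the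
  component of \<open>\<Gamma>\<close> it is identified with.\<close>

definition contract_spec ::
  "('v, 'h, 'ty) sgraph \<Rightarrow> ('v, 'h, 'ty) sgraph \<Rightarrow> ('v set, 'h, 'ty) sgraph" where
  "contract_spec G g =
     (fgraph.extend (contract (fst G) (fst g)) (lgraph.fields (snd g)), \<lambda>C. snd G (\<Union>C))"

definition residue_spec :: "('v, 'h, 'ty) sgraph \<Rightarrow> ('v set, 'h, 'ty) sgraph" where
  "residue_spec G = contract_spec G G"

definition admissible_subgraphs ::
  "'ty theory_data \<Rightarrow> ('v, 'h, 'ty) sgraph \<Rightarrow> ('v, 'h, 'ty) sgraph set" where
  "admissible_subgraphs T G =
     {g \<in> specified_subgraphs T G. graph_of_theory T (fst (contract_spec G g))}"

definition proper_admissible_subgraphs ::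
  "'ty theory_data \<Rightarrow> ('v, 'h, 'ty) sgraph \<Rightarrow> ('v, 'h, 'ty) sgraph set" where
  "proper_admissible_subgraphs T G =
     {g \<in> admissible_subgraphs T G. fst g \<noteq> fst G \<and> fst g \<noteq> skeleton (fst G)}"

definition sgraph_iso :: "('v, 'h, 'ty) sgraph \<Rightarrow> ('w, 'k, 'ty) sgraph \<Rightarrow> bool" where
  "sgraph_iso G G' \<longleftrightarrow> (case (G, G') of ((\<Gamma>, i), (\<Gamma>', i')) \<Rightarrow>
     \<exists>fv fh. bij_betw fv (verts \<Gamma>) (verts \<Gamma>') \<and> bij_betw fh (hedges \<Gamma>) (hedges \<Gamma>') \<and>
       (\<forall>e\<in>hedges \<Gamma>. sigma \<Gamma>' (fh e) = fh (sigma \<Gamma> e) \<and> bdry \<Gamma>' (fh e) = fv (bdry \<Gamma> e) \<and>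
                     htype \<Gamma>' (fh e) = htype \<Gamma> e) \<and>
       (\<forall>v\<in>verts \<Gamma>. vlab \<Gamma>' (fv v) = vlab \<Gamma> v) \<and>
       (\<forall>K\<in>components \<Gamma>. i' (fv ` K) = i K))"

definition disj_union ::
  "('v, 'h, 'ty) sgraph \<Rightarrow> ('w, 'k, 'ty) sgraph \<Rightarrow> ('v + 'w, 'h + 'k, 'ty) sgraph" where
  "disj_union G G' = (case (G, G') of ((\<Gamma>, i), (\<Gamma>', i')) \<Rightarrow>
     (\<lparr>verts = verts \<Gamma> <+> verts \<Gamma>', hedges = hedges \<Gamma> <+> hedges \<Gamma>',
       sigma = map_sum (sigma \<Gamma>) (sigma \<Gamma>'), bdry = map_sum (bdry \<Gamma>) (bdry \<Gamma>'),
       htype = case_sum (htype \<Gamma>) (htype \<Gamma>'), vlab = case_sum (vlab \<Gamma>) (vlab \<Gamma>')\<rparr>,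
      \<lambda>K. if K \<subseteq> range Inl then i (Inl -` K) else i' (Inr -` K)))"

definition empty_sgraph :: "(nat, nat, 'ty) sgraph" where
  "empty_sgraph =
     (\<lparr>verts = {}, hedges = {}, sigma = undefined, bdry = undefined, htype = undefined,
       vlab = undefined\<rparr>, undefined)"

text \<open>As graphs are finite, every isomorphism class has members with vertices and half-edges in
  \<open>nat\<close>; it is represented by the set of all of these.\<close>

type_synonym 'ty sgraph_class = "(nat, nat, 'ty) sgraph set"

definition iso_class :: "('v, 'h, 'ty) sgraph \<Rightarrow> 'ty sgraph_class" where
  "iso_class G = {G'. sgraph_iso G G'}"

definition sgraph_monoid :: "'ty theory_data \<Rightarrow> 'ty sgraph_class monoid" where
  "sgraph_monoid T =
     \<lparr>carrier = {iso_class G | G :: (nat, nat, 'ty) sgraph. specified_graph T G},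
      mult = (\<lambda>X Y. \<Union>G\<in>X. \<Union>G'\<in>Y. iso_class (disj_union G G')),
      one = iso_class empty_sgraph\<rparr>"

section \<open>The bialgebra of specified graphs and its quotient\<close>

definition Htilde :: "'ty theory_data \<Rightarrow> (complex, 'ty sgraph_class \<Rightarrow>\<^sub>0 complex) module" where
  "Htilde T = monoid_algebra (sgraph_monoid T)"

definition gen :: "('v, 'h, 'ty) sgraph \<Rightarrow> 'ty sgraph_class \<Rightarrow>\<^sub>0 complex" where
  "gen G = Poly_Mapping.single (iso_class G) 1"

definition graph_coproduct :: "'ty theory_data \<Rightarrow> ('v, 'h, 'ty) sgraph \<Rightarrow>
    ((('ty sgraph_class \<Rightarrow>\<^sub>0 complex) \<times> ('ty sgraph_class \<Rightarrow>\<^sub>0 complex)) \<Rightarrow>\<^sub>0 complex) set" where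
  "graph_coproduct T G =
     finsum (tensor (Htilde T) (Htilde T))
       (\<lambda>g. ptens (Htilde T) (Htilde T) (gen g) (gen (contract_spec G g)))
       (admissible_subgraphs T G)"

definition comult_Htilde :: "'ty theory_data \<Rightarrow> ('ty sgraph_class \<Rightarrow>\<^sub>0 complex) \<Rightarrow>
    ((('ty sgraph_class \<Rightarrow>\<^sub>0 complex) \<times> ('ty sgraph_class \<Rightarrow>\<^sub>0 complex)) \<Rightarrow>\<^sub>0 complex) set" where
  "comult_Htilde T x =
     finsum (tensor (Htilde T) (Htilde T))
       (\<lambda>X. Poly_Mapping.lookup x X \<odot>\<^bsub>tensor (Htilde T) (Htilde T)\<^esub> graph_coproduct T (SOME G. G \<in> X))
       (Poly_Mapping.keys x)"

definition counit_Htilde :: "('ty sgraph_class \<Rightarrow>\<^sub>0 complex) \<Rightarrow> complex" where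
  "counit_Htilde x =
     (\<Sum>X\<in>Poly_Mapping.keys x.
        Poly_Mapping.lookup x X * (if \<exists>G\<in>X. internal (fst G) = {} then 1 else 0))"

definition ideal_J :: "'ty theory_data \<Rightarrow> ('ty sgraph_class \<Rightarrow>\<^sub>0 complex) set" where
  "ideal_J T = Idl\<^bsub>Htilde T\<^esub>
     {\<one>\<^bsub>Htilde T\<^esub> \<ominus>\<^bsub>Htilde T\<^esub> gen (residue_spec G)
        | G :: (nat, nat, 'ty) sgraph. specified_graph T G \<and> one_PI (fst G)}"

definition HT :: "'ty theory_data \<Rightarrow> (complex, ('ty sgraph_class \<Rightarrow>\<^sub>0 complex) set) module" where
  "HT T = quot_alg (Htilde T) (ideal_J T)"

definition proj :: "'ty theory_data \<Rightarrow>
    ('ty sgraph_class \<Rightarrow>\<^sub>0 complex) \<Rightarrow> ('ty sgraph_class \<Rightarrow>\<^sub>0 complex) set" where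
  "proj T x = ideal_J T +>\<^bsub>Htilde T\<^esub> x"

definition comult_HT :: "'ty theory_data \<Rightarrow> ('ty sgraph_class \<Rightarrow>\<^sub>0 complex) set \<Rightarrow>
    ((('ty sgraph_class \<Rightarrow>\<^sub>0 complex) set \<times> ('ty sgraph_class \<Rightarrow>\<^sub>0 complex) set) \<Rightarrow>\<^sub>0 complex) set" where
  "comult_HT T X =
     the_elem ((\<lambda>x. tensor_map (HT T) (HT T) (proj T) (proj T) (comult_Htilde T x)) ` X)"

definition counit_HT :: "('ty sgraph_class \<Rightarrow>\<^sub>0 complex) set \<Rightarrow> complex" where
  "counit_HT X = the_elem (counit_Htilde ` X)"

definition loop_grading ::
  "'ty theory_data \<Rightarrow> nat \<Rightarrow> ('ty sgraph_class \<Rightarrow>\<^sub>0 complex) set set" where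
  "loop_grading T n = lin_span (HT T)
     {proj T (gen G) | G :: (nat, nat, 'ty) sgraph.
        specified_graph T G \<and> loop_number (fst G) = int n}"

end

theory Submission
  imports Defs
begin

text \<open>A covering subgraph of a specified graph \<open>G\<close> is given by the set of half-edges that are cut
  and a specification, and the conditions on it are local at the vertices. Cutting and contracting
  commute, so the chains of covering subgraphs \<open>h \<subseteq> g \<subseteq> G\<close> correspond to the pairs of a covering
  subgraph \<open>h\<close> of \<open>G\<close> and a covering subgraph \<open>g/h\<close> of \<open>G/h\<close>; this is coassociativity. The
  residues of 1PI graphs generate the monoid of graphs without internal edges, whose elements are
  grouplike, so the coproduct descends to the quotient that identifies the residues with 1. Since a
  1PI graph has no bridges, it has loop number 0 only if it has no internal edges; hence the quotient
  is connected. The antipode is the geometric series of \<open>\<eta> \<circ> \<epsilon> - id\<close> under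
  convolution, which is finite in each degree.\<close>

section \<open>Complex vector spaces and linear maps\<close>

text \<open>Graphs matter only up to isomorphism, while the objects of the theorem are cosets of
  formal sums. To keep the two apart, the coproduct of a graph is computed as a formal sum
  \<open>copr\<close> of pairs of classes, where coassociativity and the counit laws are identities
  of finite sums; tensors enter only through \<open>ptens\<close>. The laws are transferred to
  tensors once, from a spanning family that may be linearly dependent, so that one argument serves
  the monoid algebra and its quotient. Dependence is the obstacle to the grading of the quotient:
  its pieces are independent because of projectors, which exist since the relations only identify
  basis elements of equal loop number. On the graph side, embeddings onto unions of components cover
  isomorphisms and the summands of disjoint unions at once. The delicate point of coassociativity is
  the specification: for a chain h \<subseteq> g \<subseteq> G, the condition that h and g agree on
  common full components becomes, for g/h inside G/h, the condition that the specification at an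
  isolated vertex is its label.\<close>

lemma complex_alg_simps [simp]:
  "carrier complex_alg = UNIV" "x \<otimes>\<^bsub>complex_alg\<^esub> y = x * y" "\<one>\<^bsub>complex_alg\<^esub> = 1"
  "\<zero>\<^bsub>complex_alg\<^esub> = 0" "x \<oplus>\<^bsub>complex_alg\<^esub> y = x + y" "x \<odot>\<^bsub>complex_alg\<^esub> y = x * y"
  by (simp_all add: complex_alg_def)

lemma cring_complex_alg: "cring complex_alg"
  by (rule cringI; (rule abelian_groupI comm_monoidI)?)
    (auto simp: algebra_simps intro: exI[of _ "- x" for x] add.left_inverse)

lemma complex_algebra_complex_alg: "complex_algebra complex_alg"
proof -
  interpret cring complex_alg by (rule cring_complex_alg)
  show ?thesis
    by unfold_locales (auto simp: algebra_simps)
qed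

text \<open>Separates the linear statements from the product, so that \<open>complex_alg\<close>,
  quotients and iterated tensor products can all serve as targets. The module axioms are restated
  with the arithmetic of \<open>complex\<close>.\<close>

locale complex_vector_space = module complex_alg M for M (structure)
begin

lemma scale_closed [simp, intro]: "x \<in> carrier M \<Longrightarrow> c \<odot> x \<in> carrier M"
  by simp

lemma scale_add_left: "x \<in> carrier M \<Longrightarrow> (a + b) \<odot> x = a \<odot> x \<oplus> b \<odot> x"
  using smult_l_distr[of a b x] by simp

lemma scale_add_right:
  "x \<in> carrier M \<Longrightarrow> y \<in> carrier M \<Longrightarrow> a \<odot> (x \<oplus> y) = a \<odot> x \<oplus> a \<odot> y"
  using smult_r_distr[of a x y] by simp

lemma scale_scale: "x \<in> carrier M \<Longrightarrow> a \<odot> (b \<odot> x) = (a * b) \<odot> x"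
  using smult_assoc1[of a b x] by simp

lemma scale_one [simp]: "x \<in> carrier M \<Longrightarrow> 1 \<odot> x = x"
  using smult_one[of x] by simp

lemma scale_zero [simp]: "x \<in> carrier M \<Longrightarrow> 0 \<odot> x = \<zero>"
  using smult_l_null[of x] by simp

lemma scale_zero_right [simp]: "c \<odot> \<zero> = \<zero>"
  using smult_r_null[of c] by simp

lemma scale_minus_one: "x \<in> carrier M \<Longrightarrow> (- 1) \<odot> x = \<ominus> x"
  using scale_add_left[of x "-1" 1] minus_equality[of "(-1) \<odot> x" x]
  by (simp add: M.minus_equality)

lemma subspaceI:
  assumes "H \<subseteq> carrier M" "\<zero> \<in> H" "\<And>x y. x \<in> H \<Longrightarrow> y \<in> H \<Longrightarrow> x \<oplus> y \<in> H"
    and "\<And>c x. x \<in> H \<Longrightarrow> c \<odot> x \<in> H"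
  shows "submodule H complex_alg M"
  using assms scale_minus_one by (intro submoduleI) (auto simp: subset_iff, metis)

lemma subspaceD:
  assumes "submodule H complex_alg M"
  shows "H \<subseteq> carrier M" "\<zero> \<in> H" "\<And>x y. x \<in> H \<Longrightarrow> y \<in> H \<Longrightarrow> x \<oplus> y \<in> H"
    and "\<And>c x. x \<in> H \<Longrightarrow> c \<odot> x \<in> H" "\<And>x. x \<in> H \<Longrightarrow> \<ominus> x \<in> H"
    "\<And>x y. x \<in> H \<Longrightarrow> y \<in> H \<Longrightarrow> x \<ominus> y \<in> H"
proof -
  note s = submoduleE[OF assms]
  show "H \<subseteq> carrier M" "\<And>x y. x \<in> H \<Longrightarrow> y \<in> H \<Longrightarrow> x \<oplus> y \<in> H"
    "\<And>c x. x \<in> H \<Longrightarrow> c \<odot> x \<in> H" "\<And>x. x \<in> H \<Longrightarrow> \<ominus> x \<in> H"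
    using s by auto
  obtain x where x: "x \<in> H" using s(2) by auto
  then have "0 \<odot> x \<in> H" using s(4) by simp
  then show "\<zero> \<in> H" using x s(1) by auto
  show "\<And>x y. x \<in> H \<Longrightarrow> y \<in> H \<Longrightarrow> x \<ominus> y \<in> H"
    using s(3,5) by (simp add: a_minus_def)
qed

lemma subspace_finsum:
  assumes H: "submodule H complex_alg M" and f: "f \<in> A \<rightarrow> H"
  shows "finsum M f A \<in> H"
proof (cases "finite A")
  case True
  then show ?thesis using f
  proof (induction A rule: finite_induct)
    case empty then show ?case using subspaceD(2)[OF H] by simp
  next
    case (insert a A)
    then have "f a \<in> H" "finsum M f A \<in> H" "f \<in> A \<rightarrow> carrier M" "f a \<in> carrier M"
      using subspaceD(1)[OF H] by auto
    then show ?case using insert subspaceD(3)[OF H] by simp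
  qed
next
  case False then show ?thesis using subspaceD(2)[OF H] by (simp add: finsum_infinite)
qed

lemma span_subspace:
  assumes "S \<subseteq> carrier M"
  shows "submodule (lin_span M S) complex_alg M"
proof (rule subspaceI)
  show "lin_span M S \<subseteq> carrier M"
    using assms carrier_is_submodule by (auto simp: lin_span_def)
qed (auto simp: lin_span_def dest: subspaceD)

lemma span_base: "x \<in> S \<Longrightarrow> x \<in> lin_span M S"
  by (auto simp: lin_span_def)

lemma span_minimal: "submodule H complex_alg M \<Longrightarrow> S \<subseteq> H \<Longrightarrow> lin_span M S \<subseteq> H"
  by (auto simp: lin_span_def)

lemma span_closed: "S \<subseteq> carrier M \<Longrightarrow> lin_span M S \<subseteq> carrier M"
  using span_subspace subspaceD(1) by blast

text \<open>The elements of the carrier that satisfy \<open>P\<close> form a subspace containing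
  \<open>S\<close>, and the span is the least such subspace.\<close>

lemma span_induct [consumes 2, case_names base zero add scale]:
  assumes x: "x \<in> lin_span M S" and S: "S \<subseteq> carrier M"
    and base: "\<And>s. s \<in> S \<Longrightarrow> P s" and zero: "P \<zero>"
    and add: "\<And>x y. x \<in> carrier M \<Longrightarrow> y \<in> carrier M \<Longrightarrow> P x \<Longrightarrow> P y \<Longrightarrow> P (x \<oplus> y)"
    and scale: "\<And>c x. x \<in> carrier M \<Longrightarrow> P x \<Longrightarrow> P (c \<odot> x)"
  shows "P x"
proof -
  have "submodule {x \<in> carrier M. P x} complex_alg M"
    by (rule subspaceI) (use zero add scale in auto)
  with base S have "lin_span M S \<subseteq> {x \<in> carrier M. P x}" by (intro span_minimal) auto
  with x show ?thesis by auto
qed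

end

lemma complex_vector_space_complex_alg: "complex_vector_space complex_alg"
  using complex_algebra_complex_alg
  by (simp add: complex_vector_space_def complex_algebra_def)

lemma (in complex_algebra) vector_space: "complex_vector_space A"
  by (simp add: complex_vector_space_def module_axioms)

lemma linear_mapD:
  assumes "linear_map M N f"
  shows "x \<in> carrier M \<Longrightarrow> f x \<in> carrier N"
    and "x \<in> carrier M \<Longrightarrow> y \<in> carrier M \<Longrightarrow> f (x \<oplus>\<^bsub>M\<^esub> y) = f x \<oplus>\<^bsub>N\<^esub> f y"
    and "x \<in> carrier M \<Longrightarrow> f (c \<odot>\<^bsub>M\<^esub> x) = c \<odot>\<^bsub>N\<^esub> f x"
  using assms by (auto simp: linear_map_def)

lemma linear_map_cong:
  assumes "complex_vector_space M" "\<And>x. x \<in> carrier M \<Longrightarrow> f x = g x"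
  shows "linear_map M N f = linear_map M N g"
proof -
  interpret complex_vector_space M by fact
  show ?thesis using assms(2) unfolding linear_map_def by (auto simp: Pi_iff)
qed

lemma linear_map_comp:
  "linear_map M N f \<Longrightarrow> linear_map N P g \<Longrightarrow> linear_map M P (\<lambda>x. g (f x))"
  by (auto simp: linear_map_def Pi_iff)

lemma linear_map_id: "linear_map M M (\<lambda>x. x)"
  by (auto simp: linear_map_def)

lemma linear_map_zero:
  assumes "linear_map M N f" "complex_vector_space M" "complex_vector_space N"
  shows "f \<zero>\<^bsub>M\<^esub> = \<zero>\<^bsub>N\<^esub>"
proof -
  interpret M: complex_vector_space M by fact
  interpret N: complex_vector_space N by fact
  have "f (0 \<odot>\<^bsub>M\<^esub> \<zero>\<^bsub>M\<^esub>) = 0 \<odot>\<^bsub>N\<^esub> f \<zero>\<^bsub>M\<^esub>"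
    using linear_mapD(3)[OF assms(1)] by blast
  then show ?thesis using linear_mapD(1)[OF assms(1), of "\<zero>\<^bsub>M\<^esub>"] by simp
qed

lemma linear_map_uminus:
  assumes "linear_map M N f" "complex_vector_space M" "complex_vector_space N" "x \<in> carrier M"
  shows "f (\<ominus>\<^bsub>M\<^esub> x) = \<ominus>\<^bsub>N\<^esub> f x"
proof -
  interpret M: complex_vector_space M by fact
  interpret N: complex_vector_space N by fact
  show ?thesis
    using linear_mapD(3)[OF assms(1), of x "-1"] linear_mapD(1)[OF assms(1)] assms(4)
    by (simp add: M.scale_minus_one N.scale_minus_one)
qed

lemma linear_map_minus:
  assumes "linear_map M N f" "complex_vector_space M" "complex_vector_space N"
    "x \<in> carrier M" "y \<in> carrier M"
  shows "f (x \<ominus>\<^bsub>M\<^esub> y) = f x \<ominus>\<^bsub>N\<^esub> f y"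
proof -
  interpret M: complex_vector_space M by fact
  show ?thesis
    using assms linear_mapD(2)[OF assms(1), of x "\<ominus>\<^bsub>M\<^esub> y"] linear_map_uminus[OF assms(1-3)]
    by (simp add: a_minus_def)
qed

lemma linear_map_finsum:
  assumes "linear_map M N h" "complex_vector_space M" "complex_vector_space N"
    "f \<in> A \<rightarrow> carrier M"
  shows "h (finsum M f A) = finsum N (\<lambda>a. h (f a)) A"
proof -
  interpret M: complex_vector_space M by fact
  interpret N: complex_vector_space N by fact
  show ?thesis
  proof (cases "finite A")
    case True
    then show ?thesis using assms(4)
    proof (induction A rule: finite_induct)
      case empty then show ?case using linear_map_zero[OF assms(1-3)] by simp
    next
      case (insert a A)
      then have c: "f a \<in> carrier M" "f \<in> A \<rightarrow> carrier M" "finsum M f A \<in> carrier M" by auto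
      moreover have "h (f a) \<in> carrier N" "(\<lambda>a. h (f a)) \<in> A \<rightarrow> carrier N"
        using c linear_mapD(1)[OF assms(1)] by auto
      ultimately show ?case using insert linear_mapD(2)[OF assms(1), of "f a" "finsum M f A"] by simp
    qed
  next
    case False then show ?thesis
      using linear_map_zero[OF assms(1-3)] by (simp add: M.finsum_infinite N.finsum_infinite)
  qed
qed

lemma linear_map_add:
  assumes "complex_vector_space N" "linear_map M N f" "linear_map M N g"
  shows "linear_map M N (\<lambda>x. f x \<oplus>\<^bsub>N\<^esub> g x)"
proof -
  interpret complex_vector_space N by fact
  show ?thesis using assms(2,3)
    by (auto simp: linear_map_def Pi_iff a_ac scale_add_right)
qed

lemma linear_map_uminusI:
  assumes "complex_vector_space N" "linear_map M N f"
  shows "linear_map M N (\<lambda>x. \<ominus>\<^bsub>N\<^esub> f x)"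
proof -
  interpret complex_vector_space N by fact
  show ?thesis using assms(2)
    by (auto simp: linear_map_def Pi_iff minus_add smult_r_minus)
qed

lemma linear_map_minusI:
  assumes "complex_vector_space N" "linear_map M N f" "linear_map M N g"
  shows "linear_map M N (\<lambda>x. f x \<ominus>\<^bsub>N\<^esub> g x)"
  using linear_map_add[OF assms(1,2) linear_map_uminusI[OF assms(1,3)]] by (simp add: a_minus_def)

text \<open>Used together with \<open>span_minimal\<close>: a property of the form "the image lies
  in a subspace" passes from generators to their span.\<close>

lemma subspace_preimage:
  assumes "linear_map M N f" "complex_vector_space M" "complex_vector_space N"
    "submodule H complex_alg N"
  shows "submodule {x \<in> carrier M. f x \<in> H} complex_alg M"
proof -
  interpret M: complex_vector_space M by fact
  interpret N: complex_vector_space N by fact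
  show ?thesis
    using N.subspaceD[OF assms(4)] linear_mapD[OF assms(1)] linear_map_zero[OF assms(1-3)]
    by (intro M.subspaceI) auto
qed

lemma linear_map_eq_on_span:
  assumes "linear_map M N f" "linear_map M N g" "complex_vector_space M" "complex_vector_space N"
    "S \<subseteq> carrier M" "\<And>s. s \<in> S \<Longrightarrow> f s = g s" "x \<in> lin_span M S"
  shows "f x = g x"
proof -
  interpret M: complex_vector_space M by fact
  show ?thesis
    using assms(7,5)
    by (induction x rule: M.span_induct)
      (auto simp: assms(6) linear_map_zero[OF assms(1,3,4)] linear_map_zero[OF assms(2,3,4)]
        linear_mapD[OF assms(1)] linear_mapD[OF assms(2)])
qed

section \<open>Finitely supported functions\<close>

abbreviation "pscale c \<equiv> Poly_Mapping.map ((*) (c::complex))"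

lemma lookup_pscale [simp]: "Poly_Mapping.lookup (pscale c x) k = c * Poly_Mapping.lookup x k"
  by (simp add: Poly_Mapping.map.rep_eq when_def)

lemma pscale_simps:
  "pscale c (x + y) = pscale c x + pscale c y" "pscale (c + d) x = pscale c x + pscale d x"
  "pscale c (pscale d x) = pscale (c * d) x" "pscale 1 x = x"
  "pscale c 0 = 0" "pscale 0 x = 0" "pscale (-1) x = - x"
  "pscale c (Poly_Mapping.single k d) = Poly_Mapping.single k (c * d)"
  "pscale c (x - y) = pscale c x - pscale c y"
  by (rule poly_mapping_eqI; simp add: lookup_add lookup_single when_def algebra_simps lookup_minus)+

lemma pscale_sum: "pscale c (sum f A) = (\<Sum>a\<in>A. pscale c (f a))"
  by (induction A rule: infinite_finite_induct) (simp_all add: pscale_simps)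

lemma keys_pscale: "Poly_Mapping.keys (pscale c x) \<subseteq> Poly_Mapping.keys x"
  by (auto simp: in_keys_iff)

text \<open>A finitely supported function is the sum of the singles at its keys. The support is
  carried through the induction because the laws of the monoid are available only for keys in its
  carrier.\<close>

lemma poly_mapping_keys_induct [consumes 1, case_names zero single add]:
  fixes f :: "'a \<Rightarrow>\<^sub>0 'b::comm_monoid_add"
  assumes "Poly_Mapping.keys f \<subseteq> S" and "P 0"
    and "\<And>a c. a \<in> S \<Longrightarrow> P (Poly_Mapping.single a c)"
    and "\<And>f g. Poly_Mapping.keys f \<subseteq> S \<Longrightarrow> Poly_Mapping.keys g \<subseteq> S \<Longrightarrow> P f \<Longrightarrow> P g \<Longrightarrow> P (f + g)"
  shows "P f"
proof -
  have "finite A \<Longrightarrow> A \<subseteq> S \<Longrightarrow> 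
    P (\<Sum>k\<in>A. Poly_Mapping.single k (Poly_Mapping.lookup f k)) \<and>
    Poly_Mapping.keys (\<Sum>k\<in>A. Poly_Mapping.single k (Poly_Mapping.lookup f k)) \<subseteq> S" for A
  proof (induction A rule: finite_induct)
    case empty then show ?case using assms(2) by simp
  next
    case (insert a A)
    have k: "Poly_Mapping.keys (Poly_Mapping.single a (Poly_Mapping.lookup f a)) \<subseteq> S"
      using insert by simp
    have 2: "P (\<Sum>k\<in>A. Poly_Mapping.single k (Poly_Mapping.lookup f k))"
      "Poly_Mapping.keys (\<Sum>k\<in>A. Poly_Mapping.single k (Poly_Mapping.lookup f k)) \<subseteq> S"
      using insert by auto
    from assms(4)[OF k 2(2) _ 2(1)] assms(3)[of a "Poly_Mapping.lookup f a"] insert.prems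
    have "P (Poly_Mapping.single a (Poly_Mapping.lookup f a) +
        (\<Sum>k\<in>A. Poly_Mapping.single k (Poly_Mapping.lookup f k)))" by auto
    moreover have "Poly_Mapping.keys (Poly_Mapping.single a (Poly_Mapping.lookup f a) +
        (\<Sum>k\<in>A. Poly_Mapping.single k (Poly_Mapping.lookup f k))) \<subseteq> S"
      using k 2(2) keys_add by (metis (no_types, lifting) Un_subset_iff subset_trans)
    ultimately show ?case using insert.hyps by simp
  qed
  from this[of "Poly_Mapping.keys f"] assms(1)
  have "P (\<Sum>k\<in>Poly_Mapping.keys f. Poly_Mapping.single k (Poly_Mapping.lookup f k))" by simp
  moreover have "(\<Sum>k\<in>Poly_Mapping.keys f. Poly_Mapping.single k (Poly_Mapping.lookup f k)) = f"
    by (rule poly_mapping_eqI)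
      (simp add: lookup_sum lookup_single when_def in_keys_iff if_distrib sum.delta cong: if_cong)
  ultimately show ?thesis by simp
qed

text \<open>The linear extension of \<open>f\<close> to formal sums. \<open>tensor_lift\<close> on
  representatives, the coproducts and the counits all have this shape.\<close>

definition lin :: "(complex, 'a, 'm) module_scheme \<Rightarrow> ('k \<Rightarrow> 'a) \<Rightarrow> ('k \<Rightarrow>\<^sub>0 complex) \<Rightarrow> 'a" where
  "lin M f x =
     finsum M (\<lambda>k. Poly_Mapping.lookup x k \<odot>\<^bsub>M\<^esub> f k) (Poly_Mapping.keys x)"

context complex_vector_space
begin

text \<open>Keys outside the support contribute zero, so that sums over different supports can be
  written over one common finite set.\<close>

lemma lin_superset:
  assumes "finite S" "Poly_Mapping.keys x \<subseteq> S" "f \<in> S \<rightarrow> carrier M"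
  shows "lin M f x = finsum M (\<lambda>k. Poly_Mapping.lookup x k \<odot> f k) S"
  unfolding lin_def
  using assms by (intro add.finprod_mono_neutral_cong_left) (auto simp: in_keys_iff Pi_iff)

lemma lin_closed:
  "f \<in> Poly_Mapping.keys x \<rightarrow> carrier M \<Longrightarrow> lin M f x \<in> carrier M"
  unfolding lin_def by (intro finsum_closed) auto

lemma lin_add:
  assumes "f \<in> Poly_Mapping.keys x \<rightarrow> carrier M" "f \<in> Poly_Mapping.keys y \<rightarrow> carrier M"
  shows "lin M f (x + y) = lin M f x \<oplus> lin M f y"
proof -
  let ?S = "Poly_Mapping.keys x \<union> Poly_Mapping.keys y"
  have f: "f \<in> ?S \<rightarrow> carrier M" using assms by auto
  have "lin M f (x + y) = finsum M (\<lambda>k. Poly_Mapping.lookup (x + y) k \<odot> f k) ?S"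
    using f keys_add[of x y] by (intro lin_superset) auto
  also have "\<dots> = finsum M (\<lambda>k. Poly_Mapping.lookup x k \<odot> f k \<oplus> Poly_Mapping.lookup y k \<odot> f k) ?S"
    using f by (intro finsum_cong') (auto simp: lookup_add scale_add_left Pi_iff)
  also have "\<dots> = finsum M (\<lambda>k. Poly_Mapping.lookup x k \<odot> f k) ?S \<oplus>
      finsum M (\<lambda>k. Poly_Mapping.lookup y k \<odot> f k) ?S"
    using f by (intro finsum_addf) auto
  also have "\<dots> = lin M f x \<oplus> lin M f y"
    using f by (simp add: lin_superset[of ?S])
  finally show ?thesis .
qed

lemma lin_pscale:
  assumes "f \<in> Poly_Mapping.keys x \<rightarrow> carrier M"
  shows "lin M f (pscale c x) = c \<odot> lin M f x"
proof -
  have "lin M f (pscale c x) =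
      finsum M (\<lambda>k. Poly_Mapping.lookup (pscale c x) k \<odot> f k) (Poly_Mapping.keys x)"
    using assms by (intro lin_superset keys_pscale) auto
  also have "\<dots> = finsum M (\<lambda>k. c \<odot> (Poly_Mapping.lookup x k \<odot> f k)) (Poly_Mapping.keys x)"
    using assms by (intro finsum_cong') (auto simp: scale_scale Pi_iff)
  also have "\<dots> = c \<odot> lin M f x"
    unfolding lin_def using assms by (intro finsum_smult_ldistr[symmetric]) auto
  finally show ?thesis .
qed

lemma lin_single:
  assumes "f k \<in> carrier M"
  shows "lin M f (Poly_Mapping.single k c) = c \<odot> f k"
  using assms lin_superset[of "{k}" "Poly_Mapping.single k c" f]
  by (simp add: Pi_iff)

lemma lin_zero [simp]: "lin M f 0 = \<zero>"
  by (simp add: lin_def)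

lemma lin_diff:
  assumes "f \<in> Poly_Mapping.keys x \<rightarrow> carrier M" "f \<in> Poly_Mapping.keys y \<rightarrow> carrier M"
  shows "lin M f (x - y) = lin M f x \<ominus> lin M f y"
proof -
  have "lin M f (x - y) = lin M f (x + pscale (-1) y)" by (simp add: pscale_simps)
  also have "\<dots> = lin M f x \<oplus> (-1) \<odot> lin M f y"
    using assms keys_pscale[of "-1" y] by (subst lin_add) (auto simp: lin_pscale)
  finally show ?thesis using assms by (simp add: scale_minus_one lin_closed a_minus_def)
qed

lemma lin_cong:
  assumes "\<And>k. k \<in> Poly_Mapping.keys x \<Longrightarrow> f k = g k" "g \<in> Poly_Mapping.keys x \<rightarrow> carrier M"
  shows "lin M f x = lin M g x"
  unfolding lin_def using assms by (intro finsum_cong') auto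

text \<open>The map \<open>k\<close> may send several indices to the same key; \<open>lin\<close> is
  additive, so the coefficients collected at that key count each index once. Isomorphic subgraphs of
  a graph are the case of interest.\<close>

lemma lin_sum_single:
  assumes "finite I" "\<And>i. i \<in> I \<Longrightarrow> f (k i) \<in> carrier M"
  shows "lin M f (\<Sum>i\<in>I. Poly_Mapping.single (k i) 1) = finsum M (\<lambda>i. f (k i)) I"
  using assms
proof (induction I rule: finite_induct)
  case (insert a I)
  have "Poly_Mapping.keys (\<Sum>i\<in>I. Poly_Mapping.single (k i) (1::complex)) \<subseteq> k ` I"
    using keys_sum[of "\<lambda>i. Poly_Mapping.single (k i) (1::complex)" I] by auto
  then have c: "f \<in> Poly_Mapping.keys (\<Sum>i\<in>I. Poly_Mapping.single (k i) (1::complex)) \<rightarrow> carrier M"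
    using insert.prems by auto
  show ?case using insert c by (simp add: lin_add lin_single)
qed simp

lemma lin_in_subspace:
  assumes "submodule H complex_alg M" "\<And>k. k \<in> Poly_Mapping.keys x \<Longrightarrow> f k \<in> H"
  shows "lin M f x \<in> H"
  unfolding lin_def using assms subspaceD[OF assms(1)] by (intro subspace_finsum) auto

end

lemma linear_map_lin:
  assumes "linear_map M N h" "complex_vector_space M" "complex_vector_space N"
    "f \<in> Poly_Mapping.keys x \<rightarrow> carrier M"
  shows "h (lin M f x) = lin N (\<lambda>k. h (f k)) x"
proof -
  interpret M: complex_vector_space M by fact
  interpret N: complex_vector_space N by fact
  have "h (lin M f x) =
      finsum N (\<lambda>k. h (Poly_Mapping.lookup x k \<odot>\<^bsub>M\<^esub> f k)) (Poly_Mapping.keys x)"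
    unfolding lin_def using assms by (intro linear_map_finsum) auto
  also have "\<dots> = lin N (\<lambda>k. h (f k)) x"
    unfolding lin_def using assms linear_mapD[OF assms(1)]
    by (intro N.finsum_cong') (auto simp: Pi_iff)
  finally show ?thesis .
qed

section \<open>Monoid algebras\<close>

lemma monoid_algebra_simps [simp]:
  "carrier (monoid_algebra G) = {f. Poly_Mapping.keys f \<subseteq> carrier G}"
  "\<one>\<^bsub>monoid_algebra G\<^esub> = Poly_Mapping.single \<one>\<^bsub>G\<^esub> 1"
  "\<zero>\<^bsub>monoid_algebra G\<^esub> = 0" "x \<oplus>\<^bsub>monoid_algebra G\<^esub> y = x + y"
  "c \<odot>\<^bsub>monoid_algebra G\<^esub> x = pscale c x"
  by (simp_all add: monoid_algebra_def)

lemma monoid_algebra_mult_superset: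
  assumes "finite A" "finite B" "Poly_Mapping.keys f \<subseteq> A" "Poly_Mapping.keys g \<subseteq> B"
  shows "f \<otimes>\<^bsub>monoid_algebra G\<^esub> g =
    (\<Sum>x\<in>A. \<Sum>y\<in>B.
      Poly_Mapping.single (x \<otimes>\<^bsub>G\<^esub> y) (Poly_Mapping.lookup f x * Poly_Mapping.lookup g y))"
proof -
  have "f \<otimes>\<^bsub>monoid_algebra G\<^esub> g =
      (\<Sum>x\<in>Poly_Mapping.keys f. \<Sum>y\<in>Poly_Mapping.keys g.
        Poly_Mapping.single (x \<otimes>\<^bsub>G\<^esub> y) (Poly_Mapping.lookup f x * Poly_Mapping.lookup g y))"
    by (simp add: monoid_algebra_def)
  also have "\<dots> = (\<Sum>x\<in>Poly_Mapping.keys f. \<Sum>y\<in>B.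
        Poly_Mapping.single (x \<otimes>\<^bsub>G\<^esub> y) (Poly_Mapping.lookup f x * Poly_Mapping.lookup g y))"
    using assms by (intro sum.cong refl sum.mono_neutral_left) (auto simp: in_keys_iff)
  also have "\<dots> = (\<Sum>x\<in>A. \<Sum>y\<in>B.
        Poly_Mapping.single (x \<otimes>\<^bsub>G\<^esub> y) (Poly_Mapping.lookup f x * Poly_Mapping.lookup g y))"
    using assms by (intro sum.mono_neutral_left) (auto simp: in_keys_iff intro!: sum.neutral)
  finally show ?thesis .
qed

lemma monoid_algebra_mult_single [simp]:
  "Poly_Mapping.single x c \<otimes>\<^bsub>monoid_algebra G\<^esub> Poly_Mapping.single y d =
    Poly_Mapping.single (x \<otimes>\<^bsub>G\<^esub> y) (c * d)"
  by (subst monoid_algebra_mult_superset[of "{x}" "{y}"]) auto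

lemma monoid_algebra_mult_add_left:
  "(f + f') \<otimes>\<^bsub>monoid_algebra G\<^esub> g = f \<otimes>\<^bsub>monoid_algebra G\<^esub> g + f' \<otimes>\<^bsub>monoid_algebra G\<^esub> g"
proof -
  let ?A = "Poly_Mapping.keys f \<union> Poly_Mapping.keys f'"
  show ?thesis
    using keys_add[of f f']
    by (simp add: monoid_algebra_mult_superset[of ?A "Poly_Mapping.keys g"] lookup_add
        distrib_right single_add sum.distrib)
qed

lemma monoid_algebra_mult_add_right:
  "g \<otimes>\<^bsub>monoid_algebra G\<^esub> (f + f') = g \<otimes>\<^bsub>monoid_algebra G\<^esub> f + g \<otimes>\<^bsub>monoid_algebra G\<^esub> f'"
proof -
  let ?A = "Poly_Mapping.keys f \<union> Poly_Mapping.keys f'"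
  show ?thesis
    using keys_add[of f f']
    by (simp add: monoid_algebra_mult_superset[of "Poly_Mapping.keys g" ?A] lookup_add
        distrib_left single_add sum.distrib)
qed

lemma monoid_algebra_mult_pscale:
  "pscale c f \<otimes>\<^bsub>monoid_algebra G\<^esub> g = pscale c (f \<otimes>\<^bsub>monoid_algebra G\<^esub> g)"
  "f \<otimes>\<^bsub>monoid_algebra G\<^esub> pscale c g = pscale c (f \<otimes>\<^bsub>monoid_algebra G\<^esub> g)"
  using keys_pscale[of c f] keys_pscale[of c g]
  by (simp_all add: monoid_algebra_mult_superset[of "Poly_Mapping.keys f" "Poly_Mapping.keys g"]
      pscale_sum pscale_simps ac_simps)

lemma monoid_algebra_mult_zero [simp]:
  "0 \<otimes>\<^bsub>monoid_algebra G\<^esub> g = 0" "g \<otimes>\<^bsub>monoid_algebra G\<^esub> 0 = 0"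
  by (simp_all add: monoid_algebra_def)

lemma monoid_algebra_mult_minus:
  "(f - f') \<otimes>\<^bsub>monoid_algebra G\<^esub> g = f \<otimes>\<^bsub>monoid_algebra G\<^esub> g - f' \<otimes>\<^bsub>monoid_algebra G\<^esub> g"
  "g \<otimes>\<^bsub>monoid_algebra G\<^esub> (f - f') = g \<otimes>\<^bsub>monoid_algebra G\<^esub> f - g \<otimes>\<^bsub>monoid_algebra G\<^esub> f'"
  using monoid_algebra_mult_add_left[where f=f and f'="pscale (-1) f'" and G=G and g=g]
    monoid_algebra_mult_add_right[where g=g and G=G and f=f and f'="pscale (-1) f'"]
  by (simp_all add: monoid_algebra_mult_pscale, simp_all add: pscale_simps)

lemma monoid_algebra_mult_sum:
  "finite A \<Longrightarrow> (\<Sum>a\<in>A. f a) \<otimes>\<^bsub>monoid_algebra G\<^esub> g = (\<Sum>a\<in>A. f a \<otimes>\<^bsub>monoid_algebra G\<^esub> g)"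
  "finite A \<Longrightarrow> g \<otimes>\<^bsub>monoid_algebra G\<^esub> (\<Sum>a\<in>A. f a) = (\<Sum>a\<in>A. g \<otimes>\<^bsub>monoid_algebra G\<^esub> f a)"
  by (induction A rule: finite_induct;
      simp add: monoid_algebra_mult_add_left monoid_algebra_mult_add_right)+

context
  fixes G (structure)
  assumes G: "Group.monoid G"
begin

interpretation G: Group.monoid G by (rule G)

text \<open>On singles the unit law and associativity are those of the monoid, and the product is
  additive in each factor.\<close>

lemma complex_algebra_monoid_algebra: "complex_algebra (monoid_algebra G)"
proof -
  let ?A = "monoid_algebra G"
  have closed: "f \<otimes>\<^bsub>?A\<^esub> g \<in> carrier ?A" if "f \<in> carrier ?A" "g \<in> carrier ?A" for f g
  proof -
    have "Poly_Mapping.keys (f \<otimes>\<^bsub>?A\<^esub> g) \<subseteq>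
      (\<Union>x\<in>Poly_Mapping.keys f. \<Union>y\<in>Poly_Mapping.keys g. {x \<otimes> y})"
      unfolding monoid_algebra_mult_superset[OF finite_keys finite_keys order_refl order_refl]
      by (rule order_trans[OF keys_sum], rule UN_mono[OF order_refl],
          rule order_trans[OF keys_sum], rule UN_mono[OF order_refl]) auto
    then show ?thesis using that by (auto dest!: subsetD)
  qed
  have plus: "f + g \<in> carrier ?A" if "f \<in> carrier ?A" "g \<in> carrier ?A" for f g
    using that keys_add[of f g] by auto
  have abel: "abelian_group ?A"
  proof (rule abelian_groupI)
    fix x assume "x \<in> carrier ?A"
    then show "\<exists>y\<in>carrier ?A. y \<oplus>\<^bsub>?A\<^esub> x = \<zero>\<^bsub>?A\<^esub>"
      by (intro bexI[of _ "- x"]) auto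
  qed (use plus in \<open>auto simp: ac_simps\<close>)
  have one: "Poly_Mapping.single \<one> 1 \<otimes>\<^bsub>?A\<^esub> f = f \<and> f \<otimes>\<^bsub>?A\<^esub> Poly_Mapping.single \<one> 1 = f"
    if "Poly_Mapping.keys f \<subseteq> carrier G" for f :: "_ \<Rightarrow>\<^sub>0 complex"
    using that by (induction f rule: poly_mapping_keys_induct)
      (auto simp: monoid_algebra_mult_add_left monoid_algebra_mult_add_right)
  have assoc: "f \<otimes>\<^bsub>?A\<^esub> g \<otimes>\<^bsub>?A\<^esub> h = f \<otimes>\<^bsub>?A\<^esub> (g \<otimes>\<^bsub>?A\<^esub> h)"
    if "Poly_Mapping.keys f \<subseteq> carrier G" "Poly_Mapping.keys g \<subseteq> carrier G"
      "Poly_Mapping.keys h \<subseteq> carrier G" for f g h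
    using that(1)
  proof (induction f rule: poly_mapping_keys_induct)
    case (single a c)
    show ?case using that(2)
    proof (induction g rule: poly_mapping_keys_induct)
      case (single b d)
      show ?case using that(3)
        by (induction h rule: poly_mapping_keys_induct)
          (use single \<open>a \<in> carrier G\<close> in \<open>auto simp: monoid_algebra_mult_add_right G.m_assoc mult.assoc\<close>)
    qed (auto simp: monoid_algebra_mult_add_left monoid_algebra_mult_add_right)
  qed (auto simp: monoid_algebra_mult_add_left)
  have ring: "ring ?A"
  proof (rule ringI[OF abel])
    show "Group.monoid ?A"
      by (rule monoidI) (use closed one assoc in auto)
  qed (auto simp: monoid_algebra_mult_add_left monoid_algebra_mult_add_right)
  have "module complex_alg ?A"
    by (rule moduleI[OF cring_complex_alg abel])
      (auto simp: pscale_simps dest: subsetD[OF keys_pscale])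
  then show ?thesis
    using ring unfolding complex_algebra_def
    by (simp add: complex_algebra_axioms_def monoid_algebra_mult_pscale)
qed

lemma monoid_algebra_finsum:
  assumes "f \<in> A \<rightarrow> carrier (monoid_algebra G)" "finite A"
  shows "finsum (monoid_algebra G) f A = sum f A"
proof -
  interpret complex_algebra "monoid_algebra G" by (rule complex_algebra_monoid_algebra)
  show ?thesis using assms(2,1)
    by (induction A rule: finite_induct) auto
qed

lemma monoid_algebra_lin_basis:
  assumes "Poly_Mapping.keys x \<subseteq> carrier G"
  shows "lin (monoid_algebra G) (\<lambda>k. Poly_Mapping.single k 1) x = x"
proof -
  interpret complex_algebra "monoid_algebra G" by (rule complex_algebra_monoid_algebra)
  interpret complex_vector_space "monoid_algebra G" by (rule vector_space)
  show ?thesis using assms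
    by (induction x rule: poly_mapping_keys_induct)
      (auto simp: lin_single pscale_simps, subst lin_add, auto)
qed

lemma linear_map_lin_monoid_algebra:
  assumes "complex_vector_space M" "f \<in> carrier G \<rightarrow> carrier M"
  shows "linear_map (monoid_algebra G) M (lin M f)"
proof -
  interpret complex_vector_space M by fact
  show ?thesis unfolding linear_map_def
  proof (intro conjI ballI allI funcsetI)
    fix x assume "x \<in> carrier (monoid_algebra G)"
    then have f: "f \<in> Poly_Mapping.keys x \<rightarrow> carrier M" using assms(2) by auto
    then show "lin M f x \<in> carrier M" by (rule lin_closed)
    show "lin M f (c \<odot>\<^bsub>monoid_algebra G\<^esub> x) = c \<odot>\<^bsub>M\<^esub> lin M f x" for c
      using f by (simp add: lin_pscale)
    fix y assume "y \<in> carrier (monoid_algebra G)"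
    then have "f \<in> Poly_Mapping.keys y \<rightarrow> carrier M" using assms(2) by auto
    with f show "lin M f (x \<oplus>\<^bsub>monoid_algebra G\<^esub> y) = lin M f x \<oplus>\<^bsub>M\<^esub> lin M f y"
      by (simp add: lin_add)
  qed
qed

lemma monoid_algebra_span:
  "carrier (monoid_algebra G) =
    lin_span (monoid_algebra G) ((\<lambda>k. Poly_Mapping.single k 1) ` carrier G)"
proof -
  interpret complex_algebra "monoid_algebra G" by (rule complex_algebra_monoid_algebra)
  interpret complex_vector_space "monoid_algebra G" by (rule vector_space)
  let ?S = "(\<lambda>k. Poly_Mapping.single k (1::complex)) ` carrier G"
  have S: "?S \<subseteq> carrier (monoid_algebra G)" by auto
  have "x \<in> lin_span (monoid_algebra G) ?S" if "x \<in> carrier (monoid_algebra G)" for x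
  proof -
    have "lin (monoid_algebra G) (\<lambda>k. Poly_Mapping.single k 1) x \<in> lin_span (monoid_algebra G) ?S"
      using that by (intro lin_in_subspace[OF span_subspace[OF S]] span_base) auto
    then show ?thesis using that by (simp add: monoid_algebra_lin_basis)
  qed
  then show ?thesis using span_closed[OF S] by blast
qed

end

lemma cring_monoid_algebra:
  assumes "comm_monoid G"
  shows "cring (monoid_algebra G)"
proof -
  interpret G: comm_monoid G by fact
  interpret complex_algebra "monoid_algebra G"
    by (rule complex_algebra_monoid_algebra) (rule G.monoid_axioms)
  have "f \<otimes>\<^bsub>monoid_algebra G\<^esub> g = g \<otimes>\<^bsub>monoid_algebra G\<^esub> f"
    if "Poly_Mapping.keys f \<subseteq> carrier G" "Poly_Mapping.keys g \<subseteq> carrier G" for f g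
    using that(1)
  proof (induction f rule: poly_mapping_keys_induct)
    case (single a c)
    show ?case using that(2)
      by (induction g rule: poly_mapping_keys_induct)
        (use single in \<open>auto simp: monoid_algebra_mult_add_left monoid_algebra_mult_add_right
          G.m_comm mult.commute\<close>)
  qed (auto simp: monoid_algebra_mult_add_left monoid_algebra_mult_add_right)
  then show ?thesis by (unfold_locales) auto
qed

section \<open>Quotient algebras\<close>

lemma (in complex_vector_space) eq_if_minus_zero:
  assumes "x \<in> carrier M" "y \<in> carrier M" "x \<ominus> y = \<zero>"
  shows "x = y"
proof -
  have "x = (x \<ominus> y) \<oplus> y" using assms(1,2) by (simp add: a_minus_def a_assoc l_neg)
  then show ?thesis using assms by simp
qed

lemma quot_alg_simps:
  "carrier (quot_alg A I) = a_rcosets\<^bsub>A\<^esub> I" "mult (quot_alg A I) = rcoset_mult A I"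
  "one (quot_alg A I) = I +>\<^bsub>A\<^esub> \<one>\<^bsub>A\<^esub>" "zero (quot_alg A I) = I"
  "add (quot_alg A I) = set_add A"
  "smult (quot_alg A I) c X = (\<Union>x\<in>X. I +>\<^bsub>A\<^esub> (c \<odot>\<^bsub>A\<^esub> x))"
  by (simp_all add: quot_alg_def FactRing_def ring.extend_def module.fields_def ring.defs module.defs)

locale quotient_algebra = complex_algebra A + ideal I A for A (structure) and I
begin

text \<open>In an algebra with unit, \<open>c \<odot> x\<close> is the product of
  \<open>c \<odot> \<one>\<close> and \<open>x\<close>, so a ring ideal is automatically a
  subspace.\<close>

lemma ideal_scale: "x \<in> I \<Longrightarrow> c \<odot> x \<in> I"
proof -
  assume x: "x \<in> I"
  then have "(c \<odot> \<one>) \<otimes> x \<in> I" by (intro I_l_closed) auto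
  moreover have "(c \<odot> \<one>) \<otimes> x = c \<odot> x" using x by (simp add: smult_mult_left)
  ultimately show ?thesis by simp
qed

sublocale vs: complex_vector_space A by (rule vector_space)

lemma coset_eq_iff:
  "x \<in> carrier A \<Longrightarrow> y \<in> carrier A \<Longrightarrow> I +> x = I +> y \<longleftrightarrow> x \<ominus> y \<in> I"
  using quotient_eq_iff_same_a_r_cos[OF is_ideal] by blast

lemma quot_carrierE:
  assumes "X \<in> carrier (quot_alg A I)" obtains x where "x \<in> carrier A" "X = I +> x"
  using assms by (auto simp: quot_alg_simps A_RCOSETS_def')

lemma quot_carrierI: "x \<in> carrier A \<Longrightarrow> I +> x \<in> carrier (quot_alg A I)"
  by (auto simp: quot_alg_simps A_RCOSETS_def')

lemma mem_coset_iff: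
  "x \<in> carrier A \<Longrightarrow> y \<in> I +> x \<longleftrightarrow> y \<in> carrier A \<and> y \<ominus> x \<in> I"
proof -
  assume x: "x \<in> carrier A"
  have "y = (y \<ominus> x) \<oplus> x" if "y \<in> carrier A"
    using x that by (simp add: a_minus_def a_assoc l_neg)
  moreover have "(h \<oplus> x) \<ominus> x = h" if "h \<in> I" for h
    using x that a_Hcarr by (simp add: a_minus_def a_assoc r_neg)
  ultimately show ?thesis using x a_Hcarr by (auto simp: a_r_coset_def')
qed

lemma coset_add: "x \<in> carrier A \<Longrightarrow> y \<in> carrier A \<Longrightarrow>
    (I +> x) \<oplus>\<^bsub>quot_alg A I\<^esub> (I +> y) = I +> (x \<oplus> y)"
  by (simp add: quot_alg_simps a_rcos_sum)

lemma coset_mult: "x \<in> carrier A \<Longrightarrow> y \<in> carrier A \<Longrightarrow>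
    (I +> x) \<otimes>\<^bsub>quot_alg A I\<^esub> (I +> y) = I +> (x \<otimes> y)"
  by (simp add: quot_alg_simps rcoset_mult_add)

text \<open>\<open>quot_alg\<close> scales a coset by a union over all its representatives. These
  give one and the same coset because the ideal is closed under scalars.\<close>

lemma coset_scale: "x \<in> carrier A \<Longrightarrow> c \<odot>\<^bsub>quot_alg A I\<^esub> (I +> x) = I +> (c \<odot> x)"
proof -
  assume x: "x \<in> carrier A"
  have "I +> (c \<odot> y) = I +> (c \<odot> x)" if "y \<in> I +> x" for y
  proof -
    have y: "y \<in> carrier A" "y \<ominus> x \<in> I" using that x mem_coset_iff by auto
    then have "c \<odot> (y \<ominus> x) \<in> I" by (intro ideal_scale)
    moreover have "c \<odot> (y \<ominus> x) = c \<odot> y \<ominus> c \<odot> x"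
      using x y by (simp add: a_minus_def smult_r_distr smult_r_minus)
    ultimately show ?thesis using x y by (simp add: coset_eq_iff)
  qed
  moreover have "x \<in> I +> x" using x by (rule a_rcos_self)
  ultimately have "(\<Union>y\<in>I +> x. I +> (c \<odot> y)) = I +> (c \<odot> x)" by blast
  then show ?thesis by (simp only: quot_alg_simps)
qed

lemma complex_algebra_quot: "complex_algebra (quot_alg A I)"
proof -
  let ?Q = "quot_alg A I"
  interpret Q: ring "A Quot I" by (rule quotient_is_ring)
  have eq: "carrier ?Q = carrier (A Quot I)" "mult ?Q = mult (A Quot I)" "one ?Q = one (A Quot I)"
    "zero ?Q = zero (A Quot I)" "add ?Q = add (A Quot I)"
    by (simp_all add: quot_alg_simps FactRing_def)
  have abel: "abelian_group ?Q"
    by (rule abelian_groupI) (use Q.a_assoc Q.a_comm Q.l_neg in \<open>auto simp: eq\<close>)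
  have mon: "Group.monoid ?Q"
    by (rule monoidI) (use Q.m_assoc in \<open>auto simp: eq\<close>)
  have ring: "ring ?Q"
    by (rule ringI[OF abel mon]) (auto simp: eq Q.l_distr Q.r_distr)
  have "module complex_alg ?Q"
    by (rule moduleI[OF cring_complex_alg abel])
      (auto elim!: quot_carrierE simp: coset_scale coset_add vs.scale_add_left vs.scale_add_right
        vs.scale_scale quot_carrierI)
  then show ?thesis using ring
    by (auto simp: complex_algebra_def complex_algebra_axioms_def coset_scale coset_mult
        smult_mult_left smult_mult_right elim!: quot_carrierE)
qed

lemma linear_map_coset: "linear_map A (quot_alg A I) (\<lambda>x. I +> x)"
  by (auto simp: linear_map_def quot_carrierI coset_add coset_scale)

text \<open>A linear map that kills the ideal is constant on each coset, so the image of a coset is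
  a singleton and \<open>the_elem\<close> returns its value. This justifies the form in which maps
  out of quotients are defined.\<close>

lemma coset_lift:
  assumes "linear_map A N f" "complex_vector_space N" "\<And>x. x \<in> I \<Longrightarrow> f x = \<zero>\<^bsub>N\<^esub>" "x \<in> carrier A"
  shows "the_elem (f ` (I +> x)) = f x"
proof -
  interpret N: complex_vector_space N by fact
  have "f y = f x" if "y \<in> I +> x" for y
  proof -
    have y: "y \<in> carrier A" "y \<ominus> x \<in> I" using that assms(4) mem_coset_iff by auto
    then have z: "f y \<ominus>\<^bsub>N\<^esub> f x = \<zero>\<^bsub>N\<^esub>"
      using assms(3)[of "y \<ominus> x"] linear_map_minus[OF assms(1) vector_space assms(2)] assms(4) by simp
    then show ?thesis
      using y assms(4) linear_mapD(1)[OF assms(1)] z N.eq_if_minus_zero by blast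
  qed
  moreover have "x \<in> I +> x" using assms(4) by (rule a_rcos_self)
  ultimately have "f ` (I +> x) = {f x}" by blast
  then show ?thesis by simp
qed

lemma linear_map_coset_lift:
  assumes "linear_map A N f" "complex_vector_space N" "\<And>x. x \<in> I \<Longrightarrow> f x = \<zero>\<^bsub>N\<^esub>"
  shows "linear_map (quot_alg A I) N (\<lambda>X. the_elem (f ` X))"
  unfolding linear_map_def
proof (intro conjI ballI allI funcsetI)
  note l = coset_lift[OF assms] and f = linear_mapD[OF assms(1)]
  fix X c assume "X \<in> carrier (quot_alg A I)"
  then obtain x where x: "x \<in> carrier A" "X = I +> x" by (rule quot_carrierE)
  show "the_elem (f ` X) \<in> carrier N"
    using x(1) f(1) by (simp add: x(2) l)
  show "the_elem (f ` (c \<odot>\<^bsub>quot_alg A I\<^esub> X)) = c \<odot>\<^bsub>N\<^esub> the_elem (f ` X)"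
    using x(1) f(3) by (simp add: x(2) l coset_scale)
  fix Y assume "Y \<in> carrier (quot_alg A I)"
  then obtain y where y: "y \<in> carrier A" "Y = I +> y" by (rule quot_carrierE)
  show "the_elem (f ` (X \<oplus>\<^bsub>quot_alg A I\<^esub> Y)) = the_elem (f ` X) \<oplus>\<^bsub>N\<^esub> the_elem (f ` Y)"
    using x(1) y(1) f(2) by (simp add: x(2) y(2) l coset_add)
qed

end

section \<open>Tensor products\<close>

lemma (in complex_algebra) linear_map_mult_right:
  "y \<in> carrier A \<Longrightarrow> linear_map A A (\<lambda>x. x \<otimes> y)"
  by (auto simp: linear_map_def l_distr smult_mult_left)

lemma (in complex_algebra) linear_map_mult_left:
  "y \<in> carrier A \<Longrightarrow> linear_map A A (\<lambda>x. y \<otimes> x)"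
  by (auto simp: linear_map_def r_distr smult_mult_right)

text \<open>Both sides are additive in \<open>x\<close> and in \<open>y\<close>, which leaves only
  singles, where multiplicativity of \<open>g\<close> applies. It turns multiplicativity of a
  coproduct on basis elements into multiplicativity in the tensor algebra.\<close>

lemma lin_mult:
  assumes T: "complex_algebra T" and g: "g \<in> carrier N \<rightarrow> carrier T"
    and mult: "\<And>a b. a \<in> carrier N \<Longrightarrow> b \<in> carrier N \<Longrightarrow> g (a \<otimes>\<^bsub>N\<^esub> b) = g a \<otimes>\<^bsub>T\<^esub> g b"
    and N: "Group.monoid N"
    and x: "Poly_Mapping.keys x \<subseteq> carrier N" and y: "Poly_Mapping.keys y \<subseteq> carrier N"
  shows "lin T g (x \<otimes>\<^bsub>monoid_algebra N\<^esub> y) = lin T g x \<otimes>\<^bsub>T\<^esub> lin T g y"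
proof -
  interpret T: complex_algebra T by fact
  interpret V: complex_vector_space T by (rule T.vector_space)
  interpret N: Group.monoid N by fact
  interpret F: complex_algebra "monoid_algebra N" by (rule complex_algebra_monoid_algebra[OF N])
  have L: "linear_map (monoid_algebra N) T (lin T g)"
    by (rule linear_map_lin_monoid_algebra[OF N T.vector_space g])
  have lin_plus: "lin T g (u + v) = lin T g u \<oplus>\<^bsub>T\<^esub> lin T g v"
    if "Poly_Mapping.keys u \<subseteq> carrier N" "Poly_Mapping.keys v \<subseteq> carrier N" for u v
    using linear_mapD(2)[OF L, of u v] that by simp
  have cl: "lin T g u \<in> carrier T" if "Poly_Mapping.keys u \<subseteq> carrier N" for u
    using linear_mapD(1)[OF L, of u] that by simp
  have m: "Poly_Mapping.keys (u \<otimes>\<^bsub>monoid_algebra N\<^esub> v) \<subseteq> carrier N"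
    if "Poly_Mapping.keys u \<subseteq> carrier N" "Poly_Mapping.keys v \<subseteq> carrier N" for u v
    using F.m_closed[of u v] that by simp
  show ?thesis using x
  proof (induction x rule: poly_mapping_keys_induct)
    case zero show ?case using cl[OF y] by simp
  next
    case (single a c)
    show ?case using y
    proof (induction y rule: poly_mapping_keys_induct)
      case zero show ?case using g single by (simp add: V.lin_single Pi_iff)
    next
      case (single b d)
      then show ?case using g \<open>a \<in> carrier N\<close>
        by (simp add: V.lin_single Pi_iff mult T.smult_mult_left T.smult_mult_right V.scale_scale mult.commute)
    next
      case (add p q)
      moreover have s: "Poly_Mapping.keys (Poly_Mapping.single a c) \<subseteq> carrier N" using single by simp
      ultimately show ?case using m[OF s] cl[OF s] cl \<open>a \<in> carrier N\<close>
        by (simp add: monoid_algebra_mult_add_right lin_plus T.r_distr)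
    qed
  next
    case (add p q)
    then show ?case using m y cl
      by (simp add: monoid_algebra_mult_add_left lin_plus T.l_distr)
  qed
qed

definition bilinear_map ::
  "(complex, 'a, 'm) module_scheme \<Rightarrow> (complex, 'b, 'n) module_scheme \<Rightarrow>
   (complex, 'c, 'k) module_scheme \<Rightarrow> ('a \<Rightarrow> 'b \<Rightarrow> 'c) \<Rightarrow> bool" where
  "bilinear_map A B M \<phi> \<longleftrightarrow> (\<forall>a\<in>carrier A. linear_map B M (\<phi> a)) \<and>
     (\<forall>b\<in>carrier B. linear_map A M (\<lambda>a. \<phi> a b))"

lemma bilinear_map_closed:
  assumes "bilinear_map A B M \<phi>" "a \<in> carrier A" "b \<in> carrier B"
  shows "\<phi> a b \<in> carrier M"
proof -
  have "linear_map B M (\<phi> a)" using assms by (simp add: bilinear_map_def)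
  then show ?thesis using assms(3) by (rule linear_mapD(1))
qed

locale algebra_pair = A: complex_algebra A + B: complex_algebra B
  for A :: "(complex, 'a, 'm) module_scheme" and B :: "(complex, 'b, 'n) module_scheme"
begin

lemma monoid_pair: "Group.monoid (A \<times>\<times> B)"
  by (rule DirProd_monoid[OF A.monoid_axioms B.monoid_axioms])

sublocale F: complex_algebra "free_pairs A B"
  unfolding free_pairs_def by (rule complex_algebra_monoid_algebra[OF monoid_pair])

sublocale FV: complex_vector_space "free_pairs A B"
  by (rule F.vector_space)

lemma free_carrier: "x \<in> carrier (free_pairs A B) \<longleftrightarrow> Poly_Mapping.keys x \<subseteq> carrier A \<times> carrier B"
  by (simp add: free_pairs_def)

lemma free_simps [simp]:
  "\<zero>\<^bsub>free_pairs A B\<^esub> = 0" "x \<oplus>\<^bsub>free_pairs A B\<^esub> y = x + y" "c \<odot>\<^bsub>free_pairs A B\<^esub> x = pscale c x"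
  by (simp_all add: free_pairs_def)

lemma free_mult_simps:
  "Poly_Mapping.single p c \<otimes>\<^bsub>free_pairs A B\<^esub> Poly_Mapping.single q d =
     Poly_Mapping.single (fst p \<otimes>\<^bsub>A\<^esub> fst q, snd p \<otimes>\<^bsub>B\<^esub> snd q) (c * d)"
  "x \<otimes>\<^bsub>free_pairs A B\<^esub> (y + z) = x \<otimes>\<^bsub>free_pairs A B\<^esub> y + x \<otimes>\<^bsub>free_pairs A B\<^esub> z"
  "(y + z) \<otimes>\<^bsub>free_pairs A B\<^esub> x = y \<otimes>\<^bsub>free_pairs A B\<^esub> x + z \<otimes>\<^bsub>free_pairs A B\<^esub> x"
  "x \<otimes>\<^bsub>free_pairs A B\<^esub> (y - z) = x \<otimes>\<^bsub>free_pairs A B\<^esub> y - x \<otimes>\<^bsub>free_pairs A B\<^esub> z"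
  "(y - z) \<otimes>\<^bsub>free_pairs A B\<^esub> x = y \<otimes>\<^bsub>free_pairs A B\<^esub> x - z \<otimes>\<^bsub>free_pairs A B\<^esub> x"
  by (simp_all add: free_pairs_def monoid_algebra_mult_add_left monoid_algebra_mult_add_right
      monoid_algebra_mult_minus mult_DirProd' split_beta)

lemma free_single: "Poly_Mapping.single (a, b) c \<in> carrier (free_pairs A B)"
  if "a \<in> carrier A" "b \<in> carrier B"
  using that by (simp add: free_carrier)

lemma relations_closed: "tensor_relations A B \<subseteq> carrier (free_pairs A B)"
proof -
  have d: "x - y \<in> carrier (free_pairs A B)"
    if "x \<in> carrier (free_pairs A B)" "y \<in> carrier (free_pairs A B)" for x y
    using that keys_diff[of x y] unfolding free_carrier by blast
  show ?thesis
    unfolding tensor_relations_def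
    by (auto intro!: d free_single)
qed

lemma ker_subspace: "submodule (tensor_ker A B) complex_alg (free_pairs A B)"
  unfolding tensor_ker_def by (rule FV.span_subspace[OF relations_closed])

text \<open>By distributivity and compatibility of scalars with the product, multiplying by a basis
  pair carries each relation to a relation of the same kind.\<close>

lemma relations_mult:
  assumes "r \<in> tensor_relations A B" "p \<in> carrier A" "q \<in> carrier B"
  shows "Poly_Mapping.single (p, q) 1 \<otimes>\<^bsub>free_pairs A B\<^esub> r \<in> tensor_relations A B"
    and "r \<otimes>\<^bsub>free_pairs A B\<^esub> Poly_Mapping.single (p, q) 1 \<in> tensor_relations A B"
proof -
  from assms(1) consider
    (1) a a' b where "r = Poly_Mapping.single (a \<oplus>\<^bsub>A\<^esub> a', b) 1 - Poly_Mapping.single (a, b) 1 -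
        Poly_Mapping.single (a', b) 1" "a \<in> carrier A" "a' \<in> carrier A" "b \<in> carrier B"
    | (2) a b b' where "r = Poly_Mapping.single (a, b \<oplus>\<^bsub>B\<^esub> b') 1 - Poly_Mapping.single (a, b) 1 -
        Poly_Mapping.single (a, b') 1" "a \<in> carrier A" "b \<in> carrier B" "b' \<in> carrier B"
    | (3) c a b where "r = Poly_Mapping.single (c \<odot>\<^bsub>A\<^esub> a, b) 1 - Poly_Mapping.single (a, b) c"
        "a \<in> carrier A" "b \<in> carrier B"
    | (4) c a b where "r = Poly_Mapping.single (a, c \<odot>\<^bsub>B\<^esub> b) 1 - Poly_Mapping.single (a, b) c"
        "a \<in> carrier A" "b \<in> carrier B"
    unfolding tensor_relations_def by blast
  then have "Poly_Mapping.single (p, q) 1 \<otimes>\<^bsub>free_pairs A B\<^esub> r \<in> tensor_relations A B \<and>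
    r \<otimes>\<^bsub>free_pairs A B\<^esub> Poly_Mapping.single (p, q) 1 \<in> tensor_relations A B"
  proof cases
    case 1
    have "Poly_Mapping.single (x \<oplus>\<^bsub>A\<^esub> x', y) 1 - Poly_Mapping.single (x, y) 1 -
        Poly_Mapping.single (x', y) (1::complex) \<in> tensor_relations A B"
      if "x \<in> carrier A" "x' \<in> carrier A" "y \<in> carrier B" for x x' y
      unfolding tensor_relations_def using that by blast
    with 1 assms(2,3) show ?thesis by (simp add: free_mult_simps A.l_distr A.r_distr)
  next
    case 2
    have "Poly_Mapping.single (x, y \<oplus>\<^bsub>B\<^esub> y') 1 - Poly_Mapping.single (x, y) 1 -
        Poly_Mapping.single (x, y') (1::complex) \<in> tensor_relations A B"
      if "x \<in> carrier A" "y \<in> carrier B" "y' \<in> carrier B" for x y y'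
      unfolding tensor_relations_def using that by blast
    with 2 assms(2,3) show ?thesis by (simp add: free_mult_simps B.l_distr B.r_distr)
  next
    case 3
    have "Poly_Mapping.single (d \<odot>\<^bsub>A\<^esub> x, y) 1 - Poly_Mapping.single (x, y) d \<in> tensor_relations A B"
      if "x \<in> carrier A" "y \<in> carrier B" for x y d
      unfolding tensor_relations_def using that by blast
    with 3 assms(2,3) show ?thesis
      by (simp add: free_mult_simps A.smult_mult_left A.smult_mult_right)
  next
    case 4
    have "Poly_Mapping.single (x, d \<odot>\<^bsub>B\<^esub> y) 1 - Poly_Mapping.single (x, y) d \<in> tensor_relations A B"
      if "x \<in> carrier A" "y \<in> carrier B" for x y d
      unfolding tensor_relations_def using that by blast
    with 4 assms(2,3) show ?thesis
      by (simp add: free_mult_simps B.smult_mult_left B.smult_mult_right)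
  qed
  then show "Poly_Mapping.single (p, q) 1 \<otimes>\<^bsub>free_pairs A B\<^esub> r \<in> tensor_relations A B"
    "r \<otimes>\<^bsub>free_pairs A B\<^esub> Poly_Mapping.single (p, q) 1 \<in> tensor_relations A B" by auto
qed

text \<open>Each of the two factors is reduced to generators in turn: first relations are multiplied
  by a basis pair, then a fixed element of the kernel by arbitrary elements. In both rounds
  \<open>?L\<close> and \<open>?R\<close> are preimages of the kernel under a multiplication map,
  hence subspaces.\<close>

lemma ker_ideal: "ideal (tensor_ker A B) (free_pairs A B)"
proof (rule idealI[OF F.ring_axioms])
  let ?F = "free_pairs A B" and ?K = "tensor_ker A B"
  show "subgroup ?K (add_monoid ?F)"
    using ker_subspace by (rule submodule.axioms)
  note sp = monoid_algebra_span[OF monoid_pair, folded free_pairs_def]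
  have K: "?K \<subseteq> carrier ?F" using FV.subspaceD(1)[OF ker_subspace] .
  have 1: "Poly_Mapping.single p 1 \<otimes>\<^bsub>?F\<^esub> k \<in> ?K \<and> k \<otimes>\<^bsub>?F\<^esub> Poly_Mapping.single p 1 \<in> ?K"
    if p: "p \<in> carrier (A \<times>\<times> B)" and k: "k \<in> ?K" for p k
  proof -
    have s: "Poly_Mapping.single p 1 \<in> carrier ?F" using p by (simp add: free_pairs_def)
    let ?L = "{x \<in> carrier ?F. Poly_Mapping.single p 1 \<otimes>\<^bsub>?F\<^esub> x \<in> ?K}"
    let ?R = "{x \<in> carrier ?F. x \<otimes>\<^bsub>?F\<^esub> Poly_Mapping.single p 1 \<in> ?K}"
    have "submodule ?L complex_alg ?F" "submodule ?R complex_alg ?F"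
      using subspace_preimage[OF F.linear_map_mult_left[OF s] F.vector_space F.vector_space ker_subspace]
        subspace_preimage[OF F.linear_map_mult_right[OF s] F.vector_space F.vector_space ker_subspace]
      by auto
    moreover have "tensor_relations A B \<subseteq> ?L" "tensor_relations A B \<subseteq> ?R"
      using relations_mult[of _ "fst p" "snd p"] p relations_closed
      by (auto simp: tensor_ker_def intro!: FV.span_base)
    ultimately have "?K \<subseteq> ?L \<inter> ?R"
      unfolding tensor_ker_def by (intro Int_greatest FV.span_minimal)
    then show ?thesis using k by auto
  qed
  have 2: "x \<otimes>\<^bsub>?F\<^esub> k \<in> ?K \<and> k \<otimes>\<^bsub>?F\<^esub> x \<in> ?K" if k: "k \<in> ?K" and x: "x \<in> carrier ?F" for x k
  proof -
    have kF: "k \<in> carrier ?F" using k K by auto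
    let ?L = "{x \<in> carrier ?F. x \<otimes>\<^bsub>?F\<^esub> k \<in> ?K}"
    let ?R = "{x \<in> carrier ?F. k \<otimes>\<^bsub>?F\<^esub> x \<in> ?K}"
    have "submodule ?L complex_alg ?F" "submodule ?R complex_alg ?F"
      using subspace_preimage[OF F.linear_map_mult_left[OF kF] F.vector_space F.vector_space ker_subspace]
        subspace_preimage[OF F.linear_map_mult_right[OF kF] F.vector_space F.vector_space ker_subspace]
      by auto
    moreover have "(\<lambda>k. Poly_Mapping.single k 1) ` carrier (A \<times>\<times> B) \<subseteq> ?L"
      "(\<lambda>k. Poly_Mapping.single k 1) ` carrier (A \<times>\<times> B) \<subseteq> ?R"
      using 1[OF _ k] by (auto simp: free_pairs_def)
    ultimately have "carrier ?F \<subseteq> ?L \<inter> ?R"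
      unfolding sp by (intro Int_greatest FV.span_minimal)
    then show ?thesis using x by auto
  qed
  show "x \<otimes>\<^bsub>?F\<^esub> k \<in> ?K" if "k \<in> ?K" "x \<in> carrier ?F" for x k using 2 that by blast
  show "k \<otimes>\<^bsub>?F\<^esub> x \<in> ?K" if "k \<in> ?K" "x \<in> carrier ?F" for x k using 2 that by blast
qed

sublocale Q: quotient_algebra "free_pairs A B" "tensor_ker A B"
  by (rule quotient_algebra.intro[OF F.complex_algebra_axioms ker_ideal])

sublocale T: complex_algebra "tensor A B"
  unfolding tensor_def by (rule Q.complex_algebra_quot)

sublocale TV: complex_vector_space "tensor A B"
  by (rule T.vector_space)

lemma ptens_closed [simp]:
  "a \<in> carrier A \<Longrightarrow> b \<in> carrier B \<Longrightarrow> ptens A B a b \<in> carrier (tensor A B)"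
  by (simp add: ptens_def tensor_def Q.quot_carrierI free_single)

lemma ptens_eqI:
  assumes "x \<in> carrier (free_pairs A B)" "y \<in> carrier (free_pairs A B)" "x - y \<in> tensor_relations A B"
  shows "tensor_ker A B +>\<^bsub>free_pairs A B\<^esub> x = tensor_ker A B +>\<^bsub>free_pairs A B\<^esub> y"
proof -
  have "\<ominus>\<^bsub>free_pairs A B\<^esub> y = - y"
    using F.minus_equality[of "- y" y] assms(2) by (simp add: free_carrier)
  then have "x \<ominus>\<^bsub>free_pairs A B\<^esub> y \<in> tensor_ker A B"
    using assms unfolding tensor_ker_def by (simp add: a_minus_def FV.span_base)
  then show ?thesis using assms by (simp add: Q.coset_eq_iff)
qed

lemma coset_single:
  assumes "a \<in> carrier A" "b \<in> carrier B"
  shows "tensor_ker A B +>\<^bsub>free_pairs A B\<^esub> Poly_Mapping.single (a, b) c =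
    c \<odot>\<^bsub>tensor A B\<^esub> ptens A B a b"
  using Q.coset_scale[OF free_single[OF assms], of c 1] by (simp add: tensor_def ptens_def pscale_simps)

lemma ptens_add_left:
  assumes "a \<in> carrier A" "a' \<in> carrier A" "b \<in> carrier B"
  shows "ptens A B (a \<oplus>\<^bsub>A\<^esub> a') b = ptens A B a b \<oplus>\<^bsub>tensor A B\<^esub> ptens A B a' b"
proof -
  have "ptens A B (a \<oplus>\<^bsub>A\<^esub> a') b = tensor_ker A B +>\<^bsub>free_pairs A B\<^esub>
      (Poly_Mapping.single (a, b) 1 \<oplus>\<^bsub>free_pairs A B\<^esub> Poly_Mapping.single (a', b) 1)"
    unfolding ptens_def using assms F.a_closed[OF free_single[of a b 1] free_single[of a' b 1]]
    by (intro ptens_eqI) (auto simp: free_single tensor_relations_def diff_diff_eq)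
  then show ?thesis using assms by (simp only: ptens_def tensor_def Q.coset_add free_single)
qed

lemma ptens_add_right:
  assumes "a \<in> carrier A" "b \<in> carrier B" "b' \<in> carrier B"
  shows "ptens A B a (b \<oplus>\<^bsub>B\<^esub> b') = ptens A B a b \<oplus>\<^bsub>tensor A B\<^esub> ptens A B a b'"
proof -
  have "ptens A B a (b \<oplus>\<^bsub>B\<^esub> b') = tensor_ker A B +>\<^bsub>free_pairs A B\<^esub>
      (Poly_Mapping.single (a, b) 1 \<oplus>\<^bsub>free_pairs A B\<^esub> Poly_Mapping.single (a, b') 1)"
    unfolding ptens_def using assms F.a_closed[OF free_single[of a b 1] free_single[of a b' 1]]
    by (intro ptens_eqI) (auto simp: free_single tensor_relations_def diff_diff_eq)
  then show ?thesis using assms by (simp only: ptens_def tensor_def Q.coset_add free_single)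
qed

lemma ptens_scale_left:
  assumes "a \<in> carrier A" "b \<in> carrier B"
  shows "ptens A B (c \<odot>\<^bsub>A\<^esub> a) b = c \<odot>\<^bsub>tensor A B\<^esub> ptens A B a b"
  unfolding coset_single[OF assms, symmetric] unfolding ptens_def
  using assms by (intro ptens_eqI) (auto simp: free_single tensor_relations_def)

lemma ptens_scale_right:
  assumes "a \<in> carrier A" "b \<in> carrier B"
  shows "ptens A B a (c \<odot>\<^bsub>B\<^esub> b) = c \<odot>\<^bsub>tensor A B\<^esub> ptens A B a b"
  unfolding coset_single[OF assms, symmetric] unfolding ptens_def
  using assms by (intro ptens_eqI) (auto simp: free_single tensor_relations_def)

lemma ptens_bilinear: "bilinear_map A B (tensor A B) (ptens A B)"
  by (auto simp: bilinear_map_def linear_map_def ptens_add_left ptens_add_right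
      ptens_scale_left ptens_scale_right)

lemma ptens_mult:
  assumes "a \<in> carrier A" "b \<in> carrier B" "a' \<in> carrier A" "b' \<in> carrier B"
  shows "ptens A B a b \<otimes>\<^bsub>tensor A B\<^esub> ptens A B a' b' = ptens A B (a \<otimes>\<^bsub>A\<^esub> a') (b \<otimes>\<^bsub>B\<^esub> b')"
  using assms by (simp add: tensor_def ptens_def Q.coset_mult free_single free_mult_simps)

lemma tensor_one: "\<one>\<^bsub>tensor A B\<^esub> = ptens A B \<one>\<^bsub>A\<^esub> \<one>\<^bsub>B\<^esub>"
  by (simp add: tensor_def ptens_def quot_alg_simps free_pairs_def)

lemma tensor_span:
  assumes "X \<in> carrier (tensor A B)"
  shows "X \<in> lin_span (tensor A B) {ptens A B a b | a b. a \<in> carrier A \<and> b \<in> carrier B}"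
    (is "_ \<in> lin_span _ ?S")
proof -
  obtain x where x: "x \<in> carrier (free_pairs A B)" "X = tensor_ker A B +>\<^bsub>free_pairs A B\<^esub> x"
    using assms unfolding tensor_def by (elim Q.quot_carrierE)
  have S: "?S \<subseteq> carrier (tensor A B)" by auto
  have fx: "(\<lambda>k. Poly_Mapping.single k 1) \<in> Poly_Mapping.keys x \<rightarrow> carrier (free_pairs A B)"
    using x(1) by (auto simp: free_carrier)
  have "X = tensor_ker A B +>\<^bsub>free_pairs A B\<^esub> lin (free_pairs A B) (\<lambda>k. Poly_Mapping.single k 1) x"
    using monoid_algebra_lin_basis[OF monoid_pair, of x] x by (simp add: free_pairs_def)
  also have "\<dots> = lin (tensor A B)
      (\<lambda>k. tensor_ker A B +>\<^bsub>free_pairs A B\<^esub> Poly_Mapping.single k 1) x"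
    using linear_map_lin[OF Q.linear_map_coset F.vector_space T.vector_space[unfolded tensor_def] fx]
    by (simp add: tensor_def)
  also have "\<dots> \<in> lin_span (tensor A B) ?S"
  proof (rule TV.lin_in_subspace[OF TV.span_subspace[OF S]])
    fix k assume "k \<in> Poly_Mapping.keys x"
    then have "fst k \<in> carrier A" "snd k \<in> carrier B" using x(1) by (auto simp: free_carrier)
    then show "tensor_ker A B +>\<^bsub>free_pairs A B\<^esub> Poly_Mapping.single k 1 \<in> lin_span (tensor A B) ?S"
      by (intro TV.span_base) (auto simp: ptens_def intro!: exI[of _ "fst k"] exI[of _ "snd k"])
  qed
  finally show ?thesis .
qed

lemma linear_map_eq_tensor:
  assumes "linear_map (tensor A B) N f" "linear_map (tensor A B) N g" "complex_vector_space N"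
    and "\<And>a b. a \<in> carrier A \<Longrightarrow> b \<in> carrier B \<Longrightarrow> f (ptens A B a b) = g (ptens A B a b)"
    and "x \<in> carrier (tensor A B)"
  shows "f x = g x"
  by (rule linear_map_eq_on_span[OF assms(1,2) T.vector_space assms(3) _ _ tensor_span[OF assms(5)]])
    (use assms(4) in auto)

section \<open>The universal property of the tensor product\<close>

context
  fixes M :: "(complex, 'c, 'k) module_scheme" and \<phi>
  assumes M: "complex_vector_space M" and \<phi>: "bilinear_map A B M \<phi>"
begin

text \<open>Bilinearity says exactly that the linear extension of \<open>\<phi>\<close> to formal
  pairs kills the four kinds of relations, and then it kills their span.\<close>

lemma tensor_lift_aux:
  "linear_map (free_pairs A B) M (lin M (\<lambda>p. \<phi> (fst p) (snd p)))"
  "x \<in> tensor_ker A B \<Longrightarrow> lin M (\<lambda>p. \<phi> (fst p) (snd p)) x = \<zero>\<^bsub>M\<^esub>"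
proof -
  interpret M: complex_vector_space M by (rule M)
  let ?f = "lin M (\<lambda>p. \<phi> (fst p) (snd p))"
  have cl: "\<phi> a b \<in> carrier M" if "a \<in> carrier A" "b \<in> carrier B" for a b
    by (rule bilinear_map_closed[OF \<phi> that])
  show L: "linear_map (free_pairs A B) M ?f"
    unfolding free_pairs_def
    by (rule linear_map_lin_monoid_algebra[OF monoid_pair M]) (auto simp: cl)
  have s: "?f (Poly_Mapping.single (a, b) c) = c \<odot>\<^bsub>M\<^esub> \<phi> a b" if "a \<in> carrier A" "b \<in> carrier B" for a b c
    using M.lin_single[of "\<lambda>p. \<phi> (fst p) (snd p)" "(a, b)" c] cl that by simp
  have d: "?f (x - y) = ?f x \<ominus>\<^bsub>M\<^esub> ?f y"
    if "x \<in> carrier (free_pairs A B)" "y \<in> carrier (free_pairs A B)" for x y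
    using that cl by (intro M.lin_diff) (auto simp: free_carrier)
  have d2: "x - y \<in> carrier (free_pairs A B)"
    if "x \<in> carrier (free_pairs A B)" "y \<in> carrier (free_pairs A B)" for x y
    using that keys_diff[of x y] unfolding free_carrier by blast
  have lin_l: "linear_map A M (\<lambda>a. \<phi> a b)" if "b \<in> carrier B" for b
    using \<phi> that by (auto simp: bilinear_map_def)
  have lin_r: "linear_map B M (\<phi> a)" if "a \<in> carrier A" for a
    using \<phi> that by (auto simp: bilinear_map_def)
  have c1: "(x \<oplus>\<^bsub>M\<^esub> y) \<ominus>\<^bsub>M\<^esub> x \<ominus>\<^bsub>M\<^esub> y = \<zero>\<^bsub>M\<^esub>" if "x \<in> carrier M" "y \<in> carrier M" for x y
  proof -
    have "(x \<oplus>\<^bsub>M\<^esub> y) \<ominus>\<^bsub>M\<^esub> x \<ominus>\<^bsub>M\<^esub> y = (x \<oplus>\<^bsub>M\<^esub> \<ominus>\<^bsub>M\<^esub> x) \<oplus>\<^bsub>M\<^esub> (y \<oplus>\<^bsub>M\<^esub> \<ominus>\<^bsub>M\<^esub> y)"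
      using that by (simp add: a_minus_def M.M.a_ac)
    then show ?thesis using that by (simp add: M.M.r_neg)
  qed
  have c2: "x \<ominus>\<^bsub>M\<^esub> x = \<zero>\<^bsub>M\<^esub>" if "x \<in> carrier M" for x
    using that by (simp add: a_minus_def M.M.r_neg)
  have r: "?f r = \<zero>\<^bsub>M\<^esub>" if "r \<in> tensor_relations A B" for r
    using that unfolding tensor_relations_def
    by (auto simp: d d2 free_single s cl linear_mapD[OF lin_l] linear_mapD[OF lin_r] c1 c2)
  have "tensor_ker A B \<subseteq> {x \<in> carrier (free_pairs A B). ?f x \<in> {\<zero>\<^bsub>M\<^esub>}}"
    unfolding tensor_ker_def
  proof (rule FV.span_minimal[OF subspace_preimage[OF L F.vector_space M]])
    show "submodule {\<zero>\<^bsub>M\<^esub>} complex_alg M" by (rule M.subspaceI) auto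
    show "tensor_relations A B \<subseteq> {x \<in> carrier (free_pairs A B). ?f x \<in> {\<zero>\<^bsub>M\<^esub>}}"
      using r relations_closed by auto
  qed
  then show "x \<in> tensor_ker A B \<Longrightarrow> ?f x = \<zero>\<^bsub>M\<^esub>" by auto
qed

lemma tensor_lift_eq: "tensor_lift M \<phi> X = the_elem (lin M (\<lambda>p. \<phi> (fst p) (snd p)) ` X)"
  by (simp add: tensor_lift_def lin_def)

lemma linear_map_tensor_lift: "linear_map (tensor A B) M (tensor_lift M \<phi>)"
  unfolding tensor_def tensor_lift_eq
  by (rule Q.linear_map_coset_lift[OF tensor_lift_aux(1) M tensor_lift_aux(2)])

lemma tensor_lift_ptens:
  assumes "a \<in> carrier A" "b \<in> carrier B"
  shows "tensor_lift M \<phi> (ptens A B a b) = \<phi> a b"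
proof -
  interpret M: complex_vector_space M by (rule M)
  have "\<phi> a b \<in> carrier M"
    by (rule bilinear_map_closed[OF \<phi> assms])
  then show ?thesis
    using Q.coset_lift[OF tensor_lift_aux(1) M tensor_lift_aux(2) free_single[OF assms]]
      M.lin_single[of "\<lambda>p. \<phi> (fst p) (snd p)" "(a, b)" 1]
    by (simp add: tensor_lift_eq ptens_def)
qed

end

end

lemma bilinear_map_comp:
  assumes "bilinear_map C D M \<phi>" "linear_map A C f" "linear_map B D g"
  shows "bilinear_map A B M (\<lambda>a b. \<phi> (f a) (g b))"
  unfolding bilinear_map_def
proof (intro conjI ballI)
  fix a assume "a \<in> carrier A"
  then have "linear_map D M (\<phi> (f a))"
    using assms(1) linear_mapD(1)[OF assms(2)] by (auto simp: bilinear_map_def)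
  then show "linear_map B M (\<lambda>b. \<phi> (f a) (g b))" by (rule linear_map_comp[OF assms(3)])
next
  fix b assume "b \<in> carrier B"
  then have "linear_map C M (\<lambda>c. \<phi> c (g b))"
    using assms(1) linear_mapD(1)[OF assms(3)] by (auto simp: bilinear_map_def)
  then show "linear_map A M (\<lambda>a. \<phi> (f a) (g b))" by (rule linear_map_comp[OF assms(2)])
qed

lemma algebra_pairI: "complex_algebra A \<Longrightarrow> complex_algebra B \<Longrightarrow> algebra_pair A B"
  by (simp add: algebra_pair_def)

lemma tensor_map_linear:
  assumes "complex_algebra A" "complex_algebra B" "complex_algebra C" "complex_algebra D"
    and "linear_map A C f" "linear_map B D g"
  shows "linear_map (tensor A B) (tensor C D) (tensor_map C D f g)"
    and "a \<in> carrier A \<Longrightarrow> b \<in> carrier B \<Longrightarrow>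
      tensor_map C D f g (ptens A B a b) = ptens C D (f a) (g b)"
proof -
  interpret AB: algebra_pair A B by (rule algebra_pairI) fact+
  interpret CD: algebra_pair C D by (rule algebra_pairI) fact+
  note b = bilinear_map_comp[OF CD.ptens_bilinear assms(5,6)]
  show "linear_map (tensor A B) (tensor C D) (tensor_map C D f g)"
    unfolding tensor_map_def by (rule AB.linear_map_tensor_lift[OF CD.T.vector_space b])
  show "a \<in> carrier A \<Longrightarrow> b \<in> carrier B \<Longrightarrow>
      tensor_map C D f g (ptens A B a b) = ptens C D (f a) (g b)"
    unfolding tensor_map_def by (rule AB.tensor_lift_ptens[OF CD.T.vector_space b])
qed

section \<open>Reassociating triple tensors\<close>

context complex_algebra
begin

lemma self_pair: "algebra_pair A A"
  by (rule algebra_pairI) (rule complex_algebra_axioms)+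

interpretation AA: algebra_pair A A by (rule self_pair)

lemma tensor_algebra: "complex_algebra (tensor A A)"
  by (rule AA.T.complex_algebra_axioms)

lemma pair_right: "algebra_pair A (tensor A A)"
  by (rule algebra_pairI[OF complex_algebra_axioms tensor_algebra])

lemma pair_left: "algebra_pair (tensor A A) A"
  by (rule algebra_pairI[OF tensor_algebra complex_algebra_axioms])

lemma tensor_assoc_inner:
  assumes c: "c \<in> carrier A"
  defines "\<psi> \<equiv> \<lambda>a b. ptens A (tensor A A) a (ptens A A b c)"
  shows "bilinear_map A A (tensor A (tensor A A)) \<psi>"
proof -
  interpret R: algebra_pair A "tensor A A" by (rule pair_right)
  have l: "linear_map A (tensor A A) (\<lambda>b. ptens A A b c)"
    using AA.ptens_bilinear c by (auto simp: bilinear_map_def)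
  show ?thesis
    unfolding \<psi>_def
    by (rule bilinear_map_comp[OF R.ptens_bilinear linear_map_id l])
qed

text \<open>Linearity in \<open>u\<close> is that of \<open>tensor_lift\<close>. In \<open>c\<close>
  it is less direct, since \<open>c\<close> sits inside the bilinear map being lifted: for fixed
  scalars and arguments the two sides are linear in \<open>u\<close>, and they are compared on pure
  tensors.\<close>

lemma tensor_assoc_bilinear:
  "bilinear_map (tensor A A) A (tensor A (tensor A A))
    (\<lambda>u c. tensor_lift (tensor A (tensor A A)) (\<lambda>a b. ptens A (tensor A A) a (ptens A A b c)) u)"
  unfolding bilinear_map_def
proof (intro conjI ballI)
  interpret R: algebra_pair A "tensor A A" by (rule pair_right)
  let ?T = "tensor A (tensor A A)"
  let ?l = "\<lambda>c u. tensor_lift ?T (\<lambda>a b. ptens A (tensor A A) a (ptens A A b c)) u"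
  have lin: "linear_map (tensor A A) ?T (?l c)" if "c \<in> carrier A" for c
    by (rule AA.linear_map_tensor_lift[OF R.T.vector_space tensor_assoc_inner[OF that]])
  then show "linear_map (tensor A A) ?T (\<lambda>u. ?l c u)" if "c \<in> carrier A" for c using that by blast
  have val: "?l c (ptens A A a b) = ptens A (tensor A A) a (ptens A A b c)"
    if "a \<in> carrier A" "b \<in> carrier A" "c \<in> carrier A" for a b c
    by (rule AA.tensor_lift_ptens[OF R.T.vector_space tensor_assoc_inner[OF that(3)] that(1,2)])
  fix u assume u: "u \<in> carrier (tensor A A)"
  show "linear_map A ?T (\<lambda>c. ?l c u)"
    unfolding linear_map_def
  proof (intro conjI ballI allI funcsetI)
    fix c assume c: "c \<in> carrier A"
    show "?l c u \<in> carrier ?T" using linear_mapD(1)[OF lin[OF c] u] .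
    show "?l (k \<odot> c) u = k \<odot>\<^bsub>?T\<^esub> ?l c u" for k
    proof (rule AA.linear_map_eq_tensor[OF lin _ R.T.vector_space _ u])
      show "linear_map (tensor A A) ?T (\<lambda>u. k \<odot>\<^bsub>?T\<^esub> ?l c u)"
        using lin[OF c] by (auto simp: linear_map_def Pi_iff R.TV.scale_add_right R.TV.scale_scale mult.commute)
    qed (use c in \<open>auto simp: val AA.ptens_scale_right R.ptens_scale_right\<close>)
    fix d assume d: "d \<in> carrier A"
    show "?l (c \<oplus> d) u = ?l c u \<oplus>\<^bsub>?T\<^esub> ?l d u"
      by (rule AA.linear_map_eq_tensor[OF lin linear_map_add[OF R.T.vector_space lin lin]
            R.T.vector_space _ u])
        (use c d in \<open>auto simp: val AA.ptens_add_right R.ptens_add_right\<close>)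
  qed
qed

lemma tensor_assoc_linear:
  "linear_map (tensor (tensor A A) A) (tensor A (tensor A A)) (tensor_assoc A)"
proof -
  interpret R: algebra_pair A "tensor A A" by (rule pair_right)
  interpret L: algebra_pair "tensor A A" A by (rule pair_left)
  show ?thesis unfolding tensor_assoc_def
    by (rule L.linear_map_tensor_lift[OF R.T.vector_space tensor_assoc_bilinear])
qed

lemma tensor_assoc_ptens:
  assumes "u \<in> carrier (tensor A A)" "c \<in> carrier A"
  shows "tensor_assoc A (ptens (tensor A A) A u c) =
    tensor_lift (tensor A (tensor A A)) (\<lambda>a b. ptens A (tensor A A) a (ptens A A b c)) u"
proof -
  interpret R: algebra_pair A "tensor A A" by (rule pair_right)
  interpret L: algebra_pair "tensor A A" A by (rule pair_left)
  show ?thesis unfolding tensor_assoc_def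
    by (rule L.tensor_lift_ptens[OF R.T.vector_space tensor_assoc_bilinear assms])
qed

lemma tensor_assoc_inner_linear:
  assumes "c \<in> carrier A"
  shows "linear_map (tensor A A) (tensor A (tensor A A))
    (tensor_lift (tensor A (tensor A A)) (\<lambda>a b. ptens A (tensor A A) a (ptens A A b c)))"
    and "a \<in> carrier A \<Longrightarrow> b \<in> carrier A \<Longrightarrow>
      tensor_lift (tensor A (tensor A A)) (\<lambda>a b. ptens A (tensor A A) a (ptens A A b c)) (ptens A A a b)
      = ptens A (tensor A A) a (ptens A A b c)"
proof -
  interpret R: algebra_pair A "tensor A A" by (rule pair_right)
  show "linear_map (tensor A A) (tensor A (tensor A A))
    (tensor_lift (tensor A (tensor A A)) (\<lambda>a b. ptens A (tensor A A) a (ptens A A b c)))"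
    by (rule AA.linear_map_tensor_lift[OF R.T.vector_space tensor_assoc_inner[OF assms]])
  show "a \<in> carrier A \<Longrightarrow> b \<in> carrier A \<Longrightarrow>
      tensor_lift (tensor A (tensor A A)) (\<lambda>a b. ptens A (tensor A A) a (ptens A A b c)) (ptens A A a b)
      = ptens A (tensor A A) a (ptens A A b c)"
    by (rule AA.tensor_lift_ptens[OF R.T.vector_space tensor_assoc_inner[OF assms]])
qed

end

section \<open>Bialgebras with a multiplicative spanning set\<close>

abbreviation (input) triple_product ::
  "('g, 'm) monoid_scheme \<Rightarrow> ('g \<times> 'g \<times> 'g) monoid" where
  "triple_product M \<equiv> M \<times>\<times> (M \<times>\<times> M)"

text \<open>\<open>D X\<close> is the coproduct of the basis element \<open>X\<close> as a formal sum of pairs, and \<open>E X\<close> says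
  that the counit of \<open>X\<close> is 1. The elements \<open>e X\<close> span \<open>A\<close> but need not be linearly
  independent, so that both \<open>\<complex>[M]\<close> and its quotients are covered.\<close>

locale spanned_bialgebra = M: Group.monoid M + complex_algebra A
  for M :: "('g, 'm) monoid_scheme" and A :: "(complex, 'a, 'k) module_scheme" (structure) +
  fixes e :: "'g \<Rightarrow> 'a" and D :: "'g \<Rightarrow> ('g \<times> 'g) \<Rightarrow>\<^sub>0 complex" and E :: "'g \<Rightarrow> bool"
    and \<Delta> :: "'a \<Rightarrow> (('a \<times> 'a) \<Rightarrow>\<^sub>0 complex) set" and \<epsilon> :: "'a \<Rightarrow> complex"
  assumes e_closed: "X \<in> carrier M \<Longrightarrow> e X \<in> carrier A"
    and e_mult: "X \<in> carrier M \<Longrightarrow> Y \<in> carrier M \<Longrightarrow> e (X \<otimes>\<^bsub>M\<^esub> Y) = e X \<otimes> e Y"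
    and e_one: "e \<one>\<^bsub>M\<^esub> = \<one>"
    and e_span: "carrier A = lin_span A (e ` carrier M)"
    and D_closed: "X \<in> carrier M \<Longrightarrow> Poly_Mapping.keys (D X) \<subseteq> carrier M \<times> carrier M"
    and D_one: "D \<one>\<^bsub>M\<^esub> = Poly_Mapping.single (\<one>\<^bsub>M\<^esub>, \<one>\<^bsub>M\<^esub>) 1"
    and D_mult: "X \<in> carrier M \<Longrightarrow> Y \<in> carrier M \<Longrightarrow>
      D (X \<otimes>\<^bsub>M\<^esub> Y) = D X \<otimes>\<^bsub>monoid_algebra (M \<times>\<times> M)\<^esub> D Y"
    and D_coassoc: "X \<in> carrier M \<Longrightarrow>
      lin (monoid_algebra (triple_product M)) (\<lambda>(U, V). lin (monoid_algebra (triple_product M))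
        (\<lambda>(P, Q). Poly_Mapping.single (P, Q, V) 1) (D U)) (D X) =
      lin (monoid_algebra (triple_product M)) (\<lambda>(U, V). lin (monoid_algebra (triple_product M))
        (\<lambda>(P, Q). Poly_Mapping.single (U, P, Q) 1) (D V)) (D X)"
    and D_counit_left: "X \<in> carrier M \<Longrightarrow>
      lin (monoid_algebra M) (\<lambda>(U, V). if E U then Poly_Mapping.single V 1 else 0) (D X) =
      Poly_Mapping.single X 1"
    and D_counit_right: "X \<in> carrier M \<Longrightarrow>
      lin (monoid_algebra M) (\<lambda>(U, V). if E V then Poly_Mapping.single U 1 else 0) (D X) =
      Poly_Mapping.single X 1"
    and E_one: "E \<one>\<^bsub>M\<^esub>"
    and E_mult: "X \<in> carrier M \<Longrightarrow> Y \<in> carrier M \<Longrightarrow> E (X \<otimes>\<^bsub>M\<^esub> Y) \<longleftrightarrow> E X \<and> E Y"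
    and \<Delta>_linear: "linear_map A (tensor A A) \<Delta>"
    and \<Delta>_e: "X \<in> carrier M \<Longrightarrow>
      \<Delta> (e X) = lin (tensor A A) (\<lambda>(U, V). ptens A A (e U) (e V)) (D X)"
    and \<epsilon>_linear: "linear_map A complex_alg \<epsilon>"
    and \<epsilon>_e: "X \<in> carrier M \<Longrightarrow> \<epsilon> (e X) = (if E X then 1 else 0)"
begin

interpretation AA: algebra_pair A A by (rule self_pair)
interpretation AT: algebra_pair A "tensor A A" by (rule pair_right)
interpretation TA: algebra_pair "tensor A A" A by (rule pair_left)
interpretation V: complex_vector_space A by (rule vector_space)

lemma monoid_MM: "Group.monoid (M \<times>\<times> M)"
  by (rule DirProd_monoid[OF M.monoid_axioms M.monoid_axioms])

lemma monoid_MMM: "Group.monoid (triple_product M)"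
  by (rule DirProd_monoid[OF M.monoid_axioms monoid_MM])

lemma e_image: "e ` carrier M \<subseteq> carrier A"
  using e_closed by auto

lemma eq_on_e:
  assumes "linear_map A N f" "linear_map A N g" "complex_vector_space N"
    and "\<And>X. X \<in> carrier M \<Longrightarrow> f (e X) = g (e X)" "x \<in> carrier A"
  shows "f x = g x"
proof (rule linear_map_eq_on_span[OF assms(1,2) vector_space assms(3) e_image])
  show "f s = g s" if "s \<in> e ` carrier M" for s using that by (elim imageE) (simp only: assms(4))
  show "x \<in> lin_span A (e ` carrier M)" unfolding e_span[symmetric] by (rule assms(5))
qed

lemma D_keys: "X \<in> carrier M \<Longrightarrow> (U, V) \<in> Poly_Mapping.keys (D X) \<Longrightarrow> U \<in> carrier M \<and> V \<in> carrier M"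
  using D_closed by auto

lemma ee_closed:
  assumes "X \<in> carrier M"
  shows "(\<lambda>(U, V). ptens A A (e U) (e V)) \<in> Poly_Mapping.keys (D X) \<rightarrow> carrier (tensor A A)"
  using D_keys[OF assms] by (auto simp: e_closed)

text \<open>Brings any linear map of a coproduct back to a formal sum over \<open>D X\<close>, the
  level at which the assumptions of the locale are stated.\<close>

lemma linear_map_\<Delta>_e:
  assumes "X \<in> carrier M" "linear_map (tensor A A) N f" "complex_vector_space N"
  shows "f (\<Delta> (e X)) = lin N (\<lambda>(U, V). f (ptens A A (e U) (e V))) (D X)"
proof -
  have "f (\<Delta> (e X)) = lin N (\<lambda>k. f (case k of (U, V) \<Rightarrow> ptens A A (e U) (e V))) (D X)"
    unfolding \<Delta>_e[OF assms(1)]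
    by (rule linear_map_lin[OF assms(2) AA.T.vector_space assms(3) ee_closed[OF assms(1)]])
  then show ?thesis by (simp add: case_prod_unfold)
qed

lemma \<Delta>_closed: "x \<in> carrier A \<Longrightarrow> \<Delta> x \<in> carrier (tensor A A)"
  using linear_mapD(1)[OF \<Delta>_linear] .

text \<open>For generators this is \<open>lin_mult\<close> applied to the map sending a pair to its
  pure tensor; the two arguments are then extended linearly one after the other.\<close>

lemma \<Delta>_mult:
  assumes x: "x \<in> carrier A" and y: "y \<in> carrier A"
  shows "\<Delta> (x \<otimes> y) = \<Delta> x \<otimes>\<^bsub>tensor A A\<^esub> \<Delta> y"
proof -
  let ?g = "\<lambda>(U, V). ptens A A (e U) (e V)"
  have base: "\<Delta> (e X \<otimes> e Y) = \<Delta> (e X) \<otimes>\<^bsub>tensor A A\<^esub> \<Delta> (e Y)"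
    if "X \<in> carrier M" "Y \<in> carrier M" for X Y
  proof -
    have "lin (tensor A A) ?g (D X \<otimes>\<^bsub>monoid_algebra (M \<times>\<times> M)\<^esub> D Y) =
      lin (tensor A A) ?g (D X) \<otimes>\<^bsub>tensor A A\<^esub> lin (tensor A A) ?g (D Y)"
      using that D_closed e_closed
      by (intro lin_mult[OF AA.T.complex_algebra_axioms _ _ monoid_MM])
        (auto simp: e_mult AA.ptens_mult)
    then show ?thesis using that M.m_closed by (simp add: \<Delta>_e D_mult flip: e_mult)
  qed
  have 1: "\<Delta> (e X \<otimes> y) = \<Delta> (e X) \<otimes>\<^bsub>tensor A A\<^esub> \<Delta> y" if X: "X \<in> carrier M" for X
    using eq_on_e[OF linear_map_comp[OF linear_map_mult_left[OF e_closed[OF X]] \<Delta>_linear]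
        linear_map_comp[OF \<Delta>_linear AA.T.linear_map_mult_left[OF \<Delta>_closed[OF e_closed[OF X]]]]
        AA.T.vector_space base[OF X] y] .
  show ?thesis
    using eq_on_e[OF linear_map_comp[OF linear_map_mult_right[OF y] \<Delta>_linear]
        linear_map_comp[OF \<Delta>_linear AA.T.linear_map_mult_right[OF \<Delta>_closed[OF y]]]
        AA.T.vector_space 1 x] .
qed

lemma \<epsilon>_mult:
  assumes x: "x \<in> carrier A" and y: "y \<in> carrier A"
  shows "\<epsilon> (x \<otimes> y) = \<epsilon> x * \<epsilon> y"
proof -
  interpret C: complex_algebra complex_alg by (rule complex_algebra_complex_alg)
  have l: "linear_map A complex_alg (\<lambda>x. \<epsilon> x * c)" "linear_map A complex_alg (\<lambda>x. c * \<epsilon> x)" for c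
    using \<epsilon>_linear by (auto simp: linear_map_def algebra_simps)
  have base: "\<epsilon> (e X \<otimes> e Y) = \<epsilon> (e X) * \<epsilon> (e Y)" if "X \<in> carrier M" "Y \<in> carrier M" for X Y
    using that M.m_closed by (simp add: \<epsilon>_e E_mult flip: e_mult)
  have 1: "\<epsilon> (e X \<otimes> y) = \<epsilon> (e X) * \<epsilon> y" if X: "X \<in> carrier M" for X
    using eq_on_e[OF linear_map_comp[OF linear_map_mult_left[OF e_closed[OF X]] \<epsilon>_linear]
        l(2) C.vector_space base[OF X] y] .
  show ?thesis
    using eq_on_e[OF linear_map_comp[OF linear_map_mult_right[OF y] \<epsilon>_linear]
        l(1) C.vector_space 1 x] .
qed

lemma linear_lin_e: "linear_map (monoid_algebra M) A (lin A e)"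
  by (rule linear_map_lin_monoid_algebra[OF M.monoid_axioms vector_space]) (auto simp: e_closed)

lemma lin_e_single: "X \<in> carrier M \<Longrightarrow> lin A e (Poly_Mapping.single X 1) = e X"
  by (simp add: V.lin_single e_closed)

lemma counit_left_bilinear: "bilinear_map A A A (\<lambda>a b. \<epsilon> a \<odot> b)"
  using \<epsilon>_linear by (auto simp: bilinear_map_def linear_map_def Pi_iff V.scale_add_left
      V.scale_add_right V.scale_scale mult.commute)

lemma counit_right_bilinear: "bilinear_map A A A (\<lambda>a b. \<epsilon> b \<odot> a)"
  using \<epsilon>_linear by (auto simp: bilinear_map_def linear_map_def Pi_iff V.scale_add_left
      V.scale_add_right V.scale_scale mult.commute)

text \<open>On a generator, applying the counit to one leg gives the image under
  \<open>lin A e\<close> of the formal sum in \<open>D_counit_left\<close> or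
  \<open>D_counit_right\<close>. This passage is possible although the \<open>e X\<close> may be
  dependent, because only the direction from formal sums to \<open>A\<close> is used.\<close>

lemma counit_laws:
  assumes "x \<in> carrier A"
  shows "tensor_lift A (\<lambda>a b. \<epsilon> a \<odot> b) (\<Delta> x) = x" "tensor_lift A (\<lambda>a b. \<epsilon> b \<odot> a) (\<Delta> x) = x"
proof -
  interpret MA: complex_algebra "monoid_algebra M"
    by (rule complex_algebra_monoid_algebra[OF M.monoid_axioms])
  let ?l = "tensor_lift A (\<lambda>a b. \<epsilon> a \<odot> b)" and ?r = "tensor_lift A (\<lambda>a b. \<epsilon> b \<odot> a)"
  note ll = AA.linear_map_tensor_lift[OF vector_space counit_left_bilinear]
    and rl = AA.linear_map_tensor_lift[OF vector_space counit_right_bilinear]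
  have l: "?l (\<Delta> (e X)) = e X" if X: "X \<in> carrier M" for X
  proof -
    have "?l (\<Delta> (e X)) = lin A (\<lambda>(U, V). ?l (ptens A A (e U) (e V))) (D X)"
      by (rule linear_map_\<Delta>_e[OF X ll vector_space])
    also have "\<dots> = lin A (\<lambda>k. lin A e (case k of (U, V) \<Rightarrow> if E U then Poly_Mapping.single V 1 else 0)) (D X)"
      using D_keys[OF X]
      by (intro V.lin_cong) (auto simp: AA.tensor_lift_ptens[OF vector_space counit_left_bilinear]
          e_closed \<epsilon>_e V.lin_single)
    also have "\<dots> = lin A e (Poly_Mapping.single X 1)"
      unfolding D_counit_left[OF X, symmetric] using D_keys[OF X]
      by (intro linear_map_lin[OF linear_lin_e MA.vector_space vector_space, symmetric])
        (auto split: if_splits)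
    finally show ?thesis by (simp add: lin_e_single X)
  qed
  have r: "?r (\<Delta> (e X)) = e X" if X: "X \<in> carrier M" for X
  proof -
    have "?r (\<Delta> (e X)) = lin A (\<lambda>(U, V). ?r (ptens A A (e U) (e V))) (D X)"
      by (rule linear_map_\<Delta>_e[OF X rl vector_space])
    also have "\<dots> = lin A (\<lambda>k. lin A e (case k of (U, V) \<Rightarrow> if E V then Poly_Mapping.single U 1 else 0)) (D X)"
      using D_keys[OF X]
      by (intro V.lin_cong) (auto simp: AA.tensor_lift_ptens[OF vector_space counit_right_bilinear]
          e_closed \<epsilon>_e V.lin_single)
    also have "\<dots> = lin A e (Poly_Mapping.single X 1)"
      unfolding D_counit_right[OF X, symmetric] using D_keys[OF X]
      by (intro linear_map_lin[OF linear_lin_e MA.vector_space vector_space, symmetric])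
        (auto split: if_splits)
    finally show ?thesis by (simp add: lin_e_single X)
  qed
  show "?l (\<Delta> x) = x"
    using eq_on_e[OF linear_map_comp[OF \<Delta>_linear ll] linear_map_id vector_space l assms] .
  show "?r (\<Delta> x) = x"
    using eq_on_e[OF linear_map_comp[OF \<Delta>_linear rl] linear_map_id vector_space r assms] .
qed

text \<open>On a generator both sides are images of formal sums of triples under one linear map.
  \<open>D_coassoc\<close> is applied among formal sums, before the passage to tensors, so nothing
  has to be known about equality of tensors.\<close>

lemma coassoc_law:
  assumes "x \<in> carrier A"
  shows "tensor_assoc A (tensor_map (tensor A A) A \<Delta> id (\<Delta> x)) = tensor_map A (tensor A A) id \<Delta> (\<Delta> x)"
proof -
  let ?T = "tensor A (tensor A A)" and ?M3 = "monoid_algebra (triple_product M)"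
  interpret MA: complex_algebra ?M3
    by (rule complex_algebra_monoid_algebra[OF monoid_MMM])
  interpret MV: complex_vector_space ?M3 by (rule MA.vector_space)
  have id: "linear_map A A id" by (simp add: linear_map_def)
  note tl = tensor_map_linear[OF complex_algebra_axioms complex_algebra_axioms
      AA.T.complex_algebra_axioms complex_algebra_axioms \<Delta>_linear id]
  note tr = tensor_map_linear[OF complex_algebra_axioms complex_algebra_axioms
      complex_algebra_axioms AA.T.complex_algebra_axioms id \<Delta>_linear]
  note al = linear_map_comp[OF tl(1) tensor_assoc_linear]
  \<comment> \<open>Reads a formal triple as a right-nested tensor; both sides of
    \<open>D_coassoc\<close> are formal sums of such triples.\<close>
  define e3 where "e3 = (\<lambda>(P, Q, R). ptens A (tensor A A) (e P) (ptens A A (e Q) (e R)))"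
  have e3: "e3 (P, Q, R) \<in> carrier ?T" if "P \<in> carrier M" "Q \<in> carrier M" "R \<in> carrier M" for P Q R
    using that by (simp add: e3_def e_closed)
  have L: "linear_map ?M3 ?T (lin ?T e3)"
    by (rule linear_map_lin_monoid_algebra[OF monoid_MMM AT.T.vector_space]) (auto simp: e3)
  have s: "lin ?T e3 (Poly_Mapping.single (P, Q, R) 1) = ptens A (tensor A A) (e P) (ptens A A (e Q) (e R))"
    if "P \<in> carrier M" "Q \<in> carrier M" "R \<in> carrier M" for P Q R
    using that AT.TV.lin_single[of e3 "(P, Q, R)" 1] e3[OF that] by (simp add: e3_def)
  have cl1: "lin ?M3 (\<lambda>(P, Q). Poly_Mapping.single (P, Q, V) 1) (D U) \<in> carrier ?M3"
    and cl2: "lin ?M3 (\<lambda>(P, Q). Poly_Mapping.single (V, P, Q) 1) (D U) \<in> carrier ?M3"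
    if "U \<in> carrier M" "V \<in> carrier M" for U V
    using that D_keys[OF that(1)] by (intro MV.lin_closed; force)+
  have base: "tensor_assoc A (tensor_map (tensor A A) A \<Delta> id (\<Delta> (e X))) =
      tensor_map A (tensor A A) id \<Delta> (\<Delta> (e X))" if X: "X \<in> carrier M" for X
  proof -
    have "tensor_assoc A (tensor_map (tensor A A) A \<Delta> id (\<Delta> (e X))) =
      lin ?T (\<lambda>(U, V). tensor_assoc A (tensor_map (tensor A A) A \<Delta> id (ptens A A (e U) (e V)))) (D X)"
      by (rule linear_map_\<Delta>_e[OF X al AT.T.vector_space])
    also have "\<dots> = lin ?T (\<lambda>k. lin ?T e3 (case k of (U, V) \<Rightarrow>
        lin ?M3 (\<lambda>(P, Q). Poly_Mapping.single (P, Q, V) 1) (D U))) (D X)"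
    proof (rule AT.TV.lin_cong)
      show "(\<lambda>k. lin ?T e3 (case k of (U, V) \<Rightarrow>
        lin ?M3 (\<lambda>(P, Q). Poly_Mapping.single (P, Q, V) 1) (D U))) \<in> Poly_Mapping.keys (D X) \<rightarrow> carrier ?T"
        using D_keys[OF X] linear_mapD(1)[OF L cl1] by auto
    next
      fix k assume k: "k \<in> Poly_Mapping.keys (D X)"
      obtain U V where k': "k = (U, V)" by (cases k)
      have UV: "U \<in> carrier M" "V \<in> carrier M" using D_keys[OF X] k k' by auto
      let ?f = "tensor_lift ?T (\<lambda>a b. ptens A (tensor A A) a (ptens A A b (e V)))"
      have "tensor_assoc A (tensor_map (tensor A A) A \<Delta> id (ptens A A (e U) (e V))) = ?f (\<Delta> (e U))"
        using UV by (simp add: tl(2) e_closed tensor_assoc_ptens \<Delta>_closed)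
      also have "\<dots> = lin ?T (\<lambda>(P, Q). ?f (ptens A A (e P) (e Q))) (D U)"
        by (rule linear_map_\<Delta>_e[OF UV(1) tensor_assoc_inner_linear(1)[OF e_closed[OF UV(2)]] AT.T.vector_space])
      also have "\<dots> = lin ?T (\<lambda>k. lin ?T e3 (case k of (P, Q) \<Rightarrow> Poly_Mapping.single (P, Q, V) 1)) (D U)"
        using D_keys[OF UV(1)] UV
        by (intro AT.TV.lin_cong) (auto simp: tensor_assoc_inner_linear(2) e_closed s)
      also have "\<dots> = lin ?T e3 (lin ?M3 (\<lambda>(P, Q). Poly_Mapping.single (P, Q, V) 1) (D U))"
        using D_keys[OF UV(1)] UV
        by (intro linear_map_lin[OF L MA.vector_space AT.T.vector_space, symmetric]) auto
      finally show "(case k of (U, V) \<Rightarrow>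
          tensor_assoc A (tensor_map (tensor A A) A \<Delta> id (ptens A A (e U) (e V)))) =
        lin ?T e3 (case k of (U, V) \<Rightarrow> lin ?M3 (\<lambda>(P, Q). Poly_Mapping.single (P, Q, V) 1) (D U))"
        by (simp add: k')
    qed
    also have "\<dots> = lin ?T e3 (lin ?M3 (\<lambda>(U, V). lin ?M3 (\<lambda>(P, Q). Poly_Mapping.single (P, Q, V) 1) (D U)) (D X))"
      using D_keys[OF X] cl1
      by (intro linear_map_lin[OF L MA.vector_space AT.T.vector_space, symmetric])
        (auto simp del: monoid_algebra_simps)
    also have "\<dots> = lin ?T e3 (lin ?M3 (\<lambda>(U, V). lin ?M3 (\<lambda>(P, Q). Poly_Mapping.single (U, P, Q) 1) (D V)) (D X))"
      by (simp only: D_coassoc[OF X])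
    also have "\<dots> = lin ?T (\<lambda>k. lin ?T e3 (case k of (U, V) \<Rightarrow>
        lin ?M3 (\<lambda>(P, Q). Poly_Mapping.single (U, P, Q) 1) (D V))) (D X)"
      using D_keys[OF X] cl2
      by (intro linear_map_lin[OF L MA.vector_space AT.T.vector_space])
        (auto simp del: monoid_algebra_simps)
    also have "\<dots> = lin ?T (\<lambda>(U, V). tensor_map A (tensor A A) id \<Delta> (ptens A A (e U) (e V))) (D X)"
    proof (rule AT.TV.lin_cong)
      show "(\<lambda>(U, V). tensor_map A (tensor A A) id \<Delta> (ptens A A (e U) (e V)))
        \<in> Poly_Mapping.keys (D X) \<rightarrow> carrier ?T"
        using D_keys[OF X] by (auto simp: tr(2) e_closed \<Delta>_closed)
    next
      fix k assume k: "k \<in> Poly_Mapping.keys (D X)"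
      obtain U V where k': "k = (U, V)" by (cases k)
      have UV: "U \<in> carrier M" "V \<in> carrier M" using D_keys[OF X] k k' by auto
      have p: "linear_map (tensor A A) ?T (ptens A (tensor A A) (e U))"
        using AT.ptens_bilinear e_closed[OF UV(1)] by (auto simp: bilinear_map_def)
      have "tensor_map A (tensor A A) id \<Delta> (ptens A A (e U) (e V)) = ptens A (tensor A A) (e U) (\<Delta> (e V))"
        using UV by (simp add: tr(2) e_closed)
      also have "\<dots> = lin ?T (\<lambda>(P, Q). ptens A (tensor A A) (e U) (ptens A A (e P) (e Q))) (D V)"
        by (rule linear_map_\<Delta>_e[OF UV(2) p AT.T.vector_space])
      also have "\<dots> = lin ?T (\<lambda>k. lin ?T e3 (case k of (P, Q) \<Rightarrow> Poly_Mapping.single (U, P, Q) 1)) (D V)"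
        using D_keys[OF UV(2)] UV
        by (intro AT.TV.lin_cong) (auto simp: e_closed s)
      also have "\<dots> = lin ?T e3 (lin ?M3 (\<lambda>(P, Q). Poly_Mapping.single (U, P, Q) 1) (D V))"
        using D_keys[OF UV(2)] UV
        by (intro linear_map_lin[OF L MA.vector_space AT.T.vector_space, symmetric]) auto
      finally show "lin ?T e3 (case k of (U, V) \<Rightarrow> lin ?M3 (\<lambda>(P, Q). Poly_Mapping.single (U, P, Q) 1) (D V)) =
        (case k of (U, V) \<Rightarrow> tensor_map A (tensor A A) id \<Delta> (ptens A A (e U) (e V)))"
        by (simp add: k')
    qed
    also have "\<dots> = tensor_map A (tensor A A) id \<Delta> (\<Delta> (e X))"
      by (rule linear_map_\<Delta>_e[OF X tr(1) AT.T.vector_space, symmetric])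
    finally show ?thesis .
  qed
  show ?thesis
    using eq_on_e[OF linear_map_comp[OF \<Delta>_linear al] linear_map_comp[OF \<Delta>_linear tr(1)]
        AT.T.vector_space base assms] .
qed

lemma \<Delta>_one: "\<Delta> \<one> = \<one>\<^bsub>tensor A A\<^esub>"
proof -
  have "\<Delta> \<one> = ptens A A \<one> \<one>"
    using \<Delta>_e[OF M.one_closed] by (simp add: D_one AA.TV.lin_single e_one)
  then show ?thesis by (simp add: AA.tensor_one)
qed

lemma bialgebra: "bialgebra A \<Delta> \<epsilon>"
proof unfold_locales
  show "\<Delta> \<in> ring_hom A (tensor A A)"
    by (rule ring_hom_memI) (auto simp: \<Delta>_mult linear_mapD[OF \<Delta>_linear] \<Delta>_one)
  show "\<epsilon> \<in> ring_hom A complex_alg"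
    using linear_mapD[OF \<epsilon>_linear] \<epsilon>_e[of "\<one>\<^bsub>M\<^esub>"] E_one
    by (intro ring_hom_memI) (auto simp: \<epsilon>_mult e_one)
qed (use \<Delta>_linear \<epsilon>_linear counit_laws coassoc_law in auto)

end

section \<open>The antipode of a connected graded bialgebra\<close>

lemma (in complex_vector_space) sum_diff_cancel:
  assumes "x \<in> carrier M" "y \<in> carrier M"
  shows "(x \<oplus> y) \<ominus> x = y" "(x \<oplus> y) \<ominus> y = x" "x \<ominus> (x \<ominus> y) = y"
proof -
  show "(x \<oplus> y) \<ominus> y = x" using assms by (simp add: a_minus_def a_assoc r_neg)
  then show "(x \<oplus> y) \<ominus> x = y" using assms
    by (metis a_minus_def a_comm a_assoc r_neg r_zero a_inv_closed)
  show "x \<ominus> (x \<ominus> y) = y" using assms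
    by (simp add: a_minus_def minus_add minus_minus a_assoc[symmetric] r_neg)
qed

lemma (in complex_vector_space) minus_self [simp]:
  assumes "x \<in> carrier M"
  shows "x \<ominus> x = \<zero>" "x \<ominus> \<zero> = x"
  using assms by (simp_all add: a_minus_def r_neg)

lemma (in complex_vector_space) zero_subspace: "submodule {\<zero>} complex_alg M"
  by (rule subspaceI) auto

context connected_graded_bialgebra
begin

interpretation AA: algebra_pair A A by (rule self_pair)
interpretation AT: algebra_pair A "tensor A A" by (rule pair_right)
interpretation TA: algebra_pair "tensor A A" A by (rule pair_left)
interpretation V: complex_vector_space A by (rule vector_space)

lemma mult_bilinear: "bilinear_map A A A (\<lambda>a b. a \<otimes> b)"
  by (auto simp: bilinear_map_def linear_map_mult_left linear_map_mult_right)

text \<open>Convolution before the coproduct is applied: a linear map on tensors, hence determined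
  by its values on pure tensors.\<close>

definition conv_lift :: "('a \<Rightarrow> 'a) \<Rightarrow> ('a \<Rightarrow> 'a) \<Rightarrow> (('a \<times> 'a) \<Rightarrow>\<^sub>0 complex) set \<Rightarrow> 'a" where
  "conv_lift f g w = tensor_lift A (\<lambda>a b. a \<otimes> b) (tensor_map A A f g w)"

definition conv :: "('a \<Rightarrow> 'a) \<Rightarrow> ('a \<Rightarrow> 'a) \<Rightarrow> 'a \<Rightarrow> 'a" where
  "conv f g x = conv_lift f g (\<Delta> x)"

abbreviation "endo f \<equiv> linear_map A A f"

lemma conv_lift_linear:
  assumes "endo f" "endo g"
  shows "linear_map (tensor A A) A (conv_lift f g)"
    and "a \<in> carrier A \<Longrightarrow> b \<in> carrier A \<Longrightarrow> conv_lift f g (ptens A A a b) = f a \<otimes> g b"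
proof -
  note t = tensor_map_linear[OF complex_algebra_axioms complex_algebra_axioms complex_algebra_axioms
      complex_algebra_axioms assms]
  show "linear_map (tensor A A) A (conv_lift f g)"
    unfolding conv_lift_def
    by (rule linear_map_comp[OF t(1) AA.linear_map_tensor_lift[OF vector_space mult_bilinear]])
  show "a \<in> carrier A \<Longrightarrow> b \<in> carrier A \<Longrightarrow> conv_lift f g (ptens A A a b) = f a \<otimes> g b"
    using linear_mapD(1)[OF assms(1)] linear_mapD(1)[OF assms(2)]
    by (simp add: conv_lift_def t(2) AA.tensor_lift_ptens[OF vector_space mult_bilinear])
qed

lemma conv_linear: "endo f \<Longrightarrow> endo g \<Longrightarrow> endo (conv f g)"
  unfolding conv_def by (rule linear_map_comp[OF comult_linear conv_lift_linear(1)])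

lemma \<Delta>_closed: "x \<in> carrier A \<Longrightarrow> \<Delta> x \<in> carrier (tensor A A)"
  using linear_mapD(1)[OF comult_linear] .

text \<open>Although \<open>\<Delta> x\<close> is not a pure tensor, both sides are linear maps
  applied to it, so the comparison may be made on pure tensors.\<close>

lemma conv_eqI:
  assumes "endo f" "endo g" "linear_map (tensor A A) A h"
    and "\<And>a b. a \<in> carrier A \<Longrightarrow> b \<in> carrier A \<Longrightarrow> f a \<otimes> g b = h (ptens A A a b)" "x \<in> carrier A"
  shows "conv f g x = h (\<Delta> x)"
  unfolding conv_def
  by (rule AA.linear_map_eq_tensor[OF conv_lift_linear(1)[OF assms(1,2)] assms(3) vector_space _
        \<Delta>_closed[OF assms(5)]])
    (simp add: conv_lift_linear(2)[OF assms(1,2)] assms(4))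

lemma conv_cong:
  assumes "endo f" "endo g" "endo f'" "endo g'" "x \<in> carrier A"
    and "\<And>y. y \<in> carrier A \<Longrightarrow> f y = f' y" "\<And>y. y \<in> carrier A \<Longrightarrow> g y = g' y"
  shows "conv f g x = conv f' g' x"
proof -
  have "conv f g x = conv_lift f' g' (\<Delta> x)"
    by (rule conv_eqI[OF assms(1,2) conv_lift_linear(1)[OF assms(3,4)] _ assms(5)])
      (simp add: conv_lift_linear(2)[OF assms(3,4)] assms(6,7))
  then show ?thesis by (simp add: conv_def)
qed

text \<open>Both bracketings multiply the values of \<open>f\<close>, \<open>g\<close> and
  \<open>h\<close> on the three legs of an iterated coproduct. The map \<open>mu\<close> does this
  on right-nested tensors, and coassociativity exchanges the two iterated coproducts.\<close>

lemma conv_assoc: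
  assumes f: "endo f" and g: "endo g" and h: "endo h" and x: "x \<in> carrier A"
  shows "conv (conv f g) h x = conv f (conv g h) x"
proof -
  let ?T = "tensor A (tensor A A)"
  note fc = linear_mapD(1)[OF f] and gc = linear_mapD(1)[OF g] and hc = linear_mapD(1)[OF h]
  have id: "linear_map A A id" by (simp add: linear_map_def)
  note tl = tensor_map_linear[OF complex_algebra_axioms complex_algebra_axioms
      AA.T.complex_algebra_axioms complex_algebra_axioms comult_linear id]
  note tr = tensor_map_linear[OF complex_algebra_axioms complex_algebra_axioms
      complex_algebra_axioms AA.T.complex_algebra_axioms id comult_linear]
  note gh = conv_lift_linear[OF g h]
  have bil: "bilinear_map A (tensor A A) A (\<lambda>a w. f a \<otimes> conv_lift g h w)"
    by (rule bilinear_map_comp[OF mult_bilinear f gh(1)])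
  define mu where "mu = tensor_lift A (\<lambda>a w. f a \<otimes> conv_lift g h w)"
  have mu: "linear_map ?T A mu"
    "\<And>a w. a \<in> carrier A \<Longrightarrow> w \<in> carrier (tensor A A) \<Longrightarrow> mu (ptens A (tensor A A) a w) = f a \<otimes> conv_lift g h w"
    unfolding mu_def
    using AT.linear_map_tensor_lift[OF vector_space bil] AT.tensor_lift_ptens[OF vector_space bil] by auto
  have "conv f (conv g h) x = mu (tensor_map A (tensor A A) id \<Delta> (\<Delta> x))"
    by (rule conv_eqI[OF f conv_linear[OF g h] linear_map_comp[OF tr(1) mu(1)] _ x])
      (simp add: tr(2) mu(2) \<Delta>_closed conv_def)
  also have "\<dots> = mu (tensor_assoc A (tensor_map (tensor A A) A \<Delta> id (\<Delta> x)))"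
    by (simp add: coassoc x)
  also have "\<dots> = conv (conv f g) h x"
  proof (rule conv_eqI[OF conv_linear[OF f g] h
        linear_map_comp[OF tl(1) linear_map_comp[OF tensor_assoc_linear mu(1)]] _ x, symmetric])
    fix a b assume a: "a \<in> carrier A" and b: "b \<in> carrier A"
    have "conv f g a \<otimes> h b = mu (tensor_lift ?T (\<lambda>a b'. ptens A (tensor A A) a (ptens A A b' b)) (\<Delta> a))"
      unfolding conv_def
    proof (rule AA.linear_map_eq_tensor[OF linear_map_comp[OF conv_lift_linear(1)[OF f g]
            linear_map_mult_right[OF hc[OF b]]] linear_map_comp[OF tensor_assoc_inner_linear(1)[OF b] mu(1)]
          vector_space _ \<Delta>_closed[OF a]])
      fix p q assume "p \<in> carrier A" "q \<in> carrier A"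
      then show "conv_lift f g (ptens A A p q) \<otimes> h b =
          mu (tensor_lift ?T (\<lambda>a b'. ptens A (tensor A A) a (ptens A A b' b)) (ptens A A p q))"
        using b fc gc hc
        by (simp add: tensor_assoc_inner_linear(2) mu(2) gh(2) conv_lift_linear(2)[OF f g] m_assoc)
    qed
    then show "conv f g a \<otimes> h b = mu (tensor_assoc A (tensor_map (tensor A A) A \<Delta> id (ptens A A a b)))"
      using a b by (simp add: tl(2) tensor_assoc_ptens \<Delta>_closed)
  qed
  finally show ?thesis by simp
qed

text \<open>The neutral element of convolution.\<close>

definition unit_map :: "'a \<Rightarrow> 'a" where "unit_map x = \<epsilon> x \<odot> \<one>"

lemma unit_map_linear: "endo unit_map"
  using linear_mapD[OF counit_linear]
  by (auto simp: linear_map_def unit_map_def V.scale_add_left V.scale_scale)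

lemma conv_unit_left:
  assumes g: "endo g" and x: "x \<in> carrier A"
  shows "conv unit_map g x = g x"
proof -
  have bil: "bilinear_map A A A (\<lambda>a b. \<epsilon> a \<odot> b)"
    using counit_linear by (auto simp: bilinear_map_def linear_map_def Pi_iff V.scale_add_left
        V.scale_add_right V.scale_scale mult.commute)
  have "conv unit_map g x = g (tensor_lift A (\<lambda>a b. \<epsilon> a \<odot> b) (\<Delta> x))"
    by (rule conv_eqI[OF unit_map_linear g
          linear_map_comp[OF AA.linear_map_tensor_lift[OF vector_space bil] g] _ x])
      (use linear_mapD[OF g] in \<open>simp add: AA.tensor_lift_ptens[OF vector_space bil] unit_map_def smult_mult_left\<close>)
  then show ?thesis by (simp add: counit_left x)
qed

lemma conv_unit_right:
  assumes g: "endo g" and x: "x \<in> carrier A"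
  shows "conv g unit_map x = g x"
proof -
  have bil: "bilinear_map A A A (\<lambda>a b. \<epsilon> b \<odot> a)"
    using counit_linear by (auto simp: bilinear_map_def linear_map_def Pi_iff V.scale_add_left
        V.scale_add_right V.scale_scale mult.commute)
  have "conv g unit_map x = g (tensor_lift A (\<lambda>a b. \<epsilon> b \<odot> a) (\<Delta> x))"
    by (rule conv_eqI[OF g unit_map_linear
          linear_map_comp[OF AA.linear_map_tensor_lift[OF vector_space bil] g] _ x])
      (use linear_mapD[OF g] in \<open>simp add: AA.tensor_lift_ptens[OF vector_space bil] unit_map_def smult_mult_right\<close>)
  then show ?thesis by (simp add: counit_right x)
qed

lemma conv_add_left:
  assumes f: "endo f" and g: "endo g" and h: "endo h" and x: "x \<in> carrier A"
  shows "conv (\<lambda>y. f y \<oplus> g y) h x = conv f h x \<oplus> conv g h x"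
proof -
  note c = linear_mapD(1)[OF f] linear_mapD(1)[OF g] linear_mapD(1)[OF h]
  show ?thesis
    unfolding conv_def[of f] conv_def[of g]
    by (rule conv_eqI[OF linear_map_add[OF vector_space f g] h
          linear_map_add[OF vector_space conv_lift_linear(1)[OF f h] conv_lift_linear(1)[OF g h]] _ x])
      (simp add: conv_lift_linear(2)[OF f h] conv_lift_linear(2)[OF g h] c l_distr)
qed

lemma conv_minus_right:
  assumes f: "endo f" and g: "endo g" and h: "endo h" and x: "x \<in> carrier A"
  shows "conv h (\<lambda>y. f y \<ominus> g y) x = conv h f x \<ominus> conv h g x"
proof -
  note c = linear_mapD(1)[OF f] linear_mapD(1)[OF g] linear_mapD(1)[OF h]
  show ?thesis
    unfolding conv_def[of h f] conv_def[of h g]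
    by (rule conv_eqI[OF h linear_map_minusI[OF vector_space f g]
          linear_map_minusI[OF vector_space conv_lift_linear(1)[OF h f] conv_lift_linear(1)[OF h g]] _ x])
      (simp add: conv_lift_linear(2)[OF h f] conv_lift_linear(2)[OF h g] c a_minus_def r_distr r_minus)
qed

lemma conv_minus_left:
  assumes f: "endo f" and g: "endo g" and h: "endo h" and x: "x \<in> carrier A"
  shows "conv (\<lambda>y. f y \<ominus> g y) h x = conv f h x \<ominus> conv g h x"
proof -
  note c = linear_mapD(1)[OF f] linear_mapD(1)[OF g] linear_mapD(1)[OF h]
  show ?thesis
    unfolding conv_def[of f] conv_def[of g]
    by (rule conv_eqI[OF linear_map_minusI[OF vector_space f g] h
          linear_map_minusI[OF vector_space conv_lift_linear(1)[OF f h] conv_lift_linear(1)[OF g h]] _ x])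
      (simp add: conv_lift_linear(2)[OF f h] conv_lift_linear(2)[OF g h] c a_minus_def l_distr l_minus)
qed

lemma gr_closed: "x \<in> gr n \<Longrightarrow> x \<in> carrier A"
  using V.subspaceD(1)[OF gr_submodule] by blast

text \<open>The coproduct of a homogeneous element is a combination of pure tensors whose degrees
  add up to \<open>n\<close>, so only those need to be tested. With \<open>H\<close> zero this gives
  vanishing results, with \<open>H\<close> a graded piece it gives preservation of degree.\<close>

lemma conv_lift_degree:
  assumes f: "endo f" and g: "endo g" and H: "submodule H complex_alg A"
    and "\<And>p q a b. p + q = n \<Longrightarrow> a \<in> gr p \<Longrightarrow> b \<in> gr q \<Longrightarrow> f a \<otimes> g b \<in> H" and x: "x \<in> gr n"
  shows "conv f g x \<in> H"
proof -
  have "tensor_degree A gr n \<subseteq> {w \<in> carrier (tensor A A). conv_lift f g w \<in> H}"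
    unfolding tensor_degree_def
    by (rule AA.TV.span_minimal[OF subspace_preimage[OF conv_lift_linear(1)[OF f g]
            AA.T.vector_space vector_space H]])
      (use assms(4) gr_closed in \<open>auto simp: conv_lift_linear(2)[OF f g]\<close>)
  then show ?thesis using gr_comult[OF x] by (auto simp: conv_def)
qed

section \<open>Convolution powers and partial sums of the geometric series\<close>

definition aug :: "'a \<Rightarrow> 'a" where "aug x = unit_map x \<ominus> x"

primrec conv_power :: "nat \<Rightarrow> 'a \<Rightarrow> 'a" where
  "conv_power 0 = unit_map"
| "conv_power (Suc k) = conv (conv_power k) aug"

primrec geom :: "nat \<Rightarrow> 'a \<Rightarrow> 'a" where
  "geom 0 = unit_map"
| "geom (Suc k) = (\<lambda>x. geom k x \<oplus> conv_power (Suc k) x)"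

lemma aug_linear: "endo aug"
  unfolding aug_def by (rule linear_map_minusI[OF vector_space unit_map_linear linear_map_id])

lemma conv_power_linear: "endo (conv_power k)"
  by (induction k) (simp_all add: unit_map_linear conv_linear aug_linear)

lemma geom_linear: "endo (geom k)"
proof (induction k)
  case (Suc k)
  then show ?case unfolding geom.simps
    by (rule linear_map_add[OF vector_space _ conv_power_linear])
qed (simp add: unit_map_linear)

text \<open>Powers are built by multiplying on the right. Associativity moves the new factor to the
  left, which is needed since convolution is not commutative and a two-sided inverse is
  sought.\<close>

lemma conv_power_Suc: "x \<in> carrier A \<Longrightarrow> conv_power (Suc k) x = conv aug (conv_power k) x"
proof (induction k arbitrary: x)
  case 0 then show ?case by (simp add: conv_unit_left conv_unit_right aug_linear)
next
  case (Suc k)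
  have "conv_power (Suc (Suc k)) x = conv (conv_power (Suc k)) aug x" by simp
  also have "\<dots> = conv (conv aug (conv_power k)) aug x"
    by (rule conv_cong) (use Suc conv_power_linear conv_linear aug_linear in simp_all)
  also have "\<dots> = conv aug (conv_power (Suc k)) x"
    by (simp add: conv_assoc[OF aug_linear conv_power_linear aug_linear Suc.prems])
  finally show ?case .
qed

lemma counit_one: "\<epsilon> \<one> = 1"
  using ring_hom_one[OF counit_hom] by simp

text \<open>Connectedness leaves only scalar multiples of \<open>\<one>\<close> in degree 0, and on
  these counit followed by unit is the identity.\<close>

lemma aug_gr_zero: "b \<in> gr 0 \<Longrightarrow> aug b = \<zero>"
  using linear_mapD(3)[OF counit_linear]
  by (auto simp: connected_zero aug_def unit_map_def counit_one V.sum_diff_cancel)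

text \<open>Each factor \<open>aug\<close> kills degree 0 and therefore uses up at least one degree
  of the argument: in the last factor either \<open>q = 0\<close>, or the remaining \<open>k\<close>
  factors act on degree \<open>p < n\<close>.\<close>

lemma conv_power_vanish: "x \<in> gr n \<Longrightarrow> n < k \<Longrightarrow> conv_power k x = \<zero>"
proof (induction k arbitrary: n x)
  case (Suc k)
  have "conv (conv_power k) aug x \<in> {\<zero>}"
  proof (rule conv_lift_degree[OF conv_power_linear aug_linear V.zero_subspace _ Suc.prems(1)])
    fix p q a b assume pq: "p + q = n" and a: "a \<in> gr p" and b: "b \<in> gr q"
    show "conv_power k a \<otimes> aug b \<in> {\<zero>}"
    proof (cases "q = 0")
      case True
      then show ?thesis using b a aug_gr_zero linear_mapD(1)[OF conv_power_linear gr_closed[OF a]] by simp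
    next
      case False
      then have "conv_power k a = \<zero>" using Suc.IH[OF a] pq Suc.prems(2) by simp
      then show ?thesis using linear_mapD(1)[OF aug_linear gr_closed[OF b]] by simp
    qed
  qed
  then show ?case by simp
qed simp

lemma unit_map_gr: "x \<in> gr n \<Longrightarrow> unit_map x \<in> gr n"
  using gr_counit[of n x] gr_one V.subspaceD[OF gr_submodule]
  by (cases "n = 0") (auto simp: unit_map_def)

lemma aug_gr: "x \<in> gr n \<Longrightarrow> aug x \<in> gr n"
  unfolding aug_def by (intro V.subspaceD(6)[OF gr_submodule] unit_map_gr)

lemma conv_power_gr: "x \<in> gr n \<Longrightarrow> conv_power k x \<in> gr n"
proof (induction k arbitrary: n x)
  case (Suc k)
  show ?case unfolding conv_power.simps
    by (rule conv_lift_degree[OF conv_power_linear aug_linear gr_submodule _ Suc.prems])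
      (use Suc.IH aug_gr gr_mult in blast)
qed (simp add: unit_map_gr)

lemma geom_gr: "x \<in> gr n \<Longrightarrow> geom k x \<in> gr n"
  by (induction k) (auto simp: unit_map_gr intro: V.subspaceD(3)[OF gr_submodule] conv_power_gr
      simp del: conv_power.simps)

text \<open>Multiplication by \<open>aug\<close> raises each exponent of the partial sum by one. The
  result is the next partial sum without its term of exponent 0, which is
  \<open>unit_map\<close>.\<close>

lemma geom_conv_aug:
  assumes x: "x \<in> carrier A"
  shows "conv (geom k) aug x = geom (Suc k) x \<ominus> unit_map x"
    and "conv aug (geom k) x = geom (Suc k) x \<ominus> unit_map x"
proof -
  note uc = linear_mapD(1)[OF unit_map_linear x] and pc = linear_mapD(1)[OF conv_power_linear x]
    and gc = linear_mapD(1)[OF geom_linear x]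
  have add_right: "conv aug (\<lambda>y. f y \<oplus> g y) x = conv aug f x \<oplus> conv aug g x"
    if f: "endo f" and g: "endo g" for f g
  proof -
    note c = linear_mapD(1)[OF f] linear_mapD(1)[OF g] linear_mapD(1)[OF aug_linear]
    show ?thesis
      unfolding conv_def[of aug f] conv_def[of aug g]
      by (rule conv_eqI[OF aug_linear linear_map_add[OF vector_space f g]
            linear_map_add[OF vector_space conv_lift_linear(1)[OF aug_linear f]
              conv_lift_linear(1)[OF aug_linear g]] _ x])
        (simp add: conv_lift_linear(2)[OF aug_linear f] conv_lift_linear(2)[OF aug_linear g] c r_distr)
  qed
  have *: "(a \<ominus> u) \<oplus> b = (a \<oplus> b) \<ominus> u" if "a \<in> carrier A" "b \<in> carrier A" "u \<in> carrier A" for a b u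
    using that by (simp add: a_minus_def a_ac)
  have "conv (geom k) aug x = geom (Suc k) x \<ominus> unit_map x \<and>
      conv aug (geom k) x = geom (Suc k) x \<ominus> unit_map x"
  proof (induction k)
    case 0
    show ?case using uc pc[of 1] linear_mapD(1)[OF aug_linear x]
      by (simp add: conv_unit_left conv_unit_right aug_linear x V.sum_diff_cancel)
  next
    case (Suc k)
    have 1: "conv (geom (Suc k)) aug x = conv (geom k) aug x \<oplus> conv_power (Suc (Suc k)) x"
      by (simp only: geom.simps conv_add_left[OF geom_linear conv_power_linear aug_linear x])
        (simp add: x)
    have 2: "conv aug (geom (Suc k)) x = conv aug (geom k) x \<oplus> conv_power (Suc (Suc k)) x"
      by (simp only: geom.simps add_right[OF geom_linear conv_power_linear] conv_power_Suc[OF x, symmetric])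
    show ?case
      using Suc.IH 1 2 *[OF gc[of "Suc k"] pc[of "Suc (Suc k)"] uc] by (simp del: conv_power.simps)
  qed
  then show "conv (geom k) aug x = geom (Suc k) x \<ominus> unit_map x"
    "conv aug (geom k) x = geom (Suc k) x \<ominus> unit_map x" by auto
qed

text \<open>Since \<open>id\<close> is \<open>unit_map\<close> minus \<open>aug\<close>, the product
  telescopes to \<open>unit_map\<close> minus the power of exponent \<open>Suc k\<close>, and the
  latter is assumed to vanish at \<open>x\<close>.\<close>

lemma geom_conv_id:
  assumes x: "x \<in> carrier A" and "conv_power (Suc k) x = \<zero>"
  shows "conv (geom k) id x = unit_map x" "conv id (geom k) x = unit_map x"
proof -
  note uc = linear_mapD(1)[OF unit_map_linear x] and gc = linear_mapD(1)[OF geom_linear x]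
  have id: "endo id" by (simp add: linear_map_def)
  have d: "endo (\<lambda>y. unit_map y \<ominus> aug y)"
    by (rule linear_map_minusI[OF vector_space unit_map_linear aug_linear])
  have e: "id y = unit_map y \<ominus> aug y" if "y \<in> carrier A" for y
    using that linear_mapD(1)[OF unit_map_linear that] by (simp add: aug_def V.sum_diff_cancel)
  have "conv (geom k) id x = conv (geom k) (\<lambda>y. unit_map y \<ominus> aug y) x"
    by (rule conv_cong[OF geom_linear id geom_linear d x]) (simp_all only: e)
  also have "\<dots> = geom k x \<ominus> (geom k x \<ominus> unit_map x)"
    using assms gc by (simp add: conv_minus_right[OF unit_map_linear aug_linear geom_linear x]
        geom_conv_aug conv_unit_right geom_linear del: conv_power.simps)
  finally show "conv (geom k) id x = unit_map x" using uc gc by (simp add: V.sum_diff_cancel)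
  have "conv id (geom k) x = conv (\<lambda>y. unit_map y \<ominus> aug y) (geom k) x"
    by (rule conv_cong[OF id geom_linear d geom_linear x]) (simp_all only: e)
  also have "\<dots> = geom k x \<ominus> (geom k x \<ominus> unit_map x)"
    using assms gc by (simp add: conv_minus_left[OF unit_map_linear aug_linear geom_linear x]
        geom_conv_aug conv_unit_left geom_linear del: conv_power.simps)
  finally show "conv id (geom k) x = unit_map x" using uc gc by (simp add: V.sum_diff_cancel)
qed

lemma gr_decomp:
  "x \<in> carrier A \<Longrightarrow> \<exists>f S. (\<forall>n. f n \<in> gr n) \<and> finite S \<and> x = finsum A f S"
  using gr_direct_sum by blast

lemma eq_on_gr:
  assumes "linear_map A N f" "linear_map A N g" "complex_vector_space N"
    "\<And>n x. x \<in> gr n \<Longrightarrow> f x = g x" "x \<in> carrier A"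
  shows "f x = g x"
proof -
  interpret N: complex_vector_space N by fact
  obtain c S where c: "\<And>n. c n \<in> gr n" "finite S" "x = finsum A c S"
    using gr_decomp[OF assms(5)] by blast
  have cc: "c \<in> S \<rightarrow> carrier A" using c(1) gr_closed by auto
  have "f x = finsum N (\<lambda>n. f (c n)) S" "g x = finsum N (\<lambda>n. g (c n)) S"
    unfolding c(3) using linear_map_finsum[OF _ vector_space assms(3) cc] assms(1,2) by auto
  moreover have "(\<lambda>n. f (c n)) = (\<lambda>n. g (c n))" using assms(4) c(1) by blast
  ultimately show ?thesis by simp
qed

lemma conv_power_eventually_zero:
  assumes "x \<in> carrier A" shows "\<exists>N. \<forall>k>N. conv_power k x = \<zero>"
proof -
  obtain c S where c: "\<And>n. c n \<in> gr n" "finite S" "x = finsum A c S"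
    using gr_decomp[OF assms] by blast
  have cc: "c \<in> S \<rightarrow> carrier A" using c(1) gr_closed by auto
  \<comment> \<open>The bound exceeds every degree in \<open>S\<close>; the inserted 0 covers the
    case of an empty sum.\<close>
  have "conv_power k x = \<zero>" if k: "k > Max (insert 0 S)" for k
  proof -
    have "conv_power k x = finsum A (\<lambda>n. conv_power k (c n)) S"
      unfolding c(3) by (rule linear_map_finsum[OF conv_power_linear vector_space vector_space cc])
    also have "\<dots> = finsum A (\<lambda>n. \<zero>) S"
    proof (rule finsum_cong')
      fix n assume "n \<in> S"
      then have "n < k" using k c(2) by simp
      then show "conv_power k (c n) = \<zero>" using conv_power_vanish[OF c(1)] by blast
    qed auto
    finally show ?thesis by simp
  qed
  then show ?thesis by blast
qed

lemma geom_stable: "x \<in> carrier A \<Longrightarrow> \<forall>k>M. conv_power k x = \<zero> \<Longrightarrow> M \<le> N \<Longrightarrow> geom N x = geom M x"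
proof (induction N)
  case (Suc N)
  then show ?case
    using linear_mapD(1)[OF geom_linear Suc.prems(1)]
    by (cases "M = Suc N") (simp_all del: conv_power.simps)
qed simp

text \<open>The cut-off depends on \<open>x\<close>, so linearity is not immediate. By
  \<open>geom_stable\<close> any later cut-off gives the same value, and two arguments can then be
  treated with a common one.\<close>

definition antipode :: "'a \<Rightarrow> 'a" where
  "antipode x = geom (LEAST N. \<forall>k>N. conv_power k x = \<zero>) x"

lemma antipode_eq:
  assumes "x \<in> carrier A" "\<forall>k>N. conv_power k x = \<zero>"
  shows "antipode x = geom N x"
proof -
  let ?M = "LEAST N. \<forall>k>N. conv_power k x = \<zero>"
  have "\<forall>k>?M. conv_power k x = \<zero>" "?M \<le> N"
    by (rule LeastI[where P="\<lambda>N. \<forall>k>N. conv_power k x = \<zero>", OF assms(2)],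
        rule Least_le[where P="\<lambda>N. \<forall>k>N. conv_power k x = \<zero>", OF assms(2)])
  then have "geom N x = geom ?M x" by (rule geom_stable[OF assms(1)])
  then show ?thesis by (simp only: antipode_def)
qed

lemma antipode_gr: "x \<in> gr n \<Longrightarrow> n \<le> N \<Longrightarrow> antipode x = geom N x"
  using conv_power_vanish by (intro antipode_eq gr_closed) auto

lemma antipode_endo: "endo antipode"
  unfolding linear_map_def
proof (intro conjI ballI allI funcsetI)
  fix x assume x: "x \<in> carrier A"
  obtain N where N: "\<forall>k>N. conv_power k x = \<zero>" using conv_power_eventually_zero[OF x] by blast
  show "antipode x \<in> carrier A" using linear_mapD(1)[OF geom_linear x] by (simp add: antipode_def)
  show "antipode (c \<odot> x) = c \<odot> antipode x" for c
    using x N linear_mapD(3)[OF conv_power_linear x] linear_mapD(3)[OF geom_linear x]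
    by (simp add: antipode_eq[of _ N])
  fix y assume y: "y \<in> carrier A"
  obtain N' where N': "\<forall>k>N'. conv_power k y = \<zero>" using conv_power_eventually_zero[OF y] by blast
  show "antipode (x \<oplus> y) = antipode x \<oplus> antipode y"
    using x y N N' linear_mapD(2)[OF conv_power_linear x y] linear_mapD(2)[OF geom_linear x y]
    by (simp add: antipode_eq[of _ "max N N'"])
qed

text \<open>In degree \<open>n\<close> only tensor legs of degree at most \<open>n\<close> occur,
  and there the antipode agrees with \<open>geom n\<close>. The difference \<open>?D\<close> thus
  contributes nothing to the convolution, which may be computed with a fixed partial sum.\<close>

lemma antipode_conv:
  assumes "x \<in> carrier A"
  shows "conv antipode id x = unit_map x" "conv id antipode x = unit_map x"
proof -
  have id: "endo id" by (simp add: linear_map_def)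
  have 1: "conv antipode id x = unit_map x \<and> conv id antipode x = unit_map x" if x: "x \<in> gr n" for n x
  proof -
    have xc: "x \<in> carrier A" using gr_closed[OF x] .
    let ?D = "\<lambda>y. antipode y \<ominus> geom n y"
    have D: "endo ?D" by (rule linear_map_minusI[OF vector_space antipode_endo geom_linear])
    have z: "?D y = \<zero>" if "y \<in> gr p" "p \<le> n" for y p
      using antipode_gr[OF that] linear_mapD(1)[OF geom_linear gr_closed[OF that(1)]]
      by (simp add: V.sum_diff_cancel)
    have "conv ?D id x \<in> {\<zero>}"
      by (rule conv_lift_degree[OF D id V.zero_subspace _ x]) (use gr_closed z in auto)
    moreover have "conv id ?D x \<in> {\<zero>}"
      by (rule conv_lift_degree[OF id D V.zero_subspace _ x]) (use gr_closed z in auto)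
    ultimately have "conv antipode id x \<ominus> conv (geom n) id x = \<zero>"
      "conv id antipode x \<ominus> conv id (geom n) x = \<zero>"
      by (simp_all add: conv_minus_left[OF antipode_endo geom_linear id xc]
          conv_minus_right[OF antipode_endo geom_linear id xc])
    then have "conv antipode id x = conv (geom n) id x" "conv id antipode x = conv id (geom n) x"
      using V.eq_if_minus_zero[OF linear_mapD(1)[OF conv_linear[OF antipode_endo id] xc]
          linear_mapD(1)[OF conv_linear[OF geom_linear id] xc]]
        V.eq_if_minus_zero[OF linear_mapD(1)[OF conv_linear[OF id antipode_endo] xc]
          linear_mapD(1)[OF conv_linear[OF id geom_linear] xc]] by blast+
    then show ?thesis using geom_conv_id[OF xc conv_power_vanish[OF x lessI]] by simp
  qed
  show "conv antipode id x = unit_map x"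
    by (rule eq_on_gr[OF conv_linear[OF antipode_endo id] unit_map_linear vector_space _ assms])
      (use 1 in blast)
  show "conv id antipode x = unit_map x"
    by (rule eq_on_gr[OF conv_linear[OF id antipode_endo] unit_map_linear vector_space _ assms])
      (use 1 in blast)
qed

theorem hopf_algebra: "connected_graded_hopf_algebra A \<Delta> \<epsilon> gr antipode"
proof unfold_locales
  show "endo antipode" by (rule antipode_endo)
  show "antipode x \<in> gr n" if "x \<in> gr n" for n x
    using that antipode_gr[OF that order_refl] geom_gr by simp
qed (use antipode_conv in \<open>simp_all add: conv_def conv_lift_def unit_map_def\<close>)

end

section \<open>Graded quotients of monoid algebras\<close>

text \<open>The generators \<open>e X\<close> may satisfy linear relations, so a degree on the
  indices does not by itself give a grading of \<open>A\<close>. \<open>homogeneous_part\<close>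
  expresses that these relations are homogeneous.\<close>

locale graded_spanned_bialgebra = spanned_bialgebra M A e D E \<Delta> \<epsilon>
  for M :: "('g, 'm) monoid_scheme" and A :: "(complex, 'a, 'k) module_scheme" (structure)
    and e D E \<Delta> \<epsilon> +
  fixes L :: "'g \<Rightarrow> nat"
  assumes L_one: "L \<one>\<^bsub>M\<^esub> = 0"
    and L_mult: "X \<in> carrier M \<Longrightarrow> Y \<in> carrier M \<Longrightarrow> L (X \<otimes>\<^bsub>M\<^esub> Y) = L X + L Y"
    and L_D: "X \<in> carrier M \<Longrightarrow> (U, V) \<in> Poly_Mapping.keys (D X) \<Longrightarrow> L U + L V = L X"
    and L_E: "X \<in> carrier M \<Longrightarrow> E X \<Longrightarrow> L X = 0"
    and e_L: "X \<in> carrier M \<Longrightarrow> L X = 0 \<Longrightarrow> e X = \<one>"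
    and homogeneous_part: "\<And>n. \<exists>p. linear_map A A p \<and>
      (\<forall>X\<in>carrier M. p (e X) = (if L X = n then e X else \<zero>))"
begin

definition gr :: "nat \<Rightarrow> 'a set" where
  "gr n = lin_span A {e X | X. X \<in> carrier M \<and> L X = n}"

interpretation AA: algebra_pair A A by (rule self_pair)
interpretation V: complex_vector_space A by (rule vector_space)

lemma gr_base_closed: "{e X | X. X \<in> carrier M \<and> L X = n} \<subseteq> carrier A"
  using e_closed by auto

lemma gr_subspace: "submodule (gr n) complex_alg A"
  unfolding gr_def by (rule V.span_subspace[OF gr_base_closed])

lemma gr_sub: "x \<in> gr n \<Longrightarrow> x \<in> carrier A"
  using V.subspaceD(1)[OF gr_subspace] by auto

lemma e_gr: "X \<in> carrier M \<Longrightarrow> e X \<in> gr (L X)"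
  unfolding gr_def by (intro V.span_base) auto

lemma gr_minimal:
  assumes "submodule H complex_alg A" "\<And>X. X \<in> carrier M \<Longrightarrow> L X = n \<Longrightarrow> e X \<in> H" "x \<in> gr n"
  shows "x \<in> H"
proof -
  have "gr n \<subseteq> H" unfolding gr_def using assms by (intro V.span_minimal) auto
  then show ?thesis using assms by auto
qed

lemma gr_times:
  assumes x: "x \<in> gr p" and y: "y \<in> gr q"
  shows "x \<otimes> y \<in> gr (p + q)"
proof -
  have 1: "e X \<otimes> y \<in> gr (p + q)" if X: "X \<in> carrier M" "L X = p" for X
    using gr_minimal[OF subspace_preimage[OF linear_map_mult_left[OF e_closed[OF X(1)]] vector_space
          vector_space gr_subspace[of "p + q"]] _ y] X e_gr M.m_closed e_closed
    by (metis (no_types, lifting) L_mult e_mult mem_Collect_eq)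
  show ?thesis
    using gr_minimal[OF subspace_preimage[OF linear_map_mult_right[OF gr_sub[OF y]] vector_space
          vector_space gr_subspace[of "p + q"]] _ x] 1 e_closed by auto
qed

text \<open>The projectors \<open>p n\<close> provide both halves: the values \<open>p n x\<close>
  are the components of \<open>x\<close>, and applying \<open>p m\<close> to any homogeneous
  decomposition isolates its component of degree \<open>m\<close>.\<close>

lemma direct_sum:
  assumes x: "x \<in> carrier A"
  shows "\<exists>!f. (\<forall>n. f n \<in> gr n) \<and> finite {n. f n \<noteq> \<zero>} \<and> x = finsum A f {n. f n \<noteq> \<zero>}"
proof -
  obtain p where p: "\<And>n. linear_map A A (p n)"
    and pe: "\<And>n X. X \<in> carrier M \<Longrightarrow> p n (e X) = (if L X = n then e X else \<zero>)"
    using homogeneous_part by metis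
  have pz: "p n \<zero> = \<zero>" for n using linear_map_zero[OF p vector_space vector_space] .
  have id: "p n x = x" if "x \<in> gr n" for n x
    by (rule linear_map_eq_on_span[OF p linear_map_id vector_space vector_space gr_base_closed _ that[unfolded gr_def]])
      (auto simp: pe)
  have zero_map: "linear_map A A (\<lambda>x. \<zero>)" by (auto simp: linear_map_def)
  have off: "p m x = \<zero>" if "x \<in> gr n" "m \<noteq> n" for n m x
    by (rule linear_map_eq_on_span[OF p zero_map vector_space vector_space gr_base_closed _ that(1)[unfolded gr_def]])
      (use that(2) in \<open>auto simp: pe\<close>)
  have pgr: "p n y \<in> gr n" if "y \<in> carrier A" for n y
  proof -
    have "lin_span A (e ` carrier M) \<subseteq> {x \<in> carrier A. p n x \<in> gr n}"
      by (rule V.span_minimal[OF subspace_preimage[OF p vector_space vector_space gr_subspace]])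
        (use e_closed e_gr V.subspaceD(2)[OF gr_subspace] in \<open>auto simp: pe\<close>)
    then show ?thesis using that e_span by blast
  qed
  note pc = linear_mapD(1)[OF p]
  \<comment> \<open>Allowing every larger finite set in place of \<open>S\<close> lets the
    decompositions of two elements be added over the union of their sets of degrees.\<close>
  have "\<exists>S. finite S \<and> (\<forall>n. n \<notin> S \<longrightarrow> p n x = \<zero>) \<and> (\<forall>S'. finite S' \<and> S \<subseteq> S' \<longrightarrow> x = finsum A (\<lambda>n. p n x) S')"
    if "x \<in> lin_span A (e ` carrier M)" for x
    using that e_image
  proof (induction x rule: V.span_induct)
    case (base s)
    then obtain X where X: "X \<in> carrier M" "s = e X" by auto
    have "e X = finsum A (\<lambda>n. p n (e X)) S'" if "finite S'" "{L X} \<subseteq> S'" for S'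
    proof -
      have "finsum A (\<lambda>n. p n (e X)) S' = finsum A (\<lambda>n. if L X = n then e X else \<zero>) S'"
        using X e_closed by (intro finsum_cong') (auto simp: pe)
      also have "\<dots> = e X"
        using that X e_closed finsum_singleton[of "L X" S' "\<lambda>_. e X"] by auto
      finally show ?thesis by simp
    qed
    moreover have "p n (e X) = \<zero>" if "n \<notin> {L X}" for n using X(1) that by (simp add: pe)
    ultimately show ?case unfolding X(2) by (intro exI[of _ "{L X}"]) blast
  next
    case zero
    then show ?case by (intro exI[of _ "{}"]) (auto simp: pz)
  next
    case (add x y)
    then obtain S T where S: "finite S" "\<forall>n. n \<notin> S \<longrightarrow> p n x = \<zero>"
        "\<forall>S'. finite S' \<and> S \<subseteq> S' \<longrightarrow> x = finsum A (\<lambda>n. p n x) S'"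
      and T: "finite T" "\<forall>n. n \<notin> T \<longrightarrow> p n y = \<zero>"
        "\<forall>S'. finite S' \<and> T \<subseteq> S' \<longrightarrow> y = finsum A (\<lambda>n. p n y) S'" by blast
    have "x \<oplus> y = finsum A (\<lambda>n. p n (x \<oplus> y)) S'" if "finite S'" "S \<union> T \<subseteq> S'" for S'
    proof -
      have "finsum A (\<lambda>n. p n (x \<oplus> y)) S' = finsum A (\<lambda>n. p n x \<oplus> p n y) S'"
        using add pc linear_mapD(2)[OF p] by (intro finsum_cong') auto
      also have "\<dots> = finsum A (\<lambda>n. p n x) S' \<oplus> finsum A (\<lambda>n. p n y) S'"
        using add pc by (intro finsum_addf) auto
      also have "finsum A (\<lambda>n. p n x) S' = x" by (rule S(3)[rule_format, symmetric]) (use that in auto)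
      also have "finsum A (\<lambda>n. p n y) S' = y" by (rule T(3)[rule_format, symmetric]) (use that in auto)
      finally show ?thesis by simp
    qed
    moreover have "p n (x \<oplus> y) = \<zero>" if "n \<notin> S \<union> T" for n
      using that S(2) T(2) linear_mapD(2)[OF p add(1,2)] by simp
    ultimately show ?case using S(1) T(1) by (intro exI[of _ "S \<union> T"]) blast
  next
    case (scale c x)
    then obtain S where S: "finite S" "\<forall>n. n \<notin> S \<longrightarrow> p n x = \<zero>"
        "\<forall>S'. finite S' \<and> S \<subseteq> S' \<longrightarrow> x = finsum A (\<lambda>n. p n x) S'" by blast
    have "c \<odot> x = finsum A (\<lambda>n. p n (c \<odot> x)) S'" if "finite S'" "S \<subseteq> S'" for S'
    proof -
      have "finsum A (\<lambda>n. p n (c \<odot> x)) S' = finsum A (\<lambda>n. c \<odot> p n x) S'"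
        using scale pc linear_mapD(3)[OF p] by (intro finsum_cong') auto
      also have "\<dots> = c \<odot> finsum A (\<lambda>n. p n x) S'"
        using scale pc that by (intro finsum_smult_ldistr[symmetric]) auto
      also have "finsum A (\<lambda>n. p n x) S' = x" by (rule S(3)[rule_format, symmetric]) (use that in auto)
      finally show ?thesis by simp
    qed
    moreover have "p n (c \<odot> x) = \<zero>" if "n \<notin> S" for n
      using that S(2) linear_mapD(3)[OF p scale(1)] by simp
    ultimately show ?case using S(1) by (intro exI[of _ S]) blast
  qed
  from this[of x] x e_span obtain S where S: "finite S" "\<And>n. n \<notin> S \<Longrightarrow> p n x = \<zero>"
      "x = finsum A (\<lambda>n. p n x) S" by blast
  have sub: "{n. p n x \<noteq> \<zero>} \<subseteq> S" using S(2) by auto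
  show ?thesis
  proof (rule ex1I[of _ "\<lambda>n. p n x"], intro conjI allI)
    show "p n x \<in> gr n" for n using pgr[OF x] .
    show "finite {n. p n x \<noteq> \<zero>}" using sub S(1) by (rule finite_subset)
    have "finsum A (\<lambda>n. p n x) {n. p n x \<noteq> \<zero>} = finsum A (\<lambda>n. p n x) S"
      using sub S(1) pc[OF x] by (intro add.finprod_mono_neutral_cong_left) auto
    then show "x = finsum A (\<lambda>n. p n x) {n. p n x \<noteq> \<zero>}" using S(3) by (rule trans[OF _ sym, rotated])
  next
    fix f assume f: "(\<forall>n. f n \<in> gr n) \<and> finite {n. f n \<noteq> \<zero>} \<and> x = finsum A f {n. f n \<noteq> \<zero>}"
    let ?F = "{n. f n \<noteq> \<zero>}"
    have fc: "f n \<in> carrier A" for n using f gr_sub by blast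
    show "f = (\<lambda>n. p n x)"
    proof
      fix m
      \<comment> \<open>Uniqueness: \<open>p m\<close> fixes the summand of degree \<open>m\<close>
        and kills the others.\<close>
      have "p m x = p m (finsum A f ?F)" using f by (intro arg_cong[where f="p m"]) blast
      also have "\<dots> = finsum A (\<lambda>n. p m (f n)) ?F"
        by (rule linear_map_finsum[OF p vector_space vector_space]) (use fc in auto)
      also have "\<dots> = finsum A (\<lambda>n. if m = n then f n else \<zero>) ?F"
      proof (rule finsum_cong')
        fix n assume "n \<in> ?F"
        have "f n \<in> gr n" using f by blast
        then show "p m (f n) = (if m = n then f n else \<zero>)" using id off by auto
      qed (use fc in auto)
      also have "\<dots> = f m"
      proof (cases "f m = \<zero>")
        case True
        then have "finsum A (\<lambda>n. if m = n then f n else \<zero>) ?F = finsum A (\<lambda>n. \<zero>) ?F"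
          by (intro finsum_cong') auto
        then show ?thesis using True by simp
      next
        case False
        then show ?thesis using f fc finsum_singleton[of m ?F f] by auto
      qed
      finally show "f m = p m x" by simp
    qed
  qed
qed

lemma connected_graded_bialgebra: "connected_graded_bialgebra A \<Delta> \<epsilon> gr"
proof -
  interpret B: bialgebra A \<Delta> \<epsilon> by (rule bialgebra)
  have cd: "\<Delta> x \<in> tensor_degree A gr n" if x: "x \<in> gr n" for x n
  proof -
    have TD: "submodule (tensor_degree A gr n) complex_alg (tensor A A)"
      unfolding tensor_degree_def
      by (rule AA.TV.span_subspace) (auto intro!: AA.ptens_closed gr_sub)
    have "\<Delta> (e X) \<in> tensor_degree A gr n" if X: "X \<in> carrier M" "L X = n" for X
      unfolding \<Delta>_e[OF X(1)]
    proof (rule AA.TV.lin_in_subspace[OF TD])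
      fix k assume "k \<in> Poly_Mapping.keys (D X)"
      then obtain U V where k: "k = (U, V)" "(U, V) \<in> Poly_Mapping.keys (D X)" by (cases k) auto
      then have "U \<in> carrier M" "V \<in> carrier M" "L U + L V = n"
        using D_keys[OF X(1)] L_D[OF X(1)] X(2) by auto
      then show "(case k of (U, V) \<Rightarrow> ptens A A (e U) (e V)) \<in> tensor_degree A gr n"
        unfolding tensor_degree_def k(1) using e_gr[of U] e_gr[of V] by (intro AA.TV.span_base) blast
    qed
    then have "x \<in> {x \<in> carrier A. \<Delta> x \<in> tensor_degree A gr n}"
      using e_closed
      by (intro gr_minimal[OF subspace_preimage[OF \<Delta>_linear vector_space AA.T.vector_space TD] _ x]) auto
    then show ?thesis by simp
  qed
  have cu: "\<epsilon> x = 0" if n: "n > 0" and x: "x \<in> gr n" for n x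
  proof -
    interpret C: complex_vector_space complex_alg by (rule complex_vector_space_complex_alg)
    have "\<epsilon> (e X) = 0" if "X \<in> carrier M" "L X = n" for X
      using that n L_E[OF that(1)] by (auto simp: \<epsilon>_e)
    then have "x \<in> {x \<in> carrier A. \<epsilon> x \<in> {\<zero>\<^bsub>complex_alg\<^esub>}}"
      using e_closed
      by (intro gr_minimal[OF subspace_preimage[OF \<epsilon>_linear vector_space
              complex_vector_space_complex_alg C.zero_subspace] _ x]) auto
    then show ?thesis by simp
  qed
  have one: "\<one> \<in> gr 0" using e_gr[OF M.one_closed] by (simp add: L_one e_one)
  have sc: "submodule {c \<odot> \<one> | c. True} complex_alg A"
  proof (rule V.subspaceI)
    show "\<zero> \<in> {c \<odot> \<one> | c. True}" using V.scale_zero[OF one_closed] by (metis (mono_tags, lifting) mem_Collect_eq)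
    show "x \<oplus> y \<in> {c \<odot> \<one> | c. True}" if "x \<in> {c \<odot> \<one> | c. True}" "y \<in> {c \<odot> \<one> | c. True}" for x y
      using that by (auto simp flip: V.scale_add_left)
    show "c \<odot> x \<in> {c \<odot> \<one> | c. True}" if "x \<in> {c \<odot> \<one> | c. True}" for c x
      using that by (auto simp: V.scale_scale)
  qed auto
  have "gr 0 = {c \<odot> \<one> | c. True}"
  proof (intro equalityI subsetI)
    fix x assume "x \<in> gr 0"
    then show "x \<in> {c \<odot> \<one> | c. True}"
    proof (rule gr_minimal[OF sc, rotated])
      fix X assume "X \<in> carrier M" "L X = 0"
      then have "e X = 1 \<odot> \<one>" by (simp add: e_L)
      then show "e X \<in> {c \<odot> \<one> | c. True}" by blast
    qed
  next
    fix x assume "x \<in> {c \<odot> \<one> | c. True}"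
    then show "x \<in> gr 0" using V.subspaceD(4)[OF gr_subspace one] by auto
  qed
  \<comment> \<open>The counit takes the values 1 and 0 on the two sides.\<close>
  moreover have "\<one> \<noteq> \<zero>"
    using \<epsilon>_e[OF M.one_closed] E_one linear_map_zero[OF \<epsilon>_linear vector_space complex_vector_space_complex_alg]
    by (auto simp: e_one)
  ultimately show ?thesis
    by (intro connected_graded_bialgebra.intro graded_bialgebra.intro graded_bialgebra_axioms.intro
        connected_graded_bialgebra_axioms.intro bialgebra gr_subspace direct_sum one gr_times cd cu)
qed

end

text \<open>The elements of \<open>R\<close> generate the submonoid \<open>{X. E X}\<close> and are identified with the
  unit in the quotient.\<close>

locale graded_coproduct = comm_monoid M for M :: "('g, 'm) monoid_scheme" (structure) +
  fixes D :: "'g \<Rightarrow> ('g \<times> 'g) \<Rightarrow>\<^sub>0 complex" and E :: "'g \<Rightarrow> bool" and L :: "'g \<Rightarrow> nat" and R :: "'g set"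
  assumes D_closed: "X \<in> carrier M \<Longrightarrow> Poly_Mapping.keys (D X) \<subseteq> carrier M \<times> carrier M"
    and D_mult: "X \<in> carrier M \<Longrightarrow> Y \<in> carrier M \<Longrightarrow>
      D (X \<otimes> Y) = D X \<otimes>\<^bsub>monoid_algebra (M \<times>\<times> M)\<^esub> D Y"
    and D_coassoc: "X \<in> carrier M \<Longrightarrow>
      lin (monoid_algebra (triple_product M)) (\<lambda>(U, V). lin (monoid_algebra (triple_product M))
        (\<lambda>(P, Q). Poly_Mapping.single (P, Q, V) 1) (D U)) (D X) =
      lin (monoid_algebra (triple_product M)) (\<lambda>(U, V). lin (monoid_algebra (triple_product M))
        (\<lambda>(P, Q). Poly_Mapping.single (U, P, Q) 1) (D V)) (D X)"
    and D_counit_left: "X \<in> carrier M \<Longrightarrow>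
      lin (monoid_algebra M) (\<lambda>(U, V). if E U then Poly_Mapping.single V 1 else 0) (D X) =
      Poly_Mapping.single X 1"
    and D_counit_right: "X \<in> carrier M \<Longrightarrow>
      lin (monoid_algebra M) (\<lambda>(U, V). if E V then Poly_Mapping.single U 1 else 0) (D X) =
      Poly_Mapping.single X 1"
    and D_E: "X \<in> carrier M \<Longrightarrow> E X \<Longrightarrow> D X = Poly_Mapping.single (X, X) 1"
    and L_mult: "X \<in> carrier M \<Longrightarrow> Y \<in> carrier M \<Longrightarrow> L (X \<otimes> Y) = L X + L Y"
    and L_D: "X \<in> carrier M \<Longrightarrow> (U, V) \<in> Poly_Mapping.keys (D X) \<Longrightarrow> L U + L V = L X"
    and L_E: "X \<in> carrier M \<Longrightarrow> E X \<longleftrightarrow> L X = 0"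
    and R_subset: "R \<subseteq> carrier M"
    and R_E: "r \<in> R \<Longrightarrow> E r"
    and E_induct: "\<And>P. X \<in> carrier M \<Longrightarrow> E X \<Longrightarrow> P \<one> \<Longrightarrow>
      (\<And>Y r. Y \<in> carrier M \<Longrightarrow> r \<in> R \<Longrightarrow> P Y \<Longrightarrow> P (Y \<otimes> r)) \<Longrightarrow> P X"
begin

abbreviation "MA \<equiv> monoid_algebra M"
abbreviation "b X \<equiv> Poly_Mapping.single X (1::complex)"

definition comul :: "('g \<Rightarrow>\<^sub>0 complex) \<Rightarrow> ((('g \<Rightarrow>\<^sub>0 complex) \<times> ('g \<Rightarrow>\<^sub>0 complex)) \<Rightarrow>\<^sub>0 complex) set" where
  "comul = lin (tensor MA MA) (\<lambda>X. lin (tensor MA MA) (\<lambda>(U, V). ptens MA MA (b U) (b V)) (D X))"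

definition coun :: "('g \<Rightarrow>\<^sub>0 complex) \<Rightarrow> complex" where
  "coun = lin complex_alg (\<lambda>X. if E X then 1 else 0)"

definition unit_ideal :: "('g \<Rightarrow>\<^sub>0 complex) set" where
  "unit_ideal = Idl\<^bsub>MA\<^esub> {\<one>\<^bsub>MA\<^esub> \<ominus>\<^bsub>MA\<^esub> b r | r. r \<in> R}"

definition quo :: "(complex, ('g \<Rightarrow>\<^sub>0 complex) set) module" where
  "quo = quot_alg MA unit_ideal"

definition qproj :: "('g \<Rightarrow>\<^sub>0 complex) \<Rightarrow> ('g \<Rightarrow>\<^sub>0 complex) set" where
  "qproj x = unit_ideal +>\<^bsub>MA\<^esub> x"

definition qcomul where
  "qcomul X = the_elem ((\<lambda>x. tensor_map quo quo qproj qproj (comul x)) ` X)"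

definition qcoun :: "('g \<Rightarrow>\<^sub>0 complex) set \<Rightarrow> complex" where
  "qcoun X = the_elem (coun ` X)"

definition qgr :: "nat \<Rightarrow> ('g \<Rightarrow>\<^sub>0 complex) set set" where
  "qgr n = lin_span quo {qproj (b X) | X. X \<in> carrier M \<and> L X = n}"

lemma L_one: "L \<one> = 0"
  using L_mult[of \<one> \<one>] by simp

lemma E_one: "E \<one>"
  using L_E[OF one_closed] by (simp add: L_one)

lemma E_mult: "X \<in> carrier M \<Longrightarrow> Y \<in> carrier M \<Longrightarrow> E (X \<otimes> Y) \<longleftrightarrow> E X \<and> E Y"
  by (simp add: L_E L_mult)

interpretation A: complex_algebra MA
  by (rule complex_algebra_monoid_algebra) (rule monoid_axioms)
interpretation A: cring MA
  by (rule cring_monoid_algebra) (rule comm_monoid_axioms)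
interpretation AV: complex_vector_space MA by (rule A.vector_space)
interpretation AA: algebra_pair MA MA by (rule A.self_pair)

lemma D_keys: "X \<in> carrier M \<Longrightarrow> (U, V) \<in> Poly_Mapping.keys (D X) \<Longrightarrow> U \<in> carrier M \<and> V \<in> carrier M"
  using D_closed by auto

lemma b_closed: "X \<in> carrier M \<Longrightarrow> b X \<in> carrier MA" by simp

lemma ptens_D_closed:
  assumes "X \<in> carrier M"
  shows "lin (tensor MA MA) (\<lambda>(U, V). ptens MA MA (b U) (b V)) (D X) \<in> carrier (tensor MA MA)"
  using D_keys[OF assms] by (intro AA.TV.lin_closed) (auto intro!: AA.ptens_closed)

lemma comul_linear: "linear_map MA (tensor MA MA) comul"
  unfolding comul_def using ptens_D_closed
  by (intro linear_map_lin_monoid_algebra[OF monoid_axioms AA.T.vector_space]) auto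

lemma comul_b: "X \<in> carrier M \<Longrightarrow>
    comul (b X) = lin (tensor MA MA) (\<lambda>(U, V). ptens MA MA (b U) (b V)) (D X)"
  unfolding comul_def by (simp add: AA.TV.lin_single ptens_D_closed)

lemma coun_linear: "linear_map MA complex_alg coun"
  unfolding coun_def
  by (intro linear_map_lin_monoid_algebra[OF monoid_axioms complex_vector_space_complex_alg]) auto

lemma coun_b: "coun (b X) = (if E X then 1 else 0)"
  unfolding coun_def by (simp add: complex_vector_space.lin_single[OF complex_vector_space_complex_alg])

text \<open>Agreement with \<open>comul\<close> is asked for only on the carrier, since the
  coproduct of graphs is defined through representatives of classes and is arbitrary on formal sums
  of other sets.\<close>

lemma spanned_MA:
  assumes "\<And>x. x \<in> carrier MA \<Longrightarrow> \<Delta> x = comul x"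
  shows "spanned_bialgebra M MA b D E \<Delta> coun"
proof (intro spanned_bialgebra.intro spanned_bialgebra_axioms.intro)
  show "carrier MA = lin_span MA (b ` carrier M)"
    by (rule monoid_algebra_span[OF monoid_axioms])
  have "linear_map MA (tensor MA MA) \<Delta> = linear_map MA (tensor MA MA) comul"
    by (rule linear_map_cong[OF A.vector_space]) (rule assms)
  then show "linear_map MA (tensor MA MA) \<Delta>" by (simp only: comul_linear)
  show "\<Delta> (b X) = lin (tensor MA MA) (\<lambda>(U, V). ptens MA MA (b U) (b V)) (D X)" if "X \<in> carrier M" for X
    using assms[OF b_closed[OF that]] comul_b[OF that] by (rule trans)
qed (simp_all add: D_mult D_E E_one D_coassoc D_counit_left D_counit_right E_mult
    coun_linear coun_b D_closed monoid_axioms A.complex_algebra_axioms)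

lemma MA_bialgebra: "(\<And>x. x \<in> carrier MA \<Longrightarrow> \<Delta> x = comul x) \<Longrightarrow> bialgebra MA \<Delta> coun"
  by (rule spanned_bialgebra.bialgebra[OF spanned_MA])

section \<open>The quotient by the ideal that makes the elements of \<open>R\<close> equal to the
  unit\<close>

lemma generators_closed: "{\<one>\<^bsub>MA\<^esub> \<ominus>\<^bsub>MA\<^esub> b r | r. r \<in> R} \<subseteq> carrier MA"
  using R_subset by (auto intro!: A.minus_closed simp del: monoid_algebra_simps intro: A.one_closed b_closed)

interpretation Q: quotient_algebra MA unit_ideal
  unfolding unit_ideal_def
  by (rule quotient_algebra.intro[OF A.complex_algebra_axioms A.genideal_ideal[OF generators_closed]])

interpretation H: complex_algebra quo
  unfolding quo_def by (rule Q.complex_algebra_quot)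
interpretation HV: complex_vector_space quo by (rule H.vector_space)
interpretation HH: algebra_pair quo quo by (rule H.self_pair)

lemma qproj_linear: "linear_map MA quo qproj"
  using Q.linear_map_coset unfolding quo_def qproj_def[abs_def] .

lemma qproj_mult: "x \<in> carrier MA \<Longrightarrow> y \<in> carrier MA \<Longrightarrow> qproj (x \<otimes>\<^bsub>MA\<^esub> y) = qproj x \<otimes>\<^bsub>quo\<^esub> qproj y"
  unfolding quo_def qproj_def by (simp only: Q.coset_mult)

lemma qproj_one: "qproj \<one>\<^bsub>MA\<^esub> = \<one>\<^bsub>quo\<^esub>"
  unfolding quo_def qproj_def by (simp only: quot_alg_simps)

lemma qproj_R: "r \<in> R \<Longrightarrow> qproj (b r) = \<one>\<^bsub>quo\<^esub>"
proof -
  assume r: "r \<in> R"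
  then have "\<one>\<^bsub>MA\<^esub> \<ominus>\<^bsub>MA\<^esub> b r \<in> unit_ideal"
    using A.genideal_self[OF generators_closed] unfolding unit_ideal_def by blast
  then have "qproj \<one>\<^bsub>MA\<^esub> = qproj (b r)"
    unfolding qproj_def using r R_subset by (subst Q.coset_eq_iff) auto
  then show ?thesis by (simp only: qproj_one)
qed

lemma qproj_b_mult: "X \<in> carrier M \<Longrightarrow> Y \<in> carrier M \<Longrightarrow>
    qproj (b (X \<otimes> Y)) = qproj (b X) \<otimes>\<^bsub>quo\<^esub> qproj (b Y)"
  using qproj_mult[of "b X" "b Y"] by simp

lemma qproj_closed: "x \<in> carrier MA \<Longrightarrow> qproj x \<in> carrier quo"
  by (rule linear_mapD(1)[OF qproj_linear])

lemma qproj_b_closed: "X \<in> carrier M \<Longrightarrow> qproj (b X) \<in> carrier quo"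
  by (intro qproj_closed b_closed)

text \<open>By \<open>E_induct\<close>, an element with \<open>E X\<close> is a product of elements
  of \<open>R\<close>, each of which becomes the unit of the quotient.\<close>

lemma qproj_E: "X \<in> carrier M \<Longrightarrow> E X \<Longrightarrow> qproj (b X) = \<one>\<^bsub>quo\<^esub>"
proof -
  assume X: "X \<in> carrier M" "E X"
  show ?thesis
  proof (rule E_induct[OF X, where P="\<lambda>X. qproj (b X) = \<one>\<^bsub>quo\<^esub>"])
    show "qproj (b \<one>) = \<one>\<^bsub>quo\<^esub>" using qproj_one by simp
    show "qproj (b (Y \<otimes> r)) = \<one>\<^bsub>quo\<^esub>"
      if "Y \<in> carrier M" "r \<in> R" "qproj (b Y) = \<one>\<^bsub>quo\<^esub>" for Y r
      using that R_subset qproj_R[of r] qproj_b_mult[of Y r] by auto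
  qed
qed

text \<open>A linear map knows nothing of products, so its kernel need not be an ideal. Invariance
  under multiplication by \<open>r\<close> is therefore assumed for all basis elements
  \<open>X\<close>, which makes \<open>f\<close> vanish on every multiple of a generator.\<close>

lemma kills_unit_ideal:
  assumes f: "linear_map MA N f" and N: "complex_vector_space N"
    and inv: "\<And>X r. X \<in> carrier M \<Longrightarrow> r \<in> R \<Longrightarrow> f (b (X \<otimes> r)) = f (b X)"
    and x: "x \<in> unit_ideal"
  shows "f x = \<zero>\<^bsub>N\<^esub>"
proof -
  interpret N: complex_vector_space N by (rule N)
  \<comment> \<open>The largest ideal contained in the kernel of \<open>f\<close>. It contains the
    generators, hence the ideal they generate, and \<open>y\<close> equal to the unit gives back the
    kernel.\<close>
  define K where "K = {x \<in> carrier MA. \<forall>y\<in>carrier MA. f (y \<otimes>\<^bsub>MA\<^esub> x) = \<zero>\<^bsub>N\<^esub>}"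
  have zero_map: "linear_map MA N (\<lambda>x. \<zero>\<^bsub>N\<^esub>)" by (auto simp: linear_map_def)
  have fy: "linear_map MA N (\<lambda>x. f (y \<otimes>\<^bsub>MA\<^esub> x))" if "y \<in> carrier MA" for y
    by (rule linear_map_comp[OF A.linear_map_mult_left[OF that] f])
  have "submodule K complex_alg MA"
    by (rule AV.subspaceI)
      (use linear_mapD[OF fy] linear_map_zero[OF fy A.vector_space N] in \<open>auto simp: K_def simp del: monoid_algebra_simps\<close>)
  then have K: "ideal K MA"
  proof (intro idealI[OF A.ring_axioms])
    show "subgroup K (add_monoid MA)" if "submodule K complex_alg MA" using that by (rule submodule.axioms)
    show 1: "y \<otimes>\<^bsub>MA\<^esub> k \<in> K" if "k \<in> K" "y \<in> carrier MA" for k y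
      using that by (auto simp: K_def A.m_assoc[symmetric] simp del: monoid_algebra_simps)
    show "k \<otimes>\<^bsub>MA\<^esub> y \<in> K" if "k \<in> K" "y \<in> carrier MA" for k y
      using 1[OF that] that by (simp add: K_def A.m_comm del: monoid_algebra_simps)
  qed
  have "{\<one>\<^bsub>MA\<^esub> \<ominus>\<^bsub>MA\<^esub> b r | r. r \<in> R} \<subseteq> K"
  proof clarify
    fix r assume r: "r \<in> R"
    have rc: "\<one>\<^bsub>MA\<^esub> \<ominus>\<^bsub>MA\<^esub> b r \<in> carrier MA" using generators_closed r by blast
    have rM: "r \<in> carrier M" using r R_subset by auto
    have "f (y \<otimes>\<^bsub>MA\<^esub> (\<one>\<^bsub>MA\<^esub> \<ominus>\<^bsub>MA\<^esub> b r)) = \<zero>\<^bsub>N\<^esub>" if y: "y \<in> carrier MA" for y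
    proof (rule linear_map_eq_on_span[OF linear_map_comp[OF A.linear_map_mult_right[OF rc] f] zero_map
          A.vector_space N])
      show "b ` carrier M \<subseteq> carrier MA" by auto
      show "y \<in> lin_span MA (b ` carrier M)"
        unfolding monoid_algebra_span[OF monoid_axioms, symmetric] by (rule y)
      fix s assume "s \<in> b ` carrier M"
      then obtain X where X: "X \<in> carrier M" "s = b X" by auto
      have "b X \<otimes>\<^bsub>MA\<^esub> (\<one>\<^bsub>MA\<^esub> \<ominus>\<^bsub>MA\<^esub> b r) = b X \<ominus>\<^bsub>MA\<^esub> b (X \<otimes> r)"
        using X rM A.r_distr[of \<open>\<one>\<^bsub>MA\<^esub>\<close> "\<ominus>\<^bsub>MA\<^esub> b r" "b X"] A.a_inv_closed[of "b r"]
          A.one_closed A.r_one[of "b X"] A.r_minus[of "b X" "b r"]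
        by (simp add: a_minus_def)
      moreover have "f (b X \<ominus>\<^bsub>MA\<^esub> b (X \<otimes> r)) = f (b X) \<ominus>\<^bsub>N\<^esub> f (b (X \<otimes> r))"
        using X rM by (intro linear_map_minus[OF f A.vector_space N]) auto
      moreover have "f (b X) \<in> carrier N" using linear_mapD(1)[OF f, of "b X"] X by simp
      ultimately show "f (s \<otimes>\<^bsub>MA\<^esub> (\<one>\<^bsub>MA\<^esub> \<ominus>\<^bsub>MA\<^esub> b r)) = \<zero>\<^bsub>N\<^esub>"
        using inv[OF X(1) r] X(2) by simp
    qed
    then show "\<one>\<^bsub>MA\<^esub> \<ominus>\<^bsub>MA\<^esub> b r \<in> K" using rc by (simp add: K_def del: monoid_algebra_simps)
  qed
  then have "unit_ideal \<subseteq> K"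
    unfolding unit_ideal_def by (rule A.genideal_minimal[OF K])
  then have "x \<in> K" using x by auto
  then have "x \<in> carrier MA" "f (\<one>\<^bsub>MA\<^esub> \<otimes>\<^bsub>MA\<^esub> x) = \<zero>\<^bsub>N\<^esub>"
    unfolding K_def using A.one_closed by blast+
  then show ?thesis by (simp only: A.l_one)
qed

lemma lift_quo:
  assumes f: "linear_map MA N f" and N: "complex_vector_space N"
    and inv: "\<And>X r. X \<in> carrier M \<Longrightarrow> r \<in> R \<Longrightarrow> f (b (X \<otimes> r)) = f (b X)"
  shows "linear_map quo N (\<lambda>X. the_elem (f ` X))"
    and "x \<in> carrier MA \<Longrightarrow> the_elem (f ` qproj x) = f x"
proof -
  note k = kills_unit_ideal[OF assms]
  show "linear_map quo N (\<lambda>X. the_elem (f ` X))"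
    unfolding quo_def by (rule Q.linear_map_coset_lift[OF f N k])
  show "x \<in> carrier MA \<Longrightarrow> the_elem (f ` qproj x) = f x"
    unfolding qproj_def by (rule Q.coset_lift[OF f N k])
qed

lemma tmap:
  "linear_map (tensor MA MA) (tensor quo quo) (tensor_map quo quo qproj qproj)"
  "x \<in> carrier MA \<Longrightarrow> y \<in> carrier MA \<Longrightarrow>
    tensor_map quo quo qproj qproj (ptens MA MA x y) = ptens quo quo (qproj x) (qproj y)"
  using tensor_map_linear[OF A.complex_algebra_axioms A.complex_algebra_axioms
      H.complex_algebra_axioms H.complex_algebra_axioms qproj_linear qproj_linear] by auto

lemma tmap_comul_linear: "linear_map MA (tensor quo quo) (\<lambda>x. tensor_map quo quo qproj qproj (comul x))"
  by (rule linear_map_comp[OF comul_linear tmap(1)])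

lemma tmap_comul_b:
  assumes X: "X \<in> carrier M"
  shows "tensor_map quo quo qproj qproj (comul (b X)) =
    lin (tensor quo quo) (\<lambda>(U, V). ptens quo quo (qproj (b U)) (qproj (b V))) (D X)"
proof -
  have "tensor_map quo quo qproj qproj (comul (b X)) =
      lin (tensor quo quo) (\<lambda>k. tensor_map quo quo qproj qproj (case k of (U, V) \<Rightarrow> ptens MA MA (b U) (b V))) (D X)"
    unfolding comul_b[OF X] using D_keys[OF X]
    by (intro linear_map_lin[OF tmap(1) AA.T.vector_space HH.T.vector_space])
      (auto intro!: AA.ptens_closed)
  also have "\<dots> = lin (tensor quo quo) (\<lambda>(U, V). ptens quo quo (qproj (b U)) (qproj (b V))) (D X)"
    using D_keys[OF X] by (intro HH.TV.lin_cong) (auto simp: tmap(2) intro!: HH.ptens_closed qproj_b_closed)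
  finally show ?thesis .
qed

text \<open>The elements of \<open>R\<close> are grouplike, so \<open>D r\<close> is the single pair
  \<open>(r, r)\<close>, which the projection turns into the unit of the tensor square.
  Multiplicativity of \<open>D\<close> then removes the factor \<open>r\<close>.\<close>

lemma tmap_comul_invariant:
  assumes X: "X \<in> carrier M" and r: "r \<in> R"
  shows "tensor_map quo quo qproj qproj (comul (b (X \<otimes> r))) = tensor_map quo quo qproj qproj (comul (b X))"
proof -
  let ?g = "\<lambda>(U, V). ptens quo quo (qproj (b U)) (qproj (b V))"
  have rM: "r \<in> carrier M" using r R_subset by auto
  have "tensor_map quo quo qproj qproj (comul (b (X \<otimes> r))) =
      lin (tensor quo quo) ?g (D X \<otimes>\<^bsub>monoid_algebra (M \<times>\<times> M)\<^esub> D r)"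
    using X rM by (simp add: tmap_comul_b D_mult)
  also have "\<dots> = lin (tensor quo quo) ?g (D X) \<otimes>\<^bsub>tensor quo quo\<^esub> lin (tensor quo quo) ?g (D r)"
    using D_closed[OF X] D_closed[OF rM]
    by (intro lin_mult[OF HH.T.complex_algebra_axioms _ _ DirProd_monoid[OF monoid_axioms monoid_axioms]])
      (auto simp: qproj_b_mult HH.ptens_mult qproj_b_closed)
  also have "lin (tensor quo quo) ?g (D r) = \<one>\<^bsub>tensor quo quo\<^esub>"
    using D_E[OF rM R_E[OF r]] qproj_b_closed[OF rM]
    by (simp add: HH.TV.lin_single qproj_R r HH.tensor_one)
  also have "lin (tensor quo quo) ?g (D X) \<otimes>\<^bsub>tensor quo quo\<^esub> \<one>\<^bsub>tensor quo quo\<^esub> = lin (tensor quo quo) ?g (D X)"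
    using D_keys[OF X] by (intro HH.T.r_one HH.TV.lin_closed) (auto intro!: HH.ptens_closed qproj_b_closed)
  finally show ?thesis using X by (simp add: tmap_comul_b)
qed

lemma qcomul_lift:
  "linear_map quo (tensor quo quo) qcomul"
  "x \<in> carrier MA \<Longrightarrow> qcomul (qproj x) = tensor_map quo quo qproj qproj (comul x)"
  unfolding qcomul_def[abs_def]
  by (rule lift_quo[OF tmap_comul_linear HH.T.vector_space tmap_comul_invariant]; assumption)+

lemma coun_invariant: "X \<in> carrier M \<Longrightarrow> r \<in> R \<Longrightarrow> coun (b (X \<otimes> r)) = coun (b X)"
  using R_subset R_E by (auto simp: coun_b E_mult)

lemma qcoun_lift:
  "linear_map quo complex_alg qcoun"
  "x \<in> carrier MA \<Longrightarrow> qcoun (qproj x) = coun x"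
  unfolding qcoun_def[abs_def]
  by (rule lift_quo[OF coun_linear complex_vector_space_complex_alg coun_invariant]; assumption)+

lemma qproj_span: "carrier quo = lin_span quo ((\<lambda>X. qproj (b X)) ` carrier M)"
proof -
  let ?S = "(\<lambda>X. qproj (b X)) ` carrier M"
  have S: "?S \<subseteq> carrier quo" using qproj_b_closed by auto
  have "carrier MA \<subseteq> {x \<in> carrier MA. qproj x \<in> lin_span quo ?S}"
  proof -
    have "lin_span MA (b ` carrier M) \<subseteq> {x \<in> carrier MA. qproj x \<in> lin_span quo ?S}"
      by (rule AV.span_minimal[OF subspace_preimage[OF qproj_linear A.vector_space H.vector_space
              HV.span_subspace[OF S]]])
        (auto intro!: HV.span_base)
    then show "carrier MA \<subseteq> {x \<in> carrier MA. qproj x \<in> lin_span quo ?S}"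
      by (simp only: monoid_algebra_span[OF monoid_axioms, symmetric])
  qed
  then have "carrier quo \<subseteq> lin_span quo ?S"
    by (auto simp: quo_def qproj_def elim!: Q.quot_carrierE simp del: monoid_algebra_simps)
  then show ?thesis using HV.span_closed[OF S] by blast
qed

lemma spanned_quo:
  assumes "\<And>x. x \<in> carrier quo \<Longrightarrow> \<Delta> x = qcomul x"
  shows "graded_spanned_bialgebra M quo (\<lambda>X. qproj (b X)) D E \<Delta> qcoun L"
proof (intro graded_spanned_bialgebra.intro spanned_bialgebra.intro spanned_bialgebra_axioms.intro
    graded_spanned_bialgebra_axioms.intro)
  have "linear_map quo (tensor quo quo) \<Delta> = linear_map quo (tensor quo quo) qcomul"
    by (rule linear_map_cong[OF H.vector_space]) (rule assms)
  then show "linear_map quo (tensor quo quo) \<Delta>" by (simp only: qcomul_lift(1))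
  show "\<Delta> (qproj (b X)) = lin (tensor quo quo) (\<lambda>(U, V). ptens quo quo (qproj (b U)) (qproj (b V))) (D X)"
    if "X \<in> carrier M" for X
    using qcomul_lift(2)[OF b_closed[OF that]] tmap_comul_b[OF that] assms[OF qproj_b_closed[OF that]]
    by simp
  show "qcoun (qproj (b X)) = (if E X then 1 else 0)" if "X \<in> carrier M" for X
    using qcoun_lift(2)[OF b_closed[OF that]] by (simp add: coun_b)
  show "qproj (b \<one>) = \<one>\<^bsub>quo\<^esub>" using qproj_one by simp
  show "\<exists>p. linear_map quo quo p \<and>
      (\<forall>X\<in>carrier M. p (qproj (b X)) = (if L X = n then qproj (b X) else \<zero>\<^bsub>quo\<^esub>))" for n
  proof -
    \<comment> \<open>The projection of formal sums to degree \<open>n\<close>, followed by the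
      quotient map. It passes to the quotient because an element of \<open>R\<close> has degree 0
      and becomes the unit, so multiplying by it changes neither the degree nor the coset.\<close>
    let ?f = "lin quo (\<lambda>X. if L X = n then qproj (b X) else \<zero>\<^bsub>quo\<^esub>)"
    have f: "linear_map MA quo ?f"
      by (rule linear_map_lin_monoid_algebra[OF monoid_axioms H.vector_space]) (auto simp: qproj_b_closed)
    have fb: "?f (b X) = (if L X = n then qproj (b X) else \<zero>\<^bsub>quo\<^esub>)" if "X \<in> carrier M" for X
      using that by (simp add: HV.lin_single qproj_b_closed)
    have "?f (b (X \<otimes> r)) = ?f (b X)" if X: "X \<in> carrier M" and r: "r \<in> R" for X r
    proof -
      have "r \<in> carrier M" using r R_subset by auto
      then show ?thesis
        using X r R_E[OF r] L_E[of r] qproj_R[OF r] qproj_b_closed[OF X]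
        by (simp add: fb L_mult qproj_b_mult del: monoid_algebra_simps)
    qed
    from lift_quo[OF f H.vector_space this] fb b_closed show ?thesis
      by (intro exI[of _ "\<lambda>X. the_elem (?f ` X)"]) (simp del: monoid_algebra_simps)
  qed
qed (simp_all add: D_mult D_E E_one D_coassoc D_counit_left D_counit_right E_mult
    D_closed monoid_axioms H.complex_algebra_axioms qproj_b_closed qproj_b_mult qproj_span[symmetric]
    qcoun_lift(1) L_one L_mult L_D L_E qproj_E)

theorem quo_connected_graded:
  assumes "\<And>x. x \<in> carrier quo \<Longrightarrow> \<Delta> x = qcomul x"
  shows "connected_graded_bialgebra quo \<Delta> qcoun qgr"
proof -
  interpret B: graded_spanned_bialgebra M quo "\<lambda>X. qproj (b X)" D E \<Delta> qcoun L
    by (rule spanned_quo[OF assms])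
  have "B.gr = qgr" by (rule ext) (simp add: B.gr_def qgr_def)
  then show ?thesis using B.connected_graded_bialgebra by simp
qed

lemma quo_algebra: "complex_algebra quo"
  by (rule H.complex_algebra_axioms)

lemma quo_subset: "X \<in> carrier quo \<Longrightarrow> X \<subseteq> carrier MA"
  unfolding quo_def by (elim Q.quot_carrierE) (auto simp: Q.mem_coset_iff simp del: monoid_algebra_simps)

end

section \<open>Connectivity of Feynman graphs\<close>

lemma adjI: "e \<in> hedges \<Gamma> \<Longrightarrow> (bdry \<Gamma> e, bdry \<Gamma> (sigma \<Gamma> e)) \<in> adj \<Gamma>"
  by (auto simp: adj_def)

lemma wfD:
  assumes "fgraph_wf \<Gamma>"
  shows "finite (verts \<Gamma>)" "finite (hedges \<Gamma>)"
    "e \<in> hedges \<Gamma> \<Longrightarrow> sigma \<Gamma> e \<in> hedges \<Gamma>"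
    "e \<in> hedges \<Gamma> \<Longrightarrow> sigma \<Gamma> (sigma \<Gamma> e) = e"
    "e \<in> hedges \<Gamma> \<Longrightarrow> bdry \<Gamma> e \<in> verts \<Gamma>"
  using assms by (auto simp: fgraph_wf_def)

lemma conn_sym:
  assumes "fgraph_wf \<Gamma>" "(u, v) \<in> (adj \<Gamma>)\<^sup>*"
  shows "(v, u) \<in> (adj \<Gamma>)\<^sup>*"
proof -
  have "sym (adj \<Gamma>)"
  proof (rule symI)
    fix a b assume "(a, b) \<in> adj \<Gamma>"
    then obtain e where "e \<in> hedges \<Gamma>" "a = bdry \<Gamma> e" "b = bdry \<Gamma> (sigma \<Gamma> e)"
      by (auto simp: adj_def)
    then show "(b, a) \<in> adj \<Gamma>"
      using adjI[of "sigma \<Gamma> e" \<Gamma>] wfD[OF assms(1)] by simp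
  qed
  then have "sym ((adj \<Gamma>)\<^sup>*)" by (rule sym_rtrancl)
  then show ?thesis using assms(2) by (rule symD)
qed

lemma mem_component_of: "w \<in> component_of \<Gamma> v \<longleftrightarrow> (v, w) \<in> (adj \<Gamma>)\<^sup>*"
  by (simp add: component_of_def)

lemma component_of_self [simp]: "v \<in> component_of \<Gamma> v"
  by (simp add: mem_component_of)

lemma component_of_eq_iff:
  assumes "fgraph_wf \<Gamma>"
  shows "component_of \<Gamma> u = component_of \<Gamma> v \<longleftrightarrow> v \<in> component_of \<Gamma> u"
  using conn_sym[OF assms] unfolding mem_component_of set_eq_iff
  by (meson rtrancl.rtrancl_refl rtrancl_trans)

lemma component_of_eqI:
  "fgraph_wf \<Gamma> \<Longrightarrow> v \<in> component_of \<Gamma> u \<Longrightarrow> component_of \<Gamma> v = component_of \<Gamma> u"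
  using component_of_eq_iff by metis

lemma component_of_image:
  assumes "fgraph_wf \<Gamma>"
  shows "component_of \<Gamma> ` component_of \<Gamma> v = {component_of \<Gamma> v}"
proof (intro equalityI subsetI)
  fix x assume "x \<in> component_of \<Gamma> ` component_of \<Gamma> v"
  then obtain u where "x = component_of \<Gamma> u" and u: "u \<in> component_of \<Gamma> v" by (rule imageE)
  then show "x \<in> {component_of \<Gamma> v}" by (simp only: component_of_eqI[OF assms u] singleton_iff)
next
  fix x assume "x \<in> {component_of \<Gamma> v}"
  then show "x \<in> component_of \<Gamma> ` component_of \<Gamma> v" by (intro image_eqI[of _ _ v]) simp_all
qed

text \<open>Any set closed under crossing edges traps all paths that start in it. Upper bounds for
  components are obtained in this way.\<close>

lemma component_of_least:
  assumes "v \<in> S" "\<And>e. e \<in> hedges \<Gamma> \<Longrightarrow> bdry \<Gamma> e \<in> S \<Longrightarrow> bdry \<Gamma> (sigma \<Gamma> e) \<in> S"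
  shows "component_of \<Gamma> v \<subseteq> S"
proof
  fix w assume "w \<in> component_of \<Gamma> v"
  then have "(v, w) \<in> (adj \<Gamma>)\<^sup>*" by (simp add: mem_component_of)
  then show "w \<in> S" by (induction rule: rtrancl_induct) (use assms in \<open>auto simp: adj_def\<close>)
qed

lemma component_of_subset: "fgraph_wf \<Gamma> \<Longrightarrow> v \<in> verts \<Gamma> \<Longrightarrow> component_of \<Gamma> v \<subseteq> verts \<Gamma>"
  by (rule component_of_least) (auto simp: wfD)

lemma components_eq: "components \<Gamma> = component_of \<Gamma> ` verts \<Gamma>"
  by (auto simp: components_def quotient_def component_of_def)

lemma bdry_sigma_component:
  assumes "fgraph_wf \<Gamma>" "e \<in> hedges \<Gamma>"
  shows "component_of \<Gamma> (bdry \<Gamma> (sigma \<Gamma> e)) = component_of \<Gamma> (bdry \<Gamma> e)"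
  using adjI[OF assms(2)] by (intro component_of_eqI[OF assms(1)]) (auto simp: mem_component_of)

lemma component_eq_component_of: "fgraph_wf \<Gamma> \<Longrightarrow> K \<in> components \<Gamma> \<Longrightarrow> v \<in> K \<Longrightarrow> K = component_of \<Gamma> v"
  by (auto simp: components_eq component_of_eqI)

lemma components_subset: "fgraph_wf \<Gamma> \<Longrightarrow> K \<in> components \<Gamma> \<Longrightarrow> K \<subseteq> verts \<Gamma>"
  by (auto simp: components_eq dest: component_of_subset)

lemma finite_components: "fgraph_wf \<Gamma> \<Longrightarrow> finite (components \<Gamma>)"
  by (simp add: components_eq wfD)

subsection \<open>Cutting a set of half-edges\<close>

text \<open>Cutting along half-edges instead of edges: successive cuts become unions, and a cut set
  keeps its meaning when the graph is cut further or contracted.\<close>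

definition hcut :: "('v, 'h, 'ty, 'm) fgraph_scheme \<Rightarrow> 'h set \<Rightarrow> ('v, 'h, 'ty, 'm) fgraph_scheme" where
  "hcut \<Gamma> X = \<Gamma>\<lparr>sigma := (\<lambda>e. if e \<in> X then e else sigma \<Gamma> e)\<rparr>"

definition sigma_closed :: "('v, 'h, 'ty, 'm) fgraph_scheme \<Rightarrow> 'h set \<Rightarrow> bool" where
  "sigma_closed \<Gamma> X \<longleftrightarrow> X \<subseteq> hedges \<Gamma> \<and> (\<forall>e\<in>X. sigma \<Gamma> e \<in> X)"

text \<open>Closure under \<open>sigma\<close> keeps the cut graph well formed. Excluding external
  half-edges, on which cutting has no effect, makes the cut set recoverable from the cut graph
  (\<open>hcut_inj\<close>).\<close>

definition cutset :: "('v, 'h, 'ty, 'm) fgraph_scheme \<Rightarrow> 'h set \<Rightarrow> bool" where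
  "cutset \<Gamma> X \<longleftrightarrow> sigma_closed \<Gamma> X \<and> (\<forall>e\<in>X. sigma \<Gamma> e \<noteq> e)"

lemma hcut_simps [simp]:
  "verts (hcut \<Gamma> X) = verts \<Gamma>" "hedges (hcut \<Gamma> X) = hedges \<Gamma>" "bdry (hcut \<Gamma> X) = bdry \<Gamma>"
  "htype (hcut \<Gamma> X) = htype \<Gamma>" "sigma (hcut \<Gamma> X) e = (if e \<in> X then e else sigma \<Gamma> e)"
  "vtype (hcut \<Gamma> X) = vtype \<Gamma>"
  by (simp_all add: hcut_def vtype_def fun_eq_iff)

lemma vlab_hcut [simp]: "vlab (hcut \<Gamma> X) = vlab \<Gamma>"
  by (simp add: hcut_def)

lemma hcut_hcut: "hcut (hcut \<Gamma> X) Y = hcut \<Gamma> (X \<union> Y)"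
  by (auto simp: hcut_def intro!: arg_cong[where f="\<lambda>s. \<Gamma>\<lparr>sigma := s\<rparr>"])

lemma cut_eq_hcut: "cut \<Gamma> C = hcut \<Gamma> (\<Union>C)"
  by (simp add: cut_def hcut_def)

lemma hcut_empty [simp]: "hcut \<Gamma> {} = \<Gamma>"
  by (simp add: hcut_def)

lemma wf_hcut: "fgraph_wf \<Gamma> \<Longrightarrow> sigma_closed \<Gamma> X \<Longrightarrow> fgraph_wf (hcut \<Gamma> X)"
  by (auto simp: fgraph_wf_def sigma_closed_def)

lemma sigma_notin: "fgraph_wf \<Gamma> \<Longrightarrow> sigma_closed \<Gamma> X \<Longrightarrow> e \<in> hedges \<Gamma> \<Longrightarrow> sigma \<Gamma> e \<in> X \<longleftrightarrow> e \<in> X"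
  unfolding sigma_closed_def using wfD(4) by metis

lemma sigma_closed_edge: "fgraph_wf \<Gamma> \<Longrightarrow> e \<in> hedges \<Gamma> \<Longrightarrow> sigma_closed \<Gamma> {e, sigma \<Gamma> e}"
  by (auto simp: sigma_closed_def wfD)

lemma conn_hcut: "(u, v) \<in> (adj (hcut \<Gamma> X))\<^sup>* \<Longrightarrow> (u, v) \<in> (adj \<Gamma>)\<^sup>*"
proof (induction rule: rtrancl_induct)
  case (step y z)
  then obtain e where e: "e \<in> hedges \<Gamma>" "y = bdry \<Gamma> e" "z = bdry \<Gamma> (if e \<in> X then e else sigma \<Gamma> e)"
    by (auto simp: adj_def)
  then have "y = z \<or> (y, z) \<in> adj \<Gamma>" using adjI[OF e(1)] by auto
  then show ?case using step.IH by auto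
qed simp

lemma component_hcut_subset: "component_of (hcut \<Gamma> X) v \<subseteq> component_of \<Gamma> v"
  using conn_hcut by (auto simp: mem_component_of)

text \<open>An edge by which the original graph could leave the component would have to be a cut
  one, and none of these ends in the component.\<close>

lemma component_hcut_uncut:
  assumes "fgraph_wf \<Gamma>" "sigma_closed \<Gamma> X"
    and "\<And>e. e \<in> X \<Longrightarrow> bdry \<Gamma> e \<notin> component_of (hcut \<Gamma> X) v"
  shows "component_of (hcut \<Gamma> X) v = component_of \<Gamma> v"
proof (rule antisym[OF component_hcut_subset component_of_least])
  fix e assume e: "e \<in> hedges \<Gamma>" "bdry \<Gamma> e \<in> component_of (hcut \<Gamma> X) v"
  then have "e \<notin> X" using assms(3) by auto
  then have "(bdry \<Gamma> e, bdry \<Gamma> (sigma \<Gamma> e)) \<in> adj (hcut \<Gamma> X)"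
    using adjI[of e "hcut \<Gamma> X"] e by simp
  then show "bdry \<Gamma> (sigma \<Gamma> e) \<in> component_of (hcut \<Gamma> X) v"
    using e(2) by (simp add: mem_component_of)
qed simp

text \<open>A set of internal edges is determined by the half-edges in it, and a
  \<open>cutset\<close> is the union of the pairs formed by its half-edges and their images under
  \<open>sigma\<close>.\<close>

lemma covering_subgraphs_eq:
  assumes "fgraph_wf \<Gamma>"
  shows "covering_subgraphs \<Gamma> = hcut \<Gamma> ` {X. cutset \<Gamma> X}"
proof (intro equalityI subsetI)
  fix \<gamma> assume "\<gamma> \<in> covering_subgraphs \<Gamma>"
  then obtain C where C: "C \<subseteq> internal \<Gamma>" "\<gamma> = hcut \<Gamma> (\<Union>C)"
    by (auto simp: covering_subgraphs_def cut_eq_hcut)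
  have "sigma \<Gamma> e \<in> \<Union>C \<and> sigma \<Gamma> e \<noteq> e \<and> e \<in> hedges \<Gamma>" if e: "e \<in> \<Union>C" for e
  proof -
    from e C(1) obtain f where f: "f \<in> hedges \<Gamma>" "sigma \<Gamma> f \<noteq> f" "{f, sigma \<Gamma> f} \<in> C"
      "e \<in> {f, sigma \<Gamma> f}" by (auto simp: internal_def)
    then have "sigma \<Gamma> e \<in> {f, sigma \<Gamma> f} \<and> sigma \<Gamma> e \<noteq> e \<and> e \<in> hedges \<Gamma>"
      using wfD(3,4)[OF assms f(1)] by auto
    then show ?thesis using f by blast
  qed
  then have "cutset \<Gamma> (\<Union>C)" by (auto simp: cutset_def sigma_closed_def)
  then show "\<gamma> \<in> hcut \<Gamma> ` {X. cutset \<Gamma> X}" using C by auto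
next
  fix \<gamma> assume "\<gamma> \<in> hcut \<Gamma> ` {X. cutset \<Gamma> X}"
  then obtain X where X: "cutset \<Gamma> X" "\<gamma> = hcut \<Gamma> X" by auto
  let ?C = "{{e, sigma \<Gamma> e} | e. e \<in> X}"
  have "?C \<subseteq> internal \<Gamma>" "\<Union>?C = X"
    using X by (auto simp: cutset_def sigma_closed_def internal_def)
  then show "\<gamma> \<in> covering_subgraphs \<Gamma>"
    using X(2) by (auto simp: covering_subgraphs_def cut_eq_hcut intro!: exI[of _ ?C])
qed

lemma hcut_inj:
  assumes "cutset \<Gamma> X" "cutset \<Gamma> Y" "hcut \<Gamma> X = hcut \<Gamma> Y"
  shows "X = Y"
proof -
  have "(if e \<in> X then e else sigma \<Gamma> e) = (if e \<in> Y then e else sigma \<Gamma> e)" for e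
    using assms(3) by (metis hcut_simps(5))
  then show ?thesis using assms(1,2) unfolding cutset_def by (metis subsetI subset_antisym)
qed

subsection \<open>Bridges\<close>

text \<open>Phrased by the separation of the two ends instead of by a count of components. In this
  form the notion depends only on the component of the edge, and it can be followed through
  embeddings and contractions.\<close>

definition bridge :: "('v, 'h, 'ty, 'm) fgraph_scheme \<Rightarrow> 'h \<Rightarrow> bool" where
  "bridge \<Gamma> e \<longleftrightarrow> sigma \<Gamma> e \<noteq> e \<and>
     bdry \<Gamma> (sigma \<Gamma> e) \<notin> component_of (hcut \<Gamma> {e, sigma \<Gamma> e}) (bdry \<Gamma> e)"

text \<open>If the two ends stay connected after the cut, every passage through the edge can be
  replaced by a detour.\<close>

lemma component_hcut_nonbridge:
  assumes wf: "fgraph_wf \<Gamma>" and e: "e \<in> hedges \<Gamma>"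
    and "bdry \<Gamma> (sigma \<Gamma> e) \<in> component_of (hcut \<Gamma> {e, sigma \<Gamma> e}) (bdry \<Gamma> e)"
  shows "component_of (hcut \<Gamma> {e, sigma \<Gamma> e}) v = component_of \<Gamma> v"
proof (rule antisym[OF component_hcut_subset component_of_least])
  let ?\<Gamma> = "hcut \<Gamma> {e, sigma \<Gamma> e}"
  have wf': "fgraph_wf ?\<Gamma>" by (rule wf_hcut[OF wf sigma_closed_edge[OF wf e]])
  fix f assume f: "f \<in> hedges \<Gamma>" "bdry \<Gamma> f \<in> component_of ?\<Gamma> v"
  have eq: "component_of ?\<Gamma> (bdry \<Gamma> (sigma \<Gamma> e)) = component_of ?\<Gamma> (bdry \<Gamma> e)"
    by (rule component_of_eqI[OF wf' assms(3)])
  have "component_of ?\<Gamma> (bdry \<Gamma> (sigma \<Gamma> f)) = component_of ?\<Gamma> (bdry \<Gamma> f)"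
  proof (cases "f \<in> {e, sigma \<Gamma> e}")
    case True
    then consider "f = e" | "f = sigma \<Gamma> e" by blast
    then show ?thesis
    proof cases
      case 1 show ?thesis unfolding 1 by (rule eq)
    next
      case 2 show ?thesis unfolding 2 wfD(4)[OF wf e] by (rule eq[symmetric])
    qed
  next
    case False
    then show ?thesis using bdry_sigma_component[OF wf', of f] f(1) by (simp split: if_splits)
  qed
  also have "\<dots> = component_of ?\<Gamma> v" by (rule component_of_eqI[OF wf' f(2)])
  finally show "bdry \<Gamma> (sigma \<Gamma> f) \<in> component_of ?\<Gamma> v"
    using component_of_self[of "bdry \<Gamma> (sigma \<Gamma> f)" ?\<Gamma>] by simp
qed simp

text \<open>A union of components, expressed by closure under crossing edges, a condition that
  survives further cutting.\<close>

definition saturated :: "('v, 'h, 'ty, 'm) fgraph_scheme \<Rightarrow> 'v set \<Rightarrow> bool" where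
  "saturated \<Gamma> K \<longleftrightarrow> K \<subseteq> verts \<Gamma> \<and>
     (\<forall>e\<in>hedges \<Gamma>. bdry \<Gamma> e \<in> K \<longrightarrow> bdry \<Gamma> (sigma \<Gamma> e) \<in> K)"

lemma component_graph_simps [simp]:
  "verts (component_graph \<Gamma> K) = K"
  "hedges (component_graph \<Gamma> K) = {e \<in> hedges \<Gamma>. bdry \<Gamma> e \<in> K}"
  "sigma (component_graph \<Gamma> K) = sigma \<Gamma>" "bdry (component_graph \<Gamma> K) = bdry \<Gamma>"
  "htype (component_graph \<Gamma> K) = htype \<Gamma>"
  by (simp_all add: component_graph_def)

lemma vlab_component_graph [simp]: "vlab (component_graph \<Gamma> K) = vlab \<Gamma>"
  by (simp add: component_graph_def)

lemma wf_component_graph: "fgraph_wf \<Gamma> \<Longrightarrow> saturated \<Gamma> K \<Longrightarrow> fgraph_wf (component_graph \<Gamma> K)"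
  by (auto simp: fgraph_wf_def saturated_def intro: finite_subset)

lemma saturated_component: "fgraph_wf \<Gamma> \<Longrightarrow> v \<in> verts \<Gamma> \<Longrightarrow> saturated \<Gamma> (component_of \<Gamma> v)"
  using component_of_subset[of \<Gamma> v] bdry_sigma_component[of \<Gamma>] component_of_eq_iff[of \<Gamma>]
  unfolding saturated_def by (metis component_of_self)

lemma component_of_component_graph:
  assumes "saturated \<Gamma> K" "v \<in> K"
  shows "component_of (component_graph \<Gamma> K) v = component_of \<Gamma> v"
proof
  show "component_of (component_graph \<Gamma> K) v \<subseteq> component_of \<Gamma> v"
  proof (rule component_of_least)
    fix e assume "e \<in> hedges (component_graph \<Gamma> K)"
      "bdry (component_graph \<Gamma> K) e \<in> component_of \<Gamma> v"
    then show "bdry (component_graph \<Gamma> K) (sigma (component_graph \<Gamma> K) e) \<in> component_of \<Gamma> v"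
      using adjI[of e \<Gamma>] by (auto simp: mem_component_of intro: rtrancl_into_rtrancl)
  qed simp
  have "component_of \<Gamma> v \<subseteq> component_of (component_graph \<Gamma> K) v \<inter> K"
  proof (rule component_of_least)
    fix e assume "e \<in> hedges \<Gamma>" "bdry \<Gamma> e \<in> component_of (component_graph \<Gamma> K) v \<inter> K"
    then show "bdry \<Gamma> (sigma \<Gamma> e) \<in> component_of (component_graph \<Gamma> K) v \<inter> K"
      using adjI[of e "component_graph \<Gamma> K"] assms(1)
      by (auto simp: mem_component_of saturated_def intro: rtrancl_into_rtrancl)
  qed (use assms in auto)
  then show "component_of \<Gamma> v \<subseteq> component_of (component_graph \<Gamma> K) v" by auto
qed

lemma components_component_graph:
  "saturated \<Gamma> K \<Longrightarrow> components (component_graph \<Gamma> K) = component_of \<Gamma> ` K"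
  by (auto simp: components_eq component_of_component_graph)

lemma components_component_graph_component:
  assumes "fgraph_wf \<Gamma>" "v \<in> verts \<Gamma>"
  shows "components (component_graph \<Gamma> (component_of \<Gamma> v)) = {component_of \<Gamma> v}"
  by (simp only: components_component_graph[OF saturated_component[OF assms]]
      component_of_image[OF assms(1)])

lemma hcut_component_graph: "hcut (component_graph \<Gamma> K) X = component_graph (hcut \<Gamma> X) K"
  unfolding hcut_def component_graph_simps by (simp add: component_graph_def)

text \<open>Cutting commutes with restricting to a component, and after an edge is cut its former
  component is still connected exactly when the two ends of the edge are.\<close>

lemma locally_one_PI_iff:
  assumes wf: "fgraph_wf \<Gamma>"
  shows "locally_one_PI \<Gamma> \<longleftrightarrow> (\<forall>e\<in>hedges \<Gamma>. \<not> bridge \<Gamma> e)"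
proof -
  \<comment> \<open>After a cut the old component may fall apart, but it remains a union of
    components, which suffices to describe the components of its restriction.\<close>
  have sat: "saturated (hcut \<Gamma> X) (component_of \<Gamma> v)" if "v \<in> verts \<Gamma>" for v X
    using saturated_component[OF wf that] by (auto simp: saturated_def)
  have 1: "connected_graph (cut (component_graph \<Gamma> (component_of \<Gamma> (bdry \<Gamma> e))) {{e, sigma \<Gamma> e}})
      \<longleftrightarrow> \<not> bridge \<Gamma> e" if e: "e \<in> hedges \<Gamma>" "sigma \<Gamma> e \<noteq> e" for e
  proof -
    let ?\<Gamma> = "hcut \<Gamma> {e, sigma \<Gamma> e}" and ?v = "bdry \<Gamma> e"
    have v: "?v \<in> verts \<Gamma>" using wfD(5)[OF wf e(1)] .
    have w: "bdry \<Gamma> (sigma \<Gamma> e) \<in> component_of \<Gamma> ?v"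
      using bdry_sigma_component[OF wf e(1)] component_of_self by metis
    have c: "components (cut (component_graph \<Gamma> (component_of \<Gamma> ?v)) {{e, sigma \<Gamma> e}}) =
        component_of ?\<Gamma> ` component_of \<Gamma> ?v"
      by (simp add: cut_eq_hcut hcut_component_graph components_component_graph[OF sat[OF v]])
    show ?thesis
    proof
      assume "connected_graph (cut (component_graph \<Gamma> (component_of \<Gamma> ?v)) {{e, sigma \<Gamma> e}})"
      then obtain K where K: "component_of ?\<Gamma> ` component_of \<Gamma> ?v = {K}"
        unfolding connected_graph_def c by (rule card_1_singletonE)
      have "component_of ?\<Gamma> ?v \<in> {K}" "component_of ?\<Gamma> (bdry \<Gamma> (sigma \<Gamma> e)) \<in> {K}"
        unfolding K[symmetric] using w by simp_all
      then have "bdry \<Gamma> (sigma \<Gamma> e) \<in> component_of ?\<Gamma> ?v"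
        using component_of_self[of "bdry \<Gamma> (sigma \<Gamma> e)" ?\<Gamma>] by simp
      then show "\<not> bridge \<Gamma> e" using component_of_self by (simp add: bridge_def)
    next
      assume "\<not> bridge \<Gamma> e"
      then have "component_of ?\<Gamma> u = component_of \<Gamma> u" for u
        using component_hcut_nonbridge[OF wf e(1)] e(2) by (auto simp: bridge_def)
      then have "component_of ?\<Gamma> ` component_of \<Gamma> ?v = {component_of \<Gamma> ?v}"
        using component_of_image[OF wf, of ?v] by simp
      then show "connected_graph (cut (component_graph \<Gamma> (component_of \<Gamma> ?v)) {{e, sigma \<Gamma> e}})"
        unfolding connected_graph_def c by simp
    qed
  qed
  have int: "internal (component_graph \<Gamma> K) =
      {{e, sigma \<Gamma> e} | e. e \<in> hedges \<Gamma> \<and> bdry \<Gamma> e \<in> K \<and> sigma \<Gamma> e \<noteq> e}" for K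
    by (auto simp: internal_def)
  have conn: "connected_graph (component_graph \<Gamma> K)" if "K \<in> components \<Gamma>" for K
    using that components_component_graph_component[OF wf] by (auto simp: connected_graph_def components_eq)
  show ?thesis
  proof
    assume l: "locally_one_PI \<Gamma>"
    show "\<forall>e\<in>hedges \<Gamma>. \<not> bridge \<Gamma> e"
    proof
      fix e assume e: "e \<in> hedges \<Gamma>"
      show "\<not> bridge \<Gamma> e"
      proof (cases "sigma \<Gamma> e = e")
        case False
        have "component_of \<Gamma> (bdry \<Gamma> e) \<in> components \<Gamma>" using wfD(5)[OF wf e] by (simp add: components_eq)
        then have "one_PI (component_graph \<Gamma> (component_of \<Gamma> (bdry \<Gamma> e)))"
          using l by (simp add: locally_one_PI_def)
        moreover have "{e, sigma \<Gamma> e} \<in> internal (component_graph \<Gamma> (component_of \<Gamma> (bdry \<Gamma> e)))"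
          unfolding int using e False by (intro CollectI exI[of _ e]) simp
        ultimately show ?thesis using 1[OF e False] unfolding one_PI_def by blast
      qed (simp add: bridge_def)
    qed
  next
    assume b: "\<forall>e\<in>hedges \<Gamma>. \<not> bridge \<Gamma> e"
    show "locally_one_PI \<Gamma>"
      unfolding locally_one_PI_def one_PI_def
    proof (intro ballI conjI conn)
      fix K a assume K: "K \<in> components \<Gamma>" and "a \<in> internal (component_graph \<Gamma> K)"
      then obtain e where e: "e \<in> hedges \<Gamma>" "bdry \<Gamma> e \<in> K" "sigma \<Gamma> e \<noteq> e" "a = {e, sigma \<Gamma> e}"
        unfolding int by auto
      have K': "K = component_of \<Gamma> (bdry \<Gamma> e)" by (rule component_eq_component_of[OF wf K e(2)])
      show "connected_graph (cut (component_graph \<Gamma> K) {a})"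
        unfolding e(4) K' using 1[OF e(1,3)] b e(1) by blast
    qed
  qed
qed

subsection \<open>A local description of specified graphs\<close>

text \<open>The type of the residue without forming it: the half-edges of the contracted vertex are
  the external half-edges of the component.\<close>

definition rtype :: "('v, 'h, 'ty, 'm) fgraph_scheme \<Rightarrow> 'v set \<Rightarrow> 'ty \<Rightarrow> nat" where
  "rtype \<Gamma> K = (\<lambda>t. card {e \<in> hedges \<Gamma>. bdry \<Gamma> e \<in> K \<and> sigma \<Gamma> e = e \<and> htype \<Gamma> e = t})"

text \<open>Stronger than being a component by itself, since self-loops are excluded too.\<close>

definition isolated :: "('v, 'h, 'ty, 'm) fgraph_scheme \<Rightarrow> 'v \<Rightarrow> bool" where
  "isolated \<Gamma> v \<longleftrightarrow> (\<forall>e\<in>hedges \<Gamma>. bdry \<Gamma> e = v \<longrightarrow> sigma \<Gamma> e = e)"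

lemma res_type_eq:
  assumes wf: "fgraph_wf \<Gamma>" and "K \<in> components \<Gamma>"
  shows "res_type \<Gamma> K = rtype \<Gamma> K"
proof -
  obtain v where v: "v \<in> verts \<Gamma>" "K = component_of \<Gamma> v" using assms by (auto simp: components_eq)
  have "component_of (component_graph \<Gamma> K) (bdry \<Gamma> e) = K" if "bdry \<Gamma> e \<in> K" for e
    using that component_of_component_graph[OF saturated_component[OF wf v(1)]] component_of_eqI[OF wf] v
    by simp
  then have "{e \<in> hedges (residue (component_graph \<Gamma> K)).
        bdry (residue (component_graph \<Gamma> K)) e = K \<and> htype (residue (component_graph \<Gamma> K)) e = t} =
      {e \<in> hedges \<Gamma>. bdry \<Gamma> e \<in> K \<and> sigma \<Gamma> e = e \<and> htype \<Gamma> e = t}" for t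
    by (auto simp: residue_def contract_def external_def)
  then show ?thesis by (simp add: res_type_def vtype_def rtype_def)
qed

lemma component_of_isolated: "isolated \<Gamma> v \<Longrightarrow> component_of \<Gamma> v = {v}"
  using component_of_least[of v "{v}" \<Gamma>] by (auto simp: isolated_def)

lemma isolated_iff:
  assumes wf: "fgraph_wf \<Gamma>"
  shows "{v} \<in> components \<Gamma> \<and> internal (component_graph \<Gamma> {v}) = {} \<longleftrightarrow> v \<in> verts \<Gamma> \<and> isolated \<Gamma> v"
proof
  assume "{v} \<in> components \<Gamma> \<and> internal (component_graph \<Gamma> {v}) = {}"
  then show "v \<in> verts \<Gamma> \<and> isolated \<Gamma> v"
    using components_subset[OF wf, of "{v}"] by (auto simp: isolated_def internal_def)
next
  assume "v \<in> verts \<Gamma> \<and> isolated \<Gamma> v"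
  then show "{v} \<in> components \<Gamma> \<and> internal (component_graph \<Gamma> {v}) = {}"
    using component_of_isolated[of \<Gamma> v] by (auto simp: components_eq isolated_def internal_def)
qed

text \<open>Conditions on half-edges are placed at their end vertex, and conditions on a component
  are repeated at each of its vertices. In this form they can be transported by embeddings that
  reach only part of a graph.\<close>

definition local_spec :: "'ty theory_data \<Rightarrow> ('v, 'h, 'ty) sgraph \<Rightarrow> 'v \<Rightarrow> bool" where
  "local_spec T G v \<longleftrightarrow>
     (\<forall>e\<in>hedges (fst G). bdry (fst G) e = v \<longrightarrow> htype (fst G) e \<in> edge_types T \<and>
        htype (fst G) (sigma (fst G) e) = htype (fst G) e \<and> \<not> bridge (fst G) e) \<and>
     (vtype (fst G) v, vlab (fst G) v) \<in> refined_types T \<and>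
     (rtype (fst G) (component_of (fst G) v), snd G (component_of (fst G) v)) \<in> refined_types T \<and>
     (isolated (fst G) v \<longrightarrow> snd G {v} = vlab (fst G) v)"

lemma refined_vertex_type:
  assumes "field_theory T" "(t, k) \<in> refined_types T"
  shows "t \<in> vertex_types T"
proof -
  have "fst (t, k) \<in> fst ` refined_types T" using assms(2) by (rule imageI)
  then show ?thesis using assms(1) by (simp add: field_theory_def)
qed

lemma specified_graph_iff:
  assumes T: "field_theory T"
  shows "specified_graph T G \<longleftrightarrow> fgraph_wf (fst G) \<and> (\<forall>v\<in>verts (fst G). local_spec T G v)"
proof -
  obtain \<Gamma> i where G: "G = (\<Gamma>, i)" by (cases G)
  note vt = refined_vertex_type[OF T]
  have all_e: "(\<forall>e\<in>hedges \<Gamma>. P e) \<longleftrightarrow> (\<forall>v\<in>verts \<Gamma>. \<forall>e\<in>hedges \<Gamma>. bdry \<Gamma> e = v \<longrightarrow> P e)"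
    if "fgraph_wf \<Gamma>" for P using wfD(5)[OF that] by auto
  show ?thesis
  proof (cases "fgraph_wf \<Gamma>")
    case True
    have rt: "(\<forall>K\<in>components \<Gamma>. (res_type \<Gamma> K, i K) \<in> refined_types T) \<longleftrightarrow>
        (\<forall>v\<in>verts \<Gamma>. (rtype \<Gamma> (component_of \<Gamma> v), i (component_of \<Gamma> v)) \<in> refined_types T)"
      using res_type_eq[OF True] by (auto simp: components_eq)
    have sd: "(\<forall>K\<in>components \<Gamma>. (res_type \<Gamma> K, i K) \<in> refined_types T) \<Longrightarrow> superficially_divergent T \<Gamma>"
      using vt by (auto simp: superficially_divergent_def)
    have "specified_graph T G \<longleftrightarrow>
        (\<forall>e\<in>hedges \<Gamma>. htype \<Gamma> e \<in> edge_types T) \<and> (\<forall>e\<in>hedges \<Gamma>. htype \<Gamma> (sigma \<Gamma> e) = htype \<Gamma> e) \<and>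
        (\<forall>e\<in>hedges \<Gamma>. \<not> bridge \<Gamma> e) \<and> (\<forall>v\<in>verts \<Gamma>. (vtype \<Gamma> v, vlab \<Gamma> v) \<in> refined_types T) \<and>
        (\<forall>K\<in>components \<Gamma>. (res_type \<Gamma> K, i K) \<in> refined_types T) \<and>
        (\<forall>v\<in>verts \<Gamma>. isolated \<Gamma> v \<longrightarrow> i {v} = vlab \<Gamma> v)"
      using True sd isolated_iff[OF True] unfolding specified_graph_def graph_of_theory_def G Pi_iff
      by (auto simp: locally_one_PI_iff[OF True])
    moreover have "(\<forall>v\<in>verts \<Gamma>. local_spec T G v) \<longleftrightarrow>
        (\<forall>v\<in>verts \<Gamma>. \<forall>e\<in>hedges \<Gamma>. bdry \<Gamma> e = v \<longrightarrow> htype \<Gamma> e \<in> edge_types T \<and>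
          htype \<Gamma> (sigma \<Gamma> e) = htype \<Gamma> e \<and> \<not> bridge \<Gamma> e) \<and>
        (\<forall>v\<in>verts \<Gamma>. (vtype \<Gamma> v, vlab \<Gamma> v) \<in> refined_types T) \<and>
        (\<forall>v\<in>verts \<Gamma>. (rtype \<Gamma> (component_of \<Gamma> v), i (component_of \<Gamma> v)) \<in> refined_types T) \<and>
        (\<forall>v\<in>verts \<Gamma>. isolated \<Gamma> v \<longrightarrow> i {v} = vlab \<Gamma> v)"
      by (simp add: local_spec_def G ball_conj_distrib)
    ultimately show ?thesis
      unfolding rt all_e[OF True, symmetric] using True G by auto
  qed (auto simp: G specified_graph_def graph_of_theory_def)
qed

section \<open>Embeddings onto unions of components\<close>

text \<open>The last conjunct says that every half-edge at an image vertex comes from the source. It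
  makes the image a union of components, so that types, components and bridges can be computed in
  the source.\<close>

definition emb :: "('v \<Rightarrow> 'w) \<Rightarrow> ('h \<Rightarrow> 'k) \<Rightarrow> ('v, 'h, 'ty) lgraph \<Rightarrow> ('w, 'k, 'ty) lgraph \<Rightarrow> bool" where
  "emb fv fh \<Gamma> \<Gamma>' \<longleftrightarrow>
     inj_on fv (verts \<Gamma>) \<and> fv ` verts \<Gamma> \<subseteq> verts \<Gamma>' \<and>
     inj_on fh (hedges \<Gamma>) \<and> fh ` hedges \<Gamma> \<subseteq> hedges \<Gamma>' \<and>
     (\<forall>e\<in>hedges \<Gamma>. sigma \<Gamma>' (fh e) = fh (sigma \<Gamma> e) \<and> bdry \<Gamma>' (fh e) = fv (bdry \<Gamma> e) \<and>
                   htype \<Gamma>' (fh e) = htype \<Gamma> e) \<and>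
     (\<forall>v\<in>verts \<Gamma>. vlab \<Gamma>' (fv v) = vlab \<Gamma> v) \<and>
     (\<forall>e'\<in>hedges \<Gamma>'. bdry \<Gamma>' e' \<in> fv ` verts \<Gamma> \<longrightarrow> e' \<in> fh ` hedges \<Gamma>)"

definition semb :: "('v \<Rightarrow> 'w) \<Rightarrow> ('h \<Rightarrow> 'k) \<Rightarrow> ('v, 'h, 'ty) sgraph \<Rightarrow> ('w, 'k, 'ty) sgraph \<Rightarrow> bool" where
  "semb fv fh G G' \<longleftrightarrow> emb fv fh (fst G) (fst G') \<and>
     (\<forall>v\<in>verts (fst G). snd G' (fv ` component_of (fst G) v) = snd G (component_of (fst G) v))"

lemma embD:
  assumes "emb fv fh \<Gamma> \<Gamma>'"
  shows "inj_on fv (verts \<Gamma>)" "v \<in> verts \<Gamma> \<Longrightarrow> fv v \<in> verts \<Gamma>'"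
    "inj_on fh (hedges \<Gamma>)" "e \<in> hedges \<Gamma> \<Longrightarrow> fh e \<in> hedges \<Gamma>'"
    "e \<in> hedges \<Gamma> \<Longrightarrow> sigma \<Gamma>' (fh e) = fh (sigma \<Gamma> e)"
    "e \<in> hedges \<Gamma> \<Longrightarrow> bdry \<Gamma>' (fh e) = fv (bdry \<Gamma> e)"
    "e \<in> hedges \<Gamma> \<Longrightarrow> htype \<Gamma>' (fh e) = htype \<Gamma> e"
    "v \<in> verts \<Gamma> \<Longrightarrow> vlab \<Gamma>' (fv v) = vlab \<Gamma> v"
    "e' \<in> hedges \<Gamma>' \<Longrightarrow> bdry \<Gamma>' e' \<in> fv ` verts \<Gamma> \<Longrightarrow> e' \<in> fh ` hedges \<Gamma>"
  using assms unfolding emb_def by blast+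

lemma emb_hcut:
  assumes "emb fv fh \<Gamma> \<Gamma>'" "\<And>e. e \<in> hedges \<Gamma> \<Longrightarrow> fh e \<in> X' \<longleftrightarrow> e \<in> X"
  shows "emb fv fh (hcut \<Gamma> X) (hcut \<Gamma>' X')"
  using assms unfolding emb_def by simp

context
  fixes fv :: "'v \<Rightarrow> 'w" and fh :: "'h \<Rightarrow> 'k" and \<Gamma> :: "('v, 'h, 'ty) lgraph" and \<Gamma>' :: "('w, 'k, 'ty) lgraph"
  assumes wf: "fgraph_wf \<Gamma>" and emb: "emb fv fh \<Gamma> \<Gamma>'"
begin

lemma emb_fh_eq: "e \<in> hedges \<Gamma> \<Longrightarrow> f \<in> hedges \<Gamma> \<Longrightarrow> fh e = fh f \<longleftrightarrow> e = f"
  using embD(3)[OF emb] by (simp add: inj_on_eq_iff)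

lemma emb_fv_mem: "u \<in> verts \<Gamma> \<Longrightarrow> S \<subseteq> verts \<Gamma> \<Longrightarrow> fv u \<in> fv ` S \<longleftrightarrow> u \<in> S"
  using embD(1)[OF emb] by (rule inj_on_image_mem_iff)

text \<open>Edges are carried to edges, so the image of a component stays connected; every half-edge
  at an image vertex has a preimage, so the component cannot grow beyond the image.\<close>

lemma emb_component:
  assumes v: "v \<in> verts \<Gamma>"
  shows "component_of \<Gamma>' (fv v) = fv ` component_of \<Gamma> v"
proof
  note sub = component_of_subset[OF wf v]
  show "component_of \<Gamma>' (fv v) \<subseteq> fv ` component_of \<Gamma> v"
  proof (rule component_of_least)
    fix e' assume e': "e' \<in> hedges \<Gamma>'" "bdry \<Gamma>' e' \<in> fv ` component_of \<Gamma> v"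
    then obtain e where e: "e \<in> hedges \<Gamma>" "e' = fh e" using embD(9)[OF emb e'(1)] sub by blast
    then have "bdry \<Gamma> e \<in> component_of \<Gamma> v"
      using e'(2) emb_fv_mem[OF wfD(5)[OF wf e(1)] sub] embD(6)[OF emb e(1)] by simp
    then have "bdry \<Gamma> (sigma \<Gamma> e) \<in> component_of \<Gamma> v"
      using saturated_component[OF wf v] e(1) by (simp add: saturated_def)
    then show "bdry \<Gamma>' (sigma \<Gamma>' e') \<in> fv ` component_of \<Gamma> v"
      using e wfD(3)[OF wf] by (simp add: embD(5,6)[OF emb])
  qed simp
  have "component_of \<Gamma> v \<subseteq> {u. fv u \<in> component_of \<Gamma>' (fv v)}"
  proof (rule component_of_least)
    fix e assume e: "e \<in> hedges \<Gamma>" "bdry \<Gamma> e \<in> {u. fv u \<in> component_of \<Gamma>' (fv v)}"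
    have "(fv (bdry \<Gamma> e), fv (bdry \<Gamma> (sigma \<Gamma> e))) \<in> adj \<Gamma>'"
      using adjI[OF embD(4)[OF emb e(1)]] e(1) wfD(3)[OF wf] by (simp add: embD(5,6)[OF emb])
    then show "bdry \<Gamma> (sigma \<Gamma> e) \<in> {u. fv u \<in> component_of \<Gamma>' (fv v)}"
      using e(2) by (simp add: mem_component_of)
  qed simp
  then show "fv ` component_of \<Gamma> v \<subseteq> component_of \<Gamma>' (fv v)" by auto
qed

lemma emb_hedges_at:
  assumes "S \<subseteq> verts \<Gamma>" "\<And>e. e \<in> hedges \<Gamma> \<Longrightarrow> P' (fh e) \<longleftrightarrow> P e"
  shows "{e' \<in> hedges \<Gamma>'. bdry \<Gamma>' e' \<in> fv ` S \<and> P' e'} = fh ` {e \<in> hedges \<Gamma>. bdry \<Gamma> e \<in> S \<and> P e}"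
proof (intro equalityI subsetI)
  fix e' assume e': "e' \<in> {e' \<in> hedges \<Gamma>'. bdry \<Gamma>' e' \<in> fv ` S \<and> P' e'}"
  then obtain e where e: "e \<in> hedges \<Gamma>" "e' = fh e" using embD(9)[OF emb, of e'] assms(1) by blast
  then show "e' \<in> fh ` {e \<in> hedges \<Gamma>. bdry \<Gamma> e \<in> S \<and> P e}"
    using e' assms(2)[OF e(1)] embD(6)[OF emb e(1)] emb_fv_mem[OF wfD(5)[OF wf e(1)] assms(1)] by auto
next
  fix e' assume "e' \<in> fh ` {e \<in> hedges \<Gamma>. bdry \<Gamma> e \<in> S \<and> P e}"
  then show "e' \<in> {e' \<in> hedges \<Gamma>'. bdry \<Gamma>' e' \<in> fv ` S \<and> P' e'}"
    using assms(2) embD(4,6)[OF emb] by auto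
qed

lemma emb_card_hedges_at:
  assumes "S \<subseteq> verts \<Gamma>" "\<And>e. e \<in> hedges \<Gamma> \<Longrightarrow> P' (fh e) \<longleftrightarrow> P e"
  shows "card {e' \<in> hedges \<Gamma>'. bdry \<Gamma>' e' \<in> fv ` S \<and> P' e'} = card {e \<in> hedges \<Gamma>. bdry \<Gamma> e \<in> S \<and> P e}"
proof -
  have "{e' \<in> hedges \<Gamma>'. bdry \<Gamma>' e' \<in> fv ` S \<and> P' e'} = fh ` {e \<in> hedges \<Gamma>. bdry \<Gamma> e \<in> S \<and> P e}"
    by (rule emb_hedges_at) (use assms in auto)
  moreover have "inj_on fh {e \<in> hedges \<Gamma>. bdry \<Gamma> e \<in> S \<and> P e}"
    by (rule inj_on_subset[OF embD(3)[OF emb]]) auto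
  ultimately show ?thesis by (simp add: card_image)
qed

lemma emb_rtype: "S \<subseteq> verts \<Gamma> \<Longrightarrow> rtype \<Gamma>' (fv ` S) = rtype \<Gamma> S"
  unfolding rtype_def
  by (rule ext, rule emb_card_hedges_at) (auto simp: embD(5,7)[OF emb] emb_fh_eq wfD(3)[OF wf])

lemma emb_vtype: "v \<in> verts \<Gamma> \<Longrightarrow> vtype \<Gamma>' (fv v) = vtype \<Gamma> v"
  using emb_card_hedges_at[of "{v}" "\<lambda>e. htype \<Gamma>' e = t" "\<lambda>e. htype \<Gamma> e = t" for t]
  by (auto simp: vtype_def embD(7)[OF emb] fun_eq_iff)

lemma emb_hedge_at:
  assumes "v \<in> verts \<Gamma>"
  shows "(\<forall>e'\<in>hedges \<Gamma>'. bdry \<Gamma>' e' = fv v \<longrightarrow> P e') \<longleftrightarrow> (\<forall>e\<in>hedges \<Gamma>. bdry \<Gamma> e = v \<longrightarrow> P (fh e))"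
proof -
  have "{e' \<in> hedges \<Gamma>'. bdry \<Gamma>' e' \<in> fv ` {v} \<and> True} = fh ` {e \<in> hedges \<Gamma>. bdry \<Gamma> e \<in> {v} \<and> True}"
    using assms by (intro emb_hedges_at) auto
  then have eq: "{e' \<in> hedges \<Gamma>'. bdry \<Gamma>' e' = fv v} = fh ` {e \<in> hedges \<Gamma>. bdry \<Gamma> e = v}" by simp
  have "(\<forall>e'\<in>{e' \<in> hedges \<Gamma>'. bdry \<Gamma>' e' = fv v}. P e') \<longleftrightarrow> (\<forall>e\<in>{e \<in> hedges \<Gamma>. bdry \<Gamma> e = v}. P (fh e))"
    unfolding eq by simp
  then show ?thesis by auto
qed

lemma emb_isolated: "v \<in> verts \<Gamma> \<Longrightarrow> isolated \<Gamma>' (fv v) \<longleftrightarrow> isolated \<Gamma> v"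
  unfolding isolated_def by (simp add: emb_hedge_at embD(5)[OF emb] emb_fh_eq wfD(3)[OF wf])

end

text \<open>The embedding remains one after an edge and its image are cut, and components correspond
  in the two cut graphs.\<close>

lemma emb_bridge:
  assumes wf: "fgraph_wf \<Gamma>" and emb: "emb fv fh \<Gamma> \<Gamma>'" and e: "e \<in> hedges \<Gamma>"
  shows "bridge \<Gamma>' (fh e) \<longleftrightarrow> bridge \<Gamma> e"
proof -
  let ?X = "{e, sigma \<Gamma> e}" and ?X' = "{fh e, sigma \<Gamma>' (fh e)}"
  have e2: "sigma \<Gamma> e \<in> hedges \<Gamma>" using wfD(3)[OF wf e] .
  have emb': "emb fv fh (hcut \<Gamma> ?X) (hcut \<Gamma>' ?X')"
    using e e2 by (intro emb_hcut[OF emb]) (auto simp: embD(5)[OF emb] emb_fh_eq[OF wf emb])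
  have wf': "fgraph_wf (hcut \<Gamma> ?X)" by (rule wf_hcut[OF wf sigma_closed_edge[OF wf e]])
  have v: "bdry \<Gamma> e \<in> verts (hcut \<Gamma> ?X)" using wfD(5)[OF wf e] by simp
  show ?thesis
    using emb_component[OF wf' emb' v] emb_fv_mem[OF wf' emb' _ component_of_subset[OF wf' v],
        of "bdry \<Gamma> (sigma \<Gamma> e)"] wfD(5)[OF wf e2]
    by (simp add: bridge_def embD(5,6)[OF emb] e e2 emb_fh_eq[OF wf emb])
qed

text \<open>All ingredients of \<open>local_spec\<close> at a vertex are determined by its
  component, which the embedding reproduces with all of its half-edges.\<close>

lemma semb_local_spec:
  assumes wf: "fgraph_wf (fst G)" and semb: "semb fv fh G G'" and v: "v \<in> verts (fst G)"
  shows "local_spec T G' (fv v) \<longleftrightarrow> local_spec T G v"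
proof -
  have emb: "emb fv fh (fst G) (fst G')" using semb by (simp add: semb_def)
  have c: "component_of (fst G') (fv v) = fv ` component_of (fst G) v"
    by (rule emb_component[OF wf emb v])
  have i: "snd G' {fv v} = snd G {v}" if "isolated (fst G) v"
    using semb v component_of_isolated[OF that] unfolding semb_def by (metis image_empty image_insert)
  have s: "snd G' (fv ` component_of (fst G) v) = snd G (component_of (fst G) v)"
    using semb v by (simp add: semb_def)
  show ?thesis
    unfolding local_spec_def emb_hedge_at[OF wf emb v] c emb_rtype[OF wf emb component_of_subset[OF wf v]]
      emb_vtype[OF wf emb v] emb_isolated[OF wf emb v] s embD(8)[OF emb v]
    using i by (auto simp: embD(5,7)[OF emb] emb_bridge[OF wf emb] wfD(3)[OF wf])
qed

section \<open>Specified covering subgraphs\<close>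

text \<open>The implication is the compatibility of specifications on full components: a component
  of the cut graph is a full component of the whole one exactly when no cut half-edge ends in
  it.\<close>

definition sub_ok :: "'ty theory_data \<Rightarrow> ('v, 'h, 'ty) sgraph \<Rightarrow> 'h set \<Rightarrow> ('v set \<Rightarrow> nat) \<Rightarrow> 'v \<Rightarrow> bool" where
  "sub_ok T G X j v \<longleftrightarrow> local_spec T (hcut (fst G) X, j) v \<and>
     ((\<forall>e\<in>X. bdry (fst G) e \<notin> component_of (hcut (fst G) X) v) \<longrightarrow>
        j (component_of (hcut (fst G) X) v) = snd G (component_of (hcut (fst G) X) v))"

definition subs :: "'ty theory_data \<Rightarrow> ('v, 'h, 'ty) sgraph \<Rightarrow> ('h set \<times> ('v set \<Rightarrow> nat)) set" where
  "subs T G = {(X, j). cutset (fst G) X \<and> j \<in> extensional (components (hcut (fst G) X)) \<and>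
     (\<forall>v\<in>verts (fst G). sub_ok T G X j v)}"

definition sub_graph :: "('v, 'h, 'ty) sgraph \<Rightarrow> 'h set \<times> ('v set \<Rightarrow> nat) \<Rightarrow> ('v, 'h, 'ty) sgraph" where
  "sub_graph G = (\<lambda>(X, j). (hcut (fst G) X, j))"

definition contracted :: "('v, 'h, 'ty) lgraph \<Rightarrow> 'h set \<Rightarrow> ('v set \<Rightarrow> nat) \<Rightarrow> ('v set, 'h, 'ty) lgraph" where
  "contracted \<Gamma> X j =
     \<lparr>verts = components (hcut \<Gamma> X), hedges = external (hcut \<Gamma> X), sigma = sigma \<Gamma>,
      bdry = (\<lambda>e. component_of (hcut \<Gamma> X) (bdry \<Gamma> e)), htype = htype \<Gamma>, vlab = j\<rparr>"

definition sub_quot :: "('v, 'h, 'ty) sgraph \<Rightarrow> 'h set \<times> ('v set \<Rightarrow> nat) \<Rightarrow> ('v set, 'h, 'ty) sgraph" where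
  "sub_quot G = (\<lambda>(X, j). (contracted (fst G) X j, \<lambda>C. snd G (\<Union>C)))"

lemma contract_spec_sub_graph: "contract_spec G (sub_graph G s) = sub_quot G s"
  by (cases s; cases G) (simp add: contract_spec_def sub_graph_def sub_quot_def contracted_def contract_def
      fgraph.extend_def lgraph.fields_def)

lemma contracted_simps [simp]:
  "verts (contracted \<Gamma> X j) = components (hcut \<Gamma> X)"
  "hedges (contracted \<Gamma> X j) = {e \<in> hedges \<Gamma>. e \<in> X \<or> sigma \<Gamma> e = e}"
  "sigma (contracted \<Gamma> X j) = sigma \<Gamma>"
  "bdry (contracted \<Gamma> X j) e = component_of (hcut \<Gamma> X) (bdry \<Gamma> e)"
  "htype (contracted \<Gamma> X j) = htype \<Gamma>" "vlab (contracted \<Gamma> X j) = j"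
  by (auto simp: contracted_def external_def)

text \<open>The half-edges in \<open>Z\<close> are among those cut in the graph whose components are
  contracted, so cutting them first leaves the contracted components unchanged.\<close>

lemma hcut_contracted: "Z \<subseteq> X \<Longrightarrow> hcut (contracted \<Gamma> X j) Z = contracted (hcut \<Gamma> Z) X j"
proof -
  assume Z: "Z \<subseteq> X"
  then have "hcut (hcut \<Gamma> Z) X = hcut \<Gamma> X" by (simp add: hcut_hcut Un_absorb1)
  with Z show ?thesis by (intro lgraph.equality) (auto simp: fun_eq_iff)
qed

lemma cutsetD: "cutset \<Gamma> X \<Longrightarrow> sigma_closed \<Gamma> X" "cutset \<Gamma> X \<Longrightarrow> e \<in> X \<Longrightarrow> sigma \<Gamma> e \<noteq> e"
  "cutset \<Gamma> X \<Longrightarrow> e \<in> X \<Longrightarrow> e \<in> hedges \<Gamma>" "cutset \<Gamma> X \<Longrightarrow> e \<in> X \<Longrightarrow> sigma \<Gamma> e \<in> X"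
  by (auto simp: cutset_def sigma_closed_def)

lemma sigma_closed_hcut: "sigma_closed \<Gamma> X \<Longrightarrow> sigma_closed (hcut \<Gamma> Z) X"
  by (auto simp: sigma_closed_def)

lemma subs_iff:
  assumes T: "field_theory T" and wf: "fgraph_wf (fst G)" and X: "cutset (fst G) X"
  shows "(X, j) \<in> subs T G \<longleftrightarrow> (hcut (fst G) X, j) \<in> specified_subgraphs T G"
proof -
  obtain \<Gamma> i where G: "G = (\<Gamma>, i)" by (cases G)
  let ?\<delta> = "hcut \<Gamma> X"
  have wf: "fgraph_wf \<Gamma>" and X: "cutset \<Gamma> X" using wf X G by auto
  note sc = cutsetD(1)[OF X]
  have wf': "fgraph_wf ?\<delta>" by (rule wf_hcut[OF wf sc])
  \<comment> \<open>A cut half-edge at \<open>K\<close> belongs to an edge that is internal in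
    \<open>\<Gamma>\<close> but not in the subgraph. If there is none, \<open>K\<close> cannot be
    larger in \<open>\<Gamma>\<close>.\<close>
  have full: "full_component \<Gamma> ?\<delta> K \<longleftrightarrow> K \<in> components ?\<delta> \<and> (\<forall>e\<in>X. bdry \<Gamma> e \<notin> K)" for K
  proof
    assume f: "full_component \<Gamma> ?\<delta> K"
    have "bdry \<Gamma> e \<notin> K" if e: "e \<in> X" for e
    proof
      assume "bdry \<Gamma> e \<in> K"
      then have "{e, sigma \<Gamma> e} \<in> internal (component_graph \<Gamma> K)"
        using cutsetD(2,3)[OF X e] by (auto simp: internal_def)
      then have "{e, sigma \<Gamma> e} \<in> internal (component_graph ?\<delta> K)" using f by (simp add: full_component_def)
      then obtain a where a: "{e, sigma \<Gamma> e} = {a, if a \<in> X then a else sigma \<Gamma> a}"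
        "(if a \<in> X then a else sigma \<Gamma> a) \<noteq> a" by (auto simp: internal_def)
      then have "a \<notin> X" "a \<in> {e, sigma \<Gamma> e}" by (auto split: if_splits)
      then show False using e cutsetD(4)[OF X e] by auto
    qed
    then show "K \<in> components ?\<delta> \<and> (\<forall>e\<in>X. bdry \<Gamma> e \<notin> K)" using f by (auto simp: full_component_def)
  next
    assume K: "K \<in> components ?\<delta> \<and> (\<forall>e\<in>X. bdry \<Gamma> e \<notin> K)"
    then obtain v where v: "v \<in> verts \<Gamma>" "K = component_of ?\<delta> v" by (auto simp: components_eq)
    have "K = component_of \<Gamma> v" unfolding v(2) using K v(2) by (intro component_hcut_uncut[OF wf sc]) auto
    then have "K \<in> components \<Gamma>" using v(1) by (simp add: components_eq)
    moreover have "internal (component_graph ?\<delta> K) = internal (component_graph \<Gamma> K)"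
      unfolding internal_def using K by (intro Collect_cong ex_cong1) auto
    ultimately show "full_component \<Gamma> ?\<delta> K" using K by (simp add: full_component_def)
  qed
  have "?\<delta> \<in> covering_subgraphs \<Gamma>" using X by (simp add: covering_subgraphs_eq[OF wf])
  then show ?thesis
    using X wf' unfolding subs_def specified_subgraphs_def specified_graph_iff[OF T] G full sub_ok_def
    by (auto simp: full components_eq)
qed

section \<open>Components, types and bridges of contracted graphs\<close>

context
  fixes \<Gamma> :: "('v, 'h, 'ty) lgraph" and X :: "'h set"
  assumes wf: "fgraph_wf \<Gamma>" and X: "sigma_closed \<Gamma> X"
begin

lemma wf_contracted: "fgraph_wf (contracted \<Gamma> X j)"
  using finite_components[OF wf_hcut[OF wf X]] wf X
  by (auto simp: fgraph_wf_def sigma_closed_def components_eq)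

text \<open>Crossing an uncut edge of \<open>\<Gamma>\<close> stays within one vertex of the
  contraction, and crossing a cut edge is crossing an edge of the contraction. Conversely each
  vertex of the contraction is connected in \<open>\<Gamma>\<close>.\<close>

lemma component_contracted:
  "component_of (contracted \<Gamma> X j) (component_of (hcut \<Gamma> X) v) = component_of (hcut \<Gamma> X) ` component_of \<Gamma> v"
proof
  let ?\<delta> = "hcut \<Gamma> X" and ?q = "contracted \<Gamma> X j"
  have wf': "fgraph_wf ?\<delta>" by (rule wf_hcut[OF wf X])
  show "component_of ?q (component_of ?\<delta> v) \<subseteq> component_of ?\<delta> ` component_of \<Gamma> v"
  proof (rule component_of_least)
    fix e assume e: "e \<in> hedges ?q" "bdry ?q e \<in> component_of ?\<delta> ` component_of \<Gamma> v"
    then obtain w where w: "w \<in> component_of \<Gamma> v" "component_of ?\<delta> (bdry \<Gamma> e) = component_of ?\<delta> w" by auto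
    have "bdry \<Gamma> e \<in> component_of ?\<delta> w" unfolding w(2)[symmetric] by simp
    then have "bdry \<Gamma> e \<in> component_of \<Gamma> w" by (rule subsetD[OF component_hcut_subset])
    then have "component_of \<Gamma> (bdry \<Gamma> e) = component_of \<Gamma> v"
      by (rule trans[OF component_of_eqI[OF wf] component_of_eqI[OF wf w(1)]])
    then have "component_of \<Gamma> (bdry \<Gamma> (sigma \<Gamma> e)) = component_of \<Gamma> v"
      using bdry_sigma_component[OF wf] e(1) by simp
    then have "bdry \<Gamma> (sigma \<Gamma> e) \<in> component_of \<Gamma> v"
      using component_of_self[of "bdry \<Gamma> (sigma \<Gamma> e)" \<Gamma>] by simp
    then show "bdry ?q (sigma ?q e) \<in> component_of ?\<delta> ` component_of \<Gamma> v" by simp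
  qed (rule imageI, simp)
  have "component_of \<Gamma> v \<subseteq> {w. component_of ?\<delta> w \<in> component_of ?q (component_of ?\<delta> v)}"
  proof (rule component_of_least)
    fix e assume e: "e \<in> hedges \<Gamma>" "bdry \<Gamma> e \<in> {w. component_of ?\<delta> w \<in> component_of ?q (component_of ?\<delta> v)}"
    show "bdry \<Gamma> (sigma \<Gamma> e) \<in> {w. component_of ?\<delta> w \<in> component_of ?q (component_of ?\<delta> v)}"
    proof (cases "e \<in> X")
      case True
      then have "(component_of ?\<delta> (bdry \<Gamma> e), component_of ?\<delta> (bdry \<Gamma> (sigma \<Gamma> e))) \<in> adj ?q"
        using adjI[of e ?q] e(1) by simp
      then show ?thesis using e(2) by (simp add: mem_component_of)
    next
      case False
      then show ?thesis using bdry_sigma_component[OF wf', of e] e by simp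
    qed
  qed simp
  then show "component_of ?\<delta> ` component_of \<Gamma> v \<subseteq> component_of ?q (component_of ?\<delta> v)" by auto
qed

lemma Union_component_contracted: "\<Union>(component_of (hcut \<Gamma> X) ` component_of \<Gamma> v) = component_of \<Gamma> v"
proof (intro equalityI subsetI)
  fix u assume "u \<in> \<Union>(component_of (hcut \<Gamma> X) ` component_of \<Gamma> v)"
  then obtain w where w: "w \<in> component_of \<Gamma> v" and u: "u \<in> component_of (hcut \<Gamma> X) w" by auto
  have "u \<in> component_of \<Gamma> w" using component_hcut_subset u by (rule subsetD)
  then show "u \<in> component_of \<Gamma> v" by (simp only: component_of_eqI[OF wf w])
next
  fix u assume "u \<in> component_of \<Gamma> v"
  then show "u \<in> \<Union>(component_of (hcut \<Gamma> X) ` component_of \<Gamma> v)" by (intro UN_I[of u]) simp_all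
qed

lemma component_hcut_mem:
  "component_of (hcut \<Gamma> X) u \<in> component_of (hcut \<Gamma> X) ` component_of \<Gamma> v \<longleftrightarrow> u \<in> component_of \<Gamma> v"
proof
  assume "component_of (hcut \<Gamma> X) u \<in> component_of (hcut \<Gamma> X) ` component_of \<Gamma> v"
  then have "u \<in> \<Union>(component_of (hcut \<Gamma> X) ` component_of \<Gamma> v)"
    using component_of_self[of u "hcut \<Gamma> X"] by blast
  then show "u \<in> component_of \<Gamma> v" by (simp only: Union_component_contracted)
qed simp

text \<open>The half-edges of the contraction are the external ones of the subgraph. Thus the
  condition on the specification of the subgraph is the condition on the refined vertex types of the
  contraction.\<close>

lemma vtype_contracted:
  assumes "K \<in> components (hcut \<Gamma> X)"
  shows "vtype (contracted \<Gamma> X j) K = rtype (hcut \<Gamma> X) K"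
proof -
  have wf': "fgraph_wf (hcut \<Gamma> X)" by (rule wf_hcut[OF wf X])
  have K: "component_of (hcut \<Gamma> X) u = K \<longleftrightarrow> u \<in> K" for u
    using component_eq_component_of[OF wf' assms] component_of_self[of u "hcut \<Gamma> X"] by metis
  show ?thesis unfolding vtype_def rtype_def
    by (intro ext arg_cong[where f=card]) (auto simp: K)
qed

lemma rtype_contracted:
  "rtype (contracted \<Gamma> X j) (component_of (hcut \<Gamma> X) ` component_of \<Gamma> v) = rtype \<Gamma> (component_of \<Gamma> v)"
  unfolding rtype_def by (intro ext arg_cong[where f=card]) (auto simp: component_hcut_mem)

end

text \<open>Cutting the edge commutes with the contraction, and the components of the cut graph
  correspond to those of its contraction, so the ends are separated in both or in neither.\<close>

lemma bridge_contracted: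
  assumes wf: "fgraph_wf \<Gamma>" and X: "sigma_closed \<Gamma> X" and e: "e \<in> X"
  shows "bridge (contracted \<Gamma> X j) e \<longleftrightarrow> bridge \<Gamma> e"
proof -
  let ?Z = "{e, sigma \<Gamma> e}"
  have eh: "e \<in> hedges \<Gamma>" "sigma \<Gamma> e \<in> X" using X e by (auto simp: sigma_closed_def)
  have Z: "?Z \<subseteq> X" using e eh by auto
  have wf': "fgraph_wf (hcut \<Gamma> ?Z)" by (rule wf_hcut[OF wf sigma_closed_edge[OF wf eh(1)]])
  have h: "hcut (hcut \<Gamma> ?Z) X = hcut \<Gamma> X" by (simp only: hcut_hcut Un_absorb1[OF Z])
  show ?thesis
    using component_contracted[OF wf' sigma_closed_hcut[OF X], of j "bdry \<Gamma> e"]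
      component_hcut_mem[OF wf' sigma_closed_hcut[OF X], of "bdry \<Gamma> (sigma \<Gamma> e)" "bdry \<Gamma> e"]
    by (simp add: bridge_def hcut_contracted[OF Z] h)
qed

lemma specified_sub_graph:
  assumes T: "field_theory T" and wf: "fgraph_wf (fst G)" and s: "s \<in> subs T G"
  shows "specified_graph T (sub_graph G s)"
  using s wf_hcut[OF wf cutsetD(1)]
  by (auto simp: subs_def specified_graph_iff[OF T] sub_graph_def sub_ok_def)

text \<open>Refined vertex types come from the specification of the subgraph by
  \<open>vtype_contracted\<close>. Residue types, components and bridges of the contraction are
  those of \<open>G\<close>, so the remaining conditions are inherited from
  \<open>G\<close>.\<close>

lemma specified_sub_quot:
  assumes T: "field_theory T" and G: "specified_graph T G" and s: "s \<in> subs T G"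
  shows "specified_graph T (sub_quot G s)"
proof -
  obtain \<Gamma> i X j where G': "G = (\<Gamma>, i)" and s': "s = (X, j)" by (cases G, cases s)
  have wf: "fgraph_wf \<Gamma>" and loc: "\<And>v. v \<in> verts \<Gamma> \<Longrightarrow> local_spec T (\<Gamma>, i) v"
    using G by (auto simp: specified_graph_iff[OF T] G')
  have X: "cutset \<Gamma> X" and ok: "\<And>v. v \<in> verts \<Gamma> \<Longrightarrow> sub_ok T (\<Gamma>, i) X j v"
    using s by (auto simp: subs_def G' s')
  note sc = cutsetD(1)[OF X]
  have wf': "fgraph_wf (hcut \<Gamma> X)" by (rule wf_hcut[OF wf sc])
  let ?q = "contracted \<Gamma> X j"
  have "local_spec T (?q, \<lambda>C. i (\<Union>C)) (component_of (hcut \<Gamma> X) v)" if v: "v \<in> verts \<Gamma>" for v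
  proof -
    let ?K = "component_of (hcut \<Gamma> X) v"
    have K: "?K \<in> components (hcut \<Gamma> X)" using v by (simp add: components_eq)
    have 1: "htype \<Gamma> e \<in> edge_types T" "htype \<Gamma> (sigma \<Gamma> e) = htype \<Gamma> e" "\<not> bridge ?q e"
      if e: "e \<in> hedges ?q" for e
    proof -
      have eh: "e \<in> hedges \<Gamma>" using e by simp
      have l: "local_spec T (\<Gamma>, i) (bdry \<Gamma> e)" using loc wfD(5)[OF wf eh] .
      then show "htype \<Gamma> e \<in> edge_types T" "htype \<Gamma> (sigma \<Gamma> e) = htype \<Gamma> e"
        using eh by (auto simp: local_spec_def)
      have "\<not> bridge \<Gamma> e" using eh l by (auto simp: local_spec_def)
      then show "\<not> bridge ?q e"
        using bridge_contracted[OF wf sc, of e j] e by (auto simp: bridge_def)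
    qed
    have 2: "(vtype ?q ?K, vlab ?q ?K) \<in> refined_types T"
      using ok[OF v] by (simp add: vtype_contracted[OF wf sc K] sub_ok_def local_spec_def)
    have 3: "(rtype ?q (component_of ?q ?K), i (\<Union>(component_of ?q ?K))) \<in> refined_types T"
      using loc[OF v] by (simp add: component_contracted[OF wf sc] Union_component_contracted[OF wf sc]
          rtype_contracted[OF wf sc] local_spec_def)
    \<comment> \<open>An isolated vertex of the contraction is a component that no cut half-edge
      touches, that is a full component of \<open>G\<close>, where the two specifications must
      agree.\<close>
    have 4: "i (\<Union>{?K}) = vlab ?q ?K" if iso: "isolated ?q ?K"
    proof -
      have "bdry \<Gamma> e \<notin> ?K" if e: "e \<in> X" for e
      proof
        assume "bdry \<Gamma> e \<in> ?K"
        then have "bdry ?q e = ?K" using component_of_eqI[OF wf'] by simp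
        then show False using iso e cutsetD(2,3)[OF X e] by (auto simp: isolated_def)
      qed
      then show ?thesis using ok[OF v] by (simp add: sub_ok_def)
    qed
    show ?thesis unfolding local_spec_def using 1 2 3 4 by simp
  qed
  then show ?thesis
    unfolding specified_graph_iff[OF T] using wf_contracted[OF wf sc]
    by (auto simp: G' s' sub_quot_def components_eq)
qed

lemma admissible_subgraphs_eq:
  assumes T: "field_theory T" and G: "specified_graph T G"
  shows "admissible_subgraphs T G = sub_graph G ` subs T G"
proof -
  have wf: "fgraph_wf (fst G)" using G by (simp add: specified_graph_iff[OF T])
  have "g \<in> specified_subgraphs T G \<longleftrightarrow> g \<in> sub_graph G ` subs T G" for g
  proof
    assume g: "g \<in> specified_subgraphs T G"
    then obtain X where "cutset (fst G) X" "fst g = hcut (fst G) X"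
      unfolding specified_subgraphs_def covering_subgraphs_eq[OF wf] by auto
    moreover from this have "g = sub_graph G (X, snd g)" by (simp add: sub_graph_def prod_eq_iff)
    moreover from calculation have "(X, snd g) \<in> subs T G"
      using subs_iff[OF T wf, of X "snd g"] g by (simp add: sub_graph_def)
    ultimately have "(X, snd g) \<in> subs T G" "g = sub_graph G (X, snd g)" by auto
    then show "g \<in> sub_graph G ` subs T G" by (rule rev_image_eqI)
  next
    assume "g \<in> sub_graph G ` subs T G"
    then obtain X j where "(X, j) \<in> subs T G" "g = (hcut (fst G) X, j)" by (auto simp: sub_graph_def)
    moreover from this have "cutset (fst G) X" by (simp add: subs_def)
    ultimately show "g \<in> specified_subgraphs T G" using subs_iff[OF T wf] by simp
  qed
  moreover have "graph_of_theory T (fst (contract_spec G (sub_graph G s)))" if "s \<in> subs T G" for s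
    using specified_sub_quot[OF T G that] unfolding contract_spec_sub_graph
    by (auto simp: specified_graph_def split: prod.splits)
  ultimately show ?thesis unfolding admissible_subgraphs_def by auto
qed

lemma inj_sub_graph: "inj_on (sub_graph G) (subs T G)"
  using hcut_inj by (fastforce simp: inj_on_def sub_graph_def subs_def)

text \<open>Cut sets are subsets of a finite set, and on each component the specification ranges
  over the refinements of the residue type, of which a field theory allows only finitely
  many.\<close>

lemma finite_subs:
  assumes T: "field_theory T" and wf: "fgraph_wf (fst G)"
  shows "finite (subs T G)"
proof -
  have fin: "finite {k. (t, k) \<in> refined_types T}" for t
  proof (cases "t \<in> vertex_types T")
    case True then show ?thesis using T by (simp add: field_theory_def)
  next
    case False
    then have "{k. (t, k) \<in> refined_types T} = {}" using refined_vertex_type[OF T] by blast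
    then show ?thesis by (simp only: finite.emptyI)
  qed
  have sub: "subs T G \<subseteq> (SIGMA X : {X. cutset (fst G) X}. PiE (components (hcut (fst G) X))
      (\<lambda>K. {k. (rtype (hcut (fst G) X) K, k) \<in> refined_types T}))"
    by (auto simp: subs_def PiE_def components_eq sub_ok_def local_spec_def)
  have 1: "finite {X. cutset (fst G) X}"
  proof (rule finite_subset)
    show "{X. cutset (fst G) X} \<subseteq> Pow (hedges (fst G))" by (auto simp: cutset_def sigma_closed_def)
    show "finite (Pow (hedges (fst G)))" using wfD(2)[OF wf] by simp
  qed
  have 2: "finite (PiE (components (hcut (fst G) X))
      (\<lambda>K. {k. (rtype (hcut (fst G) X) K, k) \<in> refined_types T}))" if "X \<in> {X. cutset (fst G) X}" for X
    using finite_components[OF wf_hcut[OF wf cutsetD(1)]] that fin by (intro finite_PiE) auto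
  show ?thesis by (rule finite_subset[OF sub finite_SigmaI[OF 1 2]])
qed

lemma semb_sub_graph:
  assumes wf: "fgraph_wf (fst G)" and emb: "emb fv fh (fst G) (fst G')"
    and X: "\<And>e. e \<in> hedges (fst G) \<Longrightarrow> fh e \<in> X' \<longleftrightarrow> e \<in> X"
    and j: "\<And>v. v \<in> verts (fst G) \<Longrightarrow>
      j' (fv ` component_of (hcut (fst G) X) v) = j (component_of (hcut (fst G) X) v)"
  shows "semb fv fh (sub_graph G (X, j)) (sub_graph G' (X', j'))"
  using emb_hcut[OF emb X] j by (simp add: semb_def sub_graph_def)

text \<open>The vertices of a contraction are sets of vertices, so the embedding acts on them by
  taking images.\<close>

lemma semb_sub_quot:
  assumes wf: "fgraph_wf (fst G)" and semb: "semb fv fh G G'"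
    and sc: "sigma_closed (fst G) X" and X: "\<And>e. e \<in> hedges (fst G) \<Longrightarrow> fh e \<in> X' \<longleftrightarrow> e \<in> X"
    and j: "\<And>v. v \<in> verts (fst G) \<Longrightarrow>
      j' (fv ` component_of (hcut (fst G) X) v) = j (component_of (hcut (fst G) X) v)"
  shows "semb (image fv) fh (sub_quot G (X, j)) (sub_quot G' (X', j'))"
proof -
  obtain \<Gamma> i \<Gamma>' i' where G: "G = (\<Gamma>, i)" "G' = (\<Gamma>', i')" by (cases G, cases G')
  have wf: "fgraph_wf \<Gamma>" and emb: "emb fv fh \<Gamma> \<Gamma>'" and sc: "sigma_closed \<Gamma> X"
    and i: "\<And>v. v \<in> verts \<Gamma> \<Longrightarrow> i' (fv ` component_of \<Gamma> v) = i (component_of \<Gamma> v)"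
    and X: "\<And>e. e \<in> hedges \<Gamma> \<Longrightarrow> fh e \<in> X' \<longleftrightarrow> e \<in> X"
    and j: "\<And>v. v \<in> verts \<Gamma> \<Longrightarrow> j' (fv ` component_of (hcut \<Gamma> X) v) = j (component_of (hcut \<Gamma> X) v)"
    using assms by (auto simp: semb_def G)
  let ?\<delta> = "hcut \<Gamma> X" and ?\<delta>' = "hcut \<Gamma>' X'"
  have wf': "fgraph_wf ?\<delta>" by (rule wf_hcut[OF wf sc])
  have emb': "emb fv fh ?\<delta> ?\<delta>'" by (rule emb_hcut[OF emb X])
  have c: "component_of ?\<delta>' (fv v) = fv ` component_of ?\<delta> v" if "v \<in> verts \<Gamma>" for v
    using emb_component[OF wf' emb'] that by simp
  have inj: "inj_on ((`) fv) (components ?\<delta>)"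
  proof (rule inj_onI)
    fix K L assume "K \<in> components ?\<delta>" "L \<in> components ?\<delta>" and eq: "fv ` K = fv ` L"
    then have "K \<subseteq> verts \<Gamma>" "L \<subseteq> verts \<Gamma>" using components_subset[OF wf'] by auto
    then show "K = L" using eq inj_on_image_eq_iff[OF embD(1)[OF emb]] by blast
  qed
  have "emb (image fv) fh (contracted \<Gamma> X j) (contracted \<Gamma>' X' j')"
    unfolding emb_def
  proof (intro conjI ballI impI)
    show "inj_on ((`) fv) (verts (contracted \<Gamma> X j))" using inj by simp
    show "(`) fv ` verts (contracted \<Gamma> X j) \<subseteq> verts (contracted \<Gamma>' X' j')"
      using embD(2)[OF emb] by (auto simp: components_eq simp flip: c)
    show "inj_on fh (hedges (contracted \<Gamma> X j))"
      by (rule inj_on_subset[OF embD(3)[OF emb]]) auto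
    show "fh ` hedges (contracted \<Gamma> X j) \<subseteq> hedges (contracted \<Gamma>' X' j')"
      using X embD(4,5)[OF emb] by auto
  next
    fix e assume "e \<in> hedges (contracted \<Gamma> X j)"
    then have e: "e \<in> hedges \<Gamma>" by simp
    show "sigma (contracted \<Gamma>' X' j') (fh e) = fh (sigma (contracted \<Gamma> X j) e)"
      "bdry (contracted \<Gamma>' X' j') (fh e) = fv ` bdry (contracted \<Gamma> X j) e"
      "htype (contracted \<Gamma>' X' j') (fh e) = htype (contracted \<Gamma> X j) e"
      using e wfD(5)[OF wf e] by (simp_all add: embD(5-7)[OF emb] c)
  next
    fix K assume "K \<in> verts (contracted \<Gamma> X j)"
    then show "vlab (contracted \<Gamma>' X' j') (fv ` K) = vlab (contracted \<Gamma> X j) K"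
      using j by (auto simp: components_eq)
  next
    fix e' assume e': "e' \<in> hedges (contracted \<Gamma>' X' j')"
      "bdry (contracted \<Gamma>' X' j') e' \<in> (`) fv ` verts (contracted \<Gamma> X j)"
    then obtain v where v: "v \<in> verts \<Gamma>" "component_of ?\<delta>' (bdry \<Gamma>' e') = fv ` component_of ?\<delta> v"
      by (auto simp: components_eq)
    have "bdry \<Gamma>' e' \<in> fv ` component_of ?\<delta> v" unfolding v(2)[symmetric] by simp
    then have "bdry \<Gamma>' e' \<in> fv ` verts \<Gamma>" using component_of_subset[OF wf', of v] v(1) by auto
    then obtain e where e: "e \<in> hedges \<Gamma>" "e' = fh e" using embD(9)[OF emb] e'(1) by auto
    then show "e' \<in> fh ` hedges (contracted \<Gamma> X j)"
      using e' X[OF e(1)] emb_fh_eq[OF wf emb wfD(3)[OF wf e(1)] e(1)] by (auto simp: embD(5)[OF emb])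
  qed
  moreover have "i' (\<Union>((`) fv ` component_of (contracted \<Gamma> X j) K)) = i (\<Union>(component_of (contracted \<Gamma> X j) K))"
    if "K \<in> components ?\<delta>" for K
  proof -
    obtain v where v: "v \<in> verts \<Gamma>" "K = component_of ?\<delta> v" using \<open>K \<in> _\<close> by (auto simp: components_eq)
    have "\<Union>((`) fv ` component_of (contracted \<Gamma> X j) K) = fv ` \<Union>(component_of (contracted \<Gamma> X j) K)" by blast
    then show ?thesis
      using i[OF v(1)] unfolding v(2) component_contracted[OF wf sc] by (simp add: Union_component_contracted[OF wf sc])
  qed
  ultimately show ?thesis by (simp add: semb_def sub_quot_def G)
qed

section \<open>Isomorphisms and disjoint unions\<close>

abbreviation wfg :: "('v, 'h, 'ty) sgraph \<Rightarrow> bool" where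
  "wfg G \<equiv> fgraph_wf (fst G)"

abbreviation vs :: "('v, 'h, 'ty) sgraph \<Rightarrow> 'v set" where
  "vs G \<equiv> verts (fst G)"

lemma semb_emb: "semb fv fh G G' \<Longrightarrow> emb fv fh (fst G) (fst G')"
  by (simp add: semb_def)

lemma semb_comp:
  assumes wf: "wfg G" "wfg G'" and f: "semb fv fh G G'" and g: "semb gv gh G' G''"
  shows "semb (gv \<circ> fv) (gh \<circ> fh) G G''"
proof -
  note ef = semb_emb[OF f] and eg = semb_emb[OF g]
  have "emb (gv \<circ> fv) (gh \<circ> fh) (fst G) (fst G'')"
    unfolding emb_def
  proof (intro conjI ballI impI)
    show "inj_on (gv \<circ> fv) (vs G)"
      using embD(1)[OF ef] embD(1)[OF eg] embD(2)[OF ef] by (intro comp_inj_on) (auto intro: inj_on_subset)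
    show "inj_on (gh \<circ> fh) (hedges (fst G))"
      using embD(3)[OF ef] embD(3)[OF eg] embD(4)[OF ef] by (intro comp_inj_on) (auto intro: inj_on_subset)
    show "(gv \<circ> fv) ` vs G \<subseteq> vs G''" using embD(2)[OF ef] embD(2)[OF eg] by auto
    show "(gh \<circ> fh) ` hedges (fst G) \<subseteq> hedges (fst G'')" using embD(4)[OF ef] embD(4)[OF eg] by auto
  next
    fix e'' assume e'': "e'' \<in> hedges (fst G'')" "bdry (fst G'') e'' \<in> (gv \<circ> fv) ` vs G"
    then have "bdry (fst G'') e'' \<in> gv ` vs G'" using embD(2)[OF ef] by auto
    then obtain e' where e': "e' \<in> hedges (fst G')" "e'' = gh e'" using embD(9)[OF eg e''(1)] by auto
    have "gv (bdry (fst G') e') \<in> gv ` (fv ` vs G)"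
      using e''(2) by (simp add: e' embD(6)[OF eg] image_comp)
    then have "bdry (fst G') e' \<in> fv ` vs G"
      using emb_fv_mem[OF wf(2) eg wfD(5)[OF wf(2) e'(1)]] embD(2)[OF ef] by blast
    then show "e'' \<in> (gh \<circ> fh) ` hedges (fst G)" using embD(9)[OF ef e'(1)] e'(2) by auto
  qed (simp_all add: embD(2,4-8)[OF ef] embD(5-8)[OF eg])
  moreover have "snd G'' ((gv \<circ> fv) ` component_of (fst G) v) = snd G (component_of (fst G) v)"
    if v: "v \<in> vs G" for v
  proof -
    have "snd G'' (gv ` component_of (fst G') (fv v)) = snd G' (component_of (fst G') (fv v))"
      using g embD(2)[OF ef v] by (simp add: semb_def)
    then show ?thesis using f v by (simp add: emb_component[OF wf(1) ef v] semb_def image_comp)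
  qed
  ultimately show ?thesis by (simp add: semb_def)
qed

text \<open>Surjectivity on vertices forces surjectivity on half-edges, because each half-edge at an
  image vertex has a preimage.\<close>

lemma semb_inverse:
  assumes wf: "wfg G" "wfg G'" and f: "semb fv fh G G'" and surj: "fv ` vs G = vs G'"
  shows "semb (inv_into (vs G) fv) (inv_into (hedges (fst G)) fh) G' G"
    and "inv_into (vs G) fv ` vs G' = vs G"
proof -
  note ef = semb_emb[OF f]
  let ?gv = "inv_into (vs G) fv" and ?gh = "inv_into (hedges (fst G)) fh"
  have hs: "fh ` hedges (fst G) = hedges (fst G')"
    using embD(9)[OF ef] wfD(5)[OF wf(2)] embD(4)[OF ef] unfolding surj by auto
  have gv: "?gv (fv v) = v" if "v \<in> vs G" for v using embD(1)[OF ef] that by simp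
  have gh: "?gh (fh e) = e" if "e \<in> hedges (fst G)" for e using embD(3)[OF ef] that by simp
  have he: "\<exists>e\<in>hedges (fst G). e' = fh e" if "e' \<in> hedges (fst G')" for e' using hs that by auto
  have ve: "\<exists>v\<in>vs G. v' = fv v" if "v' \<in> vs G'" for v' using surj that by auto
  show im: "?gv ` vs G' = vs G" unfolding surj[symmetric] using gv by (force simp: image_image)
  have imh: "?gh ` hedges (fst G') = hedges (fst G)" unfolding hs[symmetric] using gh by (force simp: image_image)
  have "emb ?gv ?gh (fst G') (fst G)"
    unfolding emb_def
  proof (intro conjI ballI impI)
    show "inj_on ?gv (vs G')" unfolding surj[symmetric] by (rule inj_on_inv_into) simp
    show "inj_on ?gh (hedges (fst G'))" unfolding hs[symmetric] by (rule inj_on_inv_into) simp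
    fix e' assume "e' \<in> hedges (fst G')"
    then obtain e where e: "e \<in> hedges (fst G)" "e' = fh e" using he by auto
    show "sigma (fst G) (?gh e') = ?gh (sigma (fst G') e')" "bdry (fst G) (?gh e') = ?gv (bdry (fst G') e')"
      "htype (fst G) (?gh e') = htype (fst G') e'"
      using e wfD(3,5)[OF wf(1) e(1)] by (simp_all add: embD(5-7)[OF ef] gv gh)
  next
    fix v' assume "v' \<in> vs G'"
    then obtain v where v: "v \<in> vs G" "v' = fv v" using ve by auto
    then show "vlab (fst G) (?gv v') = vlab (fst G') v'" by (simp add: gv embD(8)[OF ef])
  qed (use im imh in auto)
  moreover have "snd G (?gv ` component_of (fst G') v') = snd G' (component_of (fst G') v')"
    if "v' \<in> vs G'" for v'
  proof -
    obtain v where v: "v \<in> vs G" "v' = fv v" using ve \<open>v' \<in> _\<close> by auto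
    have "?gv ` fv ` component_of (fst G) v = component_of (fst G) v"
      using component_of_subset[OF wf(1) v(1)] gv by (force simp: image_image)
    then show ?thesis using f v by (simp add: emb_component[OF wf(1) ef v(1)] semb_def)
  qed
  ultimately show "semb ?gv ?gh G' G" by (simp add: semb_def)
qed

lemma sgraph_iso_iff:
  assumes "wfg G" "wfg G'"
  shows "sgraph_iso G G' \<longleftrightarrow> (\<exists>fv fh. semb fv fh G G' \<and> fv ` vs G = vs G')"
proof -
  obtain \<Gamma> i \<Gamma>' i' where G: "G = (\<Gamma>, i)" "G' = (\<Gamma>', i')" by (cases G, cases G')
  show ?thesis
  proof
    assume "sgraph_iso G G'"
    then obtain fv fh where "bij_betw fv (verts \<Gamma>) (verts \<Gamma>')" "bij_betw fh (hedges \<Gamma>) (hedges \<Gamma>')"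
       "\<forall>e\<in>hedges \<Gamma>. sigma \<Gamma>' (fh e) = fh (sigma \<Gamma> e) \<and> bdry \<Gamma>' (fh e) = fv (bdry \<Gamma> e) \<and>
                     htype \<Gamma>' (fh e) = htype \<Gamma> e"
       "\<forall>v\<in>verts \<Gamma>. vlab \<Gamma>' (fv v) = vlab \<Gamma> v" "\<forall>K\<in>components \<Gamma>. i' (fv ` K) = i K"
      unfolding sgraph_iso_def G by auto
    then show "\<exists>fv fh. semb fv fh G G' \<and> fv ` vs G = vs G'"
      unfolding semb_def emb_def G
      by (intro exI[of _ fv] exI[of _ fh]) (auto simp: bij_betw_def components_eq)
  next
    assume "\<exists>fv fh. semb fv fh G G' \<and> fv ` vs G = vs G'"
    then obtain fv fh where f: "semb fv fh G G'" "fv ` vs G = vs G'" by auto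
    note ef = semb_emb[OF f(1)]
    have hs: "fh ` hedges (fst G) = hedges (fst G')"
      using embD(9)[OF ef] wfD(5)[OF assms(2)] embD(4)[OF ef] unfolding f(2) by auto
    show "sgraph_iso G G'"
      using f(2) hs embD[OF ef] f(1) unfolding sgraph_iso_def G
      by (auto simp: bij_betw_def components_eq semb_def intro!: exI[of _ fv] exI[of _ fh])
  qed
qed

lemma sgraph_iso_wf:
  assumes "wfg G" "sgraph_iso G G'"
  shows "wfg G'"
proof -
  obtain \<Gamma> i \<Gamma>' i' where G: "G = (\<Gamma>, i)" "G' = (\<Gamma>', i')" by (cases G, cases G')
  obtain fv fh where f: "bij_betw fv (verts \<Gamma>) (verts \<Gamma>')" "bij_betw fh (hedges \<Gamma>) (hedges \<Gamma>')"
       "\<forall>e\<in>hedges \<Gamma>. sigma \<Gamma>' (fh e) = fh (sigma \<Gamma> e) \<and> bdry \<Gamma>' (fh e) = fv (bdry \<Gamma> e)"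
    using assms(2) unfolding sgraph_iso_def G by auto
  have "verts \<Gamma>' = fv ` verts \<Gamma>" "hedges \<Gamma>' = fh ` hedges \<Gamma>" using f by (auto simp: bij_betw_def)
  then show ?thesis using f(3) assms(1) by (auto simp: fgraph_wf_def G Pi_iff)
qed

lemma sgraph_iso_sym: "wfg G \<Longrightarrow> sgraph_iso G G' \<Longrightarrow> sgraph_iso G' G"
  using semb_inverse[of G G'] sgraph_iso_wf[of G G'] by (auto simp: sgraph_iso_iff) blast

lemma sgraph_iso_trans:
  assumes "wfg G" "sgraph_iso G G'" "sgraph_iso G' G''"
  shows "sgraph_iso G G''"
proof -
  note wf = assms(1) sgraph_iso_wf[OF assms(1,2)] sgraph_iso_wf[OF sgraph_iso_wf[OF assms(1,2)] assms(3)]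
  obtain fv fh gv gh where "semb fv fh G G'" "fv ` vs G = vs G'" "semb gv gh G' G''" "gv ` vs G' = vs G''"
    using assms wf by (auto simp: sgraph_iso_iff)
  moreover from this have "semb (gv \<circ> fv) (gh \<circ> fh) G G''" by (intro semb_comp[OF wf(1,2)])
  ultimately show ?thesis
    unfolding sgraph_iso_iff[OF wf(1,3)] by (intro exI[of _ "gv \<circ> fv"] exI[of _ "gh \<circ> fh"]) (simp only: image_comp[symmetric] simp_thms)
qed

lemma iso_class_eqI:
  assumes "wfg G" "sgraph_iso G H"
  shows "iso_class G = iso_class H"
  using sgraph_iso_trans[OF sgraph_iso_wf[OF assms] sgraph_iso_sym[OF assms]] sgraph_iso_trans[OF assms]
  by (auto simp: iso_class_def)

text \<open>A class consists of graphs on natural numbers only, whereas contractions live on sets of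
  vertices. The structure is therefore transported along injections of the finite vertex and
  half-edge sets into \<open>nat\<close>.\<close>

lemma iso_class_nonempty:
  fixes G :: "('v, 'h, 'ty) sgraph"
  assumes wf: "wfg G"
  obtains G' :: "(nat, nat, 'ty) sgraph" where "sgraph_iso G G'"
proof -
  obtain \<Gamma> i where G: "G = (\<Gamma>, i)" by (cases G)
  obtain fv :: "'v \<Rightarrow> nat" where fv: "inj_on fv (verts \<Gamma>)"
    using finite_imp_inj_to_nat_seg[OF wfD(1)[OF wf]] unfolding G by auto
  obtain fh :: "'h \<Rightarrow> nat" where fh: "inj_on fh (hedges \<Gamma>)"
    using finite_imp_inj_to_nat_seg[OF wfD(2)[OF wf]] unfolding G by auto
  define gv where "gv = inv_into (verts \<Gamma>) fv"
  define gh where "gh = inv_into (hedges \<Gamma>) fh"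
  have gv: "gv (fv v) = v" if "v \<in> verts \<Gamma>" for v using fv that by (simp add: gv_def)
  have gh: "gh (fh e) = e" if "e \<in> hedges \<Gamma>" for e using fh that by (simp add: gh_def)
  let ?G = "(\<lparr>verts = fv ` verts \<Gamma>, hedges = fh ` hedges \<Gamma>, sigma = \<lambda>e. fh (sigma \<Gamma> (gh e)),
    bdry = \<lambda>e. fv (bdry \<Gamma> (gh e)), htype = \<lambda>e. htype \<Gamma> (gh e), vlab = \<lambda>v. vlab \<Gamma> (gv v)\<rparr>, \<lambda>K. i (gv ` K))"
  have "gv ` fv ` K = K" if "K \<in> components \<Gamma>" for K
    using components_subset[of \<Gamma> K] wf that gv unfolding G by (force simp: image_image)
  then have "sgraph_iso G ?G"
    unfolding sgraph_iso_def G using fv fh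
    by (auto simp: gv gh bij_betw_def intro!: exI[of _ fv] exI[of _ fh])
  then show ?thesis using that by blast
qed

text \<open>A graph covered by the images of two embeddings is the disjoint union of the two; an
  isomorphism is the special case in which one of the two is the empty graph.\<close>

definition cover where
  "cover f1v f1h G1 f2v f2h G2 G \<longleftrightarrow> semb f1v f1h G1 G \<and> semb f2v f2h G2 G \<and>
     f1v ` vs G1 \<inter> f2v ` vs G2 = {} \<and> f1v ` vs G1 \<union> f2v ` vs G2 = vs G"

lemma disj_union_simps:
  "verts (fst (disj_union G G')) = vs G <+> vs G'"
  "hedges (fst (disj_union G G')) = hedges (fst G) <+> hedges (fst G')"
  "sigma (fst (disj_union G G')) = map_sum (sigma (fst G)) (sigma (fst G'))"
  "bdry (fst (disj_union G G')) = map_sum (bdry (fst G)) (bdry (fst G'))"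
  "htype (fst (disj_union G G')) = case_sum (htype (fst G)) (htype (fst G'))"
  "vlab (fst (disj_union G G')) = case_sum (vlab (fst G)) (vlab (fst G'))"
  "snd (disj_union G G') = (\<lambda>K. if K \<subseteq> range Inl then snd G (Inl -` K) else snd G' (Inr -` K))"
  by (simp_all add: disj_union_def case_prod_unfold cong: if_cong)

lemma wf_disj_union: "wfg G \<Longrightarrow> wfg G' \<Longrightarrow> wfg (disj_union G G')"
  by (auto simp: fgraph_wf_def disj_union_simps)

lemma cover_disj_union:
  shows "cover Inl Inl G Inr Inr G' (disj_union G G')"
proof -
  \<comment> \<open>The specification of \<open>disj_union\<close> tests whether a set lies in
    \<open>range Inl\<close>. Components are nonempty, so those of the right summand fail the
    test.\<close>
  have "\<not> Inr ` component_of (fst G') v \<subseteq> range Inl" for v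
    using component_of_self[of v "fst G'"] by blast
  then show ?thesis
    by (auto simp: cover_def semb_def emb_def disj_union_simps inj_vimage_image_eq Plus_def)
qed

lemma inj_on_case_sum:
  assumes "inj_on f A" "inj_on g B" "f ` A \<inter> g ` B = {}"
  shows "inj_on (case_sum f g) (A <+> B)"
proof -
  have "f a \<noteq> g b" if "a \<in> A" "b \<in> B" for a b
  proof
    assume "f a = g b"
    then have "f a \<in> f ` A \<inter> g ` B" using that by (metis IntI imageI)
    then show False using assms(3) by simp
  qed
  then show ?thesis
    using inj_onD[OF assms(1)] inj_onD[OF assms(2)]
    by (intro inj_onI) (elim PlusE; simp; metis)
qed

lemma semb_glue:
  assumes wf: "wfg G1" "wfg G2" "wfg G"
    and f1: "semb f1v f1h G1 G" and f2: "semb f2v f2h G2 G" and dis: "f1v ` vs G1 \<inter> f2v ` vs G2 = {}"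
  shows "semb (case_sum f1v f2v) (case_sum f1h f2h) (disj_union G1 G2) G"
proof -
  note e1 = semb_emb[OF f1] and e2 = semb_emb[OF f2]
  let ?U = "disj_union G1 G2" and ?fv = "case_sum f1v f2v" and ?fh = "case_sum f1h f2h"
  have ne: "f1v u \<noteq> f2v w" "f2v w \<noteq> f1v u" if "u \<in> vs G1" "w \<in> vs G2" for u w using dis that by (metis IntI imageI empty_iff)+
  have neh: "f1h e \<noteq> f2h f" "f2h f \<noteq> f1h e" if "e \<in> hedges (fst G1)" "f \<in> hedges (fst G2)" for e f
    using ne[OF wfD(5)[OF wf(1) that(1)] wfD(5)[OF wf(2) that(2)]] embD(6)[OF e1 that(1)] embD(6)[OF e2 that(2)] by metis+
  have "emb ?fv ?fh (fst ?U) (fst G)"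
    unfolding emb_def disj_union_simps
  proof (intro conjI ballI impI)
    show "inj_on ?fv (vs G1 <+> vs G2)"
      by (rule inj_on_case_sum[OF embD(1)[OF e1] embD(1)[OF e2] dis])
    show "inj_on ?fh (hedges (fst G1) <+> hedges (fst G2))"
      by (rule inj_on_case_sum[OF embD(3)[OF e1] embD(3)[OF e2]]) (use neh in auto)
    show "?fv ` (vs G1 <+> vs G2) \<subseteq> vs G" using embD(2)[OF e1] embD(2)[OF e2] by auto
    show "?fh ` (hedges (fst G1) <+> hedges (fst G2)) \<subseteq> hedges (fst G)" using embD(4)[OF e1] embD(4)[OF e2] by auto
  next
    fix e' assume e': "e' \<in> hedges (fst G)" "bdry (fst G) e' \<in> ?fv ` (vs G1 <+> vs G2)"
    then have "e' \<in> f1h ` hedges (fst G1) \<or> e' \<in> f2h ` hedges (fst G2)"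
      using embD(9)[OF e1 e'(1)] embD(9)[OF e2 e'(1)] by auto
    then show "e' \<in> ?fh ` (hedges (fst G1) <+> hedges (fst G2))" by (force simp: Plus_def)
  qed (auto simp: embD(5-8)[OF e1] embD(5-8)[OF e2])
  moreover have "snd G (?fv ` component_of (fst ?U) v) = snd ?U (component_of (fst ?U) v)" if v: "v \<in> vs ?U" for v
  proof (cases v)
    case (Inl u)
    then have u: "u \<in> vs G1" using v by (auto simp: disj_union_simps)
    have s: "semb Inl Inl G1 ?U" using cover_disj_union[of G1 G2] by (simp add: cover_def)
    have "component_of (fst ?U) v = Inl ` component_of (fst G1) u"
      using emb_component[OF wf(1) semb_emb[OF s] u] Inl by simp
    then show ?thesis using s f1 u by (simp add: semb_def image_image)
  next
    case (Inr u)
    then have u: "u \<in> vs G2" using v by (auto simp: disj_union_simps)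
    have s: "semb Inr Inr G2 ?U" using cover_disj_union[of G1 G2] by (simp add: cover_def)
    have "component_of (fst ?U) v = Inr ` component_of (fst G2) u"
      using emb_component[OF wf(2) semb_emb[OF s] u] Inr by simp
    then show ?thesis using s f2 u by (simp add: semb_def image_image)
  qed
  ultimately show ?thesis by (simp add: semb_def)
qed

lemma cover_iso:
  assumes wf: "wfg G1" "wfg G2" "wfg G" and c: "cover f1v f1h G1 f2v f2h G2 G"
  shows "sgraph_iso (disj_union G1 G2) G"
proof -
  have "semb (case_sum f1v f2v) (case_sum f1h f2h) (disj_union G1 G2) G"
    using c by (intro semb_glue[OF wf]) (auto simp: cover_def)
  moreover have "case_sum f1v f2v ` vs (disj_union G1 G2) = vs G"
    using c by (simp add: cover_def disj_union_simps Plus_def image_Un image_image)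
  ultimately show ?thesis unfolding sgraph_iso_iff[OF wf_disj_union[OF wf(1,2)] wf(3)] by blast
qed

lemma cover_compose:
  assumes wf: "wfg H1" "wfg H2" "wfg G1" "wfg G2" "wfg G" and c: "cover f1v f1h G1 f2v f2h G2 G"
    and g1: "semb g1v g1h H1 G1" "g1v ` vs H1 = vs G1" and g2: "semb g2v g2h H2 G2" "g2v ` vs H2 = vs G2"
  shows "cover (f1v \<circ> g1v) (f1h \<circ> g1h) H1 (f2v \<circ> g2v) (f2h \<circ> g2h) H2 G"
proof -
  have s: "semb f1v f1h G1 G" "semb f2v f2h G2 G" "f1v ` vs G1 \<inter> f2v ` vs G2 = {}"
    "f1v ` vs G1 \<union> f2v ` vs G2 = vs G" using c by (simp_all add: cover_def)
  show ?thesis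
    unfolding cover_def image_comp[symmetric] g1(2) g2(2)
    by (intro conjI s(3,4) semb_comp[OF wf(1,3) g1(1) s(1)] semb_comp[OF wf(2,4) g2(1) s(2)])
qed

lemma cover_swap: "cover f1v f1h G1 f2v f2h G2 G \<Longrightarrow> cover f2v f2h G2 f1v f1h G1 G"
  by (auto simp: cover_def)

text \<open>Being specified is a condition at each vertex, and each vertex lies in one of the two
  images.\<close>

lemma cover_specified:
  assumes T: "field_theory T" and wf: "wfg G1" "wfg G2" "wfg G" and c: "cover f1v f1h G1 f2v f2h G2 G"
  shows "specified_graph T G \<longleftrightarrow> specified_graph T G1 \<and> specified_graph T G2"
proof -
  have s: "semb f1v f1h G1 G" "semb f2v f2h G2 G" "vs G = f1v ` vs G1 \<union> f2v ` vs G2"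
    using c by (auto simp: cover_def)
  show ?thesis
    using wf by (simp add: specified_graph_iff[OF T] s(3) ball_Un semb_local_spec[OF wf(1) s(1)]
        semb_local_spec[OF wf(2) s(2)])
qed

lemma fst_empty_sgraph [simp]: "verts (fst empty_sgraph) = {}" "hedges (fst empty_sgraph) = {}"
  by (simp_all add: empty_sgraph_def)

lemma wf_empty_sgraph [simp]: "fgraph_wf (fst empty_sgraph)"
  by (simp add: fgraph_wf_def)

lemma cover_empty:
  assumes "semb fv fh G G'" "fv ` vs G = vs G'"
  shows "cover fv fh G undefined undefined empty_sgraph G'"
  using assms by (simp add: cover_def semb_def emb_def)

lemma specified_empty: "field_theory T \<Longrightarrow> specified_graph T empty_sgraph"
  by (simp add: specified_graph_iff)

lemma specified_iso:
  assumes T: "field_theory T" and G: "specified_graph T G" and iso: "sgraph_iso G G'"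
  shows "specified_graph T G'"
proof -
  have wf: "wfg G" "wfg G'" using G sgraph_iso_wf[OF _ iso] by (auto simp: specified_graph_iff[OF T])
  then obtain fv fh where "semb fv fh G G'" "fv ` vs G = vs G'" using iso sgraph_iso_iff by blast
  then show ?thesis
    using cover_specified[OF T wf(1) wf_empty_sgraph wf(2) cover_empty] G specified_empty[OF T] by blast
qed

section \<open>The monoid of specified graphs\<close>

lemma sgraph_monoid_simps [simp]:
  "carrier (sgraph_monoid T) = {iso_class G | G :: (nat, nat, 'ty) sgraph. specified_graph T G}"
  "\<one>\<^bsub>sgraph_monoid T\<^esub> = iso_class empty_sgraph"
  for T :: "'ty theory_data"
  by (simp_all add: sgraph_monoid_def)

text \<open>The product of classes is a union over pairs of representatives. All of them contribute
  the same class, since a cover composed with isomorphisms is a cover of the same graph. Stating the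
  result for arbitrary covers avoids explicit isomorphisms between sums of types.\<close>

lemma class_mult:
  assumes wf: "wfg G1" "wfg G2" "wfg G" and c: "cover f1v f1h G1 f2v f2h G2 G"
  shows "iso_class G1 \<otimes>\<^bsub>sgraph_monoid T\<^esub> iso_class G2 = iso_class G"
proof -
  have u: "sgraph_iso (disj_union G1 G2) G" by (rule cover_iso[OF wf c])
  have "iso_class (disj_union H1 H2) = iso_class G"
    if "H1 \<in> iso_class G1" "H2 \<in> iso_class G2" for H1 H2
  proof -
    have i: "sgraph_iso G1 H1" "sgraph_iso G2 H2" using that by (auto simp: iso_class_def)
    note wh = sgraph_iso_wf[OF wf(1) i(1)] sgraph_iso_wf[OF wf(2) i(2)]
    obtain g1v g1h where g1: "semb g1v g1h G1 H1" "g1v ` vs G1 = vs H1"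
      using i(1) unfolding sgraph_iso_iff[OF wf(1) wh(1)] by blast
    obtain g2v g2h where g2: "semb g2v g2h G2 H2" "g2v ` vs G2 = vs H2"
      using i(2) unfolding sgraph_iso_iff[OF wf(2) wh(2)] by blast
    note wu = wf_disj_union[OF wh]
    have "sgraph_iso (disj_union G1 G2) (disj_union H1 H2)"
      by (rule cover_iso[OF wf(1,2) wu cover_compose[OF wf(1,2) wh wu cover_disj_union g1 g2]])
    then have "iso_class (disj_union G1 G2) = iso_class (disj_union H1 H2)"
      by (rule iso_class_eqI[OF wf_disj_union[OF wf(1,2)]])
    then show ?thesis using iso_class_eqI[OF wf_disj_union[OF wf(1,2)] u] by simp
  qed
  moreover obtain H1 H2 where "H1 \<in> iso_class G1" "H2 \<in> iso_class G2"
    using iso_class_nonempty[OF wf(1)] iso_class_nonempty[OF wf(2)] by (metis iso_class_def mem_Collect_eq)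
  ultimately show ?thesis unfolding sgraph_monoid_def by simp blast
qed

lemma class_closed:
  fixes G :: "('v, 'h, 'c) sgraph"
  assumes T: "field_theory T" and G: "specified_graph T G"
  shows "iso_class G \<in> carrier (sgraph_monoid T)"
proof -
  have wf: "wfg G" using G by (simp add: specified_graph_iff[OF T])
  obtain G' :: "(nat, nat, 'c) sgraph" where G': "sgraph_iso G G'" by (rule iso_class_nonempty[OF wf])
  show ?thesis
    unfolding sgraph_monoid_simps using specified_iso[OF T G G'] iso_class_eqI[OF wf G'] by blast
qed

lemma comm_monoid_sgraph_monoid:
  fixes T :: "'ty theory_data"
  assumes T: "field_theory T"
  shows "comm_monoid (sgraph_monoid T)"
proof -
  let ?M = "sgraph_monoid T"
  have spw: "wfg G" if "specified_graph T G" for G :: "(nat, nat, 'ty) sgraph"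
    using that by (simp add: specified_graph_iff[OF T])
  have m: "iso_class G \<otimes>\<^bsub>?M\<^esub> iso_class H = iso_class (disj_union G H)" if "wfg G" "wfg H"
    for G :: "('a, 'b, 'ty) sgraph" and H :: "('c, 'd, 'ty) sgraph"
    by (rule class_mult[OF that wf_disj_union[OF that] cover_disj_union])
  show ?thesis
  proof (rule comm_monoidI)
    fix X Y Z assume "X \<in> carrier ?M" "Y \<in> carrier ?M" "Z \<in> carrier ?M"
    then obtain F G H :: "(nat, nat, 'ty) sgraph" where
      g: "specified_graph T F" "specified_graph T G" "specified_graph T H" "X = iso_class F" "Y = iso_class G" "Z = iso_class H"
      by auto
    note w = spw[OF g(1)] spw[OF g(2)] spw[OF g(3)]
    note wu = wf_disj_union[OF w(1,2)] wf_disj_union[OF w(2,3)]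
    let ?W = "disj_union (disj_union F G) H"
    note ww = wf_disj_union[OF wu(1) w(3)]
    have s: "semb Inl Inl F (disj_union F G)" "semb Inr Inr G (disj_union F G)"
      "semb Inl Inl (disj_union F G) ?W" "semb Inr Inr H ?W"
      using cover_disj_union[of F G] cover_disj_union[of "disj_union F G" H] by (auto simp: cover_def)
    have sF: "semb (Inl \<circ> Inl) (Inl \<circ> Inl) F ?W" by (rule semb_comp[OF w(1) wu(1) s(1,3)])
    have sG: "semb (Inl \<circ> Inr) (Inl \<circ> Inr) G ?W" by (rule semb_comp[OF w(2) wu(1) s(2,3)])
    have sGH: "semb (case_sum (Inl \<circ> Inr) Inr) (case_sum (Inl \<circ> Inr) Inr) (disj_union G H) ?W"
      by (rule semb_glue[OF w(2,3) ww sG s(4)]) auto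
    \<comment> \<open>Associativity: the union bracketed to the left is also covered by
      \<open>F\<close> and the union of \<open>G\<close> and \<open>H\<close>.\<close>
    have "cover (Inl \<circ> Inl) (Inl \<circ> Inl) F (case_sum (Inl \<circ> Inr) Inr) (case_sum (Inl \<circ> Inr) Inr) (disj_union G H) ?W"
      unfolding cover_def using sF sGH by (force simp: disj_union_simps Plus_def)
    from class_mult[OF w(1) wu(2) ww this]
    show "(X \<otimes>\<^bsub>?M\<^esub> Y) \<otimes>\<^bsub>?M\<^esub> Z = X \<otimes>\<^bsub>?M\<^esub> (Y \<otimes>\<^bsub>?M\<^esub> Z)"
      unfolding g(4-6) by (simp only: m[OF w(1,2)] m[OF w(2,3)] m[OF wu(1) w(3)])
  next
    fix X Y assume "X \<in> carrier ?M" "Y \<in> carrier ?M"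
    then obtain F G :: "(nat, nat, 'ty) sgraph" where
      g: "specified_graph T F" "specified_graph T G" "X = iso_class F" "Y = iso_class G" by auto
    note w = spw[OF g(1)] spw[OF g(2)]
    have "specified_graph T (disj_union F G)"
      using cover_specified[OF T w wf_disj_union[OF w] cover_disj_union] g by blast
    then show "X \<otimes>\<^bsub>?M\<^esub> Y \<in> carrier ?M" unfolding g(3,4) m[OF w] by (rule class_closed[OF T])
    show "X \<otimes>\<^bsub>?M\<^esub> Y = Y \<otimes>\<^bsub>?M\<^esub> X"
      unfolding g(3,4) m[OF w]
      by (rule class_mult[OF w(2,1) wf_disj_union[OF w] cover_swap[OF cover_disj_union], symmetric])
  next
    fix X assume "X \<in> carrier ?M"
    then obtain G :: "(nat, nat, 'ty) sgraph" where g: "specified_graph T G" "X = iso_class G" by auto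
    have "cover (\<lambda>x. x) (\<lambda>x. x) G undefined undefined empty_sgraph G"
      by (rule cover_empty) (auto simp: semb_def emb_def)
    then show "\<one>\<^bsub>?M\<^esub> \<otimes>\<^bsub>?M\<^esub> X = X"
      using class_mult[OF wf_empty_sgraph spw[OF g(1)] spw[OF g(1)] cover_swap] g(2) by simp
  next
    show "\<one>\<^bsub>?M\<^esub> \<in> carrier ?M" unfolding sgraph_monoid_simps using specified_empty[OF T] by blast
  qed
qed

section \<open>The coproduct of a graph as a formal sum\<close>

text \<open>Values lie in the free space on pairs of classes, not yet in a tensor product, so that
  identities between coproducts reduce to reindexing of finite sums.\<close>

definition copr :: "'ty theory_data \<Rightarrow> ('v, 'h, 'ty) sgraph \<Rightarrow> ('ty sgraph_class \<times> 'ty sgraph_class) \<Rightarrow>\<^sub>0 complex" where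
  "copr T G = (\<Sum>s\<in>subs T G. Poly_Mapping.single (iso_class (sub_graph G s), iso_class (sub_quot G s)) 1)"

text \<open>Says that \<open>s\<close> is the restriction of \<open>s'\<close> along the embedding.
  A relation serves both directions: restricting to a summand and gluing from the summands.\<close>

definition matches :: "('v \<Rightarrow> 'w) \<Rightarrow> ('h \<Rightarrow> 'k) \<Rightarrow> ('v, 'h, 'ty) sgraph \<Rightarrow> 'h set \<times> ('v set \<Rightarrow> nat) \<Rightarrow>
    ('w, 'k, 'ty) sgraph \<Rightarrow> 'k set \<times> ('w set \<Rightarrow> nat) \<Rightarrow> bool" where
  "matches fv fh G s G' s' \<longleftrightarrow>
     (\<forall>e\<in>hedges (fst G). fh e \<in> fst s' \<longleftrightarrow> e \<in> fst s) \<and>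
     (\<forall>v\<in>vs G. snd s' (fv ` component_of (hcut (fst G) (fst s)) v) = snd s (component_of (hcut (fst G) (fst s)) v))"

text \<open>The embedding restricts to the cut graphs, which transports the local conditions.
  Whether a component is full can also be decided in the source, because all half-edges ending in
  the image of a component come from there.\<close>

lemma matches_sub_ok:
  assumes wf: "wfg G" and f: "semb fv fh G G'" and X: "sigma_closed (fst G) X" and X': "X' \<subseteq> hedges (fst G')"
    and m: "matches fv fh G (X, j) G' (X', j')" and v: "v \<in> vs G"
  shows "sub_ok T G' X' j' (fv v) \<longleftrightarrow> sub_ok T G X j v"
proof -
  note ef = semb_emb[OF f]
  have mX: "\<And>e. e \<in> hedges (fst G) \<Longrightarrow> fh e \<in> X' \<longleftrightarrow> e \<in> X"
    and mj: "\<And>v. v \<in> vs G \<Longrightarrow> j' (fv ` component_of (hcut (fst G) X) v) = j (component_of (hcut (fst G) X) v)"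
    using m by (auto simp: matches_def)
  let ?K = "component_of (hcut (fst G) X) v"
  have wf': "wfg (sub_graph G (X, j))" using wf_hcut[OF wf X] by (simp add: sub_graph_def)
  have sem: "semb fv fh (sub_graph G (X, j)) (sub_graph G' (X', j'))" by (rule semb_sub_graph[of G fv fh G' X' X j' j, OF wf ef mX mj])
  have vv: "v \<in> vs (sub_graph G (X, j))" using v by (simp add: sub_graph_def)
  have Ksub: "?K \<subseteq> vs G" using component_of_subset[OF wf' vv] by (simp add: sub_graph_def)
  have c: "component_of (hcut (fst G') X') (fv v) = fv ` ?K"
    using emb_component[OF wf' semb_emb[OF sem] vv] by (simp add: sub_graph_def)
  have l: "local_spec T (hcut (fst G') X', j') (fv v) \<longleftrightarrow> local_spec T (hcut (fst G) X, j) v"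
    using semb_local_spec[OF wf' sem vv] by (simp add: sub_graph_def)
  have un: "(\<forall>e\<in>X'. bdry (fst G') e \<notin> fv ` ?K) \<longleftrightarrow> (\<forall>e\<in>X. bdry (fst G) e \<notin> ?K)"
  proof
    assume a: "\<forall>e\<in>X'. bdry (fst G') e \<notin> fv ` ?K"
    show "\<forall>e\<in>X. bdry (fst G) e \<notin> ?K"
    proof
      fix e assume e: "e \<in> X"
      then have eh: "e \<in> hedges (fst G)" using X by (auto simp: sigma_closed_def)
      then have "fh e \<in> X'" using mX e by blast
      then have "fv (bdry (fst G) e) \<notin> fv ` ?K" using a embD(6)[OF ef eh] by auto
      then show "bdry (fst G) e \<notin> ?K" by blast
    qed
  next
    assume a: "\<forall>e\<in>X. bdry (fst G) e \<notin> ?K"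
    show "\<forall>e\<in>X'. bdry (fst G') e \<notin> fv ` ?K"
    proof
      fix e' assume e': "e' \<in> X'"
      show "bdry (fst G') e' \<notin> fv ` ?K"
      proof
        assume b: "bdry (fst G') e' \<in> fv ` ?K"
        then have "bdry (fst G') e' \<in> fv ` vs G" using Ksub by auto
        then obtain e where e: "e \<in> hedges (fst G)" "e' = fh e" using embD(9)[OF ef] e' X' by blast
        then have "e \<in> X" using mX e' by blast
        moreover have "bdry (fst G) e \<in> ?K"
          using b emb_fv_mem[OF wf ef wfD(5)[OF wf e(1)] Ksub] by (simp add: e embD(6)[OF ef])
        ultimately show False using a by blast
      qed
    qed
  qed
  have i: "snd G' (fv ` ?K) = snd G ?K" if "\<forall>e\<in>X. bdry (fst G) e \<notin> ?K"
  proof -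
    have "?K = component_of (fst G) v" using that by (intro component_hcut_uncut[OF wf X]) auto
    then show ?thesis using f v by (simp add: semb_def)
  qed
  show ?thesis unfolding sub_ok_def c l un using i mj[OF v] by auto
qed

lemma matches_sigma_closed:
  assumes wf: "wfg G" and f: "semb fv fh G G'" and "X \<subseteq> hedges (fst G)"
    and m: "matches fv fh G (X, j) G' (X', j')" and X': "cutset (fst G') X'"
  shows "cutset (fst G) X"
proof -
  note ef = semb_emb[OF f]
  have "sigma (fst G) e \<in> X \<and> sigma (fst G) e \<noteq> e" if e: "e \<in> X" for e
  proof -
    have eh: "e \<in> hedges (fst G)" using e assms(3) by auto
    then have "fh e \<in> X'" using m e by (simp add: matches_def)
    then have "fh (sigma (fst G) e) \<in> X'" "fh (sigma (fst G) e) \<noteq> fh e"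
      using cutsetD(2,4)[OF X', of "fh e"] embD(5)[OF ef eh] by auto
    then show ?thesis using m wfD(3)[OF wf eh] by (auto simp: matches_def)
  qed
  then show ?thesis using assms(3) by (auto simp: cutset_def sigma_closed_def)
qed

lemma matches_semb:
  assumes wf: "wfg G" and f: "semb fv fh G G'" and X: "sigma_closed (fst G) (fst s)"
    and m: "matches fv fh G s G' s'"
  shows "semb fv fh (sub_graph G s) (sub_graph G' s')" "semb (image fv) fh (sub_quot G s) (sub_quot G' s')"
  using semb_sub_graph[OF wf semb_emb[OF f], of "fst s'" "fst s" "snd s'" "snd s"]
    semb_sub_quot[OF wf f X, of "fst s'" "snd s'" "snd s"] m by (simp_all add: matches_def)

text \<open>The specification is restricted to the components because \<open>subs\<close> contains
  only extensional ones; by \<open>matches_unique\<close> no other element of \<open>subs\<close>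
  matches.\<close>

definition pull :: "('v \<Rightarrow> 'w) \<Rightarrow> ('h \<Rightarrow> 'k) \<Rightarrow> ('v, 'h, 'ty) sgraph \<Rightarrow> 'k set \<times> ('w set \<Rightarrow> nat) \<Rightarrow>
    'h set \<times> ('v set \<Rightarrow> nat)" where
  "pull fv fh G s' = (let X = {e \<in> hedges (fst G). fh e \<in> fst s'} in
     (X, restrict (\<lambda>K. snd s' (fv ` K)) (components (hcut (fst G) X))))"

lemma matches_pull: "matches fv fh G (pull fv fh G s') G' s'"
  by (auto simp: matches_def pull_def Let_def components_eq)

lemma pull_subs:
  assumes wf: "wfg H" and s: "semb fv fh H G" and t: "t \<in> subs T G"
  shows "pull fv fh H t \<in> subs T H"
proof -
  obtain X' j' where t': "t = (X', j')" by (cases t)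
  have X': "cutset (fst G) X'" using t by (auto simp: subs_def t')
  have X'h: "X' \<subseteq> hedges (fst G)" using cutsetD(3)[OF X'] by auto
  have ok: "\<And>v. v \<in> vs G \<Longrightarrow> sub_ok T G X' j' v" using t by (auto simp: subs_def t')
  obtain X j where p: "pull fv fh H t = (X, j)" by (cases "pull fv fh H t")
  have m: "matches fv fh H (X, j) G (X', j')"
    using matches_pull[of fv fh H t G] unfolding p unfolding t' .
  have XH: "X \<subseteq> hedges (fst H)" using p by (auto simp: pull_def Let_def)
  have X: "cutset (fst H) X" by (rule matches_sigma_closed[OF wf s XH m X'])
  have "sub_ok T H X j v" if "v \<in> vs H" for v
    using matches_sub_ok[OF wf s cutsetD(1)[OF X] X'h m that] ok embD(2)[OF semb_emb[OF s] that] by blast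
  moreover have "j \<in> extensional (components (hcut (fst H) X))" using p by (auto simp: pull_def Let_def)
  ultimately show ?thesis using X by (simp add: subs_def p)
qed

lemma component_nonempty: "K \<in> components \<Gamma> \<Longrightarrow> K \<noteq> {}"
  using component_of_self[of _ \<Gamma>] by (auto simp: components_eq simp del: component_of_self)

lemma subsD:
  assumes "s \<in> subs T G"
  shows "fst s \<subseteq> hedges (fst G)" "snd s \<in> extensional (components (hcut (fst G) (fst s)))"
  using assms cutsetD(3)[of "fst G" "fst s"] by (auto simp: subs_def)

lemma matches_unique:
  assumes "matches fv fh G s G' s'" "matches fv fh G t G' s'" "fst s \<subseteq> hedges (fst G)" "fst t \<subseteq> hedges (fst G)"
    "snd s \<in> extensional (components (hcut (fst G) (fst s)))" "snd t \<in> extensional (components (hcut (fst G) (fst t)))"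
  shows "s = t"
proof -
  have X: "fst s = fst t" using assms(1-4) by (auto simp: matches_def)
  have "snd s = snd t"
    by (rule extensionalityI[OF assms(5) assms(6)[folded X]])
      (use assms(1,2) X in \<open>auto simp: matches_def components_eq\<close>)
  then show ?thesis using X by (simp add: prod_eq_iff)
qed

text \<open>A covering subgraph of a disjoint union is a pair of covering subgraphs of the summands,
  obtained by \<open>pull\<close> and glued by \<open>push\<close>. Subgraph and contraction are
  again covered by those of the summands, so classes multiply in both legs.\<close>

lemma copr_cover:
  assumes T: "field_theory T" and wf: "wfg G1" "wfg G2" "wfg G" and c: "cover f1v f1h G1 f2v f2h G2 G"
  shows "copr T G = copr T G1 \<otimes>\<^bsub>monoid_algebra (sgraph_monoid T \<times>\<times> sgraph_monoid T)\<^esub> copr T G2"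
proof -
  let ?M = "sgraph_monoid T"
  have s: "semb f1v f1h G1 G" "semb f2v f2h G2 G" and dis: "f1v ` vs G1 \<inter> f2v ` vs G2 = {}"
    and cov: "f1v ` vs G1 \<union> f2v ` vs G2 = vs G" using c by (auto simp: cover_def)
  note e1 = semb_emb[OF s(1)] and e2 = semb_emb[OF s(2)]
  let ?m = "\<lambda>s1 s2 t. matches f1v f1h G1 s1 G t \<and> matches f2v f2h G2 s2 G t"
  have hcov: "e' \<in> f1h ` hedges (fst G1) \<union> f2h ` hedges (fst G2)" if "e' \<in> hedges (fst G)" for e'
    using wfD(5)[OF wf(3) that] embD(9)[OF e1 that] embD(9)[OF e2 that] cov by blast
  have hdis: "f1h e \<noteq> f2h f" if "e \<in> hedges (fst G1)" "f \<in> hedges (fst G2)" for e f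
  proof
    assume "f1h e = f2h f"
    then have "f1v (bdry (fst G1) e) = f2v (bdry (fst G2) f)" using embD(6)[OF e1 that(1)] embD(6)[OF e2 that(2)] by simp
    then show False using dis wfD(5)[OF wf(1) that(1)] wfD(5)[OF wf(2) that(2)] by blast
  qed
  note p1 = pull_subs[OF wf(1) s(1)] and p2 = pull_subs[OF wf(2) s(2)]
  \<comment> \<open>A component of the glued subgraph lies in one of the two images, and the
    inclusion test selects the specification to be read there.\<close>
  define push where "push = (\<lambda>((X1, j1), (X2, j2)). let X' = f1h ` X1 \<union> f2h ` X2 in
    (X', restrict (\<lambda>K. if K \<subseteq> f1v ` vs G1 then (j1 :: _ \<Rightarrow> nat) (inv_into (vs G1) f1v ` K) else j2 (inv_into (vs G2) f2v ` K))
      (components (hcut (fst G) X'))))"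
  have push: "push (s1, s2) \<in> subs T G \<and> ?m s1 s2 (push (s1, s2))" if s12: "s1 \<in> subs T G1" "s2 \<in> subs T G2" for s1 s2
  proof -
    obtain X1 j1 X2 j2 where s': "s1 = (X1, j1)" "s2 = (X2, j2)" by (cases s1, cases s2)
    have X: "cutset (fst G1) X1" "cutset (fst G2) X2" using s12 by (auto simp: subs_def s')
    have Xh: "X1 \<subseteq> hedges (fst G1)" "X2 \<subseteq> hedges (fst G2)" using cutsetD(3)[OF X(1)] cutsetD(3)[OF X(2)] by auto
    define X' where "X' = f1h ` X1 \<union> f2h ` X2"
    define j' where "j' = snd (push (s1, s2))"
    have p: "push (s1, s2) = (X', j')" by (simp add: j'_def X'_def push_def s' Let_def)
    have j': "j' K = (if K \<subseteq> f1v ` vs G1 then j1 (inv_into (vs G1) f1v ` K) else j2 (inv_into (vs G2) f2v ` K))"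
      if "K \<in> components (hcut (fst G) X')" for K
      using that by (simp add: j'_def push_def s' Let_def X'_def)
    have Xm1: "f1h e \<in> X' \<longleftrightarrow> e \<in> X1" if "e \<in> hedges (fst G1)" for e
      using that Xh hdis emb_fh_eq[OF wf(1) e1 that] unfolding X'_def by (auto, metis subsetD)
    have Xm2: "f2h e \<in> X' \<longleftrightarrow> e \<in> X2" if "e \<in> hedges (fst G2)" for e
      using that Xh hdis emb_fh_eq[OF wf(2) e2 that] unfolding X'_def by (auto, metis subsetD, metis subsetD)
    have X'h: "X' \<subseteq> hedges (fst G)" using Xh embD(4)[OF e1] embD(4)[OF e2] by (auto simp: X'_def)
    have X'c: "cutset (fst G) X'"
    proof -
      have "sigma (fst G) (f1h e) \<in> X' \<and> sigma (fst G) (f1h e) \<noteq> f1h e" if "e \<in> X1" for e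
        using that X(1) Xh(1) embD(5)[OF e1] emb_fh_eq[OF wf(1) e1] cutsetD(2-4)[OF X(1) that]
        by (auto simp: X'_def)
      moreover have "sigma (fst G) (f2h e) \<in> X' \<and> sigma (fst G) (f2h e) \<noteq> f2h e" if "e \<in> X2" for e
        using that X(2) Xh(2) embD(5)[OF e2] emb_fh_eq[OF wf(2) e2] cutsetD(2-4)[OF X(2) that]
        by (auto simp: X'_def)
      ultimately show ?thesis using X'h unfolding cutset_def sigma_closed_def by (auto simp: X'_def)
    qed
    note w1 = wf_hcut[OF wf(1) cutsetD(1)[OF X(1)]] and w2 = wf_hcut[OF wf(2) cutsetD(1)[OF X(2)]]
    have m1: "matches f1v f1h G1 s1 G (X', j')"
    proof -
      have "j' (f1v ` component_of (hcut (fst G1) X1) v) = j1 (component_of (hcut (fst G1) X1) v)" if v: "v \<in> vs G1" for v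
      proof -
        let ?K = "component_of (hcut (fst G1) X1) v"
        have K: "?K \<subseteq> vs G1" using component_of_subset[OF w1, of v] v by simp
        have "f1v ` ?K = component_of (hcut (fst G) X') (f1v v)"
          using emb_component[OF w1 emb_hcut[OF e1 Xm1], of v] v by simp
        then have "f1v ` ?K \<in> components (hcut (fst G) X')" using embD(2)[OF e1 v] by (simp add: components_eq)
        moreover have "inv_into (vs G1) f1v ` f1v ` ?K = ?K" by (rule inv_into_image_cancel[OF embD(1)[OF e1] K])
        ultimately show ?thesis using K by (simp add: j' image_mono)
      qed
      then show ?thesis using Xm1 by (simp add: matches_def s')
    qed
    have m2: "matches f2v f2h G2 s2 G (X', j')"
    proof -
      have "j' (f2v ` component_of (hcut (fst G2) X2) v) = j2 (component_of (hcut (fst G2) X2) v)" if v: "v \<in> vs G2" for v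
      proof -
        let ?K = "component_of (hcut (fst G2) X2) v"
        have K: "?K \<subseteq> vs G2" using component_of_subset[OF w2, of v] v by simp
        have "f2v ` ?K = component_of (hcut (fst G) X') (f2v v)"
          using emb_component[OF w2 emb_hcut[OF e2 Xm2], of v] v by simp
        then have "f2v ` ?K \<in> components (hcut (fst G) X')" using embD(2)[OF e2 v] by (simp add: components_eq)
        moreover have "inv_into (vs G2) f2v ` f2v ` ?K = ?K" by (rule inv_into_image_cancel[OF embD(1)[OF e2] K])
        moreover have "\<not> f2v ` ?K \<subseteq> f1v ` vs G1"
        proof
          assume "f2v ` ?K \<subseteq> f1v ` vs G1"
          then have "f2v v \<in> f1v ` vs G1" using component_of_self[of v "hcut (fst G2) X2"] by blast
          then show False using dis v by blast
        qed
        ultimately show ?thesis by (simp add: j')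
      qed
      then show ?thesis using Xm2 by (simp add: matches_def s')
    qed
    have "sub_ok T G X' j' v" if "v \<in> vs G" for v
    proof -
      from that cov consider u where "u \<in> vs G1" "v = f1v u" | u where "u \<in> vs G2" "v = f2v u" by blast
      then show ?thesis
      proof cases
        case 1
        then show ?thesis using matches_sub_ok[OF wf(1) s(1) cutsetD(1)[OF X(1)] X'h m1[unfolded s'] 1(1)] s12
          by (auto simp: subs_def s')
      next
        case 2
        then show ?thesis using matches_sub_ok[OF wf(2) s(2) cutsetD(1)[OF X(2)] X'h m2[unfolded s'] 2(1)] s12
          by (auto simp: subs_def s')
      qed
    qed
    moreover have "j' \<in> extensional (components (hcut (fst G) X'))"
      by (simp add: j'_def push_def s' Let_def X'_def)
    ultimately show ?thesis using m1 m2 X'c unfolding p by (simp add: subs_def)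
  qed
  \<comment> \<open>The two images together contain all vertices and half-edges, so a covering
    subgraph is determined by its two restrictions.\<close>
  have uniq: "t = t'" if "t \<in> subs T G" "t' \<in> subs T G" "?m s1 s2 t" "?m s1 s2 t'"
    "s1 \<in> subs T G1" "s2 \<in> subs T G2" for t t' s1 s2
  proof -
    obtain X' j' Y' k' X1 j1 X2 j2 where t: "t = (X', j')" "t' = (Y', k')" "s1 = (X1, j1)" "s2 = (X2, j2)"
      by (cases t, cases t', cases s1, cases s2)
    have sub: "X' \<subseteq> hedges (fst G)" "Y' \<subseteq> hedges (fst G)" using that cutsetD(3) by (auto simp: subs_def t)
    have eq: "X' = Y'"
    proof -
      have "e' \<in> X' \<longleftrightarrow> e' \<in> Y'" if "e' \<in> hedges (fst G)" for e'
        using hcov[OF that] \<open>?m s1 s2 t\<close> \<open>?m s1 s2 t'\<close> by (auto simp: matches_def t)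
      then show ?thesis using sub by blast
    qed
    have X: "sigma_closed (fst G1) X1" "sigma_closed (fst G2) X2" using that cutsetD(1) by (auto simp: subs_def t)
    have "j' = k'"
    proof (rule extensionalityI)
      show "j' \<in> extensional (components (hcut (fst G) X'))" "k' \<in> extensional (components (hcut (fst G) X'))"
        using that(1,2) by (auto simp: subs_def t eq)
      fix K assume "K \<in> components (hcut (fst G) X')"
      then obtain v where v: "v \<in> vs G" "K = component_of (hcut (fst G) X') v" by (auto simp: components_eq)
      from v(1) cov consider u where "u \<in> vs G1" "v = f1v u" | u where "u \<in> vs G2" "v = f2v u" by blast
      then show "j' K = k' K"
      proof cases
        case 1
        have "K = f1v ` component_of (hcut (fst G1) X1) u"
          using emb_component[OF wf_hcut[OF wf(1) X(1)] emb_hcut[OF e1, of X' X1], of u] 1 v that(3)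
          by (auto simp: matches_def t)
        then show ?thesis using that(3,4) 1(1) by (simp add: matches_def t)
      next
        case 2
        have "K = f2v ` component_of (hcut (fst G2) X2) u"
          using emb_component[OF wf_hcut[OF wf(2) X(2)] emb_hcut[OF e2, of X' X2], of u] 2 v that(3)
          by (auto simp: matches_def t)
        then show ?thesis using that(3,4) 2(1) by (simp add: matches_def t)
      qed
    qed
    then show ?thesis using eq by (simp add: t)
  qed
  have scl: "sigma_closed (fst G1) (fst s1)" "sigma_closed (fst G2) (fst s2)" "sigma_closed (fst G) (fst t)"
    if "s1 \<in> subs T G1" "s2 \<in> subs T G2" "t \<in> subs T G" for s1 s2 t
    using that cutsetD(1) by (auto simp: subs_def)
  have val: "iso_class (sub_graph G1 s1) \<otimes>\<^bsub>?M\<^esub> iso_class (sub_graph G2 s2) = iso_class (sub_graph G t) \<and>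
      iso_class (sub_quot G1 s1) \<otimes>\<^bsub>?M\<^esub> iso_class (sub_quot G2 s2) = iso_class (sub_quot G t)"
    if st: "s1 \<in> subs T G1" "s2 \<in> subs T G2" "t \<in> subs T G" and m: "?m s1 s2 t" for s1 s2 t
  proof -
    note sc = scl[OF st]
    have ws: "wfg (sub_graph G1 s1)" "wfg (sub_graph G2 s2)" "wfg (sub_graph G t)"
      using wf_hcut[OF wf(1) sc(1)] wf_hcut[OF wf(2) sc(2)] wf_hcut[OF wf(3) sc(3)]
      by (simp_all add: sub_graph_def split_beta)
    have wq: "wfg (sub_quot G1 s1)" "wfg (sub_quot G2 s2)" "wfg (sub_quot G t)"
      using wf_contracted[OF wf(1) sc(1)] wf_contracted[OF wf(2) sc(2)] wf_contracted[OF wf(3) sc(3)]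
      by (simp_all add: sub_quot_def split_beta)
    note m1 = matches_semb[OF wf(1) s(1) sc(1) conjunct1[OF m]] and m2 = matches_semb[OF wf(2) s(2) sc(2) conjunct2[OF m]]
    have "cover f1v f1h (sub_graph G1 s1) f2v f2h (sub_graph G2 s2) (sub_graph G t)"
      using m1(1) m2(1) dis cov unfolding cover_def by (simp add: sub_graph_def split_beta)
    moreover have "cover (image f1v) f1h (sub_quot G1 s1) (image f2v) f2h (sub_quot G2 s2) (sub_quot G t)"
    proof -
      have vq1: "image f1v ` vs (sub_quot G1 s1) = component_of (hcut (fst G) (fst t)) ` f1v ` vs G1"
        using emb_component[OF ws(1) semb_emb[OF m1(1)]]
        by (force simp: sub_quot_def sub_graph_def split_beta components_eq image_iff)
      have vq2: "image f2v ` vs (sub_quot G2 s2) = component_of (hcut (fst G) (fst t)) ` f2v ` vs G2"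
        using emb_component[OF ws(2) semb_emb[OF m2(1)]]
        by (force simp: sub_quot_def sub_graph_def split_beta components_eq image_iff)
      \<comment> \<open>Nonemptiness is recorded because the vertices of the contractions are sets:
        disjointness of the underlying vertex sets separates two such families only when their
        members are nonempty.\<close>
      have K1: "K \<subseteq> f1v ` vs G1 \<and> K \<noteq> {}" if KK: "K \<in> image f1v ` vs (sub_quot G1 s1)" for K
      proof -
        obtain L where L: "L \<in> components (fst (sub_graph G1 s1))" "K = f1v ` L"
          using KK by (auto simp: sub_quot_def sub_graph_def split_beta)
        then have "L \<subseteq> vs G1" using components_subset[OF ws(1) L(1)] by (simp add: sub_graph_def split_beta)
        moreover have "L \<noteq> {}" using L(1) by (rule component_nonempty)
        ultimately show ?thesis using L(2) by auto
      qed
      have K2: "K \<subseteq> f2v ` vs G2" if KK: "K \<in> image f2v ` vs (sub_quot G2 s2)" for K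
      proof -
        obtain L where L: "L \<in> components (fst (sub_graph G2 s2))" "K = f2v ` L"
          using KK by (auto simp: sub_quot_def sub_graph_def split_beta)
        then have "L \<subseteq> vs G2" using components_subset[OF ws(2) L(1)] by (simp add: sub_graph_def split_beta)
        then show ?thesis using L(2) by auto
      qed
      have "image f1v ` vs (sub_quot G1 s1) \<inter> image f2v ` vs (sub_quot G2 s2) = {}"
      proof (rule ccontr)
        assume "image f1v ` vs (sub_quot G1 s1) \<inter> image f2v ` vs (sub_quot G2 s2) \<noteq> {}"
        then obtain K where K: "K \<in> image f1v ` vs (sub_quot G1 s1)" "K \<in> image f2v ` vs (sub_quot G2 s2)"
          by (meson disjoint_iff)
        from K1[OF K(1)] obtain x where "x \<in> K" by blast
        then have "x \<in> f1v ` vs G1 \<inter> f2v ` vs G2" using K1[OF K(1)] K2[OF K(2)] by (meson IntI subsetD)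
        then show False by (simp add: dis)
      qed
      moreover have "image f1v ` vs (sub_quot G1 s1) \<union> image f2v ` vs (sub_quot G2 s2) = vs (sub_quot G t)"
        unfolding vq1 vq2 using cov by (simp add: sub_quot_def split_beta components_eq flip: image_Un)
      ultimately show ?thesis using m1(2) m2(2) by (simp add: cover_def)
    qed
    ultimately show ?thesis using class_mult[OF ws] class_mult[OF wq] by blast
  qed
  let ?f = "\<lambda>(s1, s2). Poly_Mapping.single (iso_class (sub_graph G1 s1) \<otimes>\<^bsub>?M\<^esub> iso_class (sub_graph G2 s2),
      iso_class (sub_quot G1 s1) \<otimes>\<^bsub>?M\<^esub> iso_class (sub_quot G2 s2)) (1::complex)"
  have "copr T G1 \<otimes>\<^bsub>monoid_algebra (?M \<times>\<times> ?M)\<^esub> copr T G2 = (\<Sum>s1\<in>subs T G1. \<Sum>s2\<in>subs T G2. ?f (s1, s2))"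
    unfolding copr_def
    by (simp add: monoid_algebra_mult_sum finite_subs[OF T wf(1)] finite_subs[OF T wf(2)] mult_DirProd')
      (rule sum.swap)
  also have "\<dots> = sum ?f (subs T G1 \<times> subs T G2)" by (simp add: sum.cartesian_product)
  also have "\<dots> = copr T G"
    unfolding copr_def
  proof (rule sum.reindex_bij_witness[of _ "\<lambda>t. (pull f1v f1h G1 t, pull f2v f2h G2 t)" push])
    fix a assume a: "a \<in> subs T G1 \<times> subs T G2"
    then obtain s1 s2 where s12: "a = (s1, s2)" "s1 \<in> subs T G1" "s2 \<in> subs T G2" by auto
    note ps = push[OF s12(2,3)]
    show "push a \<in> subs T G" using ps s12 by simp
    have "pull f1v f1h G1 (push a) = s1"
      using ps unfolding s12(1)
      by (intro matches_unique[OF matches_pull[of f1v f1h G1 _ G] _ subsD(1)[OF p1] subsD(1)[OF s12(2)]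
          subsD(2)[OF p1] subsD(2)[OF s12(2)]]) auto
    moreover have "pull f2v f2h G2 (push a) = s2"
      using ps unfolding s12(1)
      by (intro matches_unique[OF matches_pull[of f2v f2h G2 _ G] _ subsD(1)[OF p2] subsD(1)[OF s12(3)]
          subsD(2)[OF p2] subsD(2)[OF s12(3)]]) auto
    ultimately show "(pull f1v f1h G1 (push a), pull f2v f2h G2 (push a)) = a" using s12 by simp
    show "Poly_Mapping.single (iso_class (sub_graph G (push a)), iso_class (sub_quot G (push a))) 1 = ?f a"
      using val[OF s12(2,3) conjunct1[OF ps] conjunct2[OF ps]] s12(1) by simp
  next
    fix t assume t: "t \<in> subs T G"
    note p = p1[OF t] p2[OF t]
    show "(pull f1v f1h G1 t, pull f2v f2h G2 t) \<in> subs T G1 \<times> subs T G2" using p by simp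
    show "push (pull f1v f1h G1 t, pull f2v f2h G2 t) = t"
      using push[OF p] by (intro uniq[OF _ t _ _ p] conjI matches_pull) simp_all
  qed
  finally show ?thesis by simp
qed

section \<open>Coassociativity\<close>

lemma local_spec_cong:
  assumes "i (component_of \<Gamma> v) = i' (component_of \<Gamma> v)"
  shows "local_spec T (\<Gamma>, i) v \<longleftrightarrow> local_spec T (\<Gamma>, i') v"
  using assms component_of_isolated[of \<Gamma> v] unfolding local_spec_def by auto

lemma sgraph_iso_identity:
  assumes "verts \<Gamma> = verts \<Gamma>'" "hedges \<Gamma> = hedges \<Gamma>'"
    and "\<And>e. e \<in> hedges \<Gamma> \<Longrightarrow> sigma \<Gamma>' e = sigma \<Gamma> e \<and> bdry \<Gamma>' e = bdry \<Gamma> e \<and> htype \<Gamma>' e = htype \<Gamma> e"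
    and "\<And>v. v \<in> verts \<Gamma> \<Longrightarrow> vlab \<Gamma>' v = vlab \<Gamma> v" "\<And>K. K \<in> components \<Gamma> \<Longrightarrow> i' K = i K"
  shows "sgraph_iso (\<Gamma>, i) (\<Gamma>', i')"
  unfolding sgraph_iso_def using assms by (auto intro!: exI[of _ "\<lambda>x. x"] simp: bij_betw_def)

text \<open>Let g be the graph cut along \<open>X\<close> and h the one cut along \<open>Y\<close>
  as well. The left side is g/h, the right side is the covering subgraph of G/h that cuts
  \<open>X\<close>.\<close>

lemma contracted_hcut: "contracted (hcut \<Gamma> X) Y k = hcut (contracted \<Gamma> (X \<union> Y) k) X"
  unfolding hcut_contracted[OF Un_upper1]
  by (rule lgraph.equality) (auto simp: hcut_hcut fun_eq_iff)

text \<open>For h \<subseteq> g \<subseteq> G, where g cuts \<open>X\<close> and h cuts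
  \<open>Y\<close> as well, returns h and g/h. The internal half-edges of G/h are those in
  \<open>X \<union> Y\<close>, and g/h keeps the edges of \<open>Y\<close>, so its cut set is
  \<open>X\<close>. A component of g/h is a set of components of h whose union is the component of g
  at which \<open>j\<close> is read.\<close>

definition merge_sub where
  "merge_sub G = (\<lambda>((X, j), (Y, k)). ((X \<union> Y, k),
     (X, restrict (\<lambda>C. j (\<Union>C)) (components (hcut (fst (sub_quot G (X \<union> Y, k))) X)))))"

text \<open>The inverse: the set \<open>X\<close> that is cut in G/h is cut in G to give g, and the
  specification of g at a component is read at the set of components of h inside it.\<close>

definition split_sub where
  "split_sub G = (\<lambda>((W, k), (X, j)).
     ((X, restrict (\<lambda>K. j (component_of (hcut (fst G) W) ` K)) (components (hcut (fst G) X))), (W - X, k)))"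

text \<open>The facts about contraction, with \<open>hcut \<Gamma> X\<close> in the role of the
  whole graph and \<open>W\<close> as the cut set of the smaller subgraph.\<close>

lemma nested_components:
  assumes wf: "fgraph_wf \<Gamma>" and X: "sigma_closed \<Gamma> X" and W: "sigma_closed \<Gamma> W" and sub: "X \<subseteq> W"
  shows "hcut (contracted \<Gamma> W k) X = contracted (hcut \<Gamma> X) W k"
    and "hcut (hcut \<Gamma> X) W = hcut \<Gamma> W"
    and "component_of (hcut (contracted \<Gamma> W k) X) (component_of (hcut \<Gamma> W) v) =
      component_of (hcut \<Gamma> W) ` component_of (hcut \<Gamma> X) v"
    and "\<Union>(component_of (hcut \<Gamma> W) ` component_of (hcut \<Gamma> X) v) = component_of (hcut \<Gamma> X) v"
    and "component_of (hcut \<Gamma> W) u \<in> component_of (hcut \<Gamma> W) ` component_of (hcut \<Gamma> X) v \<longleftrightarrow>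
      u \<in> component_of (hcut \<Gamma> X) v"
    and "components (hcut (contracted \<Gamma> W k) X) =
      (\<lambda>v. component_of (hcut \<Gamma> W) ` component_of (hcut \<Gamma> X) v) ` verts \<Gamma>"
    and "rtype (hcut (contracted \<Gamma> W k) X) (component_of (hcut \<Gamma> W) ` component_of (hcut \<Gamma> X) v) =
      rtype (hcut \<Gamma> X) (component_of (hcut \<Gamma> X) v)"
proof -
  show 1: "hcut (contracted \<Gamma> W k) X = contracted (hcut \<Gamma> X) W k" by (rule hcut_contracted[OF sub])
  show 2: "hcut (hcut \<Gamma> X) W = hcut \<Gamma> W" by (simp only: hcut_hcut Un_absorb1[OF sub])
  note wf' = wf_hcut[OF wf X] and W' = sigma_closed_hcut[OF W, of X]
  show 3: "component_of (hcut (contracted \<Gamma> W k) X) (component_of (hcut \<Gamma> W) v) =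
      component_of (hcut \<Gamma> W) ` component_of (hcut \<Gamma> X) v" for v
    using component_contracted[OF wf' W', of k v] unfolding 1 2 .
  show "\<Union>(component_of (hcut \<Gamma> W) ` component_of (hcut \<Gamma> X) v) = component_of (hcut \<Gamma> X) v"
    using Union_component_contracted[OF wf' W', of v] unfolding 2 .
  show "component_of (hcut \<Gamma> W) u \<in> component_of (hcut \<Gamma> W) ` component_of (hcut \<Gamma> X) v \<longleftrightarrow>
      u \<in> component_of (hcut \<Gamma> X) v"
    using component_hcut_mem[OF wf' W', of u v] unfolding 2 .
  show "components (hcut (contracted \<Gamma> W k) X) =
      (\<lambda>v. component_of (hcut \<Gamma> W) ` component_of (hcut \<Gamma> X) v) ` verts \<Gamma>"
    unfolding components_eq[of "hcut (contracted \<Gamma> W k) X"] by (simp add: components_eq image_image 3)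
  show "rtype (hcut (contracted \<Gamma> W k) X) (component_of (hcut \<Gamma> W) ` component_of (hcut \<Gamma> X) v) =
      rtype (hcut \<Gamma> X) (component_of (hcut \<Gamma> X) v)"
    using rtype_contracted[OF wf' W', of k v] unfolding 1 2 .
qed

lemma cutset_cutset:
  assumes "cutset \<Gamma> X" "cutset (hcut \<Gamma> X) Y"
  shows "X \<inter> Y = {}" "cutset \<Gamma> (X \<union> Y)"
proof -
  have Y: "e \<notin> X \<and> sigma \<Gamma> e \<in> Y \<and> sigma \<Gamma> e \<noteq> e \<and> e \<in> hedges \<Gamma>" if "e \<in> Y" for e
    using cutsetD(2-4)[OF assms(2) that] by (auto split: if_splits)
  then show "X \<inter> Y = {}" by blast
  show "cutset \<Gamma> (X \<union> Y)" using assms(1) Y by (auto simp: cutset_def sigma_closed_def)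
qed

text \<open>The conditions on h in G combine those of the two steps of the chain. The conditions on
  g/h in G/h are those of the contraction of g by h, together with the agreement of g with G on full
  components.\<close>

lemma merge_subs:
  assumes T: "field_theory T" and G: "specified_graph T G"
    and s: "s \<in> subs T G" and t: "t \<in> subs T (sub_graph G s)"
  shows "fst (merge_sub G (s, t)) \<in> subs T G"
    and "snd (merge_sub G (s, t)) \<in> subs T (sub_quot G (fst (merge_sub G (s, t))))"
    and "split_sub G (merge_sub G (s, t)) = (s, t)"
proof -
  obtain \<Gamma> i X j Y k where eq: "G = (\<Gamma>, i)" "s = (X, j)" "t = (Y, k)" by (cases G, cases s, cases t)
  let ?W = "X \<union> Y"
  have wf: "fgraph_wf \<Gamma>" using G by (simp add: specified_graph_iff[OF T] eq)
  have X: "cutset \<Gamma> X" and okX: "\<And>v. v \<in> verts \<Gamma> \<Longrightarrow> sub_ok T (\<Gamma>, i) X j v"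
    and jx: "j \<in> extensional (components (hcut \<Gamma> X))" using s by (auto simp: subs_def eq)
  have Y: "cutset (hcut \<Gamma> X) Y" and okY: "\<And>v. v \<in> verts \<Gamma> \<Longrightarrow> sub_ok T (hcut \<Gamma> X, j) Y k v"
    and kx: "k \<in> extensional (components (hcut \<Gamma> ?W))"
    using t by (auto simp: subs_def eq sub_graph_def hcut_hcut)
  note dis = cutset_cutset(1)[OF X Y] and W = cutset_cutset(2)[OF X Y]
  note wfX = wf_hcut[OF wf cutsetD(1)[OF X]]
  note nc = nested_components[OF wf cutsetD(1)[OF X] cutsetD(1)[OF W] Un_upper1]
  have okW: "sub_ok T (\<Gamma>, i) ?W k v" if v: "v \<in> verts \<Gamma>" for v
  proof -
    let ?K = "component_of (hcut \<Gamma> ?W) v"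
    have l: "local_spec T (hcut \<Gamma> ?W, k) v" using okY[OF v] by (simp add: sub_ok_def hcut_hcut)
    \<comment> \<open>A component untouched by both cuts is full at each step of the chain, so the
      specification is carried from \<open>k\<close> to \<open>j\<close> and from \<open>j\<close>
      to \<open>i\<close>.\<close>
    have "k ?K = i ?K" if un: "\<forall>e\<in>?W. bdry \<Gamma> e \<notin> ?K"
    proof -
      have cX: "?K = component_of (hcut \<Gamma> X) v"
        using component_hcut_uncut[OF wfX cutsetD(1)[OF Y], of v] un by (simp add: hcut_hcut)
      have "k ?K = j ?K" using okY[OF v] un by (simp add: sub_ok_def hcut_hcut)
      moreover have "j (component_of (hcut \<Gamma> X) v) = i (component_of (hcut \<Gamma> X) v)"
        using okX[OF v] un unfolding sub_ok_def cX by simp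
      ultimately show ?thesis by (simp add: cX)
    qed
    then show ?thesis using l by (simp add: sub_ok_def)
  qed
  let ?q = "contracted \<Gamma> ?W k"
  let ?j = "restrict (\<lambda>C. j (\<Union>C)) (components (hcut ?q X))"
  have fm: "fst (merge_sub G (s, t)) = (?W, k)" and sm: "snd (merge_sub G (s, t)) = (X, ?j)"
    by (simp_all add: merge_sub_def eq sub_quot_def)
  show "fst (merge_sub G (s, t)) \<in> subs T G"
    using W okW kx unfolding fm by (simp add: eq subs_def)
  \<comment> \<open>As a graph, g/h inside G/h is the contraction of g by h, for which all local
    conditions are known.\<close>
  have spq: "specified_graph T (sub_quot (sub_graph G s) t)"
    by (rule specified_sub_quot[OF T specified_sub_graph[OF T _ s] t]) (simp add: eq wf)
  have "local_spec T (hcut ?q X, \<lambda>C. j (\<Union>C)) C" if "C \<in> components (hcut \<Gamma> ?W)" for C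
    using spq that by (auto simp: specified_graph_iff[OF T] eq sub_quot_def sub_graph_def contracted_hcut)
  then have lq: "local_spec T (hcut ?q X, ?j) C" if C: "C \<in> components (hcut \<Gamma> ?W)" for C
  proof -
    have "component_of (hcut ?q X) C \<in> components (hcut ?q X)" using C by (simp add: components_eq)
    then have "?j (component_of (hcut ?q X) C) = j (\<Union>(component_of (hcut ?q X) C))" by simp
    then show ?thesis
      using local_spec_cong[of ?j "hcut ?q X" C "\<lambda>C. j (\<Union>C)"] C
        \<open>\<And>C. C \<in> components (hcut \<Gamma> ?W) \<Longrightarrow> local_spec T (hcut ?q X, \<lambda>C. j (\<Union>C)) C\<close> by blast
  qed
  have jval: "?j (component_of (hcut \<Gamma> ?W) ` component_of (hcut \<Gamma> X) v) = j (component_of (hcut \<Gamma> X) v)"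
    if "v \<in> verts \<Gamma>" for v
    using that by (simp add: nc(4) nc(6))
  have "sub_ok T (sub_quot G (?W, k)) X ?j C" if C: "C \<in> components (hcut \<Gamma> ?W)" for C
  proof -
    obtain v where v: "v \<in> verts \<Gamma>" "C = component_of (hcut \<Gamma> ?W) v" using C by (auto simp: components_eq)
    have c: "component_of (hcut ?q X) C = component_of (hcut \<Gamma> ?W) ` component_of (hcut \<Gamma> X) v"
      unfolding v(2) by (rule nc(3))
    have "?j (component_of (hcut ?q X) C) = i (\<Union>(component_of (hcut ?q X) C))"
      if un: "\<forall>e\<in>X. bdry ?q e \<notin> component_of (hcut ?q X) C"
    proof -
      have "\<forall>e\<in>X. bdry \<Gamma> e \<notin> component_of (hcut \<Gamma> X) v" using un by (simp add: c nc(5))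
      then have "j (component_of (hcut \<Gamma> X) v) = i (component_of (hcut \<Gamma> X) v)"
        using okX[OF v(1)] by (simp add: sub_ok_def)
      then show ?thesis unfolding c jval[OF v(1)] nc(4) .
    qed
    then show ?thesis using lq[OF C] unfolding sub_ok_def by (simp add: sub_quot_def eq)
  qed
  moreover have "cutset ?q X" using X by (auto simp: cutset_def sigma_closed_def)
  ultimately show "snd (merge_sub G (s, t)) \<in> subs T (sub_quot G (fst (merge_sub G (s, t))))"
    unfolding fm sm by (simp add: subs_def) (simp add: sub_quot_def eq)
  have "restrict (\<lambda>K. ?j (component_of (hcut \<Gamma> ?W) ` K)) (components (hcut \<Gamma> X)) = j"
  proof (rule extensionalityI[OF restrict_extensional jx])
    fix K assume K: "K \<in> components (hcut \<Gamma> X)"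
    then obtain v where v: "v \<in> verts \<Gamma>" "K = component_of (hcut \<Gamma> X) v" by (auto simp: components_eq)
    show "restrict (\<lambda>K. ?j (component_of (hcut \<Gamma> ?W) ` K)) (components (hcut \<Gamma> X)) K = j K"
      using K jval[OF v(1)] unfolding v(2) by simp
  qed
  moreover have "X \<union> Y - X = Y" using dis by blast
  ultimately show "split_sub G (merge_sub G (s, t)) = (s, t)"
    by (simp add: split_sub_def merge_sub_def eq sub_quot_def)
qed

text \<open>Further cuts cannot reconnect two ends that are already separated.\<close>

lemma bridge_hcut_mono:
  assumes "fgraph_wf \<Gamma>" "X \<subseteq> W" "sigma_closed \<Gamma> W" "e \<in> hedges \<Gamma>" "e \<notin> W" "bridge (hcut \<Gamma> X) e"
  shows "bridge (hcut \<Gamma> W) e"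
proof -
  have "X \<union> {e, sigma \<Gamma> e} \<union> W = W \<union> {e, sigma \<Gamma> e}" using assms(2) by blast
  then have "hcut (hcut \<Gamma> W) {e, sigma \<Gamma> e} = hcut (hcut (hcut \<Gamma> X) {e, sigma \<Gamma> e}) W"
    by (simp only: hcut_hcut)
  then have "component_of (hcut (hcut \<Gamma> W) {e, sigma \<Gamma> e}) (bdry \<Gamma> e) \<subseteq>
      component_of (hcut (hcut \<Gamma> X) {e, sigma \<Gamma> e}) (bdry \<Gamma> e)"
    by (simp only: component_hcut_subset)
  moreover have "e \<notin> X" using assms by auto
  ultimately show ?thesis using assms(5,6) by (auto simp: bridge_def)
qed

text \<open>The conditions on g must be recovered from those on h and on g/h. Residue types of g are
  those of g/h, and the absence of bridges is checked separately for the edges inside h and the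
  edges of g/h.\<close>

lemma split_subs:
  assumes T: "field_theory T" and G: "specified_graph T G"
    and s: "s \<in> subs T G" and t: "t \<in> subs T (sub_quot G s)"
  shows "fst (split_sub G (s, t)) \<in> subs T G"
    and "snd (split_sub G (s, t)) \<in> subs T (sub_graph G (fst (split_sub G (s, t))))"
    and "merge_sub G (split_sub G (s, t)) = (s, t)"
proof -
  obtain \<Gamma> i W k X j' where eq: "G = (\<Gamma>, i)" "s = (W, k)" "t = (X, j')" by (cases G, cases s, cases t)
  have wf: "fgraph_wf \<Gamma>" and loc: "\<And>v. v \<in> verts \<Gamma> \<Longrightarrow> local_spec T (\<Gamma>, i) v"
    using G by (auto simp: specified_graph_iff[OF T] eq)
  have W: "cutset \<Gamma> W" and okW: "\<And>v. v \<in> verts \<Gamma> \<Longrightarrow> sub_ok T (\<Gamma>, i) W k v"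
    and kx: "k \<in> extensional (components (hcut \<Gamma> W))" using s by (auto simp: subs_def eq)
  let ?q = "contracted \<Gamma> W k"
  have Xq: "cutset ?q X" and okq: "\<And>C. C \<in> components (hcut \<Gamma> W) \<Longrightarrow> sub_ok T (?q, \<lambda>C. i (\<Union>C)) X j' C"
    and jx: "j' \<in> extensional (components (hcut ?q X))"
    using t by (auto simp: subs_def eq sub_quot_def)
  have XW: "X \<subseteq> W" using cutsetD(2,3)[OF Xq] by auto
  have X: "cutset \<Gamma> X" using Xq cutsetD(3)[OF W] XW by (auto simp: cutset_def sigma_closed_def)
  note nc = nested_components[OF wf cutsetD(1)[OF X] cutsetD(1)[OF W] XW]
  note wfX = wf_hcut[OF wf cutsetD(1)[OF X]] and wfW = wf_hcut[OF wf cutsetD(1)[OF W]]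
  let ?c = "component_of (hcut \<Gamma> W)" and ?x = "component_of (hcut \<Gamma> X)"
  define j where "j = restrict (\<lambda>K. j' (?c ` K)) (components (hcut \<Gamma> X))"
  have jval: "j (?x v) = j' (?c ` ?x v)" if "v \<in> verts \<Gamma>" for v
    using that by (simp add: j_def components_eq)
  have sp: "split_sub G (s, t) = ((X, j), (W - X, k))" by (simp add: split_sub_def eq j_def)
  have lq: "local_spec T (hcut ?q X, j') (?c v)" if "v \<in> verts \<Gamma>" for v
    using okq[of "?c v"] that by (simp add: sub_ok_def components_eq)
  have lW: "local_spec T (hcut \<Gamma> W, k) v" if "v \<in> verts \<Gamma>" for v
    using okW[OF that] by (simp add: sub_ok_def)
  \<comment> \<open>A component of h that meets no half-edge of \<open>W - X\<close> is an isolated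
    vertex of g/h, whose specification must be its label, the value of \<open>k\<close>. This
    replaces the agreement of h and g on full components.\<close>
  have iso_q: "j' {?c v} = k (?c v)"
    if v: "v \<in> verts \<Gamma>" and un: "\<forall>e\<in>W - X. bdry \<Gamma> e \<notin> ?c v" for v
  proof -
    have "isolated (hcut ?q X) (?c v)"
      unfolding isolated_def
    proof (intro ballI impI)
      fix e assume e: "e \<in> hedges (hcut ?q X)" "bdry (hcut ?q X) e = ?c v"
      then have "bdry \<Gamma> e \<in> ?c v" using component_of_self[of "bdry \<Gamma> e" "hcut \<Gamma> W"] by simp
      then have "e \<notin> W - X" using un by blast
      then show "sigma (hcut ?q X) e = e" using e(1) by auto
    qed
    then show ?thesis using lq[OF v] by (simp add: local_spec_def)
  qed
  have okX: "sub_ok T (\<Gamma>, i) X j v" if v: "v \<in> verts \<Gamma>" for v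
  proof -
    have b: "\<not> bridge (hcut \<Gamma> X) e" if e: "e \<in> hedges \<Gamma>" for e
    proof -
      note u = wfD(5)[OF wf e]
      \<comment> \<open>A half-edge of g is external because it was cut, or it survives as an edge
        of g/h, or it is untouched by \<open>W\<close>. In the second case contraction preserves
        bridges, and in the third a bridge of g would be a bridge of h.\<close>
      consider "e \<in> X" | "e \<in> W" "e \<notin> X" | "e \<notin> W" by blast
      then show ?thesis
      proof cases
        case 1 then show ?thesis by (simp add: bridge_def)
      next
        case 2
        have "\<not> bridge (hcut ?q X) e"
          using lq[OF u] 2 e unfolding local_spec_def by auto
        then show ?thesis
          using bridge_contracted[OF wfX sigma_closed_hcut[OF cutsetD(1)[OF W]] 2(1), of k] by (simp add: nc(1))
      next
        case 3
        have "\<not> bridge (hcut \<Gamma> W) e" using lW[OF u] e unfolding local_spec_def by auto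
        then show ?thesis using bridge_hcut_mono[OF wf XW cutsetD(1)[OF W] e 3] by blast
      qed
    qed
    have rt: "(rtype (hcut \<Gamma> X) (?x v), j (?x v)) \<in> refined_types T"
      using lq[OF v] unfolding local_spec_def by (simp add: nc(3) nc(7) jval[OF v])
    have iso: "j {v} = vlab \<Gamma> v" if iso: "isolated (hcut \<Gamma> X) v"
    proof -
      have isoW: "isolated (hcut \<Gamma> W) v"
        unfolding isolated_def
      proof (intro ballI impI)
        fix e assume "e \<in> hedges (hcut \<Gamma> W)" "bdry (hcut \<Gamma> W) e = v"
        then have "sigma (hcut \<Gamma> X) e = e" using iso unfolding isolated_def by simp
        then show "sigma (hcut \<Gamma> W) e = e" using XW by (auto split: if_splits)
      qed
      have xv: "?x v = {v}" and cv: "?c v = {v}"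
        using component_of_isolated[OF iso] component_of_isolated[OF isoW] by auto
      have "\<forall>e\<in>W - X. bdry \<Gamma> e \<notin> ?c v"
        using iso cutsetD(2,3)[OF W] unfolding cv isolated_def by auto
      then have "j' {?c v} = k (?c v)" by (rule iso_q[OF v])
      moreover have "k {v} = vlab \<Gamma> v" using lW[OF v] isoW by (simp add: local_spec_def)
      ultimately show ?thesis using jval[OF v] by (simp add: xv cv)
    qed
    have l: "local_spec T (hcut \<Gamma> X, j) v"
      using loc[OF v] b rt iso unfolding local_spec_def by auto
    have "j (?x v) = i (?x v)" if un: "\<forall>e\<in>X. bdry \<Gamma> e \<notin> ?x v"
    proof -
      have "\<forall>e\<in>X. bdry ?q e \<notin> component_of (hcut ?q X) (?c v)" using un by (simp add: nc(3) nc(5))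
      then have "j' (component_of (hcut ?q X) (?c v)) = i (\<Union>(component_of (hcut ?q X) (?c v)))"
        using okq[of "?c v"] v by (simp add: sub_ok_def components_eq)
      then show ?thesis using jval[OF v] unfolding nc(3) nc(4) by simp
    qed
    then show ?thesis using l by (simp add: sub_ok_def)
  qed
  show "fst (split_sub G (s, t)) \<in> subs T G"
    using X okX unfolding sp by (simp add: subs_def eq j_def)
  have h: "hcut (hcut \<Gamma> X) (W - X) = hcut \<Gamma> W"
    using XW by (simp add: hcut_hcut Un_absorb1)
  have WX: "cutset (hcut \<Gamma> X) (W - X)"
  proof -
    have "sigma \<Gamma> e \<notin> X" if "e \<in> W - X" for e
      using that sigma_notin[OF wf cutsetD(1)[OF X]] cutsetD(3)[OF W] by blast
    then show ?thesis using W by (auto simp: cutset_def sigma_closed_def)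
  qed
  have "sub_ok T (hcut \<Gamma> X, j) (W - X) k v" if v: "v \<in> verts \<Gamma>" for v
  proof -
    \<comment> \<open>Such a component of h is a component of g as well, and contracting it gives
      the single vertex to which \<open>iso_q\<close> applies.\<close>
    have "k (?c v) = j (?c v)" if un: "\<forall>e\<in>W - X. bdry \<Gamma> e \<notin> ?c v"
    proof -
      have cx: "?c v = ?x v"
        using component_hcut_uncut[OF wfX cutsetD(1)[OF WX], of v] un by (simp add: h)
      have "j (?c v) = j' (?c ` ?c v)" using jval[OF v] by (simp add: cx)
      also have "?c ` ?c v = {?c v}" by (rule component_of_image[OF wfW])
      finally show ?thesis using iso_q[OF v un] by simp
    qed
    then show ?thesis using lW[OF v] by (simp add: sub_ok_def h)
  qed
  then show "snd (split_sub G (s, t)) \<in> subs T (sub_graph G (fst (split_sub G (s, t))))"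
    using WX kx unfolding sp by (simp add: subs_def sub_graph_def eq h)
  have "restrict (\<lambda>C. j (\<Union>C)) (components (hcut ?q X)) = j'"
  proof (rule extensionalityI[OF restrict_extensional jx])
    fix C assume C: "C \<in> components (hcut ?q X)"
    then obtain v where v: "v \<in> verts \<Gamma>" "C = ?c ` ?x v" by (auto simp: nc(6))
    have "\<Union>C = ?x v" unfolding v(2) by (rule nc(4))
    then show "restrict (\<lambda>C. j (\<Union>C)) (components (hcut ?q X)) C = j' C"
      using C jval[OF v(1)] v(2) by simp
  qed
  then show "merge_sub G (split_sub G (s, t)) = (s, t)"
    using XW unfolding sp by (simp add: merge_sub_def eq sub_quot_def Un_absorb1)
qed

lemma Union_image_Union: "\<Union>(Union ` K) = \<Union>(\<Union>K)"
  by blast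

text \<open>The first legs coincide as graphs. The second differ by the specification outside the
  components. In the third, the vertices of the iterated contraction are sets of sets, and
  \<open>Union\<close> flattens them to the vertices of G/g.\<close>

lemma merge_classes:
  assumes T: "field_theory T" and G: "specified_graph T G"
    and s: "s \<in> subs T G" and t: "t \<in> subs T (sub_graph G s)" and m: "merge_sub G (s, t) = (s', t')"
  shows "sub_graph (sub_graph G s) t = sub_graph G s'"
    and "iso_class (sub_quot (sub_graph G s) t) = iso_class (sub_graph (sub_quot G s') t')"
    and "iso_class (sub_quot G s) = iso_class (sub_quot (sub_quot G s') t')"
proof -
  obtain \<Gamma> i X j Y k where eq: "G = (\<Gamma>, i)" "s = (X, j)" "t = (Y, k)" by (cases G, cases s, cases t)
  let ?W = "X \<union> Y" and ?q = "contracted \<Gamma> (X \<union> Y) k"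
  define j' where "j' = restrict (\<lambda>C. j (\<Union>C)) (components (hcut ?q X))"
  have st: "s' = (?W, k)" "t' = (X, j')"
    using m by (simp_all add: merge_sub_def eq j'_def sub_quot_def)
  have wf: "fgraph_wf \<Gamma>" using G by (simp add: specified_graph_iff[OF T] eq)
  have X: "cutset \<Gamma> X" and Y: "cutset (hcut \<Gamma> X) Y"
    using s t by (auto simp: subs_def eq sub_graph_def)
  note W = cutset_cutset(2)[OF X Y]
  note nc = nested_components[OF wf cutsetD(1)[OF X] cutsetD(1)[OF W] Un_upper1]
  show "sub_graph (sub_graph G s) t = sub_graph G s'"
    by (simp add: sub_graph_def eq st hcut_hcut)
  have wq: "fgraph_wf ?q" by (rule wf_contracted[OF wf cutsetD(1)[OF W]])
  have Xq: "sigma_closed ?q X" using X by (auto simp: cutset_def sigma_closed_def)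
  have "sgraph_iso (hcut ?q X, \<lambda>C. j (\<Union>C)) (hcut ?q X, j')"
    by (rule sgraph_iso_identity) (simp_all add: j'_def)
  then show "iso_class (sub_quot (sub_graph G s) t) = iso_class (sub_graph (sub_quot G s') t')"
    using wf_hcut[OF wq Xq] by (intro iso_class_eqI) (simp_all add: sub_quot_def sub_graph_def eq st contracted_hcut)
  let ?c = "component_of (hcut \<Gamma> ?W)" and ?x = "component_of (hcut \<Gamma> X)"
  have bij: "bij_betw Union (components (hcut ?q X)) (components (hcut \<Gamma> X))"
  proof -
    have "components (hcut \<Gamma> X) = Union ` components (hcut ?q X)"
      by (simp only: nc(6) image_image nc(4)) (simp add: components_eq)
    moreover have "inj_on Union (components (hcut ?q X))"
      by (rule inj_onI) (auto simp: nc(6) nc(4))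
    ultimately show ?thesis by (simp add: bij_betw_def)
  qed
  have "sgraph_iso (sub_quot (sub_quot G s') t') (sub_quot G s)"
    unfolding sgraph_iso_def sub_quot_def eq st prod.case fst_conv snd_conv
  proof (intro exI[of _ Union] exI[of _ "\<lambda>e. e"] conjI)
    show "bij_betw Union (verts (contracted ?q X j')) (verts (contracted \<Gamma> X j))" using bij by simp
    show "bij_betw (\<lambda>e. e) (hedges (contracted ?q X j')) (hedges (contracted \<Gamma> X j))"
      by (auto simp: bij_betw_def)
  qed (simp_all add: nc(3) nc(4) Union_image_Union j'_def)
  moreover have "wfg (sub_quot (sub_quot G s') t')"
    using wf_contracted[OF wq Xq] by (simp add: sub_quot_def eq st)
  ultimately show "iso_class (sub_quot G s) = iso_class (sub_quot (sub_quot G s') t')"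
    using iso_class_eqI by metis
qed

text \<open>The left sum runs over chains, the right one over pairs of a subgraph and a subgraph of
  its contraction. \<open>merge_sub\<close> and \<open>split_sub\<close> exchange the index sets,
  and \<open>merge_classes\<close> matches the terms.\<close>

lemma copr_coassoc:
  assumes T: "field_theory T" and G: "specified_graph T G"
  shows "(\<Sum>s\<in>subs T G. \<Sum>t\<in>subs T (sub_graph G s). Poly_Mapping.single (iso_class (sub_graph (sub_graph G s) t),
      iso_class (sub_quot (sub_graph G s) t), iso_class (sub_quot G s)) (1::complex)) =
    (\<Sum>s\<in>subs T G. \<Sum>t\<in>subs T (sub_quot G s). Poly_Mapping.single (iso_class (sub_graph G s),
      iso_class (sub_graph (sub_quot G s) t), iso_class (sub_quot (sub_quot G s) t)) 1)"
proof -
  have wf: "wfg G" using G by (simp add: specified_graph_iff[OF T])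
  have f0: "finite (subs T G)" by (rule finite_subs[OF T wf])
  have f1: "\<forall>s\<in>subs T G. finite (subs T (sub_graph G s))"
    by (intro ballI finite_subs[OF T]) (simp add: specified_sub_graph[OF T wf] specified_graph_iff[OF T, THEN iffD1])
  have f2: "\<forall>s\<in>subs T G. finite (subs T (sub_quot G s))"
    by (intro ballI finite_subs[OF T]) (simp add: specified_sub_quot[OF T G] specified_graph_iff[OF T, THEN iffD1])
  show ?thesis
    unfolding sum.Sigma[OF f0 f1] sum.Sigma[OF f0 f2]
  proof (rule sum.reindex_bij_witness[of _ "split_sub G" "merge_sub G"])
    fix a assume "a \<in> (SIGMA s:subs T G. subs T (sub_graph G s))"
    then obtain s t where a: "a = (s, t)" "s \<in> subs T G" "t \<in> subs T (sub_graph G s)" by auto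
    obtain s' t' where m: "merge_sub G (s, t) = (s', t')" by (cases "merge_sub G (s, t)")
    note ms = merge_subs[OF T G a(2,3)] and mc = merge_classes[OF T G a(2,3) m]
    show "split_sub G (merge_sub G a) = a" using ms(3) by (simp add: a)
    show "merge_sub G a \<in> (SIGMA s:subs T G. subs T (sub_quot G s))" using ms(1,2) by (simp add: a m)
    show "(case merge_sub G a of (s, t) \<Rightarrow> Poly_Mapping.single (iso_class (sub_graph G s),
        iso_class (sub_graph (sub_quot G s) t), iso_class (sub_quot (sub_quot G s) t)) 1) =
      (case a of (s, t) \<Rightarrow> Poly_Mapping.single (iso_class (sub_graph (sub_graph G s) t),
        iso_class (sub_quot (sub_graph G s) t), iso_class (sub_quot G s)) (1::complex))"
      by (simp add: a m mc)
  next
    fix b assume "b \<in> (SIGMA s:subs T G. subs T (sub_quot G s))"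
    then obtain s t where b: "b = (s, t)" "s \<in> subs T G" "t \<in> subs T (sub_quot G s)" by auto
    note ss = split_subs[OF T G b(2,3)]
    show "merge_sub G (split_sub G b) = b" using ss(3) by (simp add: b)
    show "split_sub G b \<in> (SIGMA s:subs T G. subs T (sub_graph G s))"
      using ss(1,2) by (cases "split_sub G (s, t)") (simp add: b)
  qed
qed

section \<open>The counit\<close>

definition trivial_graph :: "('v, 'h, 'ty) sgraph \<Rightarrow> bool" where
  "trivial_graph G \<longleftrightarrow> (\<forall>e\<in>hedges (fst G). sigma (fst G) e = e)"

lemma trivial_iff_internal: "trivial_graph G \<longleftrightarrow> internal (fst G) = {}"
  by (auto simp: trivial_graph_def internal_def)

definition nonfixed :: "('v, 'h, 'ty, 'm) fgraph_scheme \<Rightarrow> 'h set" where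
  "nonfixed \<Gamma> = {e \<in> hedges \<Gamma>. sigma \<Gamma> e \<noteq> e}"

text \<open>All components are single vertices, recovered by \<open>the_elem\<close>, and the
  specification of an isolated vertex is forced to be its label.\<close>

definition skeleton_sub :: "('v, 'h, 'ty) sgraph \<Rightarrow> 'h set \<times> ('v set \<Rightarrow> nat)" where
  "skeleton_sub G = (nonfixed (fst G),
     restrict (\<lambda>K. vlab (fst G) (the_elem K)) (components (hcut (fst G) (nonfixed (fst G)))))"

text \<open>The specification is restricted in order to be extensional, so that the resulting graph
  agrees with \<open>G\<close> only up to isomorphism.\<close>

definition full_sub :: "('v, 'h, 'ty) sgraph \<Rightarrow> 'h set \<times> ('v set \<Rightarrow> nat)" where
  "full_sub G = ({}, restrict (snd G) (components (fst G)))"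

lemma cutset_nonfixed: "fgraph_wf \<Gamma> \<Longrightarrow> cutset \<Gamma> (nonfixed \<Gamma>)"
  by (auto simp: cutset_def sigma_closed_def nonfixed_def wfD)

lemma isolated_nonfixed: "isolated (hcut \<Gamma> (nonfixed \<Gamma>)) v"
  by (auto simp: isolated_def nonfixed_def)

lemma component_nonfixed: "component_of (hcut \<Gamma> (nonfixed \<Gamma>)) v = {v}"
  by (rule component_of_isolated[OF isolated_nonfixed])

lemma components_nonfixed: "components (hcut \<Gamma> (nonfixed \<Gamma>)) = (\<lambda>v. {v}) ` verts \<Gamma>"
  by (simp add: components_eq component_nonfixed)

lemma skeleton_sub_mem:
  assumes T: "field_theory T" and G: "specified_graph T G"
  shows "skeleton_sub G \<in> subs T G"
proof -
  obtain \<Gamma> i where eq: "G = (\<Gamma>, i)" by (cases G)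
  have wf: "fgraph_wf \<Gamma>" and loc: "\<And>v. v \<in> verts \<Gamma> \<Longrightarrow> local_spec T (\<Gamma>, i) v"
    using G by (auto simp: specified_graph_iff[OF T] eq)
  let ?X = "nonfixed \<Gamma>"
  define j where "j = snd (skeleton_sub G)"
  have j: "j {v} = vlab \<Gamma> v" if "v \<in> verts \<Gamma>" for v
    using that by (simp add: j_def skeleton_sub_def eq components_nonfixed)
  have "sub_ok T (\<Gamma>, i) ?X j v" if v: "v \<in> verts \<Gamma>" for v
  proof -
    have r: "rtype (hcut \<Gamma> ?X) {v} = vtype \<Gamma> v"
      unfolding rtype_def vtype_def by (intro ext arg_cong[where f=card]) (auto simp: nonfixed_def)
    have b: "\<not> bridge (hcut \<Gamma> ?X) e" if "e \<in> hedges \<Gamma>" for e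
      using that by (simp add: bridge_def nonfixed_def)
    have l: "local_spec T (hcut \<Gamma> ?X, j) v"
      using loc[OF v] j[OF v] b unfolding local_spec_def by (auto simp: component_nonfixed r)
    \<comment> \<open>A vertex that meets no cut half-edge was isolated in \<open>\<Gamma>\<close>
      already, where the specification of \<open>G\<close> is the label too.\<close>
    have "j {v} = i {v}" if un: "\<forall>e\<in>?X. bdry \<Gamma> e \<notin> {v}"
    proof -
      have "isolated \<Gamma> v" using un by (auto simp: isolated_def nonfixed_def)
      then show ?thesis using loc[OF v] j[OF v] by (simp add: local_spec_def)
    qed
    then show ?thesis using l by (simp add: sub_ok_def component_nonfixed)
  qed
  moreover have "skeleton_sub G = (?X, j)" by (simp add: j_def skeleton_sub_def eq)
  moreover have "j \<in> extensional (components (hcut \<Gamma> ?X))" by (simp add: j_def skeleton_sub_def eq)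
  ultimately show ?thesis using cutset_nonfixed[OF wf] by (simp add: subs_def eq)
qed

text \<open>Without internal edges everything internal has been cut, and the condition at isolated
  vertices leaves no choice of specification. In the left counit law this singles out one
  term.\<close>

lemma trivial_sub_graph:
  assumes wf: "wfg G" and s: "s \<in> subs T G"
  shows "trivial_graph (sub_graph G s) \<longleftrightarrow> s = skeleton_sub G"
proof -
  obtain \<Gamma> i X j where eq: "G = (\<Gamma>, i)" "s = (X, j)" by (cases G, cases s)
  have X: "cutset \<Gamma> X" and ok: "\<And>v. v \<in> verts \<Gamma> \<Longrightarrow> sub_ok T (\<Gamma>, i) X j v"
    and jx: "j \<in> extensional (components (hcut \<Gamma> X))" using s by (auto simp: subs_def eq)
  show ?thesis
  proof
    assume "trivial_graph (sub_graph G s)"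
    then have X': "X = nonfixed \<Gamma>"
      using cutsetD(2,3)[OF X] by (auto simp: trivial_graph_def sub_graph_def eq nonfixed_def split: if_splits)
    have "j = snd (skeleton_sub G)"
    proof (rule extensionalityI[OF jx])
      show "snd (skeleton_sub G) \<in> extensional (components (hcut \<Gamma> X))" by (simp add: skeleton_sub_def eq X')
      fix K assume "K \<in> components (hcut \<Gamma> X)"
      then obtain v where v: "v \<in> verts \<Gamma>" "K = {v}" by (auto simp: X' components_nonfixed)
      have "j {v} = vlab \<Gamma> v"
        using ok[OF v(1)] isolated_nonfixed[of \<Gamma> v] by (simp add: sub_ok_def local_spec_def X')
      then show "j K = snd (skeleton_sub G) K" using v by (simp add: skeleton_sub_def eq components_nonfixed)
    qed
    then show "s = skeleton_sub G" by (simp add: eq X' skeleton_sub_def)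
  next
    assume "s = skeleton_sub G"
    then show "trivial_graph (sub_graph G s)"
      by (auto simp: trivial_graph_def sub_graph_def skeleton_sub_def nonfixed_def)
  qed
qed

text \<open>Contracting the skeleton merely renames each vertex \<open>v\<close> to
  \<open>{v}\<close>.\<close>

lemma iso_quot_nonfixed:
  assumes wf: "wfg G" and j: "\<And>v. v \<in> vs G \<Longrightarrow> j {v} = vlab (fst G) v"
  shows "sgraph_iso G (sub_quot G (nonfixed (fst G), j))"
proof -
  obtain \<Gamma> i where eq: "G = (\<Gamma>, i)" by (cases G)
  have h: "{e \<in> hedges \<Gamma>. e \<in> nonfixed \<Gamma> \<or> sigma \<Gamma> e = e} = hedges \<Gamma>" by (auto simp: nonfixed_def)
  have u: "\<Union>((\<lambda>v. {v}) ` K) = K" for K :: "'a set" by blast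
  show ?thesis
    unfolding sgraph_iso_def sub_quot_def eq prod.case
    by (intro exI[of _ "\<lambda>v. {v}"] exI[of _ "\<lambda>e. e"])
      (use j in \<open>simp add: eq h u components_nonfixed component_nonfixed bij_betw_def\<close>)
qed

lemma full_sub_mem:
  assumes T: "field_theory T" and G: "specified_graph T G"
  shows "full_sub G \<in> subs T G"
proof -
  obtain \<Gamma> i where eq: "G = (\<Gamma>, i)" by (cases G)
  have loc: "\<And>v. v \<in> verts \<Gamma> \<Longrightarrow> local_spec T (\<Gamma>, i) v"
    using G by (auto simp: specified_graph_iff[OF T] eq)
  have "sub_ok T (\<Gamma>, i) {} (restrict i (components \<Gamma>)) v" if v: "v \<in> verts \<Gamma>" for v
  proof -
    have "component_of \<Gamma> v \<in> components \<Gamma>" using v by (simp add: components_eq)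
    then show ?thesis
      using loc[OF v] local_spec_cong[of "restrict i (components \<Gamma>)" \<Gamma> v i T] by (simp add: sub_ok_def)
  qed
  then show ?thesis by (simp add: full_sub_def eq subs_def cutset_def sigma_closed_def)
qed

lemma iso_full_sub: "sgraph_iso (sub_graph G (full_sub G)) G"
  by (cases G) (simp add: sub_graph_def full_sub_def sgraph_iso_identity)

text \<open>The internal edges of the contraction are the cut ones. If there are none, every
  component is full, which determines the specification. In the right counit law this singles out
  one term.\<close>

lemma trivial_sub_quot:
  assumes s: "s \<in> subs T G"
  shows "trivial_graph (sub_quot G s) \<longleftrightarrow> s = full_sub G"
proof -
  obtain \<Gamma> i X j where eq: "G = (\<Gamma>, i)" "s = (X, j)" by (cases G, cases s)
  have X: "cutset \<Gamma> X" and ok: "\<And>v. v \<in> verts \<Gamma> \<Longrightarrow> sub_ok T (\<Gamma>, i) X j v"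
    and jx: "j \<in> extensional (components (hcut \<Gamma> X))" using s by (auto simp: subs_def eq)
  show ?thesis
  proof
    assume "trivial_graph (sub_quot G s)"
    then have X': "X = {}"
      using cutsetD(2,3)[OF X] by (auto simp: trivial_graph_def sub_quot_def eq)
    have "j = restrict i (components \<Gamma>)"
    proof (rule extensionalityI)
      show "j \<in> extensional (components \<Gamma>)" using jx by (simp add: X')
      fix K assume K: "K \<in> components \<Gamma>"
      then obtain v where v: "v \<in> verts \<Gamma>" "K = component_of \<Gamma> v" by (auto simp: components_eq)
      show "j K = restrict i (components \<Gamma>) K" using ok[OF v(1)] K v(2) by (simp add: sub_ok_def X')
    qed simp
    then show "s = full_sub G" by (simp add: eq X' full_sub_def)
  next
    assume "s = full_sub G"
    then show "trivial_graph (sub_quot G s)"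
      by (auto simp: trivial_graph_def sub_quot_def full_sub_def)
  qed
qed

section \<open>The loop number\<close>

text \<open>Internal edges are disjoint pairs of half-edges. Counting half-edges instead of pairs
  makes the later cardinality arguments statements about plain sets, at the price of doubling the
  loop number.\<close>

lemma card_nonfixed:
  assumes wf: "fgraph_wf \<Gamma>"
  shows "card (nonfixed \<Gamma>) = 2 * card (internal \<Gamma>)"
proof -
  have i: "internal \<Gamma> = (\<lambda>e. {e, sigma \<Gamma> e}) ` nonfixed \<Gamma>" by (auto simp: internal_def nonfixed_def)
  have fin: "finite (nonfixed \<Gamma>)" using wfD(2)[OF wf] by (simp add: nonfixed_def)
  have u: "\<Union>(internal \<Gamma>) = nonfixed \<Gamma>" using wfD(3,4)[OF wf] by (auto simp: internal_def nonfixed_def)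
  have "2 * card (internal \<Gamma>) = card (\<Union>(internal \<Gamma>))"
  proof (rule card_partition)
    show "finite (internal \<Gamma>)" using fin by (simp add: i)
    show "finite (\<Union>(internal \<Gamma>))" using fin by (simp add: u)
    show "card c = 2" if "c \<in> internal \<Gamma>" for c using that by (auto simp: internal_def)
    show "c \<inter> d = {}" if cd: "c \<in> internal \<Gamma>" "d \<in> internal \<Gamma>" "c \<noteq> d" for c d
    proof (rule ccontr)
      assume "c \<inter> d \<noteq> {}"
      then obtain x where x: "x \<in> c" "x \<in> d" by blast
      have "c = {x, sigma \<Gamma> x}" if "c \<in> internal \<Gamma>" "x \<in> c" for c
        using that wfD(4)[OF wf] by (auto simp: internal_def)
      from this[OF cd(1) x(1)] this[OF cd(2) x(2)] show False using cd(3) by simp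
    qed
  qed
  then show ?thesis by (simp add: u)
qed

lemma loop_number_eq:
  "fgraph_wf \<Gamma> \<Longrightarrow> 2 * loop_number \<Gamma> =
    int (card (nonfixed \<Gamma>)) - 2 * int (card (verts \<Gamma>)) + 2 * int (card (components \<Gamma>))"
  by (simp add: loop_number_def card_nonfixed)

lemma finite_nonfixed: "fgraph_wf \<Gamma> \<Longrightarrow> finite (nonfixed \<Gamma>)"
  by (simp add: nonfixed_def wfD)

lemma loop_number_cover:
  assumes wf: "wfg G1" "wfg G2" "wfg G" and c: "cover f1v f1h G1 f2v f2h G2 G"
  shows "loop_number (fst G) = loop_number (fst G1) + loop_number (fst G2)"
proof -
  have s: "semb f1v f1h G1 G" "semb f2v f2h G2 G" and dis: "f1v ` vs G1 \<inter> f2v ` vs G2 = {}"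
    and cov: "vs G = f1v ` vs G1 \<union> f2v ` vs G2" using c by (auto simp: cover_def)
  note e1 = semb_emb[OF s(1)] and e2 = semb_emb[OF s(2)]
  let ?\<Gamma> = "fst G" and ?\<Gamma>1 = "fst G1" and ?\<Gamma>2 = "fst G2"
  have v: "card (vs G) = card (vs G1) + card (vs G2)"
    unfolding cov using dis wfD(1)[OF wf(1)] wfD(1)[OF wf(2)]
    by (simp add: card_Un_disjoint card_image embD(1)[OF e1] embD(1)[OF e2])
  have nf: "f1h ` nonfixed ?\<Gamma>1 = {e \<in> nonfixed ?\<Gamma>. bdry ?\<Gamma> e \<in> f1v ` vs G1}"
    "f2h ` nonfixed ?\<Gamma>2 = {e \<in> nonfixed ?\<Gamma>. bdry ?\<Gamma> e \<in> f2v ` vs G2}"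
    using emb_hedges_at[OF wf(1) e1 order_refl, of "\<lambda>e. sigma ?\<Gamma> e \<noteq> e" "\<lambda>e. sigma ?\<Gamma>1 e \<noteq> e"]
      emb_hedges_at[OF wf(2) e2 order_refl, of "\<lambda>e. sigma ?\<Gamma> e \<noteq> e" "\<lambda>e. sigma ?\<Gamma>2 e \<noteq> e"]
      wfD(5)[OF wf(1)] wfD(5)[OF wf(2)]
    by (auto simp: nonfixed_def embD(5)[OF e1] embD(5)[OF e2] emb_fh_eq[OF wf(1) e1] emb_fh_eq[OF wf(2) e2]
        wfD(3)[OF wf(1)] wfD(3)[OF wf(2)])
  have "nonfixed ?\<Gamma> = f1h ` nonfixed ?\<Gamma>1 \<union> f2h ` nonfixed ?\<Gamma>2"
    unfolding nf using wfD(5)[OF wf(3)] cov by (auto simp: nonfixed_def)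
  moreover have "f1h ` nonfixed ?\<Gamma>1 \<inter> f2h ` nonfixed ?\<Gamma>2 = {}" unfolding nf using dis by auto
  moreover have "inj_on f1h (nonfixed ?\<Gamma>1)" "inj_on f2h (nonfixed ?\<Gamma>2)"
    using embD(3)[OF e1] embD(3)[OF e2] by (auto simp: nonfixed_def intro: inj_on_subset)
  ultimately have n: "card (nonfixed ?\<Gamma>) = card (nonfixed ?\<Gamma>1) + card (nonfixed ?\<Gamma>2)"
    using finite_nonfixed[OF wf(1)] finite_nonfixed[OF wf(2)] by (simp add: card_Un_disjoint card_image)
  have c1: "component_of ?\<Gamma> (f1v v) = f1v ` component_of ?\<Gamma>1 v" if "v \<in> vs G1" for v
    using emb_component[OF wf(1) e1 that] .
  have c2: "component_of ?\<Gamma> (f2v v) = f2v ` component_of ?\<Gamma>2 v" if "v \<in> vs G2" for v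
    using emb_component[OF wf(2) e2 that] .
  have "components ?\<Gamma> = (`) f1v ` components ?\<Gamma>1 \<union> (`) f2v ` components ?\<Gamma>2"
    unfolding components_eq cov image_Un image_image by (intro arg_cong2[where f="(\<union>)"] image_cong refl c1 c2)
  moreover have "(`) f1v ` components ?\<Gamma>1 \<inter> (`) f2v ` components ?\<Gamma>2 = {}"
  proof (rule ccontr)
    assume "(`) f1v ` components ?\<Gamma>1 \<inter> (`) f2v ` components ?\<Gamma>2 \<noteq> {}"
    then obtain K L where K: "K \<in> components ?\<Gamma>1" "L \<in> components ?\<Gamma>2" "f1v ` K = f2v ` L" by auto
    obtain x where "x \<in> K" using component_nonempty[OF K(1)] by blast
    then have "f1v x \<in> f1v ` vs G1" "f1v x \<in> f2v ` L"
      using components_subset[OF wf(1) K(1)] unfolding K(3)[symmetric] by auto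
    then show False using components_subset[OF wf(2) K(2)] dis by blast
  qed
  moreover have "inj_on ((`) f1v) (components ?\<Gamma>1)"
    by (rule inj_on_subset[OF inj_on_image_Pow[OF embD(1)[OF e1]]]) (use components_subset[OF wf(1)] in auto)
  moreover have "inj_on ((`) f2v) (components ?\<Gamma>2)"
    by (rule inj_on_subset[OF inj_on_image_Pow[OF embD(1)[OF e2]]]) (use components_subset[OF wf(2)] in auto)
  ultimately have k: "card (components ?\<Gamma>) = card (components ?\<Gamma>1) + card (components ?\<Gamma>2)"
    using finite_components[OF wf(1)] finite_components[OF wf(2)] by (simp add: card_Un_disjoint card_image)
  show ?thesis
    using loop_number_eq[OF wf(1)] loop_number_eq[OF wf(2)] loop_number_eq[OF wf(3)] v n k by simp
qed

lemma loop_number_empty: "loop_number (fst empty_sgraph) = 0"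
  by (simp add: loop_number_def internal_def components_eq)

lemma loop_number_iso:
  assumes wf: "wfg G" and iso: "sgraph_iso G G'"
  shows "loop_number (fst G') = loop_number (fst G)"
proof -
  note wf' = sgraph_iso_wf[OF wf iso]
  obtain fv fh where "semb fv fh G G'" "fv ` vs G = vs G'" using iso sgraph_iso_iff[OF wf wf'] by blast
  from loop_number_cover[OF wf wf_empty_sgraph wf' cover_empty[OF this]] show ?thesis
    by (simp add: loop_number_empty)
qed

text \<open>Internal half-edges are split into the uncut ones, in the subgraph, and the cut ones, in
  the contraction. The components of the subgraph are the vertices of the contraction, so these two
  counts cancel, and the components of the contraction correspond to those of
  \<open>G\<close>.\<close>

lemma loop_number_sub:
  assumes wf: "wfg G" and s: "s \<in> subs T G"
  shows "loop_number (fst (sub_graph G s)) + loop_number (fst (sub_quot G s)) = loop_number (fst G)"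
proof -
  obtain \<Gamma> i X j where eq: "G = (\<Gamma>, i)" "s = (X, j)" by (cases G, cases s)
  have wf: "fgraph_wf \<Gamma>" and X: "cutset \<Gamma> X" using wf s by (auto simp: eq subs_def)
  note sc = cutsetD(1)[OF X]
  let ?q = "contracted \<Gamma> X j"
  have "nonfixed \<Gamma> = nonfixed (hcut \<Gamma> X) \<union> X" "nonfixed (hcut \<Gamma> X) \<inter> X = {}" "nonfixed ?q = X"
    using cutsetD(2,3)[OF X] by (auto simp: nonfixed_def)
  moreover have "finite X" using wfD(2)[OF wf] cutsetD(3)[OF X] by (meson finite_subset subsetI)
  ultimately have n: "card (nonfixed \<Gamma>) = card (nonfixed (hcut \<Gamma> X)) + card (nonfixed ?q)"
    using finite_nonfixed[OF wf_hcut[OF wf sc]] by (simp add: card_Un_disjoint)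
  have "components ?q = (`) (component_of (hcut \<Gamma> X)) ` components \<Gamma>"
    unfolding components_eq[of ?q] by (simp add: components_eq image_image component_contracted[OF wf sc])
  moreover have "inj_on ((`) (component_of (hcut \<Gamma> X))) (components \<Gamma>)"
  proof (rule inj_onI)
    fix K L assume KL: "K \<in> components \<Gamma>" "L \<in> components \<Gamma>"
      "component_of (hcut \<Gamma> X) ` K = component_of (hcut \<Gamma> X) ` L"
    have "\<Union>(component_of (hcut \<Gamma> X) ` M) = M" if MM: "M \<in> components \<Gamma>" for M
    proof -
      obtain v where "M = component_of \<Gamma> v" using MM by (auto simp: components_eq)
      then show ?thesis by (simp only: Union_component_contracted[OF wf sc])
    qed
    then show "K = L" using KL by metis
  qed
  ultimately have "card (components ?q) = card (components \<Gamma>)" by (simp add: card_image)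
  then show ?thesis
    using loop_number_eq[OF wf] loop_number_eq[OF wf_hcut[OF wf sc]] loop_number_eq[OF wf_contracted[OF wf sc, of j]] n
    by (simp add: eq sub_graph_def sub_quot_def)
qed

section \<open>Cutting one edge, and nonnegativity of the loop number\<close>

lemma nonfixed_hcut_edge:
  assumes wf: "fgraph_wf \<Gamma>" and e: "e \<in> nonfixed \<Gamma>"
  shows "card (nonfixed \<Gamma>) = card (nonfixed (hcut \<Gamma> {e, sigma \<Gamma> e})) + 2"
proof -
  have eh: "e \<in> hedges \<Gamma>" "sigma \<Gamma> e \<noteq> e" using e by (auto simp: nonfixed_def)
  have u: "nonfixed \<Gamma> = nonfixed (hcut \<Gamma> {e, sigma \<Gamma> e}) \<union> {e, sigma \<Gamma> e}"
    and d: "nonfixed (hcut \<Gamma> {e, sigma \<Gamma> e}) \<inter> {e, sigma \<Gamma> e} = {}"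
    using eh wfD(3,4)[OF wf eh(1)] by (auto simp: nonfixed_def)
  have "card {e, sigma \<Gamma> e} = 2" using eh(2) by auto
  moreover have "card (nonfixed \<Gamma>) = card (nonfixed (hcut \<Gamma> {e, sigma \<Gamma> e})) + card {e, sigma \<Gamma> e}"
    unfolding u by (rule card_Un_disjoint[OF finite_nonfixed[OF wf_hcut[OF wf sigma_closed_edge[OF wf eh(1)]]] _ d]) simp
  ultimately show ?thesis by simp
qed

text \<open>Only the component that contains the edge can split, and each of its vertices stays
  connected to one of the two ends.\<close>

lemma components_hcut_edge:
  assumes wf: "fgraph_wf \<Gamma>" and e: "e \<in> hedges \<Gamma>"
  shows "card (components (hcut \<Gamma> {e, sigma \<Gamma> e})) \<le> card (components \<Gamma>) + 1"
proof -
  let ?X = "{e, sigma \<Gamma> e}" and ?a = "bdry \<Gamma> e" and ?b = "bdry \<Gamma> (sigma \<Gamma> e)"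
  let ?c = "component_of (hcut \<Gamma> ?X)"
  note sc = sigma_closed_edge[OF wf e]
  note wf' = wf_hcut[OF wf sc]
  have ab: "component_of \<Gamma> ?b = component_of \<Gamma> ?a" by (rule bdry_sigma_component[OF wf e])
  have cover: "component_of \<Gamma> ?a \<subseteq> ?c ?a \<union> ?c ?b"
  proof (rule component_of_least)
    fix f assume f: "f \<in> hedges \<Gamma>" "bdry \<Gamma> f \<in> ?c ?a \<union> ?c ?b"
    show "bdry \<Gamma> (sigma \<Gamma> f) \<in> ?c ?a \<union> ?c ?b"
    proof (cases "f \<in> ?X")
      case True then show ?thesis using wfD(4)[OF wf e] by auto
    next
      case False
      then have "?c (bdry \<Gamma> (sigma \<Gamma> f)) = ?c (bdry \<Gamma> f)" using bdry_sigma_component[OF wf', of f] f(1) by simp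
      then have "bdry \<Gamma> (sigma \<Gamma> f) \<in> ?c (bdry \<Gamma> f)" using component_of_self[of "bdry \<Gamma> (sigma \<Gamma> f)" "hcut \<Gamma> ?X"] by simp
      moreover have "?c (bdry \<Gamma> f) = ?c ?a \<or> ?c (bdry \<Gamma> f) = ?c ?b" using f(2) component_of_eqI[OF wf'] by blast
      ultimately show ?thesis by auto
    qed
  qed simp
  have sub: "components (hcut \<Gamma> ?X) \<subseteq> (components \<Gamma> - {component_of \<Gamma> ?a}) \<union> {?c ?a, ?c ?b}"
  proof
    fix K assume "K \<in> components (hcut \<Gamma> ?X)"
    then obtain v where v: "v \<in> verts \<Gamma>" "K = ?c v" by (auto simp: components_eq)
    show "K \<in> (components \<Gamma> - {component_of \<Gamma> ?a}) \<union> {?c ?a, ?c ?b}"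
    proof (cases "v \<in> component_of \<Gamma> ?a")
      case True
      then have "v \<in> ?c ?a \<or> v \<in> ?c ?b" using cover by auto
      then show ?thesis using component_of_eqI[OF wf'] v(2) by auto
    next
      case False
      have ne: "component_of \<Gamma> v \<noteq> component_of \<Gamma> ?a" using False component_of_self[of v \<Gamma>] by auto
      have "bdry \<Gamma> f \<notin> ?c v" if "f \<in> ?X" for f
      proof
        assume "bdry \<Gamma> f \<in> ?c v"
        then have "bdry \<Gamma> f \<in> component_of \<Gamma> v" by (rule subsetD[OF component_hcut_subset])
        then have "component_of \<Gamma> (bdry \<Gamma> f) = component_of \<Gamma> v" by (rule component_of_eqI[OF wf])
        then show False using ne that ab by auto
      qed
      then have "?c v = component_of \<Gamma> v" by (rule component_hcut_uncut[OF wf sc])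
      then show ?thesis using v ne by (simp add: components_eq)
    qed
  qed
  have fin: "finite (components \<Gamma>)" by (rule finite_components[OF wf])
  have a: "component_of \<Gamma> ?a \<in> components \<Gamma>" using wfD(5)[OF wf e] by (simp add: components_eq)
  then have pos: "card (components \<Gamma>) > 0" using fin card_gt_0_iff by blast
  have "card (components (hcut \<Gamma> ?X)) \<le> card ((components \<Gamma> - {component_of \<Gamma> ?a}) \<union> {?c ?a, ?c ?b})"
    by (rule card_mono[OF _ sub]) (simp add: fin)
  also have "\<dots> \<le> card (components \<Gamma> - {component_of \<Gamma> ?a}) + card {?c ?a, ?c ?b}" by (rule card_Un_le)
  also have "card {?c ?a, ?c ?b} \<le> 2" by (simp add: card_insert_if)
  finally show ?thesis using a fin pos by simp
qed

lemma components_trivial: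
  "nonfixed \<Gamma> = {} \<Longrightarrow> components \<Gamma> = (\<lambda>v. {v}) ` verts \<Gamma>"
  using components_nonfixed[of \<Gamma>] by simp

lemma loop_number_trivial:
  assumes "fgraph_wf \<Gamma>" "nonfixed \<Gamma> = {}"
  shows "loop_number \<Gamma> = 0"
  using loop_number_eq[OF assms(1)] components_trivial[OF assms(2)] assms(2) by (simp add: card_image)

text \<open>Cutting an edge removes one internal edge and adds at most one component, so it never
  raises the loop number; without internal edges the number is 0.\<close>

lemma loop_number_nonneg: "fgraph_wf \<Gamma> \<Longrightarrow> loop_number \<Gamma> \<ge> 0"
proof (induction "card (nonfixed \<Gamma>)" arbitrary: \<Gamma> rule: less_induct)
  case less
  show ?case
  proof (cases "nonfixed \<Gamma> = {}")
    case True then show ?thesis using loop_number_trivial[OF less.prems] by simp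
  next
    case False
    then obtain e where e: "e \<in> nonfixed \<Gamma>" by auto
    then have eh: "e \<in> hedges \<Gamma>" by (simp add: nonfixed_def)
    let ?\<Gamma> = "hcut \<Gamma> {e, sigma \<Gamma> e}"
    note wf' = wf_hcut[OF less.prems sigma_closed_edge[OF less.prems eh]]
    have "loop_number ?\<Gamma> \<ge> 0" using less.hyps[of ?\<Gamma>] nonfixed_hcut_edge[OF less.prems e] wf' by simp
    then show ?thesis
      using loop_number_eq[OF less.prems] loop_number_eq[OF wf'] nonfixed_hcut_edge[OF less.prems e]
        components_hcut_edge[OF less.prems eh] by simp
  qed
qed

lemma trivial_iff_nonfixed: "trivial_graph G \<longleftrightarrow> nonfixed (fst G) = {}"
  by (auto simp: trivial_graph_def nonfixed_def)

text \<open>Cutting an internal edge that is not a bridge keeps the components and so lowers the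
  loop number by one, which is impossible at 0 by nonnegativity.\<close>

lemma loop_number_zero_iff:
  assumes T: "field_theory T" and G: "specified_graph T G"
  shows "loop_number (fst G) = 0 \<longleftrightarrow> trivial_graph G"
proof
  have wf: "wfg G" and loc: "\<And>v. v \<in> vs G \<Longrightarrow> local_spec T G v"
    using G by (auto simp: specified_graph_iff[OF T])
  show "trivial_graph G \<Longrightarrow> loop_number (fst G) = 0"
    using loop_number_trivial[OF wf] by (simp add: trivial_iff_nonfixed)
  assume L: "loop_number (fst G) = 0"
  show "trivial_graph G"
  proof (rule ccontr)
    assume "\<not> trivial_graph G"
    then obtain e where e: "e \<in> nonfixed (fst G)" by (auto simp: trivial_iff_nonfixed)
    then have eh: "e \<in> hedges (fst G)" "sigma (fst G) e \<noteq> e" by (auto simp: nonfixed_def)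
    have "\<not> bridge (fst G) e" using loc[OF wfD(5)[OF wf eh(1)]] eh(1) by (simp add: local_spec_def)
    then have "components (hcut (fst G) {e, sigma (fst G) e}) = components (fst G)"
      using component_hcut_nonbridge[OF wf eh(1)] eh(2) by (auto simp: bridge_def components_eq)
    moreover note wf' = wf_hcut[OF wf sigma_closed_edge[OF wf eh(1)]]
    ultimately have "loop_number (hcut (fst G) {e, sigma (fst G) e}) = - 1"
      using loop_number_eq[OF wf] loop_number_eq[OF wf'] nonfixed_hcut_edge[OF wf e] L by simp
    then show False using loop_number_nonneg[OF wf'] by simp
  qed
qed

section \<open>Graphs without internal edges\<close>

lemma residue_spec_eq: "residue_spec G = sub_quot G ({}, snd G)"
  using contract_spec_sub_graph[of G "({}, snd G)"] by (simp add: residue_spec_def sub_graph_def)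

lemma residue_iso: "sgraph_iso (sub_quot G (full_sub G)) (residue_spec G)"
  unfolding residue_spec_eq sub_quot_def full_sub_def prod.case
  by (rule sgraph_iso_identity) simp_all

lemma residue_specified:
  assumes "field_theory T" "specified_graph T G"
  shows "specified_graph T (residue_spec G)" "trivial_graph (residue_spec G)"
proof -
  show "specified_graph T (residue_spec G)"
    by (rule specified_iso[OF assms(1) specified_sub_quot[OF assms full_sub_mem[OF assms]] residue_iso])
  show "trivial_graph (residue_spec G)"
    by (simp add: residue_spec_eq trivial_graph_def sub_quot_def)
qed

definition residue_classes :: "'ty theory_data \<Rightarrow> 'ty sgraph_class set" where
  "residue_classes T =
     {iso_class (residue_spec G) | G :: (nat, nat, 'ty) sgraph. specified_graph T G \<and> one_PI (fst G)}"

lemma component_graph_semb: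
  assumes wf: "wfg G" and sat: "saturated (fst G) K"
  shows "semb (\<lambda>v. v) (\<lambda>e. e) (component_graph (fst G) K, snd G) G"
  using sat component_of_component_graph[OF sat] unfolding semb_def emb_def saturated_def by auto

text \<open>Vertices are split off one at a time. A single vertex without internal edges is
  isomorphic to its own residue, because its specification equals its label, and it is 1PI, so its
  class is one of the generators.\<close>

lemma trivial_class_induct:
  fixes G :: "(nat, nat, 'ty) sgraph"
  assumes T: "field_theory T" and "specified_graph T G" "trivial_graph G"
    and one: "P \<one>\<^bsub>sgraph_monoid T\<^esub>"
    and step: "\<And>Y r. Y \<in> carrier (sgraph_monoid T) \<Longrightarrow> r \<in> residue_classes T \<Longrightarrow> P Y \<Longrightarrow>
      P (Y \<otimes>\<^bsub>sgraph_monoid T\<^esub> r)"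
  shows "P (iso_class G)"
  using assms(2,3)
proof (induction "card (vs G)" arbitrary: G)
  case 0
  have wf: "wfg G" using 0 by (simp add: specified_graph_iff[OF T])
  then have v: "vs G = {}" using 0 wfD(1)[OF wf] by simp
  then have h: "hedges (fst G) = {}" using wfD(5)[OF wf] by auto
  have "semb (\<lambda>v. v) (\<lambda>e. e) empty_sgraph G" using v h by (simp add: semb_def emb_def)
  then have "sgraph_iso empty_sgraph G" unfolding sgraph_iso_iff[OF wf_empty_sgraph wf] using v by auto
  then have "iso_class empty_sgraph = iso_class G" by (rule iso_class_eqI[OF wf_empty_sgraph])
  then show ?case using one by simp
next
  case (Suc n)
  obtain \<Gamma> i where eq: "G = (\<Gamma>, i)" by (cases G)
  have wf: "fgraph_wf \<Gamma>" and wfG: "wfg G" using Suc.prems by (auto simp: specified_graph_iff[OF T] eq)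
  have triv: "sigma \<Gamma> e = e" if "e \<in> hedges \<Gamma>" for e using Suc.prems(2) that by (simp add: trivial_graph_def eq)
  have "verts \<Gamma> \<noteq> {}" using Suc.hyps(2) by (auto simp: eq)
  then obtain v where v: "v \<in> verts \<Gamma>" by auto
  let ?H = "(component_graph \<Gamma> {v}, i)" and ?G = "(component_graph \<Gamma> (verts \<Gamma> - {v}), i)"
  have sat: "saturated \<Gamma> {v}" "saturated \<Gamma> (verts \<Gamma> - {v})"
    using v triv by (auto simp: saturated_def)
  have w: "wfg ?H" "wfg ?G" using wf_component_graph[OF wf sat(1)] wf_component_graph[OF wf sat(2)] by simp_all
  have c: "cover (\<lambda>v. v) (\<lambda>e. e) ?G (\<lambda>v. v) (\<lambda>e. e) ?H G"
    using component_graph_semb[OF wfG, unfolded eq fst_conv snd_conv, OF sat(1)]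
      component_graph_semb[OF wfG, unfolded eq fst_conv snd_conv, OF sat(2)] v
    by (auto simp: cover_def eq)
  have sp: "specified_graph T ?G" "specified_graph T ?H"
    using cover_specified[OF T w(2,1) wfG c] Suc.prems(1) by auto
  have m: "iso_class G = iso_class ?G \<otimes>\<^bsub>sgraph_monoid T\<^esub> iso_class ?H"
    by (rule class_mult[OF w(2,1) wfG c, symmetric])
  have tG: "trivial_graph ?G" and tH: "trivial_graph ?H" using triv by (auto simp: trivial_graph_def)
  have "P (iso_class ?G)"
  proof (rule Suc.hyps(1)[OF _ sp(1) tG])
    show "n = card (vs ?G)" using Suc.hyps(2) v wfD(1)[OF wf] by (simp add: eq)
  qed
  moreover have "iso_class ?H \<in> residue_classes T"
  proof -
    have iso_v: "isolated (fst ?H) v" using triv by (auto simp: isolated_def)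
    have "i {v} = vlab \<Gamma> v"
      using sp(2) iso_v by (simp add: specified_graph_iff[OF T] local_spec_def)
    then have "sgraph_iso ?H (sub_quot ?H (nonfixed (fst ?H), i))"
      by (intro iso_quot_nonfixed[OF w(1)]) simp
    moreover have "nonfixed (fst ?H) = {}" using tH by (simp add: trivial_iff_nonfixed)
    ultimately have "sgraph_iso ?H (residue_spec ?H)" by (simp add: residue_spec_eq)
    then have "iso_class ?H = iso_class (residue_spec ?H)" by (rule iso_class_eqI[OF w(1)])
    moreover have "one_PI (fst ?H)"
    proof -
      have "internal (fst ?H) = {}" using tH by (simp add: trivial_iff_internal)
      moreover have "components (fst ?H) = {{v}}"
        using components_trivial[of "fst ?H"] \<open>nonfixed (fst ?H) = {}\<close> by simp
      ultimately show ?thesis by (simp add: one_PI_def connected_graph_def)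
    qed
    ultimately show ?thesis using sp(2) unfolding residue_classes_def by blast
  qed
  ultimately show ?case unfolding m using step class_closed[OF T sp(1)] by blast
qed

section \<open>The coproduct on isomorphism classes\<close>

text \<open>Uses the same choice of representative as \<open>comult_Htilde\<close>; independence of
  the choice is \<open>copr_iso\<close>.\<close>

definition class_copr where
  "class_copr T X = copr T (SOME G :: (nat, nat, 'ty) sgraph. G \<in> X)"
  for T :: "'ty theory_data"

definition class_trivial :: "'ty sgraph_class \<Rightarrow> bool" where
  "class_trivial X \<longleftrightarrow> (\<exists>G\<in>X. internal (fst G) = {})"

definition class_loops :: "'ty sgraph_class \<Rightarrow> nat" where
  "class_loops X = nat (loop_number (fst (SOME G. G \<in> X)))"

lemma copr_empty:
  fixes T :: "'ty theory_data"
  shows "copr T empty_sgraph = Poly_Mapping.single (iso_class empty_sgraph, iso_class empty_sgraph) 1"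
proof -
  let ?u = "\<lambda>_. undefined"
  let ?e = "empty_sgraph :: (nat, nat, 'ty) sgraph"
  have iso: "sgraph_iso empty_sgraph H" if "verts (fst H) = {}" "hedges (fst H) = {}" for H :: "('x, 'y, 'z) sgraph"
    using that by (cases H) (auto simp: sgraph_iso_def empty_sgraph_def components_eq bij_betw_def)
  have "subs T empty_sgraph = {({}, ?u)}"
    by (auto simp: subs_def cutset_def sigma_closed_def components_eq)
  moreover have "iso_class (sub_graph ?e ({}, ?u)) = iso_class ?e"
    by (rule iso_class_eqI[OF wf_empty_sgraph, symmetric], rule iso) (simp_all add: sub_graph_def)
  moreover have "iso_class (sub_quot ?e ({}, ?u)) = iso_class ?e"
    by (rule iso_class_eqI[OF wf_empty_sgraph, symmetric], rule iso) (simp_all add: sub_quot_def components_eq)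
  ultimately show ?thesis by (simp add: copr_def)
qed

context
  fixes T :: "'ty theory_data"
  assumes T: "field_theory T"
begin

abbreviation "M \<equiv> sgraph_monoid T"

interpretation M: comm_monoid M by (rule comm_monoid_sgraph_monoid[OF T])

lemma MM: "Group.monoid (M \<times>\<times> M)"
  by (rule DirProd_monoid[OF M.monoid_axioms M.monoid_axioms])

lemma spec_wf: "specified_graph T G \<Longrightarrow> wfg G"
  by (simp add: specified_graph_iff[OF T])

lemma classes_closed:
  assumes "specified_graph T G" "s \<in> subs T G"
  shows "iso_class (sub_graph G s) \<in> carrier M" "iso_class (sub_quot G s) \<in> carrier M"
  using class_closed[OF T] specified_sub_graph[OF T spec_wf[OF assms(1)] assms(2)] specified_sub_quot[OF T assms]
  by blast+

lemma keys_copr: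
  "Poly_Mapping.keys (copr T G) \<subseteq> (\<lambda>s. (iso_class (sub_graph G s), iso_class (sub_quot G s))) ` subs T G"
  unfolding copr_def by (rule order_trans[OF keys_sum]) auto

lemma copr_closed: "specified_graph T G \<Longrightarrow> Poly_Mapping.keys (copr T G) \<subseteq> carrier M \<times> carrier M"
  using keys_copr[of G] classes_closed[of G] by (force simp del: sgraph_monoid_simps)

text \<open>An isomorphic copy is covered by \<open>G\<close> and the empty graph, whose coproduct
  is the unit of the algebra of pairs, so invariance is an instance of multiplicativity.\<close>

lemma copr_iso:
  assumes G: "specified_graph T G" and iso: "sgraph_iso G G'"
  shows "copr T G' = copr T G"
proof -
  note wf = spec_wf[OF G] and wf' = sgraph_iso_wf[OF spec_wf[OF G] iso]
  interpret A: complex_algebra "monoid_algebra (M \<times>\<times> M)" by (rule complex_algebra_monoid_algebra[OF MM])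
  obtain fv fh where "semb fv fh G G'" "fv ` vs G = vs G'" using iso sgraph_iso_iff[OF wf wf'] by blast
  from copr_cover[OF T wf wf_empty_sgraph wf' cover_empty[OF this]]
  have "copr T G' = copr T G \<otimes>\<^bsub>monoid_algebra (M \<times>\<times> M)\<^esub> \<one>\<^bsub>monoid_algebra (M \<times>\<times> M)\<^esub>"
    by (simp add: copr_empty)
  then show ?thesis using copr_closed[OF G] A.r_one[of "copr T G"] by (simp del: sgraph_monoid_simps)
qed

lemma some_rep:
  assumes "wfg G"
  shows "sgraph_iso G (SOME H :: (nat, nat, 'ty) sgraph. H \<in> iso_class G)"
proof -
  obtain H :: "(nat, nat, 'ty) sgraph" where "sgraph_iso G H" by (rule iso_class_nonempty[OF assms])
  then have "H \<in> iso_class G" by (simp add: iso_class_def)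
  then have "(SOME H. H \<in> iso_class G) \<in> iso_class G" by (rule someI)
  then show ?thesis by (simp add: iso_class_def)
qed

lemma class_copr_eq: "specified_graph T G \<Longrightarrow> class_copr T (iso_class G) = copr T G"
  unfolding class_copr_def by (rule copr_iso[OF _ some_rep[OF spec_wf]])

lemma class_loops_eq: "specified_graph T G \<Longrightarrow> class_loops (iso_class G) = nat (loop_number (fst G))"
  unfolding class_loops_def using loop_number_iso[OF spec_wf some_rep[OF spec_wf]] by metis

lemma loops_int: "specified_graph T G \<Longrightarrow> int (class_loops (iso_class G)) = loop_number (fst G)"
  using loop_number_nonneg[OF spec_wf] by (simp add: class_loops_eq)

text \<open>For specified graphs the absence of internal edges means loop number 0, which is
  invariant under isomorphism; hence all representatives agree.\<close>

lemma class_trivial_eq: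
  assumes G: "specified_graph T G"
  shows "class_trivial (iso_class G) \<longleftrightarrow> trivial_graph G"
proof -
  have "trivial_graph H \<longleftrightarrow> trivial_graph G" if "H \<in> iso_class G" for H
    using that loop_number_iso[OF spec_wf[OF G]] loop_number_zero_iff[OF T G]
      loop_number_zero_iff[OF T specified_iso[OF T G]] by (metis iso_class_def mem_Collect_eq)
  moreover obtain H :: "(nat, nat, 'ty) sgraph" where "sgraph_iso G H"
    by (rule iso_class_nonempty[OF spec_wf[OF G]])
  then have "H \<in> iso_class G" by (simp add: iso_class_def)
  ultimately show ?thesis unfolding class_trivial_def trivial_iff_internal[symmetric] by blast
qed

lemma carrierE:
  assumes "X \<in> carrier M"
  obtains G :: "(nat, nat, 'ty) sgraph" where "specified_graph T G" "X = iso_class G"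
  using assms by auto

lemma sub_classes:
  assumes G: "specified_graph T G"
  shows "iso_class (sub_quot G (skeleton_sub G)) = iso_class G"
    and "iso_class (sub_graph G (full_sub G)) = iso_class G"
proof -
  have wf: "wfg G" by (rule spec_wf[OF G])
  show "iso_class (sub_quot G (skeleton_sub G)) = iso_class G"
    unfolding skeleton_sub_def
    by (rule iso_class_eqI[OF wf iso_quot_nonfixed[OF wf], symmetric]) (simp add: components_nonfixed)
  show "iso_class (sub_graph G (full_sub G)) = iso_class G"
    using iso_full_sub[of G] specified_sub_graph[OF T wf full_sub_mem[OF T G]]
    by (intro iso_class_eqI[OF spec_wf]) auto
qed

text \<open>With nothing to cut, the skeleton and the full subgraph coincide and form the only term,
  so the class is grouplike.\<close>

lemma copr_trivial:
  assumes G: "specified_graph T G" and t: "trivial_graph G"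
  shows "copr T G = Poly_Mapping.single (iso_class G, iso_class G) 1"
proof -
  have wf: "wfg G" by (rule spec_wf[OF G])
  have "s = skeleton_sub G \<and> s = full_sub G" if s: "s \<in> subs T G" for s
    using t trivial_sub_graph[OF wf s] trivial_sub_quot[OF s]
    by (auto simp: trivial_graph_def sub_graph_def sub_quot_def split: prod.splits)
  then have sub: "subs T G = {full_sub G}" "full_sub G = skeleton_sub G"
    using full_sub_mem[OF T G] by blast+
  show ?thesis
    by (simp add: copr_def sub(1) sub_classes(2)[OF G]) (simp add: sub(2) sub_classes(1)[OF G])
qed

lemma lin_copr:
  assumes "complex_vector_space N" "specified_graph T G"
    "\<And>s. s \<in> subs T G \<Longrightarrow> f (iso_class (sub_graph G s), iso_class (sub_quot G s)) \<in> carrier N"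
  shows "lin N f (copr T G) = finsum N (\<lambda>s. f (iso_class (sub_graph G s), iso_class (sub_quot G s))) (subs T G)"
  unfolding copr_def
  by (rule complex_vector_space.lin_sum_single[OF assms(1) finite_subs[OF T spec_wf[OF assms(2)]]])
    (rule assms(3))

lemma graded_coproduct_classes:
  "graded_coproduct M (class_copr T) class_trivial class_loops (residue_classes T)"
proof (intro graded_coproduct.intro graded_coproduct_axioms.intro)
  show "comm_monoid M" by (rule M.comm_monoid_axioms)
  fix X assume "X \<in> carrier M"
  then obtain G :: "(nat, nat, 'ty) sgraph" where G: "specified_graph T G" "X = iso_class G" by (rule carrierE)
  have wf: "wfg G" by (rule spec_wf[OF G(1)])
  show "Poly_Mapping.keys (class_copr T X) \<subseteq> carrier M \<times> carrier M"
    unfolding G(2) class_copr_eq[OF G(1)] by (rule copr_closed[OF G(1)])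
  show "class_trivial X \<Longrightarrow> class_copr T X = Poly_Mapping.single (X, X) 1"
    unfolding G(2) class_copr_eq[OF G(1)] class_trivial_eq[OF G(1)] by (rule copr_trivial[OF G(1)])
  show "class_trivial X \<longleftrightarrow> class_loops X = 0"
    unfolding G(2) class_trivial_eq[OF G(1)] loop_number_zero_iff[OF T G(1), symmetric] loops_int[OF G(1), symmetric]
    by simp
  show "class_loops U + class_loops V = class_loops X" if UV: "(U, V) \<in> Poly_Mapping.keys (class_copr T X)" for U V
  proof -
    obtain s where s: "s \<in> subs T G" "U = iso_class (sub_graph G s)" "V = iso_class (sub_quot G s)"
      using UV keys_copr[of G] unfolding G(2) class_copr_eq[OF G(1)] by auto
    have "int (class_loops U) + int (class_loops V) = int (class_loops X)"
      unfolding s G(2) loops_int[OF G(1)] loops_int[OF specified_sub_graph[OF T wf s(1)]]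
        loops_int[OF specified_sub_quot[OF T G(1) s(1)]] by (rule loop_number_sub[OF wf s(1)])
    then show ?thesis by simp
  qed
  show "P X" if "class_trivial X" "P \<one>\<^bsub>M\<^esub>"
    "\<And>Y r. Y \<in> carrier M \<Longrightarrow> r \<in> residue_classes T \<Longrightarrow> P Y \<Longrightarrow> P (Y \<otimes>\<^bsub>M\<^esub> r)" for P
    unfolding G(2)
  proof (rule trivial_class_induct[OF T G(1)])
    show "trivial_graph G" using that(1) unfolding G(2) class_trivial_eq[OF G(1)] .
  qed (use that in blast)+
  interpret A: complex_algebra "monoid_algebra M" by (rule complex_algebra_monoid_algebra[OF M.monoid_axioms])
  have fin: "finite (subs T G)" by (rule finite_subs[OF T wf])
  have cc: "iso_class (sub_graph G s) \<in> carrier M" "iso_class (sub_quot G s) \<in> carrier M" if "s \<in> subs T G" for s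
    using classes_closed[OF G(1) that] .
  have pick: "(\<Sum>s\<in>subs T G. if s = t then f s else 0) = f t" if "t \<in> subs T G" for t and f :: "_ \<Rightarrow> 'ty sgraph_class \<Rightarrow>\<^sub>0 complex"
    using that fin by simp
  show "lin (monoid_algebra M) (\<lambda>(U, V). if class_trivial U then Poly_Mapping.single V 1 else 0) (class_copr T X) =
      Poly_Mapping.single X 1"
  proof -
    have "lin (monoid_algebra M) (\<lambda>(U, V). if class_trivial U then Poly_Mapping.single V 1 else 0) (copr T G) =
        finsum (monoid_algebra M) (\<lambda>s. if class_trivial (iso_class (sub_graph G s))
          then Poly_Mapping.single (iso_class (sub_quot G s)) 1 else 0) (subs T G)"
      using cc by (subst lin_copr[OF A.vector_space G(1)]) (auto simp del: sgraph_monoid_simps)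
    also have "\<dots> = (\<Sum>s\<in>subs T G. if class_trivial (iso_class (sub_graph G s))
          then Poly_Mapping.single (iso_class (sub_quot G s)) 1 else 0)"
      using cc by (intro monoid_algebra_finsum[OF M.monoid_axioms] fin) (auto simp del: sgraph_monoid_simps)
    \<comment> \<open>Only the skeleton survives on the left, and its contraction is
      \<open>G\<close> again.\<close>
    also have "\<dots> = (\<Sum>s\<in>subs T G. if s = skeleton_sub G then Poly_Mapping.single (iso_class (sub_quot G s)) 1 else 0)"
      by (intro sum.cong refl) (simp add: class_trivial_eq[OF specified_sub_graph[OF T wf]] trivial_sub_graph[OF wf])
    also have "\<dots> = Poly_Mapping.single (iso_class G) 1"
      using pick[OF skeleton_sub_mem[OF T G(1)]] by (simp add: sub_classes[OF G(1)])
    finally show ?thesis unfolding G(2) class_copr_eq[OF G(1)] .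
  qed
  show "lin (monoid_algebra M) (\<lambda>(U, V). if class_trivial V then Poly_Mapping.single U 1 else 0) (class_copr T X) =
      Poly_Mapping.single X 1"
  proof -
    have "lin (monoid_algebra M) (\<lambda>(U, V). if class_trivial V then Poly_Mapping.single U 1 else 0) (copr T G) =
        finsum (monoid_algebra M) (\<lambda>s. if class_trivial (iso_class (sub_quot G s))
          then Poly_Mapping.single (iso_class (sub_graph G s)) 1 else 0) (subs T G)"
      using cc by (subst lin_copr[OF A.vector_space G(1)]) (auto simp del: sgraph_monoid_simps)
    also have "\<dots> = (\<Sum>s\<in>subs T G. if class_trivial (iso_class (sub_quot G s))
          then Poly_Mapping.single (iso_class (sub_graph G s)) 1 else 0)"
      using cc by (intro monoid_algebra_finsum[OF M.monoid_axioms] fin) (auto simp del: sgraph_monoid_simps)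
    \<comment> \<open>Only the full subgraph has a contraction without internal edges.\<close>
    also have "\<dots> = (\<Sum>s\<in>subs T G. if s = full_sub G then Poly_Mapping.single (iso_class (sub_graph G s)) 1 else 0)"
      by (intro sum.cong refl) (simp add: class_trivial_eq[OF specified_sub_quot[OF T G(1)]] trivial_sub_quot)
    also have "\<dots> = Poly_Mapping.single (iso_class G) 1"
      using pick[OF full_sub_mem[OF T G(1)]] by (simp add: sub_classes[OF G(1)])
    finally show ?thesis unfolding G(2) class_copr_eq[OF G(1)] .
  qed
  let ?M3 = "monoid_algebra (triple_product M)"
  have M3: "Group.monoid (triple_product M)" by (rule DirProd_monoid[OF M.monoid_axioms MM])
  interpret A3: complex_algebra ?M3 by (rule complex_algebra_monoid_algebra[OF M3])
  have sum3: "lin ?M3 f (copr T H) = (\<Sum>s\<in>subs T H. f (iso_class (sub_graph H s), iso_class (sub_quot H s)))"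
    if "specified_graph T H" "\<And>U V. U \<in> carrier M \<Longrightarrow> V \<in> carrier M \<Longrightarrow> f (U, V) \<in> carrier ?M3"
    for f and H :: "('x, 'y, 'ty) sgraph"
    using that classes_closed[OF that(1)] finite_subs[OF T spec_wf[OF that(1)]]
    by (subst lin_copr[OF A3.vector_space that(1)], blast, subst monoid_algebra_finsum[OF M3]) blast+
  have c1: "(\<lambda>(P, Q). Poly_Mapping.single (P, Q, V) 1) (P, Q) \<in> carrier ?M3"
    "(\<lambda>(P, Q). Poly_Mapping.single (V, P, Q) 1) (P, Q) \<in> carrier ?M3"
    if "P \<in> carrier M" "Q \<in> carrier M" "V \<in> carrier M" for P Q V
    using that by (simp_all del: sgraph_monoid_simps)
  show "lin ?M3 (\<lambda>(U, V). lin ?M3 (\<lambda>(P, Q). Poly_Mapping.single (P, Q, V) 1) (class_copr T U)) (class_copr T X) =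
      lin ?M3 (\<lambda>(U, V). lin ?M3 (\<lambda>(P, Q). Poly_Mapping.single (U, P, Q) 1) (class_copr T V)) (class_copr T X)"
  proof -
    have cl: "lin ?M3 f (class_copr T U) \<in> carrier ?M3"
      if U: "U \<in> carrier M" and f: "\<And>P Q. P \<in> carrier M \<Longrightarrow> Q \<in> carrier M \<Longrightarrow> f (P, Q) \<in> carrier ?M3" for f U
    proof -
      from U obtain H :: "(nat, nat, 'ty) sgraph" where H: "specified_graph T H" "U = iso_class H" by (rule carrierE)
      show ?thesis
        unfolding H(2) class_copr_eq[OF H(1)]
        using copr_closed[OF H(1)] f
        by (intro complex_vector_space.lin_closed[OF A3.vector_space]) (auto simp del: sgraph_monoid_simps monoid_algebra_simps)
    qed
    have "lin ?M3 (\<lambda>(U, V). lin ?M3 (\<lambda>(P, Q). Poly_Mapping.single (P, Q, V) 1) (class_copr T U)) (copr T G) =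
      (\<Sum>s\<in>subs T G. lin ?M3 (\<lambda>(P, Q). Poly_Mapping.single (P, Q, iso_class (sub_quot G s)) 1)
        (class_copr T (iso_class (sub_graph G s))))"
      using cl c1 by (subst sum3[OF G(1)]) (simp_all del: sgraph_monoid_simps monoid_algebra_simps)
    also have "\<dots> = (\<Sum>s\<in>subs T G. \<Sum>t\<in>subs T (sub_graph G s). Poly_Mapping.single (iso_class (sub_graph (sub_graph G s) t),
      iso_class (sub_quot (sub_graph G s) t), iso_class (sub_quot G s)) (1::complex))"
    proof (rule sum.cong[OF refl])
      fix s assume s: "s \<in> subs T G"
      note sp = specified_sub_graph[OF T wf s]
      show "lin ?M3 (\<lambda>(P, Q). Poly_Mapping.single (P, Q, iso_class (sub_quot G s)) 1)
          (class_copr T (iso_class (sub_graph G s))) =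
        (\<Sum>t\<in>subs T (sub_graph G s). Poly_Mapping.single (iso_class (sub_graph (sub_graph G s) t),
          iso_class (sub_quot (sub_graph G s) t), iso_class (sub_quot G s)) (1::complex))"
        unfolding class_copr_eq[OF sp] using c1(1)[OF _ _ cc(2)[OF s]] by (subst sum3[OF sp]) simp_all
    qed
    also have "\<dots> = (\<Sum>s\<in>subs T G. \<Sum>t\<in>subs T (sub_quot G s). Poly_Mapping.single (iso_class (sub_graph G s),
      iso_class (sub_graph (sub_quot G s) t), iso_class (sub_quot (sub_quot G s) t)) 1)"
      by (rule copr_coassoc[OF T G(1)])
    also have "\<dots> = (\<Sum>s\<in>subs T G. lin ?M3 (\<lambda>(P, Q). Poly_Mapping.single (iso_class (sub_graph G s), P, Q) 1)
        (class_copr T (iso_class (sub_quot G s))))"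
    proof (rule sum.cong[OF refl])
      fix s assume s: "s \<in> subs T G"
      note sp = specified_sub_quot[OF T G(1) s]
      show "(\<Sum>t\<in>subs T (sub_quot G s). Poly_Mapping.single (iso_class (sub_graph G s),
          iso_class (sub_graph (sub_quot G s) t), iso_class (sub_quot (sub_quot G s) t)) 1) =
        lin ?M3 (\<lambda>(P, Q). Poly_Mapping.single (iso_class (sub_graph G s), P, Q) 1)
          (class_copr T (iso_class (sub_quot G s)))"
        unfolding class_copr_eq[OF sp] using c1(2)[OF _ _ cc(1)[OF s]] by (subst sum3[OF sp]) simp_all
    qed
    also have "\<dots> = lin ?M3 (\<lambda>(U, V). lin ?M3 (\<lambda>(P, Q). Poly_Mapping.single (U, P, Q) 1) (class_copr T V)) (copr T G)"
      using cl c1 by (subst sum3[OF G(1)]) (simp_all del: sgraph_monoid_simps monoid_algebra_simps)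
    finally show ?thesis unfolding G(2) class_copr_eq[OF G(1)] .
  qed
  fix Y assume "Y \<in> carrier M"
  then obtain H :: "(nat, nat, 'ty) sgraph" where H: "specified_graph T H" "Y = iso_class H" by (rule carrierE)
  note wH = spec_wf[OF H(1)]
  note wU = wf_disj_union[OF wf wH]
  have U: "specified_graph T (disj_union G H)"
    using cover_specified[OF T wf wH wU cover_disj_union] G(1) H(1) by blast
  have m: "X \<otimes>\<^bsub>M\<^esub> Y = iso_class (disj_union G H)"
    unfolding G(2) H(2) by (rule class_mult[OF wf wH wU cover_disj_union])
  show "class_copr T (X \<otimes>\<^bsub>M\<^esub> Y) = class_copr T X \<otimes>\<^bsub>monoid_algebra (M \<times>\<times> M)\<^esub> class_copr T Y"
    unfolding m class_copr_eq[OF U] unfolding G(2) H(2) class_copr_eq[OF G(1)] class_copr_eq[OF H(1)]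
    by (rule copr_cover[OF T wf wH wU cover_disj_union])
  have "int (class_loops (X \<otimes>\<^bsub>M\<^esub> Y)) = int (class_loops X) + int (class_loops Y)"
    unfolding m loops_int[OF U] unfolding G(2) H(2) loops_int[OF G(1)] loops_int[OF H(1)]
    by (rule loop_number_cover[OF wf wH wU cover_disj_union])
  then show "class_loops (X \<otimes>\<^bsub>M\<^esub> Y) = class_loops X + class_loops Y" by simp
next
  show "residue_classes T \<subseteq> carrier M"
    using residue_specified(1)[OF T] class_closed[OF T] unfolding residue_classes_def by blast
  show "class_trivial r" if "r \<in> residue_classes T" for r
    using that residue_specified[OF T] class_trivial_eq unfolding residue_classes_def by blast
qed


section \<open>Identification of the abstract quotient with \<open>HT\<close>\<close>

interpretation GC: graded_coproduct M "class_copr T" class_trivial class_loops "residue_classes T"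
  by (rule graded_coproduct_classes)

interpretation A: complex_algebra "monoid_algebra M"
  by (rule complex_algebra_monoid_algebra[OF M.monoid_axioms])

interpretation AA: algebra_pair "monoid_algebra M" "monoid_algebra M"
  by (rule A.self_pair)

lemma ideal_J_eq: "ideal_J T = GC.unit_ideal"
proof -
  have "{\<one>\<^bsub>GC.MA\<^esub> \<ominus>\<^bsub>GC.MA\<^esub> GC.b (iso_class (residue_spec G)) | G :: (nat, nat, 'ty) sgraph.
      specified_graph T G \<and> one_PI (fst G)} = {\<one>\<^bsub>GC.MA\<^esub> \<ominus>\<^bsub>GC.MA\<^esub> GC.b r | r. r \<in> residue_classes T}"
    unfolding residue_classes_def by blast
  then show ?thesis by (simp only: ideal_J_def GC.unit_ideal_def Htilde_def gen_def)
qed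

lemma HT_eq: "HT T = GC.quo"
  by (simp add: HT_def GC.quo_def ideal_J_eq Htilde_def)

lemma proj_eq: "proj T = GC.qproj"
  by (rule ext) (simp add: proj_def GC.qproj_def ideal_J_eq Htilde_def)

lemma graph_coproduct_eq:
  assumes G: "specified_graph T G"
  shows "graph_coproduct T G = lin (tensor (monoid_algebra M) (monoid_algebra M))
    (\<lambda>(U, V). ptens (monoid_algebra M) (monoid_algebra M) (GC.b U) (GC.b V)) (copr T G)"
proof -
  let ?A = "monoid_algebra M"
  have cl: "ptens ?A ?A (GC.b (iso_class (sub_graph G s))) (GC.b (iso_class (sub_quot G s))) \<in> carrier (tensor ?A ?A)"
    if "s \<in> subs T G" for s
    by (intro AA.ptens_closed GC.b_closed classes_closed[OF G that])
  have "graph_coproduct T G = finsum (tensor ?A ?A)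
      (\<lambda>s. ptens ?A ?A (gen (sub_graph G s)) (gen (contract_spec G (sub_graph G s)))) (subs T G)"
    unfolding graph_coproduct_def admissible_subgraphs_eq[OF T G] Htilde_def
    by (rule AA.T.finsum_reindex[OF _ inj_sub_graph])
      (use cl in \<open>auto simp: gen_def contract_spec_sub_graph\<close>)
  also have "\<dots> = lin (tensor ?A ?A) (\<lambda>(U, V). ptens ?A ?A (GC.b U) (GC.b V)) (copr T G)"
    using cl by (subst lin_copr[OF AA.T.vector_space G]) (simp_all add: gen_def contract_spec_sub_graph)
  finally show ?thesis .
qed

lemma some_specified:
  assumes "X \<in> carrier M"
  shows "specified_graph T (SOME G :: (nat, nat, 'ty) sgraph. G \<in> X)"
proof -
  obtain G :: "(nat, nat, 'ty) sgraph" where G: "specified_graph T G" "X = iso_class G"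
    using assms by (rule carrierE)
  show ?thesis unfolding G(2) by (rule specified_iso[OF T G(1) some_rep[OF spec_wf[OF G(1)]]])
qed

text \<open>Both sides evaluate a class at the same chosen representative. On the carrier every key
  is the class of a specified graph, which ensures that a representative exists and is
  specified.\<close>

lemma comult_eq:
  assumes x: "x \<in> carrier (monoid_algebra M)"
  shows "comult_Htilde T x = GC.comul x"
  unfolding comult_Htilde_def GC.comul_def lin_def[of _ _ x] Htilde_def
proof (rule AA.T.finsum_cong')
  let ?A = "monoid_algebra M"
  have X: "X \<in> carrier M" if "X \<in> Poly_Mapping.keys x" for X using x that by (auto simp del: sgraph_monoid_simps)
  show "(\<lambda>X. Poly_Mapping.lookup x X \<odot>\<^bsub>tensor ?A ?A\<^esub>
      lin (tensor ?A ?A) (\<lambda>(U, V). ptens ?A ?A (GC.b U) (GC.b V)) (class_copr T X))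
    \<in> Poly_Mapping.keys x \<rightarrow> carrier (tensor ?A ?A)"
    using GC.ptens_D_closed[OF X] by (auto intro: AA.TV.scale_closed)
  show "Poly_Mapping.lookup x X \<odot>\<^bsub>tensor ?A ?A\<^esub> graph_coproduct T (SOME G. G \<in> X) =
      Poly_Mapping.lookup x X \<odot>\<^bsub>tensor ?A ?A\<^esub>
      lin (tensor ?A ?A) (\<lambda>(U, V). ptens ?A ?A (GC.b U) (GC.b V)) (class_copr T X)"
    if "X \<in> Poly_Mapping.keys x" for X
    unfolding graph_coproduct_eq[OF some_specified[OF X[OF that]]] class_copr_def ..
qed simp

lemma finsum_complex_alg: "finite B \<Longrightarrow> finsum complex_alg f B = sum f B"
proof (induction B rule: finite_induct)
  case (insert a B)
  interpret C: complex_vector_space complex_alg by (rule complex_vector_space_complex_alg)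
  show ?case using insert by simp
qed (simp add: finsum_def finprod_def)

lemma counit_eq: "counit_Htilde = GC.coun"
  by (rule ext) (simp add: counit_Htilde_def GC.coun_def lin_def finsum_complex_alg class_trivial_def)

lemma counit_HT_eq: "counit_HT = GC.qcoun"
  by (rule ext) (simp add: counit_HT_def GC.qcoun_def counit_eq)

lemma comult_HT_eq:
  assumes "X \<in> carrier GC.quo"
  shows "comult_HT T X = GC.qcomul X"
proof -
  have "(\<lambda>x. tensor_map GC.quo GC.quo GC.qproj GC.qproj (comult_Htilde T x)) ` X =
      (\<lambda>x. tensor_map GC.quo GC.quo GC.qproj GC.qproj (GC.comul x)) ` X"
    by (intro image_cong refl arg_cong[where f="tensor_map GC.quo GC.quo GC.qproj GC.qproj"] comult_eq)
      (use GC.quo_subset[OF assms] in blast)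
  then show ?thesis unfolding comult_HT_def GC.qcomul_def HT_eq proj_eq by simp
qed

lemma loop_grading_eq: "loop_grading T = GC.qgr"
proof
  fix n
  have "{proj T (gen G) | G :: (nat, nat, 'ty) sgraph. specified_graph T G \<and> loop_number (fst G) = int n} =
      {GC.qproj (GC.b X) | X. X \<in> carrier M \<and> class_loops X = n}" (is "?l = ?r")
  proof (intro equalityI subsetI)
    fix y assume "y \<in> ?l"
    then obtain G :: "(nat, nat, 'ty) sgraph" where
      G: "y = proj T (gen G)" "specified_graph T G" "loop_number (fst G) = int n" by auto
    have "class_loops (iso_class G) = n" using loops_int[OF G(2)] G(3) by simp
    then show "y \<in> ?r" using class_closed[OF T G(2)] unfolding G(1) proj_eq gen_def by blast
  next
    fix y assume "y \<in> ?r"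
    then obtain X where X: "y = GC.qproj (GC.b X)" "X \<in> carrier M" "class_loops X = n" by auto
    from X(2) obtain G :: "(nat, nat, 'ty) sgraph" where G: "specified_graph T G" "X = iso_class G" by (rule carrierE)
    have "loop_number (fst G) = int n" using loops_int[OF G(1)] X(3) G(2) by simp
    then show "y \<in> ?l" using G unfolding X(1) proj_eq gen_def by blast
  qed
  then show "loop_grading T n = GC.qgr n" by (simp only: loop_grading_def GC.qgr_def HT_eq)
qed

lemma Htilde_bialgebra: "bialgebra (Htilde T) (comult_Htilde T) counit_Htilde"
  unfolding Htilde_def counit_eq by (rule GC.MA_bialgebra[OF comult_eq])

lemma HT_connected_graded: "connected_graded_bialgebra (HT T) (comult_HT T) counit_HT (loop_grading T)"
  unfolding HT_eq counit_HT_eq loop_grading_eq by (rule GC.quo_connected_graded[OF comult_HT_eq])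

lemma gen_closed: "specified_graph T G \<Longrightarrow> gen G \<in> carrier (Htilde T)"
  using class_closed[OF T, of G] unfolding gen_def Htilde_def by (intro GC.b_closed)

lemma comult_gen: "specified_graph T G \<Longrightarrow> comult_Htilde T (gen G) = graph_coproduct T G"
  using comult_eq[OF gen_closed[unfolded Htilde_def], of G] class_closed[OF T, of G]
  by (simp add: gen_def GC.comul_b class_copr_eq graph_coproduct_eq del: sgraph_monoid_simps)

lemma comult_HT_proj:
  assumes "x \<in> carrier (Htilde T)"
  shows "comult_HT T (proj T x) = tensor_map (HT T) (HT T) (proj T) (proj T) (comult_Htilde T x)"
    and "counit_HT (proj T x) = counit_Htilde x"
  using assms GC.qcomul_lift(2)[of x] GC.qcoun_lift(2)[of x] comult_HT_eq[OF GC.qproj_closed[of x]] comult_eq[of x]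
  unfolding Htilde_def proj_eq HT_eq counit_HT_eq counit_eq by simp_all

text \<open>\<open>proper_admissible_subgraphs\<close> excludes two underlying graphs regardless of
  specification, so each must be shown to carry only one. Here nothing is cut, all components are
  full, and the specification is that of \<open>G\<close>.\<close>

lemma full_sub_cut_iff: "s \<in> subs T G \<Longrightarrow> fst (sub_graph G s) = fst G \<longleftrightarrow> s = full_sub G"
proof
  assume s: "s \<in> subs T G" and eq: "fst (sub_graph G s) = fst G"
  have X: "cutset (fst G) (fst s)" using s by (auto simp: subs_def)
  have "hcut (fst G) (fst s) = hcut (fst G) {}" using eq by (simp add: sub_graph_def split_beta)
  then have "fst s = {}" using X by (intro hcut_inj[OF X]) (auto simp: cutset_def sigma_closed_def)
  then have "trivial_graph (sub_quot G s)" by (simp add: trivial_graph_def sub_quot_def split_beta)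
  then show "s = full_sub G" using trivial_sub_quot[OF s] by simp
qed (simp add: full_sub_def sub_graph_def)

lemma skeleton_sub_cut_iff:
  assumes wf: "wfg G" and s: "s \<in> subs T G"
  shows "fst (sub_graph G s) = skeleton (fst G) \<longleftrightarrow> s = skeleton_sub G"
proof -
  have u: "\<Union>(internal (fst G)) = nonfixed (fst G)"
    using wfD(3,4)[OF wf] by (auto simp: internal_def nonfixed_def)
  have sk: "skeleton (fst G) = hcut (fst G) (nonfixed (fst G))"
    unfolding skeleton_def cut_eq_hcut u ..
  show ?thesis
  proof
    assume eq: "fst (sub_graph G s) = skeleton (fst G)"
    have X: "cutset (fst G) (fst s)" using s by (auto simp: subs_def)
    have "fst s = nonfixed (fst G)"
      using eq by (intro hcut_inj[OF X cutset_nonfixed[OF wf]]) (simp add: sub_graph_def split_beta sk)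
    then have "trivial_graph (sub_graph G s)"
      by (simp add: trivial_graph_def sub_graph_def split_beta nonfixed_def)
    then show "s = skeleton_sub G" using trivial_sub_graph[OF wf s] by simp
  qed (simp add: sk skeleton_sub_def sub_graph_def)
qed

interpretation H: complex_algebra "HT T"
  unfolding HT_eq by (rule GC.quo_algebra)

interpretation HH: algebra_pair "HT T" "HT T"
  by (rule H.self_pair)

text \<open>The skeleton contributes the term with \<open>G\<close> on the right, the full subgraph
  the term with \<open>G\<close> on the left. The other leg of each is a graph without internal
  edges, which is the unit of the quotient.\<close>

lemma comult_HT_gen:
  assumes G: "specified_graph T G" and int: "internal (fst G) \<noteq> {}"
  shows "comult_HT T (proj T (gen G)) =
    ptens (HT T) (HT T) \<one>\<^bsub>HT T\<^esub> (proj T (gen G))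
    \<oplus>\<^bsub>tensor (HT T) (HT T)\<^esub> ptens (HT T) (HT T) (proj T (gen G)) \<one>\<^bsub>HT T\<^esub>
    \<oplus>\<^bsub>tensor (HT T) (HT T)\<^esub> finsum (tensor (HT T) (HT T))
      (\<lambda>g. ptens (HT T) (HT T) (proj T (gen g)) (proj T (gen (contract_spec G g))))
      (proper_admissible_subgraphs T G)"
proof -
  note wf = spec_wf[OF G]
  let ?p = "\<lambda>g. proj T (gen g)" and ?T = "tensor (HT T) (HT T)"
  let ?t = "\<lambda>s. ptens (HT T) (HT T) (?p (sub_graph G s)) (?p (sub_quot G s))"
  have pc: "?p H \<in> carrier (HT T)" if "specified_graph T H" for H :: "('x, 'y, 'ty) sgraph"
    unfolding proj_eq HT_eq using gen_closed[OF that] by (intro GC.qproj_closed) (simp only: Htilde_def)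
  have q_closed: "GC.qproj (GC.b X) \<in> carrier (HT T)" if "X \<in> carrier M" for X
    unfolding HT_eq by (rule GC.qproj_b_closed[OF that])
  have tc: "?t s \<in> carrier ?T" if "s \<in> subs T G" for s
    unfolding proj_eq gen_def
    by (intro HH.ptens_closed q_closed classes_closed[OF G that])
  let ?sk = "skeleton_sub G" and ?fu = "full_sub G"
  define P where "P = subs T G - {?sk, ?fu}"
  have fin: "finite (subs T G)" by (rule finite_subs[OF T wf])
  have mem: "?sk \<in> subs T G" "?fu \<in> subs T G" by (rule skeleton_sub_mem[OF T G], rule full_sub_mem[OF T G])
  \<comment> \<open>An internal edge is cut in the skeleton but not in the full subgraph; without
    one the two terms would be the same summand.\<close>
  have ne: "?sk \<noteq> ?fu"
    using int by (auto simp: skeleton_sub_def full_sub_def nonfixed_def internal_def)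
  have "comult_HT T (?p G) = lin ?T (\<lambda>(U, V). ptens (HT T) (HT T) (proj T (GC.b U)) (proj T (GC.b V))) (copr T G)"
    using comult_HT_proj(1)[OF gen_closed[OF G]] comult_eq[OF gen_closed[OF G, unfolded Htilde_def]]
      GC.tmap_comul_b[OF class_closed[OF T G]]
    unfolding HT_eq proj_eq by (simp add: gen_def class_copr_eq[OF G])
  also have "\<dots> = finsum ?T ?t (subs T G)"
    using tc by (subst lin_copr[OF HH.T.vector_space G]) (simp_all add: gen_def)
  also have "subs T G = insert ?sk (insert ?fu P)" using mem by (auto simp: P_def)
  also have "finsum ?T ?t (insert ?sk (insert ?fu P)) = ?t ?sk \<oplus>\<^bsub>?T\<^esub> (?t ?fu \<oplus>\<^bsub>?T\<^esub> finsum ?T ?t P)"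
    using fin tc mem ne by (simp add: P_def Pi_iff)
  also have "?t ?sk = ptens (HT T) (HT T) \<one>\<^bsub>HT T\<^esub> (?p G)"
  proof -
    have "class_trivial (iso_class (sub_graph G ?sk))"
      using class_trivial_eq[OF specified_sub_graph[OF T wf mem(1)]] trivial_sub_graph[OF wf mem(1)] by simp
    then have "?p (sub_graph G ?sk) = \<one>\<^bsub>HT T\<^esub>"
      unfolding proj_eq HT_eq gen_def by (rule GC.qproj_E[OF classes_closed(1)[OF G mem(1)]])
    then show ?thesis by (simp add: gen_def sub_classes[OF G])
  qed
  also have "?t ?fu = ptens (HT T) (HT T) (?p G) \<one>\<^bsub>HT T\<^esub>"
  proof -
    have "class_trivial (iso_class (sub_quot G ?fu))"
      using class_trivial_eq[OF specified_sub_quot[OF T G mem(2)]] trivial_sub_quot[OF mem(2)] by simp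
    then have "?p (sub_quot G ?fu) = \<one>\<^bsub>HT T\<^esub>"
      unfolding proj_eq HT_eq gen_def by (rule GC.qproj_E[OF classes_closed(2)[OF G mem(2)]])
    then show ?thesis by (simp add: gen_def sub_classes[OF G])
  qed
  also have "finsum ?T ?t P = finsum ?T (\<lambda>g. ptens (HT T) (HT T) (?p g) (?p (contract_spec G g)))
      (proper_admissible_subgraphs T G)"
  proof -
    have "proper_admissible_subgraphs T G = sub_graph G ` P"
      unfolding proper_admissible_subgraphs_def admissible_subgraphs_eq[OF T G] P_def
      using full_sub_cut_iff skeleton_sub_cut_iff[OF wf] by blast
    moreover have "finsum ?T (\<lambda>g. ptens (HT T) (HT T) (?p g) (?p (contract_spec G g))) (sub_graph G ` P) =
        finsum ?T (\<lambda>s. ptens (HT T) (HT T) (?p (sub_graph G s)) (?p (contract_spec G (sub_graph G s)))) P"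
      using tc by (intro HH.T.finsum_reindex inj_on_subset[OF inj_sub_graph])
        (auto simp: P_def contract_spec_sub_graph)
    ultimately show ?thesis by (simp add: contract_spec_sub_graph)
  qed
  finally show ?thesis
    using tc fin mem pc[OF G] H.one_closed
    by (subst HH.T.a_assoc) (auto simp: proper_admissible_subgraphs_def admissible_subgraphs_eq[OF T G]
        contract_spec_sub_graph intro!: HH.T.finsum_closed)
qed

end

theorem mainTheorem3:
  fixes T :: "'ty theory_data"
  assumes "field_theory T"
  shows "bialgebra (Htilde T) (comult_Htilde T) counit_Htilde \<and>
    (\<forall>G :: ('v, 'h, 'ty) sgraph. specified_graph T G \<longrightarrow>
       comult_Htilde T (gen G) = graph_coproduct T G) \<and>
    (\<forall>x\<in>carrier (Htilde T).
       comult_HT T (proj T x) =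
         tensor_map (HT T) (HT T) (proj T) (proj T) (comult_Htilde T x) \<and>
       counit_HT (proj T x) = counit_Htilde x) \<and>
    connected_graded_bialgebra (HT T) (comult_HT T) counit_HT (loop_grading T) \<and>
    (\<exists>S. connected_graded_hopf_algebra (HT T) (comult_HT T) counit_HT (loop_grading T) S) \<and>
    (\<forall>G :: ('v, 'h, 'ty) sgraph. specified_graph T G \<and> internal (fst G) \<noteq> {} \<longrightarrow>
       comult_HT T (proj T (gen G)) =
         ptens (HT T) (HT T) \<one>\<^bsub>HT T\<^esub> (proj T (gen G))
         \<oplus>\<^bsub>tensor (HT T) (HT T)\<^esub> ptens (HT T) (HT T) (proj T (gen G)) \<one>\<^bsub>HT T\<^esub>
         \<oplus>\<^bsub>tensor (HT T) (HT T)\<^esub>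
           finsum (tensor (HT T) (HT T))
             (\<lambda>g. ptens (HT T) (HT T) (proj T (gen g)) (proj T (gen (contract_spec G g))))
             (proper_admissible_subgraphs T G))"
  proof (intro conjI allI ballI impI exI)
  note T = assms
  show "bialgebra (Htilde T) (comult_Htilde T) counit_Htilde"
    by (rule Htilde_bialgebra[OF T])
  show "comult_Htilde T (gen G) = graph_coproduct T G" if "specified_graph T G" for G :: "('v, 'h, 'ty) sgraph"
    by (rule comult_gen[OF T that])
  show "comult_HT T (proj T x) = tensor_map (HT T) (HT T) (proj T) (proj T) (comult_Htilde T x)"
    "counit_HT (proj T x) = counit_Htilde x" if "x \<in> carrier (Htilde T)" for x
    using comult_HT_proj[OF T that] by auto
  show "connected_graded_bialgebra (HT T) (comult_HT T) counit_HT (loop_grading T)"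
    by (rule HT_connected_graded[OF T])
  show "connected_graded_hopf_algebra (HT T) (comult_HT T) counit_HT (loop_grading T)
      (connected_graded_bialgebra.antipode (HT T) (comult_HT T) counit_HT)"
    by (rule connected_graded_bialgebra.hopf_algebra[OF HT_connected_graded[OF T]])
qed (use comult_HT_gen[OF assms] in blast)

end
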